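(* Let $N \geq 2$ and let $s \geq \frac{D_{2}-D_{1}}{2}$. Let $m \geq 1$ be the largest integer such that $$D_{m}\leq 2s\qquad\text{and}\qquad D_{m+1}-D_{1}\leq 2s,$$ and set $$\beta_{j}:=D_{j+1}-D_{j}\quad (0\leq j\leq m-1),\qquad \beta_{m}:=\min\left\{2s,\,D_{m+1}\right\}-D_{m},\qquad \beta_{m+1}:=\left(D_{m+1}-2s\right)^{+}.$$ Then, for all $u \in C_{0}^{\infty}(\mathbb{R}^{N})$, $$\left(\int_{\mathbb{R}^{N}}\left|(-\Delta)^{s/2}u\right|^{2}dx\right)^{\frac{1}{2}}\left(\int_{\mathbb{R}^{N}}|x|^{2}|\nabla u|^{2}\,dx\right)^{\frac{1}{2}}-\frac{N+s}{2}\int_{\mathbb{R}^{N}}\left|(-\Delta)^{s/4}u\right|^{2}dx\ \geq\ \sum_{j=0}^{m+1}\frac{\beta_{j}}{2}\inf_{w \in \mathcal{H}_{j}^{s}}\int_{\mathbb{R}^{N}}\left|(-\Delta)^{s/4}(u-w)\right|^{2}dx.$$ The constants $\frac{\beta_j}{2}$ add up to $\frac{D_{m+1}}{2}$, and the first of them, $\frac{\beta_{0}}{2}=\frac{D_{1}}{2}$, is the sharp (largest) constant $K$ in the stability estimate $$\left(\int_{\mathbb{R}^{N}}\left|(-\Delta)^{s/2}u\right|^{2}dx\right)^{\frac{1}{2}}\left(\int_{\mathbb{R}^{N}}|x|^{2}|\nabla u|^{2}\,dx\right)^{\frac{1}{2}}-\frac{N+s}{2}\int_{\mathbb{R}^{N}}\left|(-\Delta)^{s/4}u\right|^{2}dx\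 \geq\ K\inf_{\alpha\in\mathbb{C},\,\lambda>0}\int_{\mathbb{R}^{N}}\left|(-\Delta)^{s/4}(u-\alpha\,G_{s,\lambda})\right|^{2}dx\qquad\text{for all } u\in C_0^\infty(\mathbb{R}^N).$$ In fact, the constants $\frac{\beta_{j}}{2}$, $0\leq j\leq m+1$, in the sum $\sum_{j=0}^{m+1}\frac{\beta_{j}}{2}\inf_{w \in \mathcal{H}_{j}^{s}}\int_{\mathbb{R}^{N}}\left|(-\Delta)^{s/4}(u-w)\right|^{2}dx$ cannot be improved, with the possible exception of $\beta_{m}$.
   Context: Functions may be complex-valued. The Fourier transform is $\mathcal{F}(f)(\xi)=\widehat f(\xi)=\int_{\mathbb{R}^N} f(x)e^{-2\pi i x\cdot\xi}\,dx$, with inverse $\mathcal{F}^{-1}$. For $\kappa\in\mathbb{R}$, $(-\Delta)^{\kappa/2}$ is defined by $\mathcal{F}((-\Delta)^{\kappa/2}u)(\xi)=(2\pi|\xi|)^{\kappa}\widehat u(\xi)$, so that $\int_{\mathbb{R}^N}|(-\Delta)^{\kappa/2}u|^2dx=(2\pi)^{2\kappa}\int_{\mathbb{R}^N}|\xi|^{2\kappa}|\widehat u(\xi)|^2d\xi$. For $\lambda>0$, $G_{s,\lambda}:=\mathcal{F}^{-1}\left(e^{-\lambda|\xi|^{s}/s}\right)$. For $k\ge0$, $c_k:=k(N+k-2)$ and $D_k:=\sqrt{N^2+4c_k}-N$ (so $D_0=0$). $t^+:=\max\{t,0\}$. For each $k\ge0$, $\{\phi_{k,i}\}_{i=1}^{N_k}$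 is an $L^2(\mathbb{S}^{N-1})$-orthonormal basis of the spherical harmonics of degree $k$, and $\mathbf{\Phi}_k:=(\phi_{k,1},\dots,\phi_{k,N_k})$. For $j\ge0$ set $$\mathcal{Y}_{j}^{\ast}:=\left\{\sum_{k=0}^{j}|\xi|^{\frac{D_{k}}{2}}\,\mathbf{d}_{k}\cdot\mathbf{\Phi}_{k}(\xi/|\xi|):\ \mathbf{d}_{k}\in\mathbb{C}^{N_{k}}\right\}.$$ Then, for $0\le j\le m$, $$\mathcal{H}_{j}^{s}:=\left\{\mathcal{F}^{-1}\left(P\,e^{-\lambda|\xi|^{s}/s}\right):\ P \in \mathcal{Y}_{j}^{\ast},\ \lambda>0\right\},$$ and $$\mathcal{H}_{m+1}^{s}:=\left\{\mathcal{F}^{-1}\left(\left(P+d|\xi|^{s}\right)e^{-\lambda|\xi|^{s}/s}\right):\ P \in \mathcal{Y}_{m}^{\ast},\ d \in \mathbb{C},\ \lambda>0\right\}.$$ "A constant cannot be improved" means that it cannot be increased, for the inequality to hold for all $u$, when the other constants are kept fixed. *)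

theory Defs
  imports "HOL-Analysis.Analysis"
begin

definition partial_deriv :: "'n \<Rightarrow> (real^'n \<Rightarrow> complex) \<Rightarrow> real^'n \<Rightarrow> complex" where
  "partial_deriv i f x = frechet_derivative f (at x) (axis i 1)"

primrec C_k :: "nat \<Rightarrow> (real^'n \<Rightarrow> complex) \<Rightarrow> bool" where
  "C_k 0 f \<longleftrightarrow> continuous_on UNIV f"
| "C_k (Suc k) f \<longleftrightarrow> (\<forall>x. f differentiable (at x)) \<and> (\<forall>i. C_k k (partial_deriv i f))"

definition C0_infinity :: "(real^'n \<Rightarrow> complex) set" where
  "C0_infinity = {u. (\<forall>k. C_k k u) \<and> compact (closure {x. u x \<noteq> 0})}"

definition grad_norm_sq :: "(real^'n \<Rightarrow> complex) \<Rightarrow> real^'n \<Rightarrow> real" where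
  "grad_norm_sq u x = (\<Sum>i\<in>UNIV. (cmod (partial_deriv i u x))\<^sup>2)"

definition fourier_integral :: "(real^'n \<Rightarrow> complex) \<Rightarrow> real^'n \<Rightarrow> complex" where
  "fourier_integral f \<xi> = (LINT x|lborel. f x * exp (- 2 * of_real pi * \<i> * of_real (x \<bullet> \<xi>)))"

definition is_L2_fourier :: "(real^'n \<Rightarrow> complex) \<Rightarrow> (real^'n \<Rightarrow> complex) \<Rightarrow> bool" where
  "is_L2_fourier f g \<longleftrightarrow> g \<in> borel_measurable borel \<and>
     ((\<lambda>R::real. \<integral>\<^sup>+\<xi>. ennreal ((cmod (fourier_integral (\<lambda>x. if x \<in> ball 0 R then f x else 0) \<xi> - g \<xi>))\<^sup>2) \<partial>lborel)
        \<longlongrightarrow> 0) at_top"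

text \<open>
  The transform is given by the integral whenever the integral converges absolutely. Otherwise it is
  the Plancherel extension to square-integrable functions, the \<open>L\<^sup>2\<close> limit of the integrals over
  balls. This determines it up to null sets, and \<open>SOME\<close> picks a representative.
\<close>

definition fourier :: "(real^'n \<Rightarrow> complex) \<Rightarrow> real^'n \<Rightarrow> complex" where
  "fourier f = (if integrable lborel f then fourier_integral f else (SOME g. is_L2_fourier f g))"

text \<open>The inverse transform has the kernel \<open>exp (2 \<pi> \<i> x \<bullet> \<xi>)\<close>.\<close>

definition inv_fourier :: "(real^'n \<Rightarrow> complex) \<Rightarrow> real^'n \<Rightarrow> complex" where
  "inv_fourier g x = fourier g (- x)"

text \<open>\<open>neg_laplacian_pow a\<close> is \<open>(-\<Delta>)\<^sup>a\<close>: with \<open>a = \<kappa>/2\<close> the multiplier is \<open>(2 \<pi> |\<xi>|)\<^sup>\<kappa>\<close>.\<close>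

definition neg_laplacian_pow :: "real \<Rightarrow> (real^'n \<Rightarrow> complex) \<Rightarrow> real^'n \<Rightarrow> complex" where
  "neg_laplacian_pow a u = inv_fourier (\<lambda>\<xi>. of_real ((2 * pi * norm \<xi>) powr (2 * a)) * fourier u \<xi>)"

definition energy :: "real \<Rightarrow> (real^'n \<Rightarrow> complex) \<Rightarrow> real" where
  "energy a u = (LINT x|lborel. (cmod (neg_laplacian_pow a u x))\<^sup>2)"

definition deficit :: "real \<Rightarrow> (real^'n \<Rightarrow> complex) \<Rightarrow> real" where
  "deficit s u =
     sqrt (energy (s/2) u) * sqrt (LINT x|lborel. (norm x)\<^sup>2 * grad_norm_sq u x)
     - (real CARD('n) + s) / 2 * energy (s/4) u"

definition energy_dist :: "real \<Rightarrow> (real^'n \<Rightarrow> complex) set \<Rightarrow> (real^'n \<Rightarrow> complex) \<Rightarrow> real" where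
  "energy_dist s W u = (INF w\<in>W. energy (s/4) (\<lambda>x. u x - w x))"

definition G_fun :: "real \<Rightarrow> real \<Rightarrow> real^'n \<Rightarrow> complex" where
  "G_fun s l = inv_fourier (\<lambda>\<xi>. of_real (exp (- l * norm \<xi> powr s / s)))"

text \<open>Surface measure as cone measure: \<open>\<sigma> A = N * Leb {t *\<^sub>R a | 0 < t < 1, a \<in> A}\<close>.\<close>

definition sphere_measure :: "(real^'n) measure" where
  "sphere_measure = scale_measure (of_nat CARD('n))
     (distr (restrict_space lborel (ball 0 1)) borel (\<lambda>x. x /\<^sub>R norm x))"

definition harmonic_homogeneous_poly :: "nat \<Rightarrow> (real^'n \<Rightarrow> complex) \<Rightarrow> bool" where
  "harmonic_homogeneous_poly k p \<longleftrightarrow> polynomial_function p \<and>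
     (\<forall>t x. p (t *\<^sub>R x) = of_real (t ^ k) * p x) \<and>
     (\<forall>x. (\<Sum>i\<in>UNIV. partial_deriv i (partial_deriv i p) x) = 0)"

definition spherical_harmonic :: "nat \<Rightarrow> (real^'n \<Rightarrow> complex) \<Rightarrow> bool" where
  "spherical_harmonic k Y \<longleftrightarrow> (\<exists>p. harmonic_homogeneous_poly k p \<and> (\<forall>x\<in>sphere 0 1. Y x = p x))"

text \<open>The values of spherical harmonics off the unit sphere are irrelevant throughout.\<close>

definition orthonormal_harmonic_basis ::
  "nat \<Rightarrow> nat \<Rightarrow> (nat \<Rightarrow> real^'n \<Rightarrow> complex) \<Rightarrow> bool" where
  "orthonormal_harmonic_basis k n \<phi> \<longleftrightarrow>
     (\<forall>i\<in>{1..n}. spherical_harmonic k (\<phi> i)) \<and>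
     (\<forall>i\<in>{1..n}. \<forall>j\<in>{1..n}.
        (LINT x:sphere 0 1|sphere_measure. \<phi> i x * cnj (\<phi> j x)) = (if i = j then 1 else 0)) \<and>
     (\<forall>Y. spherical_harmonic k Y \<longrightarrow>
        (\<exists>d::nat \<Rightarrow> complex. \<forall>x\<in>sphere 0 1. Y x = (\<Sum>i=1..n. d i * \<phi> i x)))"

definition c_const :: "nat \<Rightarrow> nat \<Rightarrow> real" where
  "c_const N k = real k * (real N + real k - 2)"

definition D_const :: "nat \<Rightarrow> nat \<Rightarrow> real" where
  "D_const N k = sqrt ((real N)\<^sup>2 + 4 * c_const N k) - real N"

definition \<beta> :: "nat \<Rightarrow> real \<Rightarrow> nat \<Rightarrow> nat \<Rightarrow> real" where
  "\<beta> N s m j =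
     (if j < m then D_const N (j + 1) - D_const N j
      else if j = m then min (2 * s) (D_const N (m + 1)) - D_const N m
      else max (D_const N (m + 1) - 2 * s) 0)"

text \<open>Here \<open>\<phi> k i\<close> with \<open>1 \<le> i \<le> n k\<close> are the basis elements of degree \<open>k\<close>.\<close>

definition Y_star ::
  "(nat \<Rightarrow> nat) \<Rightarrow> (nat \<Rightarrow> nat \<Rightarrow> real^'n \<Rightarrow> complex) \<Rightarrow> nat \<Rightarrow> (real^'n \<Rightarrow> complex) set" where
  "Y_star n \<phi> j =
     {\<lambda>\<xi>. \<Sum>k=0..j. of_real (norm \<xi> powr (D_const CARD('n) k / 2)) *
                      (\<Sum>i=1..n k. d k i * \<phi> k i (\<xi> /\<^sub>R norm \<xi>)) |
      d :: nat \<Rightarrow> nat \<Rightarrow> complex. True}"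

text \<open>For \<open>j \<le> m\<close> the class does not depend on \<open>m\<close>; it is meant for \<open>j \<le> m + 1\<close> only.\<close>

definition \<H> ::
  "(nat \<Rightarrow> nat) \<Rightarrow> (nat \<Rightarrow> nat \<Rightarrow> real^'n \<Rightarrow> complex) \<Rightarrow> real \<Rightarrow> nat \<Rightarrow> nat \<Rightarrow> (real^'n \<Rightarrow> complex) set" where
  "\<H> n \<phi> s m j =
     (if j \<le> m then
        {inv_fourier (\<lambda>\<xi>. P \<xi> * of_real (exp (- l * norm \<xi> powr s / s))) |
           P l. P \<in> Y_star n \<phi> j \<and> l > 0}
      else
        {inv_fourier (\<lambda>\<xi>. (P \<xi> + d * of_real (norm \<xi> powr s)) * of_real (exp (- l * norm \<xi> powr s / s))) |
           P d l. P \<in> Y_star n \<phi> m \<and> l > 0})"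

definition stability_estimate :: "'n::finite itself \<Rightarrow> real \<Rightarrow> real \<Rightarrow> bool" where
  "stability_estimate _ s K \<longleftrightarrow>
     (\<forall>u::real^'n \<Rightarrow> complex. u \<in> C0_infinity \<longrightarrow>
        deficit s u \<ge> K * energy_dist s {\<lambda>x. \<alpha> * G_fun s l x | \<alpha> l. l > 0} u)"

definition multi_stability_estimate ::
  "(nat \<Rightarrow> nat) \<Rightarrow> (nat \<Rightarrow> nat \<Rightarrow> real^'n \<Rightarrow> complex) \<Rightarrow> real \<Rightarrow> nat \<Rightarrow> (nat \<Rightarrow> real) \<Rightarrow> bool" where
  "multi_stability_estimate n \<phi> s m b \<longleftrightarrow>
     (\<forall>u\<in>C0_infinity. deficit s u \<ge> (\<Sum>j=0..m+1. b j * energy_dist s (\<H> n \<phi> s m j) u))"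

end

theory Submission
  imports Defs "HOL-Probability.Probability"
begin

text \<open>
  Let \<open>v\<close> be the Fourier transform of \<open>u\<close>. By the arithmetic-geometric mean inequality, the deficit of \<open>u\<close>
  is \<open>(2\<pi>)\<^sup>s\<close> times the infimum over \<open>l > 0\<close> of the quadratic form
  \<open>Q\<^sub>l(v) = (1/2l) \<integral> |\<xi>|\<^sup>2|\<nabla>v|\<^sup>2 + (l/2) \<integral> |\<xi>|\<^sup>2\<^sup>s|v|\<^sup>2 - ((N+s)/2) \<integral> |\<xi>|\<^sup>s|v|\<^sup>2\<close>. With respect to the inner product
  with weight \<open>|\<xi>|\<^sup>s\<close>, the form \<open>Q\<^sub>l\<close> has eigenvalues \<open>D\<^sub>k/2 + s q\<close> for natural numbers \<open>k\<close> and \<open>q\<close>: it is triangular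
  on the functions \<open>|\<xi>|\<close> to the power \<open>D\<^sub>k/2 + s q\<close> times a spherical harmonic of degree \<open>k\<close> times
  \<open>exp (- l |\<xi>|\<^sup>s / s)\<close>, and these functions span a dense subspace.
  The functions with index \<open>j\<close> contain all eigenfunctions whose eigenvalue is less than the sum of the
  \<open>\<beta>\<^sub>i/2\<close> over \<open>i \<le> j\<close>, and summation by parts gives the inequality.

  For the sharpness, take the eigenfunction with eigenvalue \<open>D\<^sub>k/2\<close> for \<open>l = 1\<close> and the lowest degree \<open>k\<close> that
  the classes do not contain. It is orthogonal to all of them, so that the inequality, extended to
  it by approximation, bounds the sum of the coefficients of these classes by \<open>D\<^sub>k/2\<close>.
\<close>

section \<open>Rapidly decaying functions, possibly singular at the origin\<close>

text \<open>In general the eigenfunctions contain fractional powers of |\<xi>| and are singular at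
  the origin, so their inverse transforms are not test functions. Hence the function classes below
  ask for continuity off the origin only, gradients carry a factor |\<xi>|, and the sharpness
  argument reaches an eigenfunction through truncations of its inverse transform. No spectral
  theorem is used: finitely many eigenfunctions whose span comes within \<epsilon> of the transform
  of \<open>u\<close> suffice. The constants reflect the order of the eigenvalues. As D_(m+1) - D_1
  <= 2s and D_1 <= 2s, every eigenvalue with q >= 1 other than s itself is at least D_1/2 + s >=
  D_(m+1)/2. Below D_(m+1)/2 there are only D_0/2, ..., D_m/2 and possibly s; the latter is the
  origin of the minimum in \<beta>_m and of the term d|\<xi>|^s in the last class. Functions of
  different degrees are orthogonal for all values of \<lambda> at once, and only this makes an
  eigenfunction orthogonal to a whole class. The eigenfunction for s has degree 0, like members of
  every class, so it is no substitute when j = m.\<close>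

definition polygrowth :: "(real^'n \<Rightarrow> complex) \<Rightarrow> bool" where
  "polygrowth g \<longleftrightarrow> continuous_on (-{0}) g \<and> (\<exists>C M. \<forall>x. cmod (g x) \<le> C * (1 + norm x) ^ M)"

text \<open>Schwartz decay without Schwartz smoothness: M = 0 gives boundedness up to the origin,
  but nothing is asked of the limit or the value there. This admits x_i / |x| and fractional powers
  of |x| as factors.\<close>

definition rapid :: "(real^'n \<Rightarrow> complex) \<Rightarrow> bool" where
  "rapid f \<longleftrightarrow> continuous_on (-{0}) f \<and> (\<forall>M. \<exists>C. \<forall>x. (1 + norm x) ^ M * cmod (f x) \<le> C)"

lemma polygrowthI:
  assumes "continuous_on (-{0}) g" "\<And>x. cmod (g x) \<le> C * (1 + norm x) ^ M"
  shows "polygrowth g"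
  using assms unfolding polygrowth_def by blast

lemma polygrowthE:
  assumes "polygrowth g"
  obtains C M where "C \<ge> 0" "\<And>x. cmod (g x) \<le> C * (1 + norm x) ^ M"
proof -
  from assms obtain C M where *: "\<And>x. cmod (g x) \<le> C * (1 + norm x) ^ M"
    unfolding polygrowth_def by blast
  have "0 \<le> C * (1 + norm (0::real^'a)) ^ M"
    using *[of 0] norm_ge_zero order_trans by blast
  then have "C \<ge> 0" by simp
  with * show thesis using that by blast
qed

lemma rapidE:
  assumes "rapid f"
  obtains C where "C \<ge> 0" "\<And>x. (1 + norm x) ^ M * cmod (f x) \<le> C"
proof -
  from assms obtain C where *: "\<And>x. (1 + norm x) ^ M * cmod (f x) \<le> C"
    unfolding rapid_def by blast
  have "0 \<le> C"
    using *[of 0] by (rule order_trans[rotated]) auto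
  with * show thesis using that by blast
qed

lemma rapid_continuous: "rapid f \<Longrightarrow> continuous_on (-{0}) f"
  by (simp add: rapid_def)

lemma borel_measurable_continuous_off_0:
  fixes f :: "real^'n \<Rightarrow> 'b::topological_space"
  assumes "continuous_on (-{0}) f"
  shows "f \<in> borel_measurable borel"
  by (rule borel_measurable_continuous_countable_exceptions[of "{0}"]) (use assms in auto)

lemma rapid_measurable [measurable]: "rapid f \<Longrightarrow> f \<in> borel_measurable borel"
  by (rule borel_measurable_continuous_off_0) (simp add: rapid_def)

lemma rapid_mult_polygrowth:
  assumes "polygrowth g" "rapid f"
  shows "rapid (\<lambda>x. g x * f x)"
  unfolding rapid_def
proof (intro conjI allI)
  show "continuous_on (-{0}) (\<lambda>x. g x * f x)"
    using assms by (auto simp: rapid_def polygrowth_def intro: continuous_intros)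
  fix M
  obtain C L where g: "C \<ge> 0" "\<And>x. cmod (g x) \<le> C * (1 + norm x) ^ L"
    using polygrowthE[OF assms(1)] by blast
  obtain K where f: "\<And>x. (1 + norm x) ^ (M + L) * cmod (f x) \<le> K"
    using rapidE[OF assms(2)] by blast
  have "(1 + norm x) ^ M * cmod (g x * f x) \<le> C * K" for x
  proof -
    have "(1 + norm x) ^ M * cmod (g x * f x) \<le> (1 + norm x) ^ M * (C * (1 + norm x) ^ L * cmod (f x))"
      using g by (intro mult_left_mono) (auto simp: norm_mult intro!: mult_right_mono)
    also have "\<dots> = C * ((1 + norm x) ^ (M + L) * cmod (f x))"
      by (simp add: power_add algebra_simps)
    also have "\<dots> \<le> C * K"
      using g f by (intro mult_left_mono) auto
    finally show ?thesis .
  qed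
  then show "\<exists>C. \<forall>x. (1 + norm x) ^ M * cmod (g x * f x) \<le> C" by blast
qed

lemma rapid_polygrowth: "rapid f \<Longrightarrow> polygrowth f"
  by (rule rapidE[of f 0], assumption) (auto intro!: polygrowthI[where M=0] simp: rapid_continuous)

lemma rapid_mult: "rapid f \<Longrightarrow> rapid g \<Longrightarrow> rapid (\<lambda>x. f x * g x)"
  by (simp add: rapid_mult_polygrowth rapid_polygrowth)

lemma rapid_zero [simp]: "rapid (\<lambda>x. 0)"
  by (auto simp: rapid_def)

lemma rapid_add: 
  assumes "rapid f" "rapid g"
  shows "rapid (\<lambda>x. f x + g x)"
  unfolding rapid_def
proof (intro conjI allI)
  show "continuous_on (-{0}) (\<lambda>x. f x + g x)"
    using assms by (auto simp: rapid_def intro: continuous_intros)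
  fix M
  obtain C where f: "\<And>x. (1 + norm x) ^ M * cmod (f x) \<le> C"
    using rapidE[OF assms(1)] by blast
  obtain K where g: "\<And>x. (1 + norm x) ^ M * cmod (g x) \<le> K"
    using rapidE[OF assms(2)] by blast
  have "(1 + norm x) ^ M * cmod (f x + g x) \<le> C + K" for x
  proof -
    have "(1 + norm x) ^ M * cmod (f x + g x) \<le> (1 + norm x) ^ M * (cmod (f x) + cmod (g x))"
      by (intro mult_left_mono norm_triangle_ineq) auto
    also have "\<dots> \<le> C + K"
      using f[of x] g[of x] by (simp add: algebra_simps)
    finally show ?thesis .
  qed
  then show "\<exists>C. \<forall>x. (1 + norm x) ^ M * cmod (f x + g x) \<le> C" by blast
qed

lemma polygrowth_const [simp]: "polygrowth (\<lambda>x. c)"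
  by (rule polygrowthI[of _ "cmod c" 0]) auto

lemma rapid_scale: "rapid f \<Longrightarrow> rapid (\<lambda>x. c * f x)"
  by (simp add: rapid_mult_polygrowth)

lemma rapid_uminus: "rapid f \<Longrightarrow> rapid (\<lambda>x. - f x)"
  using rapid_scale[of f "-1"] by simp

lemma rapid_diff: "rapid f \<Longrightarrow> rapid g \<Longrightarrow> rapid (\<lambda>x. f x - g x)"
  using rapid_add[of f "\<lambda>x. - g x"] rapid_uminus[of g] by simp

lemma rapid_sum: "(\<And>i. i \<in> I \<Longrightarrow> rapid (f i)) \<Longrightarrow> rapid (\<lambda>x. \<Sum>i\<in>I. f i x)"
  by (induction I rule: infinite_finite_induct) (auto intro: rapid_add)

lemma rapid_cnj: "rapid f \<Longrightarrow> rapid (\<lambda>x. cnj (f x))"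
  by (auto simp: rapid_def intro: continuous_on_cnj)

lemma polygrowth_component: "polygrowth (\<lambda>x::real^'n. of_real (x $ i))"
  by (rule polygrowthI[where C=1 and M=1])
     (auto intro!: continuous_intros order_trans[OF component_le_norm_cart])

lemma polygrowth_powr:
  assumes "g \<ge> 0"
  shows "polygrowth (\<lambda>x::real^'n. of_real (norm x powr g))"
proof (rule polygrowthI[where C=1 and M="nat \<lceil>g\<rceil>"])
  show "continuous_on (- {0}) (\<lambda>x::real^'n. complex_of_real (norm x powr g))"
    by (auto intro!: continuous_intros)
  fix x :: "real^'n"
  have "norm x powr g \<le> (1 + norm x) powr g"
    using assms by (intro powr_mono2) auto
  also have "\<dots> \<le> (1 + norm x) powr (real (nat \<lceil>g\<rceil>))"
    by (intro powr_mono) (auto, linarith)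
  also have "\<dots> = (1 + norm x) ^ nat \<lceil>g\<rceil>"
    by (subst powr_realpow) (auto simp: add_pos_nonneg)
  finally show "cmod (of_real (norm x powr g)) \<le> 1 * (1 + norm x) ^ nat \<lceil>g\<rceil>"
    by simp
qed

lemma polygrowth_norm: "polygrowth (\<lambda>x::real^'n. of_real (norm x))"
  by (rule polygrowthI[where C=1 and M=1]) (auto intro!: continuous_intros)

lemma polygrowth_bounded:
  assumes "continuous_on (-{0}) g" "\<And>x. cmod (g x) \<le> C"
  shows "polygrowth g"
  using assms by (intro polygrowthI[where C=C and M=0]) auto

section \<open>Product integrals and the integrability of inverse powers\<close>

lemma integrable_inverse_one_plus_square: "integrable lborel (\<lambda>x::real. inverse (1 + x\<^sup>2))"
  using integrable_inverse_1_plus_square(1) by (simp add: set_integrable_def einterval_def)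

lemma sum_Basis_vec:
  fixes g :: "real^'n \<Rightarrow> 'b::comm_monoid_add"
  shows "(\<Sum>b\<in>Basis. g b) = (\<Sum>i\<in>UNIV. g (axis i 1))"
proof -
  have "(Basis :: (real^'n) set) = (\<lambda>i. axis i 1) ` UNIV"
    by (auto simp: Basis_vec_def)
  moreover have "inj (\<lambda>i::'n. axis i (1::real))"
    by (auto simp: inj_on_def axis_eq_axis)
  ultimately show ?thesis
    by (metis (no_types, lifting) sum.reindex_cong)
qed

lemma prod_Basis_vec:
  fixes g :: "real^'n \<Rightarrow> 'b::comm_monoid_mult"
  shows "(\<Prod>b\<in>Basis. g b) = (\<Prod>i\<in>UNIV. g (axis i 1))"
proof -
  have "(Basis :: (real^'n) set) = (\<lambda>i. axis i 1) ` UNIV"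
    by (auto simp: Basis_vec_def)
  moreover have "inj (\<lambda>i::'n. axis i (1::real))"
    by (auto simp: inj_on_def axis_eq_axis)
  ultimately show ?thesis
    by (metis (no_types, lifting) prod.reindex_cong)
qed

text \<open>\<open>lborel\<close> is the image of a product measure indexed by basis vectors, so the
  factors indexed by coordinates are carried over to the basis before the product theorem for
  integrals applies.\<close>

lemma lborel_prod_coordinates:
  fixes f :: "'n::finite \<Rightarrow> real \<Rightarrow> complex"
  assumes "\<And>i. integrable lborel (f i)"
  shows "integrable lborel (\<lambda>x::real^'n. \<Prod>i\<in>UNIV. f i (x $ i))" (is ?A)
    and "(LINT x|lborel. (\<Prod>i\<in>UNIV. f i ((x::real^'n) $ i))) = (\<Prod>i\<in>UNIV. LINT t|lborel. f i t)" (is ?B)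
proof -
  interpret product_sigma_finite "\<lambda>b::real^'n. lborel :: real measure" ..
  define F where "F b = f (THE i. b = axis i 1)" for b :: "real^'n"
  have F: "F (axis i 1) = f i" for i
  proof -
    have "(THE j. axis i (1::real) = axis j 1) = i" by (auto simp: axis_eq_axis)
    then show ?thesis by (simp add: F_def)
  qed
  have intF: "integrable lborel (F b)" for b unfolding F_def using assms by auto
  have [measurable]: "f i \<in> borel_measurable borel" for i
    using borel_measurable_integrable[OF assms[of i]] by simp
  have T: "(\<lambda>g. \<Sum>b\<in>Basis. g b *\<^sub>R b) \<in> (\<Pi>\<^sub>M b\<in>(Basis::(real^'n) set). lborel) \<rightarrow>\<^sub>M borel"
    by measurable
  have meas: "(\<lambda>x::real^'n. \<Prod>i\<in>UNIV. f i (x $ i)) \<in> borel_measurable borel" by measurable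
  have comp: "(\<Prod>i\<in>UNIV. f i ((\<Sum>b\<in>Basis. g b *\<^sub>R b) $ i)) = (\<Prod>b\<in>Basis. F b (g b))" for g :: "real^'n \<Rightarrow> real"
  proof -
    have "(\<Sum>b\<in>Basis. g b *\<^sub>R b) $ i = g (axis i 1)" for i
      by (subst sum_Basis_vec) (simp add: axis_def sum.delta' if_distrib cong: if_cong)
    then show ?thesis by (simp add: prod_Basis_vec F)
  qed
  have 1: "integrable (\<Pi>\<^sub>M b\<in>Basis. lborel) (\<lambda>g. \<Prod>b\<in>(Basis::(real^'n) set). F b (g b))"
    by (rule product_integrable_prod) (auto intro: intF)
  then show ?A
    by (subst lborel_eq, subst integrable_distr_eq[OF T meas]) (simp only: comp)
  have "(LINT x|lborel. (\<Prod>i\<in>UNIV. f i ((x::real^'n) $ i))) = (LINT g|(\<Pi>\<^sub>M b\<in>Basis. lborel). (\<Prod>b\<in>(Basis::(real^'n) set). F b (g b)))"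
    by (subst lborel_eq, subst integral_distr[OF T meas]) (simp only: comp)
  also have "\<dots> = (\<Prod>b\<in>Basis. LINT t|lborel. F b t)"
    by (rule product_integral_prod) (auto intro: intF)
  finally show ?B by (simp add: prod_Basis_vec F)
qed

text \<open>The product of the N functions 1 / (1 + x_i^2) dominates: each 1 + x_i^2 is at most (1 +
  |x|)^2, which accounts for the exponent 2N.\<close>

lemma integrable_inverse_power:
  assumes "M \<ge> 2 * CARD('n)"
  shows "integrable lborel (\<lambda>x::real^'n. 1 / (1 + norm x) ^ M)"
proof -
  have "integrable lborel (\<lambda>x::real^'n. \<Prod>i\<in>UNIV. complex_of_real (inverse (1 + (x $ i)\<^sup>2)))"
    by (rule lborel_prod_coordinates) (rule integrable_of_real[OF integrable_inverse_one_plus_square])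
  then have "integrable lborel (\<lambda>x::real^'n. complex_of_real (\<Prod>i\<in>UNIV. inverse (1 + (x $ i)\<^sup>2)))"
    by simp
  then show ?thesis
  proof (rule Bochner_Integration.integrable_bound)
    show "AE x in lborel. norm (1 / (1 + norm x) ^ M) \<le> norm (complex_of_real (\<Prod>i\<in>(UNIV::'n set). inverse (1 + (x $ i)\<^sup>2)))"
    proof (rule AE_I2)
      fix x :: "real^'n"
      have "1 + (x $ i)\<^sup>2 \<le> (1 + norm x)\<^sup>2" for i
      proof -
        have "(x $ i)\<^sup>2 \<le> (norm x)\<^sup>2" using component_le_norm_cart[of x i] by (metis abs_le_square_iff abs_norm_cancel)
        then show ?thesis by (simp add: power2_sum add_increasing2)
      qed
      then have "(\<Prod>i\<in>(UNIV::'n set). 1 + (x $ i)\<^sup>2) \<le> (\<Prod>i\<in>(UNIV::'n set). (1 + norm x)\<^sup>2)"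
        by (intro prod_mono) auto
      also have "\<dots> = (1 + norm x) ^ (2 * CARD('n))" by (simp add: power_mult)
      also have "\<dots> \<le> (1 + norm x) ^ M" using assms by (intro power_increasing) auto
      finally have le: "(\<Prod>i\<in>(UNIV::'n set). 1 + (x $ i)\<^sup>2) \<le> (1 + norm x) ^ M" .
      have pos: "0 < (\<Prod>i\<in>(UNIV::'n set). 1 + (x $ i)\<^sup>2)"
        by (intro prod_pos) (auto simp: add_pos_nonneg)
      have "1 / (1 + norm x) ^ M \<le> inverse (\<Prod>i\<in>(UNIV::'n set). 1 + (x $ i)\<^sup>2)"
        using le pos by (simp add: divide_simps)
      then have "1 / (1 + norm x) ^ M \<le> (\<Prod>i\<in>(UNIV::'n set). inverse (1 + (x $ i)\<^sup>2))"
        by (simp add: prod_inversef[symmetric] o_def)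
      then show "norm (1 / (1 + norm x) ^ M) \<le> norm (complex_of_real (\<Prod>i\<in>(UNIV::'n set). inverse (1 + (x $ i)\<^sup>2)))"
        by (simp only: norm_of_real real_norm_def) (rule order_trans[OF _ abs_ge_self], simp)
    qed
  qed auto
qed

lemma rapid_bound:
  assumes "rapid f"
  obtains C where "\<And>x. cmod (f x) \<le> C / (1 + norm x) ^ M"
proof -
  obtain C where "\<And>x. (1 + norm x) ^ M * cmod (f x) \<le> C"
    using rapidE[OF assms] by blast
  moreover have "(1 + norm x) ^ M > 0" for x :: "real^'a" by (simp add: add_pos_nonneg)
  ultimately show thesis using that[of C] by (simp add: pos_le_divide_eq mult.commute)
qed

lemma rapid_integrable: 
  fixes f :: "real^'n \<Rightarrow> complex"
  assumes "rapid f"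
  shows "integrable lborel f"
proof -
  obtain C where C: "\<And>x. cmod (f x) \<le> C / (1 + norm x) ^ (2 * CARD('n))"
    using rapid_bound[OF assms] by blast
  have "integrable lborel (\<lambda>x::real^'n. C * (1 / (1 + norm x) ^ (2 * CARD('n))))"
    by (intro integrable_mult_right integrable_inverse_power) simp
  then show ?thesis
    by (rule Bochner_Integration.integrable_bound)
       (use assms in \<open>auto intro!: AE_I2 order_trans[OF C] divide_right_mono\<close>)
qed

lemma rapid_bounded: "rapid f \<Longrightarrow> \<exists>C. \<forall>x. cmod (f x) \<le> C"
  by (erule rapidE[of _ 0]) auto

lemma AE_lborel_neq: "AE x in (lborel :: (real^'n) measure). x \<noteq> c"
  by (rule AE_lborel_singleton)

lemma rapid_cong: "rapid f \<Longrightarrow> (\<And>x. f x = g x) \<Longrightarrow> rapid g"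
  by (metis ext)

section \<open>Fourier integrals and Gaussians\<close>

definition fker :: "real^'n \<Rightarrow> real^'n \<Rightarrow> complex" where
  "fker x \<xi> = exp (- 2 * of_real pi * \<i> * of_real (x \<bullet> \<xi>))"

lemma fourier_integral_fker: "fourier_integral f \<xi> = (LINT x|lborel. f x * fker x \<xi>)"
  by (simp add: fourier_integral_def fker_def)

lemma norm_fker [simp]: "cmod (fker x \<xi>) = 1"
proof -
  have "fker x \<xi> = exp (\<i> * of_real (- 2 * pi * (x \<bullet> \<xi>)))"
    by (simp add: fker_def algebra_simps)
  then show ?thesis by (simp only: norm_exp_i_times)
qed

lemma fker_sym: "fker x y = fker y x"
  by (simp add: fker_def inner_commute)

lemma fker_add: "fker (x + y) z = fker x z * fker y z"
  by (simp add: fker_def inner_add_left algebra_simps flip: exp_add)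

lemma fker_diff: "fker (x - y) z = fker x z * fker (-y) z"
  using fker_add[of x "-y" z] by simp

lemma fker_minus: "fker (- x) z = cnj (fker x z)"
  by (simp add: fker_def exp_cnj)

lemma fker_minus_right: "fker x (- z) = cnj (fker x z)"
  using fker_minus[of z x] by (simp add: fker_sym)

lemma continuous_fker: "continuous_on A f \<Longrightarrow> continuous_on A g \<Longrightarrow> continuous_on A (\<lambda>x. fker (f x) (g x))"
  unfolding fker_def by (intro continuous_intros)

lemma measurable_fker [measurable]:
  assumes [measurable]: "f \<in> borel_measurable M" "g \<in> borel_measurable M"
  shows "(\<lambda>x. fker (f x) (g x)) \<in> borel_measurable M"
  unfolding fker_def by measurable

lemma integrable_fker:
  assumes "integrable lborel f"
  shows "integrable lborel (\<lambda>x. f x * fker x \<xi>)"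
  using assms by (rule Bochner_Integration.integrable_bound)
    (use borel_measurable_integrable[OF assms] in \<open>auto simp: norm_mult\<close>)

lemma fourier_integral_cong_AE:
  assumes "AE x in lborel. f x = g x" "f \<in> borel_measurable borel" "g \<in> borel_measurable borel"
  shows "fourier_integral f = fourier_integral g"
  unfolding fourier_integral_fker fun_eq_iff
  by (intro allI integral_cong_AE) (use assms in auto)

lemma fourier_integral_bound: "cmod (fourier_integral f \<xi>) \<le> (LINT x|lborel. cmod (f x))"
  unfolding fourier_integral_fker
  by (rule order_trans[OF integral_norm_bound]) (simp add: norm_mult)

lemma fourier_integral_diff:
  assumes "integrable lborel f" "integrable lborel g"
  shows "fourier_integral (\<lambda>x. f x - g x) \<xi> = fourier_integral f \<xi> - fourier_integral g \<xi>"
  unfolding fourier_integral_fker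
  by (subst Bochner_Integration.integral_diff[symmetric]) (auto intro: integrable_fker assms simp: algebra_simps)

lemma fourier_integral_cmult: "fourier_integral (\<lambda>x. c * f x) \<xi> = c * fourier_integral f \<xi>"
  unfolding fourier_integral_fker by (simp add: mult.assoc)

lemma continuous_fourier_integral:
  assumes "integrable lborel (f :: real^'n \<Rightarrow> complex)"
  shows "continuous_on UNIV (fourier_integral f)"
proof -
  have [measurable]: "f \<in> borel_measurable borel" using borel_measurable_integrable[OF assms] by simp
  have "isCont (fourier_integral f) x" for x
    unfolding continuous_at_sequentially o_def fourier_integral_fker
  proof (intro allI impI)
    fix X assume X: "X \<longlonglongrightarrow> x"
    show "(\<lambda>n. LINT y|lborel. f y * fker y (X n)) \<longlonglongrightarrow> (LINT y|lborel. f y * fker y x)"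
    proof (rule integral_dominated_convergence[where w="\<lambda>y. cmod (f y)"])
      show "AE y in lborel. (\<lambda>n. f y * fker y (X n)) \<longlonglongrightarrow> f y * fker y x"
        unfolding fker_def by (intro AE_I2 tendsto_intros X)
    qed (use assms in \<open>auto simp: norm_mult\<close>)
  qed
  then show ?thesis by (simp add: continuous_on_eq_continuous_at)
qed

lemma measurable_fourier_integral [measurable]:
  assumes "integrable lborel (f :: real^'n \<Rightarrow> complex)"
  shows "fourier_integral f \<in> borel_measurable borel"
  by (intro borel_measurable_continuous_onI continuous_fourier_integral assms)

text \<open>The kernels of Fourier integrals have modulus one, so a product bound is all that Fubini
  requires of the double integrals in this section and the next.\<close>

lemma integrable_pair_bound:
  fixes K :: "'a::euclidean_space \<times> 'b::euclidean_space \<Rightarrow> complex"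
  assumes f: "integrable lborel f" and g: "integrable lborel g"
    and [measurable]: "K \<in> borel_measurable (borel \<Otimes>\<^sub>M borel)"
    and le: "\<And>x y. cmod (K (x, y)) \<le> f x * (g y :: real)"
  shows "integrable (lborel \<Otimes>\<^sub>M lborel) K"
proof (rule lborel_pair.Fubini_integrable)
  have [measurable]: "f \<in> borel_measurable borel" "g \<in> borel_measurable borel"
    using borel_measurable_integrable[OF f] borel_measurable_integrable[OF g] by simp_all
  show K: "K \<in> borel_measurable (lborel \<Otimes>\<^sub>M lborel)" by measurable
  have le0: "norm (K (x, y)) \<le> norm (f x * g y)" for x y
    using le[of x y] by simp
  have i: "integrable lborel (\<lambda>y. K (x, y))" for x
    by (rule Bochner_Integration.integrable_bound[of _ "\<lambda>y. f x * g y"])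
       (use g le0 in \<open>auto simp: abs_mult\<close>)
  show "AE x in lborel. integrable lborel (\<lambda>y. K (x, y))" using i by auto
  show "integrable lborel (\<lambda>x. LINT y|lborel. norm (K (x, y)))"
  proof (rule Bochner_Integration.integrable_bound[of _ "\<lambda>x. f x * (LINT y|lborel. g y)"])
    show "integrable lborel (\<lambda>x. f x * (LINT y|lborel. g y))" using f by simp
    show "AE x in lborel. norm (LINT y|lborel. norm (K (x, y))) \<le> norm (f x * (LINT y|lborel. g y))"
    proof (rule AE_I2)
      fix x
      have "(LINT y|lborel. norm (K (x, y))) \<le> (LINT y|lborel. f x * g y)"
        by (intro integral_mono) (use i g le in auto)
      moreover have "0 \<le> (LINT y|lborel. norm (K (x, y)))" by simp
      ultimately show "norm (LINT y|lborel. norm (K (x, y))) \<le> norm (f x * (LINT y|lborel. g y))"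
        by simp
    qed
  qed measurable
qed

text \<open>Fubini, with a kernel symmetric in its two arguments. It takes the place of a
  convolution theorem: each later use of duality, from Plancherel to the transform of a truncated
  function, goes through it.\<close>

lemma fourier_multiplication_formula:
  fixes f g :: "real^'n \<Rightarrow> complex"
  assumes f: "integrable lborel f" and g: "integrable lborel g"
  shows "(LINT \<xi>|lborel. fourier_integral f \<xi> * g \<xi>) = (LINT x|lborel. f x * fourier_integral g x)"
proof -
  have [measurable]: "f \<in> borel_measurable borel" "g \<in> borel_measurable borel"
    using borel_measurable_integrable[OF f] borel_measurable_integrable[OF g] by simp_all
  have "integrable (lborel \<Otimes>\<^sub>M lborel) (case_prod (\<lambda>x \<xi>. f x * fker x \<xi> * g \<xi>))"
    by (rule integrable_pair_bound[of "\<lambda>x. cmod (f x)" "\<lambda>x. cmod (g x)"])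
       (use f g in \<open>auto simp: norm_mult\<close>)
  note eq = lborel_pair.Fubini_integral[OF this]
  have "(LINT \<xi>|lborel. fourier_integral f \<xi> * g \<xi>) = (LINT \<xi>|lborel. LINT x|lborel. f x * fker x \<xi> * g \<xi>)"
    by (simp add: fourier_integral_fker)
  also have "\<dots> = (LINT x|lborel. LINT \<xi>|lborel. f x * fker x \<xi> * g \<xi>)" by (rule eq)
  also have "\<dots> = (LINT x|lborel. f x * fourier_integral g x)"
    by (simp add: fourier_integral_fker mult.assoc fker_sym[of x for x] mult.left_commute flip: integral_mult_right_zero) (simp add: mult_ac)
  finally show ?thesis .
qed

lemma integrable_complex_mult_iff:
  fixes f :: "'a \<Rightarrow> complex"
  assumes "c \<noteq> 0"
  shows "integrable M (\<lambda>x. c * f x) \<longleftrightarrow> integrable M f"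
  using assms integrable_mult_right[of "1/c" M "\<lambda>x. c * f x"] by auto

lemma
  fixes f :: "real^'n \<Rightarrow> complex"
  assumes c: "c \<noteq> 0" and [measurable]: "f \<in> borel_measurable borel"
  shows lborel_integral_affine: "(LINT x|lborel. f x) = of_real (\<bar>c\<bar> ^ CARD('n)) * (LINT x|lborel. f (t + c *\<^sub>R x))"
    and lborel_integrable_affine: "integrable lborel f \<longleftrightarrow> integrable lborel (\<lambda>x. f (t + c *\<^sub>R x))"
proof -
  have "(LINT x|lborel. f x) = (LINT x|density (distr lborel borel (\<lambda>x. t + c *\<^sub>R x)) (\<lambda>_. ennreal (\<bar>c\<bar> ^ CARD('n))). f x)"
    using lborel_affine[OF c, of t] by (simp add: ennreal_power)
  also have "\<dots> = (LINT x|distr lborel borel (\<lambda>x. t + c *\<^sub>R x). (\<bar>c\<bar> ^ CARD('n)) *\<^sub>R f x)"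
    by (subst integral_density) auto
  also have "\<dots> = (LINT x|lborel. (\<bar>c\<bar> ^ CARD('n)) *\<^sub>R f (t + c *\<^sub>R x))"
    by (subst integral_distr) auto
  finally show "(LINT x|lborel. f x) = of_real (\<bar>c\<bar> ^ CARD('n)) * (LINT x|lborel. f (t + c *\<^sub>R x))"
    by (simp add: scaleR_conv_of_real)
  have "integrable lborel f \<longleftrightarrow> integrable (density (distr lborel borel (\<lambda>x. t + c *\<^sub>R x)) (\<lambda>_. ennreal (\<bar>c\<bar> ^ CARD('n)))) f"
    using lborel_affine[OF c, of t] by (simp add: ennreal_power)
  also have "\<dots> \<longleftrightarrow> integrable (distr lborel borel (\<lambda>x. t + c *\<^sub>R x)) (\<lambda>x. (\<bar>c\<bar> ^ CARD('n)) *\<^sub>R f x)"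
    by (subst integrable_density) auto
  also have "\<dots> \<longleftrightarrow> integrable lborel (\<lambda>x. (\<bar>c\<bar> ^ CARD('n)) *\<^sub>R f (t + c *\<^sub>R x))"
    by (subst integrable_distr_eq) auto
  finally show "integrable lborel f \<longleftrightarrow> integrable lborel (\<lambda>x. f (t + c *\<^sub>R x))"
    using c integrable_complex_mult_iff[of "of_real (\<bar>c\<bar> ^ CARD('n))" lborel "\<lambda>x. f (t + c *\<^sub>R x)"]
    by (simp add: scaleR_conv_of_real[where 'a=complex])
qed

section \<open>Gaussians and their transforms\<close>

definition gauss :: "real \<Rightarrow> real^'n \<Rightarrow> real" where
  "gauss \<sigma> x = exp (- \<sigma>\<^sup>2 * (norm x)\<^sup>2 / 2)"

lemma norm_vec_power2: "(norm (x :: real^'n))\<^sup>2 = (\<Sum>i\<in>UNIV. (x $ i)\<^sup>2)"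
  by (simp add: norm_eq_sqrt_inner inner_vec_def power2_eq_square sum_nonneg)

text \<open>The characteristic function of the standard normal law, after the substitution t ->
  \<sigma> t.\<close>

lemma gaussian_char_integral:
  fixes \<sigma> :: real
  assumes "\<sigma> > 0"
  shows "integrable lborel (\<lambda>t. complex_of_real (exp (- \<sigma>\<^sup>2 * t\<^sup>2 / 2)) * exp (- 2 * of_real pi * \<i> * of_real (t * x)))" (is "integrable _ ?g")
    and "(LINT t|lborel. complex_of_real (exp (- \<sigma>\<^sup>2 * t\<^sup>2 / 2)) * exp (- 2 * of_real pi * \<i> * of_real (t * x)))
       = of_real (sqrt (2 * pi) / \<sigma> * exp (- 2 * pi\<^sup>2 * x\<^sup>2 / \<sigma>\<^sup>2))"
proof -
  \<comment> \<open>With this \<open>y\<close> the phase y (\<sigma> t) equals - 2 pi t x.\<close>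
  define y where "y = - 2 * pi * x / \<sigma>"
  define f where "f t = complex_of_real (std_normal_density t) * iexp (y * t)" for t
  have "(LINT t|std_normal_distribution. iexp (y * t)) = of_real (exp (- y\<^sup>2 / 2))"
    using char_std_normal_distribution unfolding char_def fun_eq_iff by simp
  then have 1: "(LINT t|lborel. f t) = of_real (exp (- y\<^sup>2 / 2))"
    by (subst (asm) integral_density) (auto simp: scaleR_conv_of_real f_def)
  have int: "integrable lborel f"
    unfolding f_def
    by (rule Bochner_Integration.integrable_bound[OF integrable_std_normal_moment[of 0]])
       (auto simp: norm_mult)
  have 2: "f (0 + \<sigma> * t) = of_real (1 / sqrt (2 * pi)) * ?g t" for t
  proof -
    have "y * (\<sigma> * t) = - 2 * pi * (t * x)" using assms by (simp add: y_def field_simps)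
    then have "iexp (y * (\<sigma> * t)) = exp (- 2 * of_real pi * \<i> * of_real (t * x))"
      by (simp add: algebra_simps)
    moreover have "std_normal_density (\<sigma> * t) = 1 / sqrt (2 * pi) * exp (- \<sigma>\<^sup>2 * t\<^sup>2 / 2)"
      by (simp add: std_normal_density_def power_mult_distrib)
    ultimately show ?thesis by (simp add: f_def)
  qed
  have "integrable lborel (\<lambda>t. f (0 + \<sigma> * t))"
    using assms by (intro lborel_integrable_real_affine int) auto
  then show "integrable lborel ?g"
    unfolding 2 by (subst (asm) integrable_complex_mult_iff) auto
  have "(LINT t|lborel. f t) = \<bar>\<sigma>\<bar> *\<^sub>R (LINT t|lborel. f (0 + \<sigma> * t))"
    by (rule lborel_integral_real_affine) (use assms in auto)
  then have "of_real (exp (- y\<^sup>2 / 2)) = of_real \<sigma> * (of_real (1 / sqrt (2 * pi)) * (LINT t|lborel. ?g t))"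
    using assms by (simp only: 1 2 scaleR_conv_of_real abs_of_pos) (simp add: mult.assoc)
  then have "(LINT t|lborel. ?g t) = of_real (sqrt (2 * pi) / \<sigma> * exp (- y\<^sup>2 / 2))"
    using assms by (simp add: field_simps)
  also have "- y\<^sup>2 / 2 = - 2 * pi\<^sup>2 * x\<^sup>2 / \<sigma>\<^sup>2"
    by (simp add: y_def power_mult_distrib power_divide)
  finally show "(LINT t|lborel. ?g t) = of_real (sqrt (2 * pi) / \<sigma> * exp (- 2 * pi\<^sup>2 * x\<^sup>2 / \<sigma>\<^sup>2))" .
qed

text \<open>Both the Gaussian and the kernel factor over the coordinates, which reduces everything
  to dimension one.\<close>

lemma gauss_fourier:
  fixes x :: "real^'n"
  assumes "\<sigma> > 0"
  shows "integrable lborel (\<lambda>x::real^'n. complex_of_real (gauss \<sigma> x))" (is ?A)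
    and "fourier_integral (\<lambda>x. of_real (gauss \<sigma> x)) x =
      of_real ((sqrt (2 * pi) / \<sigma>) ^ CARD('n) * gauss (2 * pi / \<sigma>) x)" (is ?B)
proof -
  let ?g = "\<lambda>(x::real^'n) i t. complex_of_real (exp (- \<sigma>\<^sup>2 * t\<^sup>2 / 2)) * exp (- 2 * of_real pi * \<i> * of_real (t * (x$i)))"
  have eq: "complex_of_real (gauss \<sigma> y) * fker y x = (\<Prod>i\<in>UNIV. ?g x i (y $ i))" for x y :: "real^'n"
  proof -
    have "(\<Prod>i\<in>UNIV. ?g x i (y $ i)) =
      of_real (exp (\<Sum>i\<in>UNIV. - \<sigma>\<^sup>2 * (y $ i)\<^sup>2 / 2)) * exp (\<Sum>i\<in>UNIV. - 2 * of_real pi * \<i> * of_real (y $ i * (x$i)))"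
      by (simp only: prod.distrib exp_sum[OF finite_class.finite_UNIV] of_real_prod)
    also have "(\<Sum>i\<in>UNIV. - \<sigma>\<^sup>2 * (y $ i)\<^sup>2 / 2) = - \<sigma>\<^sup>2 * (norm y)\<^sup>2 / 2"
      by (simp add: norm_vec_power2 sum_distrib_left sum_divide_distrib sum_negf)
    also have "(\<Sum>i\<in>UNIV. - 2 * of_real pi * \<i> * of_real (y $ i * (x$i))) = - 2 * of_real pi * \<i> * of_real (y \<bullet> x)"
      by (simp add: inner_vec_def sum_distrib_left sum_negf)
    finally show ?thesis by (simp add: gauss_def fker_def)
  qed
  note int = gaussian_char_integral[OF assms]
  have "integrable lborel (\<lambda>y::real^'n. complex_of_real (gauss \<sigma> y) * fker y 0)"
    unfolding eq by (rule lborel_prod_coordinates) (rule int(1))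
  then show ?A by (simp add: fker_def)
  have "fourier_integral (\<lambda>x. of_real (gauss \<sigma> x)) x = (LINT y|lborel. (\<Prod>i\<in>UNIV. ?g x i (y $ i)))"
    unfolding fourier_integral_fker eq ..
  also have "\<dots> = (\<Prod>i\<in>UNIV. LINT t|lborel. ?g x i t)"
    by (rule lborel_prod_coordinates) (rule int(1))
  also have "\<dots> = (\<Prod>i\<in>UNIV. of_real (sqrt (2 * pi) / \<sigma> * exp (- 2 * pi\<^sup>2 * (x$i)\<^sup>2 / \<sigma>\<^sup>2)))"
    unfolding int(2) ..
  also have "\<dots> = of_real ((sqrt (2 * pi) / \<sigma>) ^ CARD('n) * exp (\<Sum>i\<in>UNIV. - 2 * pi\<^sup>2 * (x$i)\<^sup>2 / \<sigma>\<^sup>2))"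
    by (simp only: exp_sum[OF finite_class.finite_UNIV] of_real_prod[symmetric] prod.distrib prod_constant)
  also have "(\<Sum>i\<in>UNIV. - 2 * pi\<^sup>2 * (x$i)\<^sup>2 / \<sigma>\<^sup>2) = - (2 * pi / \<sigma>)\<^sup>2 * (norm x)\<^sup>2 / 2"
    by (simp add: norm_vec_power2 sum_distrib_left sum_divide_distrib sum_negf power_divide power_mult_distrib mult.assoc)
  finally show ?B by (simp add: gauss_def)
qed

lemma gauss_measurable [measurable]: "gauss \<sigma> \<in> borel_measurable borel"
  unfolding gauss_def[abs_def] by measurable

lemma gauss_integral:
  shows "integrable lborel (\<lambda>x::real^'n. gauss 1 x)"
    and "(LINT x|lborel. gauss 1 (x::real^'n)) = sqrt (2 * pi) ^ CARD('n)"
proof -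
  have i: "integrable lborel (\<lambda>x::real^'n. complex_of_real (gauss 1 x))"
    by (rule gauss_fourier) simp
  then show "integrable lborel (\<lambda>x::real^'n. gauss 1 x)"
    using integrable_Re by fastforce
  have "complex_of_real (LINT x|lborel. gauss 1 (x::real^'n)) = fourier_integral (\<lambda>x. of_real (gauss 1 x)) (0::real^'n)"
    by (simp add: fourier_integral_fker fker_def)
  also have "\<dots> = of_real (sqrt (2 * pi) ^ CARD('n))"
    by (subst gauss_fourier) (auto simp: gauss_def)
  finally show "(LINT x|lborel. gauss 1 (x::real^'n)) = sqrt (2 * pi) ^ CARD('n)"
    using of_real_eq_iff by blast
qed

section \<open>Plancherel's identity\<close>

lemma borel_measurable_cnj [measurable]:
  assumes "f \<in> borel_measurable M"
  shows "(\<lambda>x. cnj (f x)) \<in> borel_measurable M"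
  using measurable_comp[OF assms borel_measurable_continuous_onI[OF continuous_on_cnj[OF continuous_on_id]]]
  by (simp add: o_def)

text \<open>The hypotheses under which Gaussian means of \<open>h\<close> converge to
  \<open>h\<close> almost everywhere and under an integrable bound. They are weak enough for
  truncations to balls, which jump on a sphere and which enter the definition of the L^2
  transform.\<close>

definition tame :: "(real^'n \<Rightarrow> complex) \<Rightarrow> bool" where
  "tame h \<longleftrightarrow> integrable lborel h \<and> (\<exists>B. \<forall>x. cmod (h x) \<le> B) \<and> (AE x in lborel. isCont h x)"

lemma tame_integrable: "tame h \<Longrightarrow> integrable lborel h"
  by (simp add: tame_def)

lemma tame_measurable [measurable]: "tame h \<Longrightarrow> h \<in> borel_measurable borel"
  using borel_measurable_integrable[of lborel h] by (simp add: tame_def)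

lemma rapid_tame: "rapid h \<Longrightarrow> tame h"
  unfolding tame_def
proof (intro conjI)
  assume h: "rapid h"
  show "AE x in lborel. isCont h x"
    using AE_lborel_neq[of 0]
  proof eventually_elim
    case (elim x)
    then show ?case
      using rapid_continuous[OF h] continuous_on_eq_continuous_at[of "-{0}" h] by auto
  qed
qed (auto intro: rapid_integrable rapid_bounded)

lemma integrable_bounded_mult:
  fixes f g :: "'a \<Rightarrow> complex"
  assumes f: "integrable M f" and g: "\<And>x. cmod (g x) \<le> B" and [measurable]: "g \<in> borel_measurable M"
  shows "integrable M (\<lambda>x. f x * g x)" "integrable M (\<lambda>x. g x * f x)"
proof -
  have [measurable]: "f \<in> borel_measurable M" using f by simp
  have "B \<ge> 0" using g[of undefined] norm_ge_zero order_trans by blast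
  show 1: "integrable M (\<lambda>x. f x * g x)"
    by (rule Bochner_Integration.integrable_bound[of _ "\<lambda>x. B * cmod (f x)"])
       (use f g \<open>B \<ge> 0\<close> in \<open>auto simp: norm_mult abs_mult mult.commute[of B] intro!: mult_left_mono\<close>)
  then show "integrable M (\<lambda>x. g x * f x)" by (simp add: mult.commute)
qed

text \<open>The Gaussian factor makes all integrals absolutely convergent. Its own transform is
  again a Gaussian, so duality turns the damped integral of the squared transform into the pairing
  of \<open>h\<close> with its Gaussian means at scale \<sigma> / (2 pi).\<close>

lemma plancherel_gauss:
  fixes h :: "real^'n \<Rightarrow> complex"
  assumes h: "integrable lborel h" and \<sigma>: "\<sigma> > 0"
  shows "(LINT \<xi>|lborel. of_real (gauss \<sigma> \<xi> * (cmod (fourier_integral h \<xi>))\<^sup>2)) =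
    (LINT x|lborel. h x * (LINT z|lborel. cnj (h (x - (\<sigma> / (2*pi)) *\<^sub>R z)) * of_real (gauss 1 z / sqrt (2*pi) ^ CARD('n))))"
    and "integrable lborel (\<lambda>\<xi>. gauss \<sigma> \<xi> * (cmod (fourier_integral h \<xi>))\<^sup>2)"
proof -
  let ?F = "fourier_integral h"
  have [measurable]: "h \<in> borel_measurable borel" using borel_measurable_integrable[OF h] by simp
  have [measurable]: "?F \<in> borel_measurable borel" by (rule measurable_fourier_integral[OF h])
  define B where "B = (LINT x|lborel. cmod (h x))"
  have B: "cmod (?F \<xi>) \<le> B" for \<xi> unfolding B_def by (rule fourier_integral_bound)
  note g = gauss_fourier(1)[where 'n='n, OF \<sigma>]
  \<comment> \<open>One of the two factors of the squared transform is merged with the Gaussian; the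
    multiplication formula then moves the transform off the other.\<close>
  define \<psi> where "\<psi> \<xi> = of_real (gauss \<sigma> \<xi>) * cnj (?F \<xi>)" for \<xi>
  have \<psi>: "integrable lborel \<psi>"
    unfolding \<psi>_def by (rule integrable_bounded_mult[where B=B]) (use g B in auto)
  have e0: "of_real (gauss \<sigma> \<xi> * (cmod (?F \<xi>))\<^sup>2) = \<psi> \<xi> * ?F \<xi>" for \<xi>
    by (simp only: of_real_mult complex_norm_square \<psi>_def) (simp add: mult_ac)
  have "integrable lborel (\<lambda>\<xi>. \<psi> \<xi> * ?F \<xi>)"
    by (rule integrable_bounded_mult[where B=B]) (use \<psi> B in auto)
  then have "integrable lborel (\<lambda>\<xi>. complex_of_real (gauss \<sigma> \<xi> * (cmod (?F \<xi>))\<^sup>2))"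
    by (simp only: e0)
  then show "integrable lborel (\<lambda>\<xi>. gauss \<sigma> \<xi> * (cmod (fourier_integral h \<xi>))\<^sup>2)"
    using integrable_Re by fastforce
  have inner: "fourier_integral \<psi> x = (LINT z|lborel. cnj (h (x - (\<sigma> / (2*pi)) *\<^sub>R z)) * of_real (gauss 1 z / sqrt (2*pi) ^ CARD('n)))" for x
  proof -
    have "integrable (lborel \<Otimes>\<^sub>M lborel) (case_prod (\<lambda>y \<xi>. cnj (h y) * (of_real (gauss \<sigma> \<xi>) * fker (x - y) \<xi>)))"
      by (rule integrable_pair_bound[of "\<lambda>x. cmod (h x)" "\<lambda>x. cmod (of_real (gauss \<sigma> x))"])
         (use h integrable_norm[OF g] in \<open>auto simp: norm_mult\<close>)
    note eq = lborel_pair.Fubini_integral[OF this]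
    have "fourier_integral \<psi> x = (LINT \<xi>|lborel. LINT y|lborel. cnj (h y) * (of_real (gauss \<sigma> \<xi>) * fker (x - y) \<xi>))"
    proof -
      have "\<psi> \<xi> * fker \<xi> x = (LINT y|lborel. cnj (h y) * (of_real (gauss \<sigma> \<xi>) * fker (x - y) \<xi>))" for \<xi>
      proof -
        have "\<psi> \<xi> * fker \<xi> x = (of_real (gauss \<sigma> \<xi>) * fker x \<xi>) * (LINT y|lborel. cnj (h y * fker y \<xi>))"
          by (simp add: \<psi>_def fourier_integral_fker fker_sym[of \<xi> x] mult_ac del: complex_cnj_mult)
        also have "\<dots> = (LINT y|lborel. (of_real (gauss \<sigma> \<xi>) * fker x \<xi>) * cnj (h y * fker y \<xi>))"
          by (simp only: integral_mult_right_zero)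
        also have "\<dots> = (LINT y|lborel. cnj (h y) * (of_real (gauss \<sigma> \<xi>) * fker (x - y) \<xi>))"
          by (rule Bochner_Integration.integral_cong) (auto simp: fker_diff fker_minus)
        finally show ?thesis .
      qed
      then show ?thesis by (simp add: fourier_integral_fker)
    qed
    also have "\<dots> = (LINT y|lborel. LINT \<xi>|lborel. cnj (h y) * (of_real (gauss \<sigma> \<xi>) * fker (x - y) \<xi>))" by (rule eq)
    also have "\<dots> = (LINT y|lborel. cnj (h y) * fourier_integral (\<lambda>x. of_real (gauss \<sigma> x)) (x - y))"
      by (simp add: fourier_integral_fker fker_sym[of "x - _"])
    also have "\<dots> = (LINT y|lborel. cnj (h y) * of_real ((sqrt (2 * pi) / \<sigma>) ^ CARD('n) * gauss (2 * pi / \<sigma>) (x - y)))"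
      by (simp only: gauss_fourier(2)[OF \<sigma>])
    also have "\<dots> = of_real (\<bar>- (\<sigma> / (2*pi))\<bar> ^ CARD('n)) * (LINT z|lborel. cnj (h (x + (- (\<sigma> / (2*pi))) *\<^sub>R z)) * of_real ((sqrt (2 * pi) / \<sigma>) ^ CARD('n) * gauss (2 * pi / \<sigma>) (x - (x + (- (\<sigma> / (2*pi))) *\<^sub>R z))))"
      by (subst lborel_integral_affine[where t=x and c="- (\<sigma> / (2*pi))"]) (use \<sigma> in auto)
    also have "\<dots> = (LINT z|lborel. of_real (\<bar>- (\<sigma> / (2*pi))\<bar> ^ CARD('n)) * (cnj (h (x + (- (\<sigma> / (2*pi))) *\<^sub>R z)) * of_real ((sqrt (2 * pi) / \<sigma>) ^ CARD('n) * gauss (2 * pi / \<sigma>) (x - (x + (- (\<sigma> / (2*pi))) *\<^sub>R z)))))"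
      by (simp only: integral_mult_right_zero)
    also have "\<dots> = (LINT z|lborel. cnj (h (x - (\<sigma> / (2*pi)) *\<^sub>R z)) * of_real (gauss 1 z / sqrt (2*pi) ^ CARD('n)))"
    proof (rule Bochner_Integration.integral_cong[OF refl])
      fix z :: "real^'n"
      have 1: "gauss (2 * pi / \<sigma>) (x - (x + (- (\<sigma> / (2*pi))) *\<^sub>R z)) = gauss 1 z"
        using \<sigma> by (simp add: gauss_def power_mult_distrib field_simps)
      have "\<bar>- (\<sigma> / (2*pi))\<bar> * (sqrt (2 * pi) / \<sigma>) = 1 / sqrt (2*pi)"
        using \<sigma> by (simp add: field_simps)
      then have "\<bar>- (\<sigma> / (2*pi))\<bar> ^ CARD('n) * (sqrt (2 * pi) / \<sigma>) ^ CARD('n) = 1 / sqrt (2*pi) ^ CARD('n)"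
        by (simp only: power_mult_distrib[symmetric] power_one_over)
      then have 2: "\<bar>- (\<sigma> / (2*pi))\<bar> ^ CARD('n) * ((sqrt (2 * pi) / \<sigma>) ^ CARD('n) * gauss 1 z) = gauss 1 z / sqrt (2*pi) ^ CARD('n)"
        by (simp only: mult.assoc[symmetric]) simp
      show "of_real (\<bar>- (\<sigma> / (2*pi))\<bar> ^ CARD('n)) * (cnj (h (x + (- (\<sigma> / (2*pi))) *\<^sub>R z)) * of_real ((sqrt (2 * pi) / \<sigma>) ^ CARD('n) * gauss (2 * pi / \<sigma>) (x - (x + (- (\<sigma> / (2*pi))) *\<^sub>R z)))) = cnj (h (x - (\<sigma> / (2*pi)) *\<^sub>R z)) * of_real (gauss 1 z / sqrt (2*pi) ^ CARD('n))"
        unfolding 1 2[symmetric] by (simp add: mult_ac)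
    qed
    finally show ?thesis .
  qed
  have "(LINT \<xi>|lborel. of_real (gauss \<sigma> \<xi> * (cmod (?F \<xi>))\<^sup>2)) = (LINT \<xi>|lborel. ?F \<xi> * \<psi> \<xi>)"
    unfolding e0 by (simp add: mult.commute)
  also have "\<dots> = (LINT x|lborel. h x * fourier_integral \<psi> x)"
    by (rule fourier_multiplication_formula[OF h \<psi>])
  finally show "(LINT \<xi>|lborel. of_real (gauss \<sigma> \<xi> * (cmod (fourier_integral h \<xi>))\<^sup>2)) =
    (LINT x|lborel. h x * (LINT z|lborel. cnj (h (x - (\<sigma> / (2*pi)) *\<^sub>R z)) * of_real (gauss 1 z / sqrt (2*pi) ^ CARD('n))))"
    by (simp only: inner)
qed

text \<open>Dominated convergence twice: the inner means tend to the conjugate of \<open>h\<close>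
  at each continuity point and are bounded by \<open>B\<close>, so B |h| dominates the outer
  integrands.\<close>

lemma plancherel_limit:
  fixes h :: "real^'n \<Rightarrow> complex"
  assumes "tame h" and \<tau>: "\<tau> \<longlonglongrightarrow> 0"
  shows "(\<lambda>k. LINT x|lborel. h x * (LINT z|lborel. cnj (h (x - \<tau> k *\<^sub>R z)) * of_real (gauss 1 z / sqrt (2*pi) ^ CARD('n))))
    \<longlonglongrightarrow> (LINT x|lborel. of_real ((cmod (h x))\<^sup>2))"
proof -
  have [measurable]: "h \<in> borel_measurable borel" and int: "integrable lborel h"
    using assms(1) tame_measurable tame_integrable by auto
  obtain B where B: "\<And>x. cmod (h x) \<le> B" using assms(1) unfolding tame_def by blast
  have "B \<ge> 0" using B[of undefined] norm_ge_zero order_trans by blast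
  define G where "G z = gauss 1 (z::real^'n) / sqrt (2*pi) ^ CARD('n)" for z
  have G: "integrable lborel G" "(LINT z|lborel. G z) = 1" "G z \<ge> 0" for z
    unfolding G_def using gauss_integral[where 'n='n] by (auto simp: gauss_def)
  have [measurable]: "G \<in> borel_measurable borel" unfolding G_def by measurable
  have inner_bound: "cmod (LINT z|lborel. cnj (h (x - t *\<^sub>R z)) * of_real (G z)) \<le> B" for x t
  proof -
    have "cmod (LINT z|lborel. cnj (h (x - t *\<^sub>R z)) * of_real (G z)) \<le> (LINT z|lborel. cmod (cnj (h (x - t *\<^sub>R z)) * of_real (G z)))"
      by (rule integral_norm_bound)
    also have "\<dots> \<le> (LINT z|lborel. B * G z)"
      by (rule integral_mono_AE')
         (use G B \<open>B \<ge> 0\<close> in \<open>auto simp: norm_mult intro!: mult_right_mono\<close>)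
    also have "\<dots> = B" using G by simp
    finally show ?thesis .
  qed
  have inner_lim: "(\<lambda>k. LINT z|lborel. cnj (h (x - \<tau> k *\<^sub>R z)) * of_real (G z)) \<longlonglongrightarrow> cnj (h x)" if "isCont h x" for x
  proof -
    have "(\<lambda>k. LINT z|lborel. cnj (h (x - \<tau> k *\<^sub>R z)) * of_real (G z)) \<longlonglongrightarrow> (LINT z|lborel. cnj (h x) * of_real (G z))"
    proof (rule integral_dominated_convergence[where w="\<lambda>z. B * G z"])
      show "AE z in lborel. (\<lambda>k. cnj (h (x - \<tau> k *\<^sub>R z)) * complex_of_real (G z)) \<longlonglongrightarrow> cnj (h x) * complex_of_real (G z)"
      proof (rule AE_I2)
        fix z
        have "(\<lambda>k. x - \<tau> k *\<^sub>R z) \<longlonglongrightarrow> x - 0 *\<^sub>R z" by (intro tendsto_intros \<tau>)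
        then have "(\<lambda>k. h (x - \<tau> k *\<^sub>R z)) \<longlonglongrightarrow> h x"
          using that by (intro isCont_tendsto_compose[of x h]) auto
        then show "(\<lambda>k. cnj (h (x - \<tau> k *\<^sub>R z)) * complex_of_real (G z)) \<longlonglongrightarrow> cnj (h x) * complex_of_real (G z)"
          by (intro tendsto_intros)
      qed
    qed (use G B in \<open>auto simp: norm_mult intro!: mult_right_mono\<close>)
    also have "(LINT z|lborel. cnj (h x) * of_real (G z)) = cnj (h x)"
      using G by simp
    finally show ?thesis .
  qed
  have "(\<lambda>k. LINT x|lborel. h x * (LINT z|lborel. cnj (h (x - \<tau> k *\<^sub>R z)) * of_real (G z)))
    \<longlonglongrightarrow> (LINT x|lborel. h x * cnj (h x))"
  proof (rule integral_dominated_convergence[where w="\<lambda>x. B * cmod (h x)"])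
    show "AE x in lborel. (\<lambda>k. h x * (LINT z|lborel. cnj (h (x - \<tau> k *\<^sub>R z)) * of_real (G z))) \<longlonglongrightarrow> h x * cnj (h x)"
    proof -
      have "AE x in lborel. isCont h x" using assms(1) by (simp add: tame_def)
      then show ?thesis by eventually_elim (intro tendsto_mult tendsto_const inner_lim)
    qed
    show "AE x in lborel. norm (h x * (LINT z|lborel. cnj (h (x - \<tau> k *\<^sub>R z)) * of_real (G z))) \<le> B * cmod (h x)" for k
      by (rule AE_I2) (simp only: norm_mult mult.commute[of B], intro mult_left_mono inner_bound, simp)
  qed (use int in auto)
  then show ?thesis by (simp only: G_def complex_norm_square)
qed

text \<open>As \<sigma> decreases to 0 the Gaussians increase to 1. Monotone convergence yields the
  value and also the square integrability of the transform, which is not known beforehand.\<close>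

theorem plancherel:
  fixes h :: "real^'n \<Rightarrow> complex"
  assumes "tame h"
  shows "integrable lborel (\<lambda>\<xi>. (cmod (fourier_integral h \<xi>))\<^sup>2)"
    and "(LINT \<xi>|lborel. (cmod (fourier_integral h \<xi>))\<^sup>2) = (LINT x|lborel. (cmod (h x))\<^sup>2)"
proof -
  have h: "integrable lborel h" using assms tame_integrable by auto
  have [measurable]: "fourier_integral h \<in> borel_measurable borel" by (rule measurable_fourier_integral[OF h])
  \<comment> \<open>The factor 2 pi cancels in the scale \<sigma> / (2 pi) of the means, leaving 1 /
    (k + 1).\<close>
  define \<sigma> where "\<sigma> k = 2 * pi * (1 / real (Suc k))" for k
  have \<sigma>: "\<sigma> k > 0" for k by (simp add: \<sigma>_def)
  have dec: "\<sigma> k \<le> \<sigma> j" if "j \<le> k" for j k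
    using that by (simp add: \<sigma>_def frac_le)
  have \<tau>: "(\<lambda>k. \<sigma> k / (2*pi)) \<longlonglongrightarrow> 0"
    using LIMSEQ_inverse_real_of_nat by (simp add: \<sigma>_def inverse_eq_divide)
  have "(\<lambda>k. LINT \<xi>|lborel. complex_of_real (gauss (\<sigma> k) \<xi> * (cmod (fourier_integral h \<xi>))\<^sup>2)) \<longlonglongrightarrow> (LINT x|lborel. of_real ((cmod (h x))\<^sup>2))"
    unfolding plancherel_gauss(1)[OF h \<sigma>] by (rule plancherel_limit[OF assms \<tau>])
  then have lim: "(\<lambda>k. LINT \<xi>|lborel. gauss (\<sigma> k) \<xi> * (cmod (fourier_integral h \<xi>))\<^sup>2) \<longlonglongrightarrow> (LINT x|lborel. (cmod (h x))\<^sup>2)"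
    by (simp only: integral_complex_of_real tendsto_of_real_iff)
  have gl: "(\<lambda>k. gauss (\<sigma> k) \<xi> * (cmod (fourier_integral h \<xi>))\<^sup>2) \<longlonglongrightarrow> (cmod (fourier_integral h \<xi>))\<^sup>2" for \<xi>
  proof -
    have "\<sigma> \<longlonglongrightarrow> 0"
      using tendsto_mult_left[OF \<tau>, of "2*pi"] by simp
    then have "(\<lambda>k. exp (- (\<sigma> k)\<^sup>2 * (norm \<xi>)\<^sup>2 / 2)) \<longlonglongrightarrow> exp (- 0\<^sup>2 * (norm \<xi>)\<^sup>2 / 2)"
      by (intro tendsto_intros) auto
    then have "(\<lambda>k. gauss (\<sigma> k) \<xi>) \<longlonglongrightarrow> 1" by (simp add: gauss_def)
    from tendsto_mult_right[OF this, of "(cmod (fourier_integral h \<xi>))\<^sup>2"] show ?thesis by simp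
  qed
  have mono: "mono (\<lambda>k. gauss (\<sigma> k) \<xi> * (cmod (fourier_integral h \<xi>))\<^sup>2)" for \<xi>
  proof (rule monoI)
    fix j k :: nat assume "j \<le> k"
    then have "(\<sigma> k)\<^sup>2 \<le> (\<sigma> j)\<^sup>2" using dec[of j k] \<sigma>[of k] by (intro power_mono) auto
    then have "gauss (\<sigma> j) \<xi> \<le> gauss (\<sigma> k) \<xi>" by (simp add: gauss_def mult_right_mono)
    then show "gauss (\<sigma> j) \<xi> * (cmod (fourier_integral h \<xi>))\<^sup>2 \<le> gauss (\<sigma> k) \<xi> * (cmod (fourier_integral h \<xi>))\<^sup>2"
      by (rule mult_right_mono) simp
  qed
  show "integrable lborel (\<lambda>\<xi>. (cmod (fourier_integral h \<xi>))\<^sup>2)"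
    by (rule integrable_monotone_convergence[OF plancherel_gauss(2)[OF h \<sigma>] _ _ lim])
       (use mono gl in auto)
  show "(LINT \<xi>|lborel. (cmod (fourier_integral h \<xi>))\<^sup>2) = (LINT x|lborel. (cmod (h x))\<^sup>2)"
    by (rule integral_monotone_convergence[OF plancherel_gauss(2)[OF h \<sigma>] _ _ lim])
       (use mono gl in auto)
qed

lemma tame_square_integrable:
  assumes "tame h"
  shows "integrable lborel (\<lambda>x. (cmod (h x))\<^sup>2)"
proof -
  have [measurable]: "h \<in> borel_measurable borel" and int: "integrable lborel h"
    using assms tame_measurable tame_integrable by auto
  obtain B where B: "\<And>x. cmod (h x) \<le> B" using assms(1) unfolding tame_def by blast
  have "integrable lborel (\<lambda>x. h x * cnj (h x))"
    by (rule integrable_bounded_mult[where B=B]) (use int B in auto)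
  then have "integrable lborel (\<lambda>x. complex_of_real ((cmod (h x))\<^sup>2))"
    by (simp only: complex_norm_square)
  then show ?thesis using integrable_Re by fastforce
qed

section \<open>Fourier inversion and the energy\<close>

lemma lebesgue_integral_cnj: "(LINT x|M. cnj (f x)) = cnj (LINT x|M. f x)"
  by (rule integral_bounded_linear'[OF bounded_linear_cnj bounded_linear_cnj]) simp

lemma fourier_integral_cnj: "fourier_integral (\<lambda>x. cnj (f x)) \<xi> = cnj (fourier_integral f (- \<xi>))"
proof -
  have "(LINT x|lborel. cnj (f x) * fker x \<xi>) = (LINT x|lborel. cnj (f x * fker x (- \<xi>)))"
    by (simp add: fker_minus_right)
  then show ?thesis unfolding fourier_integral_fker by (simp only: lebesgue_integral_cnj)
qed

lemma AE_lborel_norm_neq: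
  assumes "R \<noteq> 0"
  shows "AE x in (lborel :: 'a::euclidean_space measure). norm x \<noteq> R"
proof -
  have "sphere (0::'a) R \<in> null_sets lebesgue"
    using negligible_sphere[of "0::'a" R] by (simp add: negligible_iff_null_sets)
  then have "sphere (0::'a) R \<in> null_sets lborel"
    by (subst (asm) null_sets_completion_iff) auto
  then show ?thesis by (auto dest!: AE_not_in simp: dist_norm)
qed

lemma borel_measurable_uminus_comp:
  assumes [measurable]: "f \<in> borel_measurable borel"
  shows "(\<lambda>x::real^'n. f (- x)) \<in> borel_measurable borel"
  by measurable

lemma lborel_integral_uminus:
  fixes f :: "real^'n \<Rightarrow> complex"
  assumes "f \<in> borel_measurable borel"
  shows "(LINT x|lborel. f (- x)) = (LINT x|lborel. f x)" "integrable lborel (\<lambda>x. f (- x)) \<longleftrightarrow> integrable lborel f"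
  using lborel_integral_affine[of "-1" f 0] lborel_integrable_affine[of "-1" f 0] assms by simp_all

lemma integrable_complex_of_real_iff:
  "integrable M (\<lambda>x. complex_of_real (f x)) \<longleftrightarrow> integrable M f"
  using integrable_Re[of M "\<lambda>x. complex_of_real (f x)"] by auto

lemma lborel_integral_uminus_real:
  fixes f :: "real^'n \<Rightarrow> real"
  assumes [measurable]: "f \<in> borel_measurable borel"
  shows "(LINT x|lborel. f (- x)) = (LINT x|lborel. f x)" "integrable lborel (\<lambda>x. f (- x)) \<longleftrightarrow> integrable lborel f"
proof -
  have "complex_of_real (LINT x|lborel. f (- x)) = complex_of_real (LINT x|lborel. f x)"
    unfolding integral_complex_of_real[symmetric] by (rule lborel_integral_uminus(1)) simp
  then show "(LINT x|lborel. f (- x)) = (LINT x|lborel. f x)" using of_real_eq_iff by blast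
  have "integrable lborel (\<lambda>x. complex_of_real (f (- x))) \<longleftrightarrow> integrable lborel (\<lambda>x. complex_of_real (f x))"
    by (rule lborel_integral_uminus(2)) simp
  then show "integrable lborel (\<lambda>x. f (- x)) \<longleftrightarrow> integrable lborel f"
    by (simp only: integrable_complex_of_real_iff)
qed

lemma plancherel_inverse:
  fixes g :: "real^'n \<Rightarrow> complex"
  assumes "tame g"
  shows "integrable lborel (\<lambda>x. (cmod (fourier_integral g (- x)))\<^sup>2)"
    and "(LINT x|lborel. (cmod (fourier_integral g (- x)))\<^sup>2) = (LINT x|lborel. (cmod (g x))\<^sup>2)"
proof -
  have [measurable]: "fourier_integral g \<in> borel_measurable borel"
    using measurable_fourier_integral[OF tame_integrable[OF assms]] .
  have m: "(\<lambda>x. (cmod (fourier_integral g x))\<^sup>2) \<in> borel_measurable borel" by measurable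
  show "integrable lborel (\<lambda>x. (cmod (fourier_integral g (- x)))\<^sup>2)"
    using lborel_integral_uminus_real(2)[OF m] plancherel(1)[OF assms] by simp
  show "(LINT x|lborel. (cmod (fourier_integral g (- x)))\<^sup>2) = (LINT x|lborel. (cmod (g x))\<^sup>2)"
    using lborel_integral_uminus_real(1)[OF m] plancherel(2)[OF assms] by simp
qed

lemma integrable_mult_L2:
  fixes f g :: "'a \<Rightarrow> complex"
  assumes "integrable M (\<lambda>x. (cmod (f x))\<^sup>2)" "integrable M (\<lambda>x. (cmod (g x))\<^sup>2)"
    and [measurable]: "f \<in> borel_measurable M" "g \<in> borel_measurable M"
  shows "integrable M (\<lambda>x. f x * g x)"
proof (rule Bochner_Integration.integrable_bound)
  show "integrable M (\<lambda>x. (cmod (f x))\<^sup>2 + (cmod (g x))\<^sup>2)" using assms by simp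
  show "AE x in M. norm (f x * g x) \<le> norm ((cmod (f x))\<^sup>2 + (cmod (g x))\<^sup>2)"
  proof (rule AE_I2)
    fix x
    have "2 * cmod (f x) * cmod (g x) \<le> (cmod (f x))\<^sup>2 + (cmod (g x))\<^sup>2"
      by (rule sum_squares_bound)
    moreover have "0 \<le> cmod (f x) * cmod (g x)" by simp
    ultimately show "norm (f x * g x) \<le> norm ((cmod (f x))\<^sup>2 + (cmod (g x))\<^sup>2)"
      unfolding norm_mult by (simp only: real_norm_def)
  qed
qed measurable

lemma cmod_diff_power2: "(cmod (a - b))\<^sup>2 = (cmod a)\<^sup>2 + (cmod b)\<^sup>2 - 2 * Re (a * cnj b)"
  unfolding cmod_power2 by (simp add: power2_eq_square algebra_simps)

text \<open>After expanding the square, Plancherel moves the norms and the multiplication formula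
  the mixed term to the side of \<open>h\<close>. The result is the expanded square distance from
  \<open>h\<close> to the inverse transform of \<open>g\<close>, so inversion and L^2 convergence of
  transforms can both be read off from it.\<close>

lemma fourier_defect:
  fixes g h :: "real^'n \<Rightarrow> complex"
  assumes g: "tame g" and h: "tame h"
  shows "integrable lborel (\<lambda>\<xi>. (cmod (fourier_integral h \<xi> - g \<xi>))\<^sup>2)"
   and "(LINT \<xi>|lborel. (cmod (fourier_integral h \<xi> - g \<xi>))\<^sup>2) =
     (LINT x|lborel. (cmod (h x))\<^sup>2) + (LINT x|lborel. (cmod (fourier_integral g (- x)))\<^sup>2)
       - 2 * Re (LINT x|lborel. h x * cnj (fourier_integral g (- x)))"
proof -
  note gi = tame_integrable[OF g] and hi = tame_integrable[OF h]
  have [measurable]: "fourier_integral h \<in> borel_measurable borel" "h \<in> borel_measurable borel" "g \<in> borel_measurable borel"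
    using measurable_fourier_integral[OF hi] tame_measurable g h by auto
  have prod: "integrable lborel (\<lambda>\<xi>. fourier_integral h \<xi> * cnj (g \<xi>))"
    by (rule integrable_mult_L2) (use plancherel(1)[OF h] tame_square_integrable[OF g] in auto)
  note re = integrable_Re[OF prod]
  have int: "integrable lborel (\<lambda>\<xi>. (cmod (fourier_integral h \<xi>))\<^sup>2 + (cmod (g \<xi>))\<^sup>2)"
    using plancherel(1)[OF h] tame_square_integrable[OF g] by simp
  show "integrable lborel (\<lambda>\<xi>. (cmod (fourier_integral h \<xi> - g \<xi>))\<^sup>2)"
    unfolding cmod_diff_power2 by (intro Bochner_Integration.integrable_diff int integrable_mult_right re)
  have "(LINT \<xi>|lborel. (cmod (fourier_integral h \<xi> - g \<xi>))\<^sup>2) =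
     (LINT \<xi>|lborel. (cmod (fourier_integral h \<xi>))\<^sup>2) + (LINT \<xi>|lborel. (cmod (g \<xi>))\<^sup>2)
      - 2 * Re (LINT \<xi>|lborel. fourier_integral h \<xi> * cnj (g \<xi>))"
  proof -
    have "(LINT \<xi>|lborel. Re (fourier_integral h \<xi> * cnj (g \<xi>))) = Re (LINT \<xi>|lborel. fourier_integral h \<xi> * cnj (g \<xi>))"
      by (rule integral_Re[OF prod])
    then show ?thesis
      unfolding cmod_diff_power2 using plancherel(1)[OF h] tame_square_integrable[OF g] re int
      by (simp del: times_complex.sel)
  qed
  also have "(LINT \<xi>|lborel. fourier_integral h \<xi> * cnj (g \<xi>)) = (LINT x|lborel. h x * fourier_integral (\<lambda>x. cnj (g x)) x)"
    by (rule fourier_multiplication_formula) (use gi hi in auto)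
  finally show "(LINT \<xi>|lborel. (cmod (fourier_integral h \<xi> - g \<xi>))\<^sup>2) =
     (LINT x|lborel. (cmod (h x))\<^sup>2) + (LINT x|lborel. (cmod (fourier_integral g (- x)))\<^sup>2)
       - 2 * Re (LINT x|lborel. h x * cnj (fourier_integral g (- x)))"
    by (simp add: fourier_integral_cnj plancherel(2)[OF h] plancherel_inverse(2)[OF g])
qed

lemma AE_eq_if_L2_zero:
  fixes f g :: "'a \<Rightarrow> complex"
  assumes "integrable M (\<lambda>x. (cmod (f x - g x))\<^sup>2)" "(LINT x|M. (cmod (f x - g x))\<^sup>2) = 0"
  shows "AE x in M. f x = g x"
proof -
  have "AE x in M. (cmod (f x - g x))\<^sup>2 = 0"
    using assms integral_nonneg_eq_0_iff_AE[OF assms(1)] by simp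
  then show ?thesis by eventually_elim simp
qed

text \<open>If \<open>h\<close> is the inverse transform of \<open>g\<close>, the three integrals in
  the defect coincide and cancel: 1 + 1 - 2 = 0.\<close>

lemma fourier_integral_inverse:
  fixes g :: "real^'n \<Rightarrow> complex"
  assumes g: "tame g" and h: "tame (\<lambda>x. fourier_integral g (- x))"
  shows "AE \<xi> in lborel. fourier_integral (\<lambda>x. fourier_integral g (- x)) \<xi> = g \<xi>"
proof (rule AE_eq_if_L2_zero)
  note d = fourier_defect[OF g h]
  show "integrable lborel (\<lambda>x. (cmod (fourier_integral (\<lambda>x. fourier_integral g (- x)) x - g x))\<^sup>2)"
    by (rule d)
  have "(LINT x|lborel. fourier_integral g (- x) * cnj (fourier_integral g (- x))) = of_real (LINT x|lborel. (cmod (fourier_integral g (- x)))\<^sup>2)"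
    by (simp only: complex_norm_square[symmetric] integral_complex_of_real)
  then show "(LINT x|lborel. (cmod (fourier_integral (\<lambda>x. fourier_integral g (- x)) x - g x))\<^sup>2) = 0"
    unfolding d(2) by simp
qed

section \<open>The L^2 transform as a limit over balls\<close>

lemma tame_truncation:
  fixes W :: "real^'n \<Rightarrow> complex"
  assumes W: "continuous_on UNIV W" "\<And>x. cmod (W x) \<le> B" and R: "R > 0"
  shows "tame (\<lambda>x. if x \<in> ball 0 R then W x else 0)"
  unfolding tame_def
proof (intro conjI)
  have [measurable]: "W \<in> borel_measurable borel" using W(1) by (rule borel_measurable_continuous_onI)
  have "B \<ge> 0" using W(2)[of undefined] norm_ge_zero order_trans by blast
  have "integrable lborel (\<lambda>x::real^'n. complex_of_real (indicator (ball 0 R) x))"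
    by (rule integrable_of_real, rule integrable_real_indicator) (use emeasure_lborel_ball_finite[of "0::real^'n" R] in auto)
  then have "integrable lborel (\<lambda>x::real^'n. complex_of_real (indicator (ball 0 R) x) * W x)"
    by (rule integrable_bounded_mult[where B=B]) (use W in auto)
  then show "integrable lborel (\<lambda>x. if x \<in> ball 0 R then W x else 0)"
    by (rule Bochner_Integration.integrable_cong[THEN iffD1, rotated 2]) (auto simp: indicator_def)
  show "\<exists>B. \<forall>x. cmod (if x \<in> ball 0 R then W x else 0) \<le> B"
    using W(2) \<open>B \<ge> 0\<close> by (intro exI[of _ B]) auto
  show "AE x in lborel. isCont (\<lambda>x. if x \<in> ball 0 R then W x else 0) x"
    using AE_lborel_norm_neq[OF less_imp_neq[OF R, symmetric]]
  proof eventually_elim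
    case (elim x)
    show ?case
    proof (cases "x \<in> ball 0 R")
      case True
      have "isCont W x" using W(1) by (simp add: continuous_on_eq_continuous_at)
      then show ?thesis
        by (rule isCont_cong[THEN iffD2, rotated])
           (use True in \<open>auto intro!: eventually_mono[OF eventually_nhds_in_open[of "ball 0 R" x]]\<close>)
    next
      case False
      then have "x \<in> - cball 0 R" using elim by auto
      then show ?thesis
        by (intro isCont_cong[THEN iffD2, OF _ continuous_const[of _ 0]] eventually_mono[OF eventually_nhds_in_open[of "- cball 0 R" x]]) auto
    qed
  qed
qed

text \<open>The defect of the truncation to the ball of radius R is exactly the square norm of the
  inverse transform outside that ball, and this tail tends to 0.\<close>

lemma is_L2_fourier_inverse:
  fixes g f :: "real^'n \<Rightarrow> complex"
  assumes g: "tame g" and f: "AE x in lborel. f x = fourier_integral g (- x)" "f \<in> borel_measurable borel"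
  shows "is_L2_fourier f g"
  unfolding is_L2_fourier_def
proof
  show [measurable]: "g \<in> borel_measurable borel" by (rule tame_measurable[OF g])
  define W where "W x = fourier_integral g (- x)" for x
  have Wc: "continuous_on UNIV W"
    unfolding W_def by (intro continuous_on_compose2[OF continuous_fourier_integral[OF tame_integrable[OF g]]] continuous_intros) auto
  have [measurable]: "W \<in> borel_measurable borel" using Wc by (rule borel_measurable_continuous_onI)
  have Wb: "cmod (W x) \<le> (LINT x|lborel. cmod (g x))" for x
    unfolding W_def by (rule fourier_integral_bound)
  have Wi: "integrable lborel (\<lambda>x. (cmod (W x))\<^sup>2)"
    unfolding W_def by (rule plancherel_inverse[OF g])
  define WR where "WR R x = (if x \<in> ball 0 R then W x else 0)" for R :: real and x
  have WR: "tame (WR R)" if "R > 0" for R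
    unfolding WR_def using Wc Wb that by (rule tame_truncation)
  have eq: "fourier_integral (\<lambda>x. if x \<in> ball 0 R then f x else 0) = fourier_integral (WR R)" for R
    by (rule fourier_integral_cong_AE) (use f in \<open>auto simp: WR_def[abs_def] W_def[symmetric]\<close>)
  have "((\<lambda>R. LINT x|lborel. (cmod (WR R x))\<^sup>2) \<longlongrightarrow> (LINT x|lborel. (cmod (W x))\<^sup>2)) at_top"
  proof (rule integral_dominated_convergence_at_top[where w="\<lambda>x. (cmod (W x))\<^sup>2"])
    show "AE x in lborel. ((\<lambda>R. (cmod (WR R x))\<^sup>2) \<longlongrightarrow> (cmod (W x))\<^sup>2) at_top"
    proof (rule AE_I2, rule tendsto_eventually)
      fix x
      show "\<forall>\<^sub>F R in at_top. (cmod (WR R x))\<^sup>2 = (cmod (W x))\<^sup>2"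
        using eventually_gt_at_top[of "norm x"] by eventually_elim (auto simp: WR_def)
    qed
  qed (use Wi in \<open>auto simp: WR_def\<close>)
  from tendsto_diff[OF tendsto_const[of "LINT x|lborel. (cmod (W x))\<^sup>2"] this]
  have lim: "((\<lambda>R. (LINT x|lborel. (cmod (W x))\<^sup>2) - (LINT x|lborel. (cmod (WR R x))\<^sup>2)) \<longlongrightarrow> 0) at_top"
    by simp
  have val: "(\<integral>\<^sup>+\<xi>. ennreal ((cmod (fourier_integral (WR R) \<xi> - g \<xi>))\<^sup>2) \<partial>lborel) =
     ennreal ((LINT x|lborel. (cmod (W x))\<^sup>2) - (LINT x|lborel. (cmod (WR R x))\<^sup>2))" if "R > 0" for R
  proof -
    note d = fourier_defect[OF g WR[OF that]]
    have "(LINT x|lborel. WR R x * cnj (fourier_integral g (- x))) = (LINT x|lborel. complex_of_real ((cmod (WR R x))\<^sup>2))"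
      by (rule Bochner_Integration.integral_cong[OF refl], unfold complex_norm_square) (auto simp: WR_def W_def)
    then have "Re (LINT x|lborel. WR R x * cnj (fourier_integral g (- x))) = (LINT x|lborel. (cmod (WR R x))\<^sup>2)"
      by (simp only: integral_complex_of_real Re_complex_of_real)
    then show ?thesis
      using d by (subst nn_integral_eq_integral) (auto simp: W_def)
  qed
  show "((\<lambda>R::real. \<integral>\<^sup>+\<xi>. ennreal ((cmod (fourier_integral (\<lambda>x. if x \<in> ball 0 R then f x else 0) \<xi> - g \<xi>))\<^sup>2) \<partial>lborel) \<longlongrightarrow> 0) at_top"
    unfolding eq
  proof (rule Lim_transform_eventually)
    show "((\<lambda>R. ennreal ((LINT x|lborel. (cmod (W x))\<^sup>2) - (LINT x|lborel. (cmod (WR R x))\<^sup>2))) \<longlongrightarrow> 0) at_top"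
      using tendsto_ennrealI[OF lim] by simp
    show "\<forall>\<^sub>F R in at_top. ennreal ((LINT x|lborel. (cmod (W x))\<^sup>2) - (LINT x|lborel. (cmod (WR R x))\<^sup>2)) =
      (\<integral>\<^sup>+\<xi>. ennreal ((cmod (fourier_integral (WR R) \<xi> - g \<xi>))\<^sup>2) \<partial>lborel)"
      using eventually_gt_at_top[of 0] by eventually_elim (simp add: val)
  qed
qed

text \<open>\<open>SOME\<close> fixes no particular representative, so the limit has to be unique up
  to null sets before anything can be said about \<open>fourier\<close>.\<close>

lemma is_L2_fourier_unique:
  fixes f g h :: "real^'n \<Rightarrow> complex"
  assumes "is_L2_fourier f g" "is_L2_fourier f h" and f: "\<And>R. fourier_integral (\<lambda>x. if x \<in> ball 0 R then f x else 0) \<in> borel_measurable borel"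
  shows "AE \<xi> in lborel. g \<xi> = h \<xi>"
proof -
  define F where "F R = fourier_integral (\<lambda>x. if x \<in> ball 0 R then f x else 0)" for R :: real
  have [measurable]: "F R \<in> borel_measurable borel" for R using f by (simp only: F_def)
  have [measurable]: "g \<in> borel_measurable borel" "h \<in> borel_measurable borel"
    using assms by (auto simp: is_L2_fourier_def)
  have "((\<lambda>R::real. 2 * (\<integral>\<^sup>+\<xi>. ennreal ((cmod (F R \<xi> - g \<xi>))\<^sup>2) \<partial>lborel) + 2 * (\<integral>\<^sup>+\<xi>. ennreal ((cmod (F R \<xi> - h \<xi>))\<^sup>2) \<partial>lborel)) \<longlongrightarrow> 2 * 0 + 2 * 0) at_top"
    by (intro tendsto_add ennreal_tendsto_cmult assms(1)[unfolded is_L2_fourier_def F_def[symmetric], THEN conjunct2]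
      assms(2)[unfolded is_L2_fourier_def F_def[symmetric], THEN conjunct2]) simp_all
  moreover have "(\<integral>\<^sup>+\<xi>. ennreal ((cmod (g \<xi> - h \<xi>))\<^sup>2) \<partial>lborel) \<le> 2 * (\<integral>\<^sup>+\<xi>. ennreal ((cmod (F R \<xi> - g \<xi>))\<^sup>2) \<partial>lborel) + 2 * (\<integral>\<^sup>+\<xi>. ennreal ((cmod (F R \<xi> - h \<xi>))\<^sup>2) \<partial>lborel)" for R
  proof -
    have "(\<integral>\<^sup>+\<xi>. ennreal ((cmod (g \<xi> - h \<xi>))\<^sup>2) \<partial>lborel) \<le> (\<integral>\<^sup>+\<xi>. 2 * ennreal ((cmod (F R \<xi> - g \<xi>))\<^sup>2) + 2 * ennreal ((cmod (F R \<xi> - h \<xi>))\<^sup>2) \<partial>lborel)"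
    proof (rule nn_integral_mono)
      fix \<xi>
      let ?a = "cmod (F R \<xi> - g \<xi>)" and ?b = "cmod (F R \<xi> - h \<xi>)"
      have "cmod (g \<xi> - h \<xi>) \<le> ?a + ?b"
        using norm_triangle_ineq[of "g \<xi> - F R \<xi>" "F R \<xi> - h \<xi>"] by (simp add: norm_minus_commute)
      then have "(cmod (g \<xi> - h \<xi>))\<^sup>2 \<le> (?a + ?b)\<^sup>2" by (intro power_mono) auto
      also have "\<dots> \<le> 2 * ?a\<^sup>2 + 2 * ?b\<^sup>2"
        using sum_squares_bound[of ?a ?b] by (simp add: power2_sum)
      finally have "ennreal ((cmod (g \<xi> - h \<xi>))\<^sup>2) \<le> ennreal (2 * ?a\<^sup>2 + 2 * ?b\<^sup>2)" by (rule ennreal_leI)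
      then show "ennreal ((cmod (g \<xi> - h \<xi>))\<^sup>2) \<le> 2 * ennreal (?a\<^sup>2) + 2 * ennreal (?b\<^sup>2)"
        by (simp add: ennreal_mult)
    qed
    also have "\<dots> = 2 * (\<integral>\<^sup>+\<xi>. ennreal ((cmod (F R \<xi> - g \<xi>))\<^sup>2) \<partial>lborel) + 2 * (\<integral>\<^sup>+\<xi>. ennreal ((cmod (F R \<xi> - h \<xi>))\<^sup>2) \<partial>lborel)"
      by (simp add: nn_integral_add nn_integral_cmult)
    finally show ?thesis .
  qed
  ultimately have "(\<integral>\<^sup>+\<xi>. ennreal ((cmod (g \<xi> - h \<xi>))\<^sup>2) \<partial>lborel) \<le> 0"
    by (intro tendsto_lowerbound[where F=at_top]) (auto intro!: always_eventually)
  then have "AE \<xi> in lborel. ennreal ((cmod (g \<xi> - h \<xi>))\<^sup>2) = 0"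
    by (subst nn_integral_0_iff_AE[symmetric]) auto
  then show ?thesis by eventually_elim simp
qed

text \<open>Whether the inverse transform \<open>f\<close> is integrable is left open, since a
  singularity of \<open>g\<close> at the origin slows the decay of \<open>f\<close>. Both branches
  of \<open>fourier\<close> therefore have to give back \<open>g\<close>: the integral by inversion,
  the chosen L^2 limit by uniqueness.\<close>

theorem fourier_inverse_AE:
  fixes g f :: "real^'n \<Rightarrow> complex"
  assumes g: "tame g" and f: "AE x in lborel. f x = fourier_integral g (- x)" "f \<in> borel_measurable borel"
  shows "AE \<xi> in lborel. fourier f \<xi> = g \<xi>" "fourier f \<in> borel_measurable borel"
proof -
  define W where "W x = fourier_integral g (- x)" for x
  have Wc: "continuous_on UNIV W"
    unfolding W_def by (intro continuous_on_compose2[OF continuous_fourier_integral[OF tame_integrable[OF g]]] continuous_intros) auto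
  have [measurable]: "W \<in> borel_measurable borel" using Wc by (rule borel_measurable_continuous_onI)
  have Wb: "cmod (W x) \<le> (LINT x|lborel. cmod (g x))" for x
    unfolding W_def by (rule fourier_integral_bound)
  have "(AE \<xi> in lborel. fourier f \<xi> = g \<xi>) \<and> fourier f \<in> borel_measurable borel"
  proof (cases "integrable lborel f")
    case True
    have fW: "fourier_integral f = fourier_integral W"
      by (rule fourier_integral_cong_AE) (use f in \<open>auto simp: W_def\<close>)
    have "integrable lborel W"
      by (rule integrable_cong_AE_imp[OF True]) (use f in \<open>auto simp: W_def\<close>)
    then have "tame W"
      unfolding tame_def using Wc Wb by (auto simp: continuous_on_eq_continuous_at)
    then have "AE \<xi> in lborel. fourier_integral W \<xi> = g \<xi>"
      using fourier_integral_inverse[OF g] by (simp add: W_def[abs_def])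
    moreover have "fourier_integral W \<in> borel_measurable borel"
      using \<open>integrable lborel W\<close> by (rule measurable_fourier_integral)
    ultimately show ?thesis using True by (simp add: fourier_def fW)
  next
    case False
    have ex: "is_L2_fourier f g" by (rule is_L2_fourier_inverse[OF g f])
    then have sel: "is_L2_fourier f (fourier f)"
      unfolding fourier_def using False by (simp add: someI)
    have "fourier_integral (\<lambda>x. if x \<in> ball 0 R then f x else 0) \<in> borel_measurable borel" for R
    proof -
      have "fourier_integral (\<lambda>x. if x \<in> ball 0 R then f x else 0) = fourier_integral (\<lambda>x. if x \<in> ball 0 R then W x else 0)"
        by (rule fourier_integral_cong_AE) (use f in \<open>auto simp: W_def\<close>)
      moreover have "integrable lborel (\<lambda>x. if x \<in> ball 0 R then W x else 0)"
      proof (cases "R > 0")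
        case True then show ?thesis using tame_truncation[OF Wc Wb] tame_integrable by blast
      next
        case False
        then have "(\<lambda>x. if x \<in> ball 0 R then W x else 0) = (\<lambda>x. 0)"
          using norm_ge_zero by (auto simp: fun_eq_iff not_less intro!: dest: order.strict_trans1[OF norm_ge_zero])
        then show ?thesis by simp
      qed
      ultimately show ?thesis using measurable_fourier_integral by metis
    qed
    then have "AE \<xi> in lborel. fourier f \<xi> = g \<xi>"
      by (rule is_L2_fourier_unique[OF sel ex])
    then show ?thesis using sel by (simp add: is_L2_fourier_def)
  qed
  then show "AE \<xi> in lborel. fourier f \<xi> = g \<xi>" "fourier f \<in> borel_measurable borel" by auto
qed

text \<open>The multiplier times \<open>g\<close> is integrable, so its inverse transform is given
  by the integral and sees \<open>fourier f\<close> only up to null sets; Plancherel does the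
  rest.\<close>

lemma energy_eq:
  fixes g f :: "real^'n \<Rightarrow> complex"
  assumes g: "tame g" and f: "AE x in lborel. f x = fourier_integral g (- x)" "f \<in> borel_measurable borel"
    and mg: "tame (\<lambda>\<xi>. of_real ((2 * pi * norm \<xi>) powr (2 * a)) * g \<xi>)"
  shows "energy a f = (LINT \<xi>|lborel. (cmod (of_real ((2 * pi * norm \<xi>) powr (2 * a)) * g \<xi>))\<^sup>2)"
proof -
  let ?m = "\<lambda>\<xi>::real^'n. complex_of_real ((2 * pi * norm \<xi>) powr (2 * a))"
  note ff = fourier_inverse_AE[OF g f]
  note [measurable] = ff(2) tame_measurable[OF mg]
  have ae: "AE \<xi> in lborel. ?m \<xi> * g \<xi> = ?m \<xi> * fourier f \<xi>" using ff(1) by eventually_elim simp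
  have int: "integrable lborel (\<lambda>\<xi>. ?m \<xi> * fourier f \<xi>)"
    by (rule integrable_cong_AE_imp[OF tame_integrable[OF mg]]) (use ff(1) in auto)
  have "neg_laplacian_pow a f x = fourier_integral (\<lambda>\<xi>. ?m \<xi> * g \<xi>) (- x)" for x
  proof -
    have "neg_laplacian_pow a f x = fourier_integral (\<lambda>\<xi>. ?m \<xi> * fourier f \<xi>) (- x)"
      using int by (simp add: neg_laplacian_pow_def inv_fourier_def fourier_def[of "\<lambda>\<xi>. ?m \<xi> * fourier f \<xi>"])
    also have "fourier_integral (\<lambda>\<xi>. ?m \<xi> * fourier f \<xi>) = fourier_integral (\<lambda>\<xi>. ?m \<xi> * g \<xi>)"
      by (rule fourier_integral_cong_AE) (use ff(1) in auto)
    finally show ?thesis .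
  qed
  then show ?thesis
    unfolding energy_def using plancherel_inverse(2)[OF mg] by simp
qed

section \<open>Partial derivatives off the origin\<close>

text \<open>Derivatives along coordinate lines are all that the fundamental theorem of calculus
  uses. The origin is excluded because the eigenfunctions may fail to be differentiable there; the
  value of \<open>D\<close> at 0 is left free.\<close>

definition has_partial :: "'n \<Rightarrow> (real^'n \<Rightarrow> complex) \<Rightarrow> (real^'n \<Rightarrow> complex) \<Rightarrow> bool" where
  "has_partial i F D \<longleftrightarrow> (\<forall>x. x \<noteq> 0 \<longrightarrow> ((\<lambda>t. F (x + t *\<^sub>R axis i 1)) has_vector_derivative D x) (at 0))"

lemma has_partialD:
  assumes "has_partial i F D" "x + t *\<^sub>R axis i 1 \<noteq> 0"
  shows "((\<lambda>t. F (x + t *\<^sub>R axis i 1)) has_vector_derivative D (x + t *\<^sub>R axis i 1)) (at t)"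
proof -
  have "((\<lambda>u. F ((x + t *\<^sub>R axis i 1) + u *\<^sub>R axis i 1)) has_vector_derivative D (x + t *\<^sub>R axis i 1)) (at 0)"
    using assms by (auto simp: has_partial_def)
  then have "((\<lambda>u. F ((x + t *\<^sub>R axis i 1) + u *\<^sub>R axis i 1)) has_vector_derivative D (x + t *\<^sub>R axis i 1)) (at (t - t))"
    by simp
  moreover have "((\<lambda>u::real. u - t) has_vector_derivative 1) (at t)"
    by (auto intro!: derivative_eq_intros)
  ultimately have "(((\<lambda>u. F ((x + t *\<^sub>R axis i 1) + u *\<^sub>R axis i 1)) \<circ> (\<lambda>u. u - t)) has_vector_derivative 1 *\<^sub>R D (x + t *\<^sub>R axis i 1)) (at t)"
    by (intro vector_diff_chain_at)
  then show ?thesis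
    by (simp add: o_def scaleR_diff_left)
qed

lemma has_partial_from_derivative:
  assumes "\<And>x. x \<noteq> 0 \<Longrightarrow> (F has_derivative F' x) (at x)"
  shows "has_partial i F (\<lambda>x. F' x (axis i 1))"
  unfolding has_partial_def
proof (intro allI impI)
  fix x :: "real^'a" assume "x \<noteq> 0"
  have "((\<lambda>t::real. x + t *\<^sub>R axis i 1) has_derivative (\<lambda>t. t *\<^sub>R axis i 1)) (at 0)"
    by (auto intro!: derivative_eq_intros)
  moreover have "(F has_derivative F' x) (at (x + 0 *\<^sub>R axis i 1))" using assms[OF \<open>x \<noteq> 0\<close>] by simp
  ultimately have "((\<lambda>t. F (x + t *\<^sub>R axis i 1)) has_derivative (\<lambda>t. F' x (t *\<^sub>R axis i 1))) (at 0)"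
    by (rule has_derivative_compose)
  moreover have "F' x (t *\<^sub>R axis i 1) = t *\<^sub>R F' x (axis i 1)" for t
    using assms[OF \<open>x \<noteq> 0\<close>] by (simp add: has_derivative_bounded_linear linear_simps(5))
  ultimately show "((\<lambda>t. F (x + t *\<^sub>R axis i 1)) has_vector_derivative F' x (axis i 1)) (at 0)"
    by (simp add: has_vector_derivative_def)
qed

lemma has_partial_const: "has_partial i (\<lambda>x. c) (\<lambda>x. 0)"
  by (auto simp: has_partial_def intro!: derivative_eq_intros)

lemma has_partial_add:
  "has_partial i F D \<Longrightarrow> has_partial i G E \<Longrightarrow> has_partial i (\<lambda>x. F x + G x) (\<lambda>x. D x + E x)"
  by (auto simp: has_partial_def intro!: derivative_eq_intros)

lemma has_partial_mult:
  assumes "has_partial i F D" "has_partial i G E"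
  shows "has_partial i (\<lambda>x. F x * G x) (\<lambda>x. D x * G x + F x * E x)"
  unfolding has_partial_def
proof (intro allI impI)
  fix x :: "real^'a" assume "x \<noteq> 0"
  then have "((\<lambda>t. F (x + t *\<^sub>R axis i 1)) has_vector_derivative D x) (at 0)" 
    "((\<lambda>t. G (x + t *\<^sub>R axis i 1)) has_vector_derivative E x) (at 0)"
    using assms by (auto simp: has_partial_def)
  from has_vector_derivative_mult[OF this]
  show "((\<lambda>t. F (x + t *\<^sub>R axis i 1) * G (x + t *\<^sub>R axis i 1)) has_vector_derivative D x * G x + F x * E x) (at 0)"
    by (simp add: add.commute)
qed

lemma has_partial_cmult: "has_partial i F D \<Longrightarrow> has_partial i (\<lambda>x. c * F x) (\<lambda>x. c * D x)"
  using has_partial_mult[OF has_partial_const[of i c]] by simp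

lemma has_partial_diff:
  "has_partial i F D \<Longrightarrow> has_partial i G E \<Longrightarrow> has_partial i (\<lambda>x. F x - G x) (\<lambda>x. D x - E x)"
  by (auto simp: has_partial_def intro!: derivative_eq_intros)

lemma has_partial_cnj: "has_partial i F D \<Longrightarrow> has_partial i (\<lambda>x. cnj (F x)) (\<lambda>x. cnj (D x))"
  by (auto simp: has_partial_def intro!: has_vector_derivative_cnj)

lemma has_partial_cong:
  assumes "has_partial i F D" "\<And>x. F x = G x" "\<And>x. x \<noteq> 0 \<Longrightarrow> D x = E x"
  shows "has_partial i G E"
  using assms by (auto simp: has_partial_def)

lemma has_partial_component: "has_partial i (\<lambda>x::real^'n. of_real (x $ j)) (\<lambda>x. if i = j then 1 else 0)"
proof -
  have "((\<lambda>x::real^'n. complex_of_real (x $ j)) has_derivative (\<lambda>h. of_real (h $ j))) (at x)" for x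
    by (auto intro!: derivative_eq_intros bounded_linear.has_derivative[OF bounded_linear_vec_nth])
  from has_partial_from_derivative[OF this, of i] show ?thesis
    by (rule has_partial_cong) (auto simp: axis_def)
qed

lemma has_partial_fker: "has_partial i (\<lambda>x. fker x \<xi>) (\<lambda>x. - 2 * of_real pi * \<i> * of_real (\<xi> $ i) * fker x \<xi>)"
proof -
  have "((\<lambda>x. fker x \<xi>) has_derivative (\<lambda>h. (- 2 * of_real pi * \<i> * of_real (h \<bullet> \<xi>)) * fker x \<xi>)) (at x)" for x
  proof -
    have "((\<lambda>x. - 2 * of_real pi * \<i> * of_real (x \<bullet> \<xi>)) has_derivative (\<lambda>h. - 2 * of_real pi * \<i> * complex_of_real (h \<bullet> \<xi>))) (at x)"
      by (auto intro!: derivative_eq_intros)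
    from has_derivative_compose[OF this has_field_derivative_imp_has_derivative[OF DERIV_exp]]
    show ?thesis by (simp add: fker_def mult_ac)
  qed
  from has_partial_from_derivative[OF this, of i] show ?thesis
    by (rule has_partial_cong) (auto simp: cart_eq_inner_axis inner_commute)
qed

lemma has_partial_unique:
  assumes "has_partial i F D" "has_partial i F E" "x \<noteq> 0"
  shows "D x = E x"
  using assms vector_derivative_unique_at by (fastforce simp: has_partial_def)

lemma AE_lborel_component_neq: "AE x in (lborel :: (real^'n) measure). x $ j \<noteq> 0"
proof -
  have b: "{x::real^'n. x $ j = 0} \<in> sets borel" by measurable
  have "{x::real^'n. x $ j = 0} \<in> null_sets lebesgue"
    using negligible_standard_hyperplane_cart by (simp add: negligible_iff_null_sets)
  then have "{x::real^'n. x $ j = 0} \<in> null_sets lborel"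
    using b by (subst (asm) null_sets_completion_iff) auto
  then show ?thesis by (auto dest!: AE_not_in)
qed

text \<open>Translating \<open>F\<close> by a unit vector does not change its integral, and the difference is the integral
  of \<open>D\<close> over the translates. Lines through the origin are null because the dimension is at least 2.\<close>

lemma integral_partial_eq_0:
  fixes F D :: "real^'n \<Rightarrow> complex"
  assumes N: "CARD('n) \<ge> 2" and F: "integrable lborel F" and D: "integrable lborel D"
    and cD: "continuous_on (-{0}) D" and FD: "has_partial i F D"
  shows "(LINT x|lborel. D x) = 0"
proof -
  let ?e = "axis i 1 :: real^'n"
  have [measurable]: "F \<in> borel_measurable borel" "D \<in> borel_measurable borel"
    using F D borel_measurable_integrable by force+
  have transl: "(LINT x|lborel. f (x + v)) = (LINT x|lborel. f x)" "integrable lborel f \<Longrightarrow> integrable lborel (\<lambda>x. f (x + v))"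
    if [measurable]: "f \<in> borel_measurable borel" for f :: "real^'n \<Rightarrow> complex" and v
    using lborel_integral_affine[of 1 f v] lborel_integrable_affine[of 1 f v] that by (simp_all add: add.commute)
  \<comment> \<open>A second coordinate: where x_j is nonzero, the whole line x + t e_i avoids the
    origin.\<close>
  obtain j where j: "j \<noteq> i"
  proof -
    have "UNIV \<noteq> {i}"
    proof
      assume "UNIV = {i}"
      then have "CARD('n) = card {i}" by (rule arg_cong)
      with N show False by simp
    qed
    then show thesis using that by auto
  qed
  have ftc: "(LINT t|lborel. indicator {0..1::real} t *\<^sub>R D (x + t *\<^sub>R ?e)) = F (x + ?e) - F x" if "x $ j \<noteq> 0" for x
  proof -
    have nz: "x + t *\<^sub>R ?e \<noteq> 0" for t
    proof
      assume "x + t *\<^sub>R ?e = 0"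
      then have "(x + t *\<^sub>R ?e) $ j = 0" by simp
      with j that show False by (simp add: axis_def)
    qed
    have "(LINT t|lborel. indicator {0..1::real} t *\<^sub>R D (x + t *\<^sub>R ?e)) = F (x + 1 *\<^sub>R ?e) - F (x + 0 *\<^sub>R ?e)"
    proof (rule integral_FTC_Icc)
      show "continuous_on {0..1} (\<lambda>t. D (x + t *\<^sub>R ?e))"
        by (rule continuous_on_compose2[OF cD]) (use nz in \<open>auto intro!: continuous_intros\<close>)
      show "((\<lambda>t. F (x + t *\<^sub>R ?e)) has_vector_derivative D (x + t *\<^sub>R ?e)) (at t within {0..1})" for t
        by (rule has_vector_derivative_at_within[OF has_partialD[OF FD nz]])
    qed simp
    then show ?thesis by simp
  qed
  let ?K = "\<lambda>(t::real) x. indicator {0..1::real} t *\<^sub>R D (x + t *\<^sub>R ?e)"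
  have pair: "integrable (lborel \<Otimes>\<^sub>M lborel) (case_prod ?K)"
  proof (rule lborel_pair.Fubini_integrable)
    show "case_prod ?K \<in> borel_measurable (lborel \<Otimes>\<^sub>M lborel)" by measurable
    have eq: "(LINT x|lborel. norm (case_prod ?K (t, x))) = indicator {0..1} t * (LINT x|lborel. cmod (D x))" for t
    proof -
      have "complex_of_real (LINT x|lborel. cmod (D (x + t *\<^sub>R ?e))) = complex_of_real (LINT x|lborel. cmod (D x))"
        unfolding integral_complex_of_real[symmetric] by (rule transl(1)[of "\<lambda>x. of_real (cmod (D x))"]) measurable
      then have "(LINT x|lborel. cmod (D (x + t *\<^sub>R ?e))) = (LINT x|lborel. cmod (D x))"
        using of_real_eq_iff by blast
      then show ?thesis by (simp add: abs_mult)
    qed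
    have "integrable lborel (\<lambda>t::real. indicator {0..1} t * (LINT x|lborel. cmod (D x)))"
      by (intro integrable_mult_left integrable_real_indicator) auto
    then show "integrable lborel (\<lambda>t. LINT x|lborel. norm (case_prod ?K (t, x)))"
      by (simp only: eq)
    show "AE t in lborel. integrable lborel (\<lambda>x. case_prod ?K (t, x))"
      using transl(2)[OF _ D] by (intro AE_I2) simp
  qed
  have "0 = (LINT x|lborel. F (x + ?e)) - (LINT x|lborel. F x)"
    using transl(1)[of F ?e] by simp
  also have "\<dots> = (LINT x|lborel. F (x + ?e) - F x)"
    using transl(2)[of F ?e] F by simp
  also have "\<dots> = (LINT x|lborel. LINT t|lborel. ?K t x)"
  proof (rule integral_cong_AE)
    show "(\<lambda>x. LINT t|lborel. ?K t x) \<in> borel_measurable lborel" by measurable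
    show "AE x in lborel. F (x + ?e) - F x = (LINT t|lborel. ?K t x)"
      using AE_lborel_component_neq[of j] by eventually_elim (rule ftc[symmetric])
  qed measurable
  also have "\<dots> = (LINT t|lborel. LINT x|lborel. ?K t x)"
    by (rule lborel_pair.Fubini_integral[OF pair])
  also have "\<dots> = (LINT t|lborel. indicator {0..1::real} t *\<^sub>R (LINT x|lborel. D x))"
    using transl(1)[of D] by simp
  also have "\<dots> = (LINT x|lborel. D x)" by simp
  finally show ?thesis by simp
qed

text \<open>The partial derivative of the product of \<open>f\<close> and the kernel has integral
  zero, and the product rule splits this integral into the two transforms.\<close>

lemma fourier_integral_partial:
  fixes f :: "real^'n \<Rightarrow> complex"
  assumes N: "CARD('n) \<ge> 2" and f: "rapid f" and D: "rapid D" and fD: "has_partial i f D"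
  shows "fourier_integral D \<xi> = 2 * of_real pi * \<i> * of_real (\<xi> $ i) * fourier_integral f \<xi>"
proof -
  have int: "integrable lborel (\<lambda>x. f x * fker x \<xi>)" "integrable lborel (\<lambda>x. D x * fker x \<xi>)"
    by (intro integrable_fker rapid_integrable f D)+
  let ?c = "- 2 * of_real pi * \<i> * of_real (\<xi> $ i) :: complex"
  have "(LINT x|lborel. D x * fker x \<xi> + f x * (?c * fker x \<xi>)) = 0"
  proof (rule integral_partial_eq_0[OF N int(1)])
    have "integrable lborel (\<lambda>x. D x * fker x \<xi> + ?c * (f x * fker x \<xi>))"
      by (intro Bochner_Integration.integrable_add integrable_mult_right int)
    then show "integrable lborel (\<lambda>x. D x * fker x \<xi> + f x * (?c * fker x \<xi>))"
      by (simp add: mult_ac)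
    show "continuous_on (-{0}) (\<lambda>x. D x * fker x \<xi> + f x * (?c * fker x \<xi>))"
      by (intro continuous_intros continuous_fker rapid_continuous f D)
    show "has_partial i (\<lambda>x. f x * fker x \<xi>) (\<lambda>x. D x * fker x \<xi> + f x * (?c * fker x \<xi>))"
      by (intro has_partial_mult has_partial_fker fD)
  qed
  then have "(LINT x|lborel. D x * fker x \<xi> + ?c * (f x * fker x \<xi>)) = 0"
    by (simp add: mult_ac)
  then have "(LINT x|lborel. D x * fker x \<xi>) + ?c * (LINT x|lborel. f x * fker x \<xi>) = 0"
    by (subst (asm) Bochner_Integration.integral_add) (use int in auto)
  then show ?thesis by (simp add: fourier_integral_fker eq_neg_iff_add_eq_0)
qed

lemma rapid_component: "rapid f \<Longrightarrow> rapid (\<lambda>x. of_real (x $ i) * f x)"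
  by (rule rapid_mult_polygrowth[OF polygrowth_component])

text \<open>A total derivative, not only partial ones, is demanded by \<open>C_k\<close>. It comes
  from the second order remainder of the exponential and the finite second moment of |g|.\<close>

lemma has_derivative_fourier_integral:
  fixes g :: "real^'n \<Rightarrow> complex"
  assumes g: "rapid g"
  shows "(fourier_integral g has_derivative
    (\<lambda>h. \<Sum>j\<in>UNIV. of_real (h $ j) * fourier_integral (\<lambda>x. - 2 * of_real pi * \<i> * (of_real (x $ j) * g x)) \<xi>)) (at \<xi>)"
proof -
  note [measurable] = rapid_measurable[OF g]
  let ?L = "\<lambda>h. \<Sum>j\<in>UNIV. of_real (h $ j) * fourier_integral (\<lambda>x. - 2 * of_real pi * \<i> * (of_real (x $ j) * g x)) \<xi>"
  have L: "?L h = (LINT x|lborel. g x * fker x \<xi> * (- 2 * of_real pi * \<i> * of_real (x \<bullet> h)))" for h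
  proof -
    have "?L h = (\<Sum>j\<in>UNIV. (LINT x|lborel. of_real (h $ j) * ((- 2 * of_real pi * \<i> * (of_real (x $ j) * g x)) * fker x \<xi>)))"
      by (simp only: fourier_integral_fker integral_mult_right_zero)
    also have "\<dots> = (LINT x|lborel. (\<Sum>j\<in>UNIV. of_real (h $ j) * ((- 2 * of_real pi * \<i> * (of_real (x $ j) * g x)) * fker x \<xi>)))"
      by (rule Bochner_Integration.integral_sum[symmetric])
         (intro integrable_mult_right integrable_fker rapid_integrable rapid_component g)
    also have "\<dots> = (LINT x|lborel. g x * fker x \<xi> * (- 2 * of_real pi * \<i> * of_real (x \<bullet> h)))"
      by (rule Bochner_Integration.integral_cong) (auto simp: inner_vec_def sum_distrib_left sum_distrib_right mult_ac)
    finally show ?thesis .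
  qed
  have quad: "integrable lborel (\<lambda>x. cmod (g x) * (norm x)\<^sup>2)"
  proof -
    have "rapid (\<lambda>x. of_real (norm x) * (of_real (norm x) * g x))"
      by (intro rapid_mult_polygrowth[OF polygrowth_norm] g)
    from integrable_norm[OF rapid_integrable[OF this]] show ?thesis
      by (simp add: norm_mult power2_eq_square mult_ac)
  qed
  \<comment> \<open>From |e^(i\<theta>) - 1 - i\<theta>| <= \<theta>^2 / 2 with \<theta> = - 2 pi (x
    . h) and the Cauchy-Schwarz inequality.\<close>
  define C where "C = 2 * pi\<^sup>2 * (LINT x|lborel. cmod (g x) * (norm x)\<^sup>2)"
  have est: "cmod (fourier_integral g (\<xi> + h) - fourier_integral g \<xi> - ?L h) \<le> C * (norm h)\<^sup>2" for h
  proof -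
    let ?r = "\<lambda>x. g x * fker x \<xi> * (fker x h - 1 - (- 2 * of_real pi * \<i> * of_real (x \<bullet> h)))"
    have "integrable lborel (\<lambda>x. of_real (x \<bullet> h) * g x)"
    proof -
      have "integrable lborel (\<lambda>x. \<Sum>j\<in>UNIV. of_real (h $ j) * (of_real (x $ j) * g x))"
        by (intro Bochner_Integration.integrable_sum integrable_mult_right rapid_integrable rapid_component g)
      then show ?thesis by (simp add: inner_vec_def sum_distrib_left mult_ac)
    qed
    from integrable_mult_right[OF integrable_fker[OF this, of \<xi>], of "- 2 * of_real pi * \<i>"]
    have i3: "integrable lborel (\<lambda>x. g x * fker x \<xi> * (- 2 * of_real pi * \<i> * of_real (x \<bullet> h)))"
      by (simp add: mult_ac)
    have i12: "integrable lborel (\<lambda>x. g x * fker x (\<xi> + h))" "integrable lborel (\<lambda>x. g x * fker x \<xi>)"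
      by (intro integrable_fker rapid_integrable g)+
    have rint: "integrable lborel ?r"
    proof -
      have "integrable lborel (\<lambda>x. g x * fker x (\<xi> + h) - g x * fker x \<xi> - g x * fker x \<xi> * (- 2 * of_real pi * \<i> * of_real (x \<bullet> h)))"
        by (intro Bochner_Integration.integrable_diff i12 i3)
      then show ?thesis by (simp add: algebra_simps fker_sym[of _ "\<xi> + h"] fker_add fker_sym[of \<xi>] fker_sym[of h])
    qed
    have "fourier_integral g (\<xi> + h) - fourier_integral g \<xi> - ?L h =
      (LINT x|lborel. g x * fker x (\<xi> + h) - g x * fker x \<xi> - g x * fker x \<xi> * (- 2 * of_real pi * \<i> * of_real (x \<bullet> h)))"
      unfolding L unfolding fourier_integral_fker using i12 i3 by (simp del: times_complex.sel)
    also have "\<dots> = (LINT x|lborel. ?r x)"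
      by (rule Bochner_Integration.integral_cong[OF refl])
         (simp add: algebra_simps fker_sym[of _ "\<xi> + h"] fker_add fker_sym[of \<xi>] fker_sym[of h])
    also have "cmod \<dots> \<le> (LINT x|lborel. cmod (?r x))" by (rule integral_norm_bound)
    also have "\<dots> \<le> (LINT x|lborel. 2 * pi\<^sup>2 * (norm h)\<^sup>2 * (cmod (g x) * (norm x)\<^sup>2))"
    proof (rule integral_mono)
      fix x
      let ?\<theta> = "- 2 * pi * (x \<bullet> h)"
      have "cmod (iexp ?\<theta> - (\<Sum>k\<le>1. (\<i> * ?\<theta>)^k / fact k)) \<le> \<bar>?\<theta>\<bar>^(Suc 1) / fact (Suc 1)"
        by (rule iexp_approx1)
      moreover have "iexp ?\<theta> - (\<Sum>k\<le>1. (\<i> * ?\<theta>)^k / fact k) = fker x h - 1 - (- 2 * of_real pi * \<i> * of_real (x \<bullet> h))"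
        by (simp add: fker_def algebra_simps)
      moreover have "\<bar>?\<theta>\<bar>^(Suc 1) / fact (Suc 1) = 2 * pi\<^sup>2 * (x \<bullet> h)\<^sup>2"
        by (simp add: power2_eq_square numeral_2_eq_2[symmetric])
      moreover have "(x \<bullet> h)\<^sup>2 \<le> (norm x)\<^sup>2 * (norm h)\<^sup>2"
        using Cauchy_Schwarz_ineq[of x h] by (simp add: power2_norm_eq_inner)
      ultimately have "cmod (fker x h - 1 - (- 2 * of_real pi * \<i> * of_real (x \<bullet> h))) \<le> 2 * pi\<^sup>2 * ((norm x)\<^sup>2 * (norm h)\<^sup>2)"
        by (smt (verit, best) mult_left_mono pi_ge_zero zero_le_power2)
      then have "cmod (g x) * cmod (fker x h - 1 - (- 2 * of_real pi * \<i> * of_real (x \<bullet> h))) \<le> cmod (g x) * (2 * pi\<^sup>2 * ((norm x)\<^sup>2 * (norm h)\<^sup>2))"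
        by (intro mult_left_mono) auto
      then show "cmod (?r x) \<le> 2 * pi\<^sup>2 * (norm h)\<^sup>2 * (cmod (g x) * (norm x)\<^sup>2)"
        by (simp only: norm_mult norm_fker) (simp add: mult_ac)
    qed (use rint quad in auto)
    also have "\<dots> = C * (norm h)\<^sup>2" by (simp add: C_def)
    finally show ?thesis .
  qed
  have bl: "bounded_linear ?L"
    by (intro bounded_linear_sum bounded_linear_compose[OF bounded_linear_mult_left]
      bounded_linear_compose[OF bounded_linear_of_real] bounded_linear_vec_nth)
  show ?thesis
  proof (rule has_derivativeI_sandwich[of 1])
    fix y assume "y \<noteq> \<xi>" "dist y \<xi> < 1"
    have "cmod (fourier_integral g y - fourier_integral g \<xi> - ?L (y - \<xi>)) \<le> C * (norm (y - \<xi>))\<^sup>2"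
      using est[of "y - \<xi>"] by simp
    then show "cmod (fourier_integral g y - fourier_integral g \<xi> - ?L (y - \<xi>)) / norm (y - \<xi>) \<le> C * norm (y - \<xi>)"
      using \<open>y \<noteq> \<xi>\<close> by (simp add: divide_le_eq power2_eq_square mult.assoc)
  next
    have "((\<lambda>y. C * norm (y - \<xi>)) \<longlongrightarrow> C * norm (\<xi> - \<xi>)) (at \<xi>)" by (intro tendsto_intros)
    then show "((\<lambda>y. C * norm (y - \<xi>)) \<longlongrightarrow> 0) (at \<xi>)" by simp
  qed (use bl in auto)
qed

section \<open>The form domain\<close>

lemma partial_deriv_eq: "(f has_derivative f') (at x) \<Longrightarrow> partial_deriv i f x = f' (axis i 1)"
  unfolding partial_deriv_def by (metis frechet_derivative_at)

lemma partial_deriv_add: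
  assumes "f differentiable (at x)" "g differentiable (at x)"
  shows "partial_deriv i (\<lambda>x. f x + g x) x = partial_deriv i f x + partial_deriv i g x"
proof -
  obtain f' g' where d: "(f has_derivative f') (at x)" "(g has_derivative g') (at x)"
    using assms by (auto simp: differentiable_def)
  from partial_deriv_eq[OF has_derivative_add[OF this]] partial_deriv_eq[OF d(1)] partial_deriv_eq[OF d(2)]
  show ?thesis by simp
qed

lemma partial_deriv_mult:
  assumes "f differentiable (at x)" "g differentiable (at x)"
  shows "partial_deriv i (\<lambda>x. f x * g x) x = f x * partial_deriv i g x + partial_deriv i f x * g x"
proof -
  obtain f' g' where d: "(f has_derivative f') (at x)" "(g has_derivative g') (at x)"
    using assms by (auto simp: differentiable_def)
  from partial_deriv_eq[OF has_derivative_mult[OF this]] partial_deriv_eq[OF d(1)] partial_deriv_eq[OF d(2)]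
  show ?thesis by simp
qed

lemma has_partial_partial_deriv:
  assumes "\<And>x. f differentiable (at x)"
  shows "has_partial i f (partial_deriv i f)"
  unfolding partial_deriv_def
  by (rule has_partial_from_derivative) (use assms in \<open>simp add: frechet_derivative_works\<close>)

lemma C_k_Suc_imp: "C_k (Suc k) f \<Longrightarrow> C_k k f"
proof (induction k arbitrary: f)
  case 0
  then have "\<And>x. f differentiable (at x)" by simp
  then show ?case
    by (auto intro!: differentiable_imp_continuous_on simp: differentiable_on_def differentiable_at_withinI)
next
  case (Suc k)
  then show ?case by (metis C_k.simps(2))
qed

lemma C_k_add: "C_k k f \<Longrightarrow> C_k k g \<Longrightarrow> C_k k (\<lambda>x. f x + g x)"
proof (induction k arbitrary: f g)
  case (Suc k)
  then have "partial_deriv i (\<lambda>x. f x + g x) = (\<lambda>x. partial_deriv i f x + partial_deriv i g x)" for i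
    by (intro ext partial_deriv_add) auto
  with Suc show ?case by auto
qed (auto intro: continuous_intros)

lemma C_k_mult: "C_k k f \<Longrightarrow> C_k k g \<Longrightarrow> C_k k (\<lambda>x. f x * g x)"
proof (induction k arbitrary: f g)
  case (Suc k)
  then have eq: "partial_deriv i (\<lambda>x. f x * g x) = (\<lambda>x. f x * partial_deriv i g x + partial_deriv i f x * g x)" for i
    by (intro ext partial_deriv_mult) auto
  have "C_k k f" "C_k k g" using Suc.prems C_k_Suc_imp by blast+
  with Suc have "C_k k (\<lambda>x. f x * partial_deriv i g x + partial_deriv i f x * g x)" for i
    by (intro C_k_add Suc.IH) auto
  with Suc eq show ?case by auto
qed (auto intro: continuous_intros)

lemma C_k_const: "C_k k (\<lambda>x. c)"
proof (induction k arbitrary: c)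
  case (Suc k)
  have "partial_deriv i (\<lambda>x::real^'a. c) = (\<lambda>x. 0)" for i :: 'a
    by (intro ext) (simp add: partial_deriv_eq[OF has_derivative_const])
  with Suc show ?case by simp
qed auto

lemma C_k_component: "C_k k (\<lambda>x::real^'n. of_real (x $ j))"
proof (cases k)
  case (Suc l)
  have d: "((\<lambda>x::real^'n. complex_of_real (x $ j)) has_derivative (\<lambda>h. of_real (h $ j))) (at x)" for x
    by (auto intro!: derivative_eq_intros bounded_linear.has_derivative[OF bounded_linear_vec_nth])
  have "partial_deriv i (\<lambda>x::real^'n. complex_of_real (x $ j)) = (\<lambda>x. of_real (axis i 1 $ j))" for i
    by (intro ext partial_deriv_eq[OF d])
  with Suc d show ?thesis by (auto simp: C_k_const differentiable_def)
qed (auto intro!: continuous_intros)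

lemma sum_axis: "(\<Sum>j\<in>UNIV. of_real (axis i 1 $ j) * G j) = (G i :: complex)"
proof -
  have "(\<Sum>j\<in>UNIV. of_real (axis i 1 $ j) * G j) = (\<Sum>j\<in>UNIV. if j = i then G j else 0)"
    by (rule sum.cong) (auto simp: axis_def)
  then show ?thesis by simp
qed

text \<open>Each derivative of the transform is the transform of another rapidly decaying function,
  so the induction runs over all \<open>g\<close> at once.\<close>

lemma C_k_fourier_integral: "rapid g \<Longrightarrow> C_k k (fourier_integral g)"
proof (induction k arbitrary: g)
  case 0
  then show ?case by (simp add: continuous_fourier_integral rapid_integrable)
next
  case (Suc k)
  note d = has_derivative_fourier_integral[OF Suc.prems]
  have "partial_deriv i (fourier_integral g) = fourier_integral (\<lambda>x. - 2 * of_real pi * \<i> * (of_real (x $ i) * g x))" for i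
    by (intro ext) (simp only: partial_deriv_eq[OF d] sum_axis)
  moreover have "C_k k (fourier_integral (\<lambda>x. - 2 * of_real pi * \<i> * (of_real (x $ i) * g x)))" for i
    by (intro Suc.IH rapid_scale rapid_component Suc.prems)
  ultimately show ?case using d by (auto simp: differentiable_def)
qed

lemma has_partial_fourier_integral:
  assumes "rapid g"
  shows "has_partial i (fourier_integral g) (fourier_integral (\<lambda>x. - 2 * of_real pi * \<i> * (of_real (x $ i) * g x)))"
  using has_partial_from_derivative[OF has_derivative_fourier_integral[OF assms], of i] unfolding sum_axis .

lemma fourier_integral_reflect:
  assumes "f \<in> borel_measurable borel"
  shows "fourier_integral f (- x) = fourier_integral (\<lambda>y. f (- y)) (x::real^'n)"
proof -
  note [measurable] = assms
  have "fourier_integral (\<lambda>y. f (- y)) x = (LINT y|lborel. f (- y) * fker (- (- y)) x)"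
    by (simp add: fourier_integral_fker)
  also have "\<dots> = (LINT y|lborel. f y * fker (- y) x)"
    using lborel_integral_uminus(1)[of "\<lambda>y. f y * fker (- y) x"] by simp
  finally show ?thesis by (simp add: fourier_integral_fker fker_minus fker_minus_right)
qed

lemma rapid_reflect:
  assumes "rapid f"
  shows "rapid (\<lambda>x. f (- x))"
  unfolding rapid_def
proof (intro conjI allI)
  show "continuous_on (-{0}) (\<lambda>x. f (- x))"
    by (rule continuous_on_compose2[OF rapid_continuous[OF assms]]) (auto intro: continuous_intros)
  fix M
  obtain C where C: "\<And>x. (1 + norm x) ^ M * cmod (f x) \<le> C"
    using rapidE[OF assms] by blast
  have "(1 + norm x) ^ M * cmod (f (- x)) \<le> C" for x using C[of "- x"] by simp
  then show "\<exists>C. \<forall>x. (1 + norm x) ^ M * cmod (f (- x)) \<le> C" by blast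
qed

lemma C0_infinityD:
  assumes "u \<in> C0_infinity"
  shows "C_k k u" "u differentiable (at x)" "continuous_on UNIV u" "compact (closure {x. u x \<noteq> 0})"
proof -
  show "C_k k u" "compact (closure {x. u x \<noteq> 0})" using assms by (auto simp: C0_infinity_def)
  have "C_k (Suc 0) u" "C_k 0 u" using assms unfolding C0_infinity_def by blast+
  then show "u differentiable (at x)" "continuous_on UNIV u" by auto
qed

lemma compact_closure_subset: "compact (closure B) \<Longrightarrow> A \<subseteq> closure B \<Longrightarrow> compact (closure A)"
  using compact_Int_closed[of "closure B" "closure A"] closure_minimal[of A "closure B"]
  by (simp add: Int_absorb1)

lemma C0_infinity_mult:
  assumes "\<And>k. C_k k g" "u \<in> C0_infinity"
  shows "(\<lambda>x. g x * u x) \<in> C0_infinity"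
proof -
  have "{x. g x * u x \<noteq> 0} \<subseteq> closure {x. u x \<noteq> 0}"
    by (rule order_trans[OF _ closure_subset]) auto
  then show ?thesis
    unfolding C0_infinity_def
    by (intro CollectI conjI allI C_k_mult assms C0_infinityD(1)[OF assms(2)] compact_closure_subset[OF C0_infinityD(4)[OF assms(2)]])
qed

lemma C0_infinity_partial:
  assumes "u \<in> C0_infinity"
  shows "partial_deriv i u \<in> C0_infinity"
proof -
  have "C_k k (partial_deriv i u)" for k
    using C0_infinityD(1)[OF assms, of "Suc k"] by simp
  moreover have "partial_deriv i u x = 0" if x: "x \<notin> closure {x. u x \<noteq> 0}" for x
  proof -
    have o: "open (- closure {x. u x \<noteq> 0})" by auto
    have z: "0 = u y" if "y \<in> - closure {x. u x \<noteq> 0}" for y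
      using that closure_subset[of "{x. u x \<noteq> 0}"] by auto
    have "(u has_derivative (\<lambda>x. 0)) (at x)"
      by (rule has_derivative_transform_within_open[OF has_derivative_const o _ z]) (use x in simp)
    then show ?thesis by (simp add: partial_deriv_eq)
  qed
  then have "{x. partial_deriv i u x \<noteq> 0} \<subseteq> closure {x. u x \<noteq> 0}" by auto
  ultimately show ?thesis
    unfolding C0_infinity_def
    by (intro CollectI conjI allI compact_closure_subset[OF C0_infinityD(4)[OF assms]])
qed

lemma C0_infinity_rapid:
  assumes "u \<in> C0_infinity"
  shows "rapid u"
  unfolding rapid_def
proof (intro conjI allI)
  have c: "continuous_on UNIV u" by (rule C0_infinityD[OF assms])
  then show "continuous_on (-{0}) u" by (rule continuous_on_subset) auto
  fix M
  let ?S = "closure {x. u x \<noteq> 0}"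
  have "continuous_on ?S (\<lambda>x. (1 + norm x) ^ M * cmod (u x))"
    by (intro continuous_intros continuous_on_subset[OF c]) auto
  then have "bounded ((\<lambda>x. (1 + norm x) ^ M * cmod (u x)) ` ?S)"
    using C0_infinityD(4)[OF assms] compact_continuous_image compact_imp_bounded by blast
  then obtain C where C: "\<And>x. x \<in> ?S \<Longrightarrow> norm ((1 + norm x) ^ M * cmod (u x)) \<le> C"
    unfolding bounded_iff by blast
  have "(1 + norm x) ^ M * cmod (u x) \<le> max C 0" for x
  proof (cases "u x = 0")
    case False
    then have "x \<in> ?S" using closure_subset[of "{x. u x \<noteq> 0}"] by auto
    from C[OF this] show ?thesis by auto
  qed auto
  then show "\<exists>C. \<forall>x. (1 + norm x) ^ M * cmod (u x) \<le> C" by blast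
qed

lemma C0_infinity_component: "u \<in> C0_infinity \<Longrightarrow> (\<lambda>x. of_real (x $ j) * u x) \<in> C0_infinity"
  by (intro C0_infinity_mult C_k_component)

lemma C0_infinity_scale: "u \<in> C0_infinity \<Longrightarrow> (\<lambda>x. c * u x) \<in> C0_infinity"
  by (intro C0_infinity_mult C_k_const)

lemma fourier_partial_deriv:
  fixes u :: "real^'n \<Rightarrow> complex"
  assumes N: "CARD('n) \<ge> 2" and u: "u \<in> C0_infinity"
  shows "fourier_integral (partial_deriv i u) \<xi> = 2 * of_real pi * \<i> * of_real (\<xi> $ i) * fourier_integral u \<xi>"
  by (intro fourier_integral_partial N C0_infinity_rapid C0_infinity_partial u has_partial_partial_deriv C0_infinityD)

text \<open>One power of 1 + |\<xi>| is gained per derivative of \<open>u\<close>: |\<xi>| is at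
  most the sum of the |\<xi>_i|, and \<xi>_i times the transform is, up to the factor 2 pi i, the
  transform of a partial derivative, again a test function.\<close>

lemma rapid_fourier_integral:
  fixes u :: "real^'n \<Rightarrow> complex"
  assumes N: "CARD('n) \<ge> 2" and u: "u \<in> C0_infinity"
  shows "rapid (fourier_integral u)"
  unfolding rapid_def
proof (intro conjI allI)
  show "continuous_on (-{0}) (fourier_integral u)"
    using continuous_fourier_integral[OF rapid_integrable[OF C0_infinity_rapid[OF u]]] by (rule continuous_on_subset) auto
  fix M
  show "\<exists>C. \<forall>x. (1 + norm x) ^ M * cmod (fourier_integral u x) \<le> C"
    using u
  proof (induction M arbitrary: u)
    case 0
    then show ?case using fourier_integral_bound by auto
  next
    case (Suc M)
    obtain C where C: "\<And>x. (1 + norm x) ^ M * cmod (fourier_integral u x) \<le> C"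
      using Suc by blast
    have "\<forall>i. \<exists>C. \<forall>x. (1 + norm x) ^ M * cmod (fourier_integral (partial_deriv i u) x) \<le> C"
      using Suc C0_infinity_partial by blast
    then obtain K where K: "\<And>i x. (1 + norm x) ^ M * cmod (fourier_integral (partial_deriv i u) x) \<le> K i"
      by metis
    have "(1 + norm x) ^ Suc M * cmod (fourier_integral u x) \<le> C + (\<Sum>i\<in>UNIV. K i)" for x
    proof -
      have "(1 + norm x) ^ Suc M * cmod (fourier_integral u x) = (1 + norm x) ^ M * cmod (fourier_integral u x) + norm x * ((1 + norm x) ^ M * cmod (fourier_integral u x))"
        by (simp add: algebra_simps)
      also have "norm x * ((1 + norm x) ^ M * cmod (fourier_integral u x)) \<le> (\<Sum>i\<in>UNIV. \<bar>x $ i\<bar>) * ((1 + norm x) ^ M * cmod (fourier_integral u x))"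
        by (intro mult_right_mono norm_le_l1_cart) auto
      also have "\<dots> = (\<Sum>i\<in>UNIV. (1 + norm x) ^ M * (\<bar>x $ i\<bar> * cmod (fourier_integral u x)))"
          by (simp only: sum_distrib_right) (simp only: mult_ac)
      also have "\<dots> \<le> (\<Sum>i\<in>UNIV. K i)"
      proof (rule sum_mono)
        fix i
        have "\<bar>x $ i\<bar> * cmod (fourier_integral u x) \<le> 2 * pi * (\<bar>x $ i\<bar> * cmod (fourier_integral u x))"
          using pi_gt3 by (intro mult_right_mono[of 1 "2*pi", simplified]) auto
        also have "\<dots> = cmod (fourier_integral (partial_deriv i u) x)"
          by (simp add: fourier_partial_deriv[OF N Suc.prems] norm_mult)
        finally have "(1 + norm x) ^ M * (\<bar>x $ i\<bar> * cmod (fourier_integral u x)) \<le> (1 + norm x) ^ M * cmod (fourier_integral (partial_deriv i u) x)"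
          by (intro mult_left_mono) auto
        also have "\<dots> \<le> K i" by (rule K)
        finally show "(1 + norm x) ^ M * (\<bar>x $ i\<bar> * cmod (fourier_integral u x)) \<le> K i" .
      qed
      finally show ?thesis using C[of x] by simp
    qed
    then show ?case by blast
  qed
qed

text \<open>The gradient is scaled by \<open>|x|\<close>, which makes it insensitive to a singularity of the
  derivative at the origin.\<close>

definition gr :: "'n \<Rightarrow> (real^'n \<Rightarrow> complex) \<Rightarrow> real^'n \<Rightarrow> complex" where
  "gr i v x = of_real (norm x) * vector_derivative (\<lambda>t. v (x + t *\<^sub>R axis i 1)) (at 0)"

text \<open>Differentiability is required separately because \<open>gr\<close> is built on
  \<open>vector_derivative\<close>, an arbitrary value where no derivative exists. The set contains
  both the transforms of test functions and the eigenfunctions.\<close>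

definition form_domain :: "(real^'n \<Rightarrow> complex) set" where
  "form_domain = {v. rapid v \<and> (\<forall>i. (\<exists>D. has_partial i v D) \<and> rapid (gr i v))}"

lemma gr_eq: "has_partial i v D \<Longrightarrow> gr i v x = of_real (norm x) * D x"
  by (cases "x = 0") (auto simp: gr_def has_partial_def vector_derivative_at)

lemma form_domainI:
  assumes "rapid v" "\<And>i. has_partial i v (D i)" "\<And>i. rapid (\<lambda>x. of_real (norm x) * D i x)"
  shows "v \<in> form_domain"
proof -
  have "gr i v = (\<lambda>x. of_real (norm x) * D i x)" for i using gr_eq[OF assms(2)] by auto
  then show ?thesis using assms by (auto simp: form_domain_def)
qed

lemma form_domain_rapid: "v \<in> form_domain \<Longrightarrow> rapid v"
  and form_domain_gr: "v \<in> form_domain \<Longrightarrow> rapid (gr i v)"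
  by (auto simp: form_domain_def)

lemma form_domain_partial:
  assumes "v \<in> form_domain"
  shows "has_partial i v (\<lambda>x. gr i v x / of_real (norm x))"
proof -
  obtain D where D: "has_partial i v D" using assms by (auto simp: form_domain_def)
  then show ?thesis by (rule has_partial_cong) (auto simp: gr_eq[OF D])
qed

lemma form_domain_add:
  assumes "v \<in> form_domain" "w \<in> form_domain"
  shows "(\<lambda>x. v x + w x) \<in> form_domain" "gr i (\<lambda>x. v x + w x) = (\<lambda>x. gr i v x + gr i w x)"
proof -
  have p: "has_partial i (\<lambda>x. v x + w x) (\<lambda>x. gr i v x / of_real (norm x) + gr i w x / of_real (norm x))" for i
    by (intro has_partial_add form_domain_partial assms)
  have z: "gr i v 0 = 0" for i v by (simp add: gr_def)
  have eq: "of_real (norm x) * (gr i v x / of_real (norm x) + gr i w x / of_real (norm x)) = gr i v x + gr i w x" for x i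
    by (cases "x = 0") (auto simp: z distrib_left)
  show "(\<lambda>x. v x + w x) \<in> form_domain"
    by (rule form_domainI[OF _ p], unfold eq) (intro rapid_add form_domain_rapid form_domain_gr assms)+
  show "gr i (\<lambda>x. v x + w x) = (\<lambda>x. gr i v x + gr i w x)"
    by (rule ext) (simp only: gr_eq[OF p] eq)
qed

lemma form_domain_scale:
  assumes "v \<in> form_domain"
  shows "(\<lambda>x. c * v x) \<in> form_domain" "gr i (\<lambda>x. c * v x) = (\<lambda>x. c * gr i v x)"
proof -
  have p: "has_partial i (\<lambda>x. c * v x) (\<lambda>x. c * (gr i v x / of_real (norm x)))" for i
    by (intro has_partial_cmult form_domain_partial assms)
  have z: "gr i v 0 = 0" for i v by (simp add: gr_def)
  have eq: "of_real (norm x) * (c * (gr i v x / of_real (norm x))) = c * gr i v x" for x i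
    by (cases "x = 0") (auto simp: z)
  show "(\<lambda>x. c * v x) \<in> form_domain"
    by (rule form_domainI[OF _ p], unfold eq) (intro rapid_scale form_domain_rapid form_domain_gr assms)+
  show "gr i (\<lambda>x. c * v x) = (\<lambda>x. c * gr i v x)"
    by (rule ext) (simp only: gr_eq[OF p] eq)
qed

lemma fourier_integral_form_domain:
  fixes u :: "real^'n \<Rightarrow> complex"
  assumes N: "CARD('n) \<ge> 2" and u: "u \<in> C0_infinity"
  shows "fourier_integral u \<in> form_domain"
  by (rule form_domainI[OF rapid_fourier_integral[OF N u] has_partial_fourier_integral[OF C0_infinity_rapid[OF u]]])
     (intro rapid_mult_polygrowth[OF polygrowth_norm] rapid_fourier_integral N C0_infinity_scale C0_infinity_component u)

lemma has_partial_norm_powr: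
  "has_partial i (\<lambda>x::real^'n. of_real (norm x powr g)) (\<lambda>x. of_real (g * norm x powr (g - 2) * x $ i))"
proof -
  have "((\<lambda>x::real^'n. complex_of_real (norm x powr g)) has_derivative (\<lambda>h. of_real (g * norm x powr (g - 2) * (h \<bullet> x)))) (at x)" if "x \<noteq> 0" for x
  proof -
    have "((\<lambda>x::real^'n. norm x) has_derivative (\<lambda>h. h \<bullet> sgn x)) (at x)"
      by (rule has_derivative_norm[OF that])
    from has_derivative_powr[OF this has_derivative_const[of g]] that
    have "((\<lambda>x::real^'n. norm x powr g) has_derivative (\<lambda>h. norm x powr g * (h \<bullet> sgn x * g / norm x))) (at x)"
      by simp
    also have "(\<lambda>h. norm x powr g * (h \<bullet> sgn x * g / norm x)) = (\<lambda>h. g * norm x powr (g - 2) * (h \<bullet> x))"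
    proof
      fix h
      have "norm x powr (g - 2) = norm x powr g / (norm x)\<^sup>2"
        using that by (simp add: powr_diff)
      then show "norm x powr g * (h \<bullet> sgn x * g / norm x) = g * norm x powr (g - 2) * (h \<bullet> x)"
        by (simp add: sgn_div_norm power2_eq_square field_simps)
    qed
    finally show ?thesis by (intro has_derivative_of_real)
  qed
  from has_partial_from_derivative[OF this, of i] show ?thesis
    by (rule has_partial_cong) (auto simp: inner_axis' )
qed

section \<open>The quadratic form\<close>

definition ucomp :: "'n \<Rightarrow> real^'n \<Rightarrow> complex" where
  "ucomp i x = of_real (x $ i / norm x)"

text \<open>The Euler operator x . grad v: the factor |x| inside \<open>gr\<close> cancels against
  the denominator of \<open>ucomp\<close>.\<close>

definition eul :: "(real^'n \<Rightarrow> complex) \<Rightarrow> real^'n \<Rightarrow> complex" where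
  "eul v x = (\<Sum>i\<in>UNIV. ucomp i x * gr i v x)"

lemma cnj_ucomp [simp]: "cnj (ucomp i x) = ucomp i x"
  by (simp add: ucomp_def)

lemma polygrowth_ucomp: "polygrowth (ucomp i)"
  by (rule polygrowth_bounded[where C=1])
     (auto simp: ucomp_def norm_divide divide_le_eq_1 component_le_norm_cart intro!: continuous_intros)

lemma sum_ucomp_square: 
  assumes "x \<noteq> 0" shows "(\<Sum>i\<in>UNIV. ucomp i x * ucomp i x) = 1"
proof -
  have "(\<Sum>i\<in>UNIV. ucomp i x * ucomp i x) = of_real ((\<Sum>i\<in>UNIV. (x $ i)\<^sup>2) / (norm x)\<^sup>2)"
    by (simp add: ucomp_def power2_eq_square sum_divide_distrib)
  with assms show ?thesis by (simp flip: norm_vec_power2)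
qed

lemma rapid_ucomp: "rapid f \<Longrightarrow> rapid (\<lambda>x. ucomp i x * f x)"
  by (rule rapid_mult_polygrowth[OF polygrowth_ucomp])

lemma rapid_powr: "g \<ge> 0 \<Longrightarrow> rapid f \<Longrightarrow> rapid (\<lambda>x. of_real (norm x powr g) * f x)"
  by (rule rapid_mult_polygrowth[OF polygrowth_powr])

lemma rapid_eul: "v \<in> form_domain \<Longrightarrow> rapid (eul v)"
  unfolding eul_def[abs_def] by (intro rapid_sum rapid_ucomp form_domain_gr)

lemma rapid_mult_cnj: "rapid f \<Longrightarrow> rapid g \<Longrightarrow> rapid (\<lambda>x. f x * cnj (g x))"
  by (intro rapid_mult rapid_cnj)

text \<open>The divergence theorem for the field |x|^g x v cnj(w), since div (|x|^g x) = (N + g)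
  |x|^g.\<close>

lemma radial_integration_by_parts:
  fixes v w :: "real^'n \<Rightarrow> complex"
  assumes N: "CARD('n) \<ge> 2" and v: "v \<in> form_domain" and w: "w \<in> form_domain" and g: "g \<ge> 0"
  shows "(LINT x|lborel. of_real (norm x powr g) * (eul v x * cnj (w x))) + (LINT x|lborel. of_real (norm x powr g) * (v x * cnj (eul w x)))
     = - of_real (real CARD('n) + g) * (LINT x|lborel. of_real (norm x powr g) * (v x * cnj (w x)))"
proof -
  note rv = form_domain_rapid[OF v] form_domain_gr[OF v] and rw = form_domain_rapid[OF w] form_domain_gr[OF w]
  let ?p = "\<lambda>x. complex_of_real (norm x powr g)"
  \<comment> \<open>The i-th partial derivative of |x|^g x_i v cnj(w), rewritten with x_i / |x| and
    \<open>gr\<close> so that no negative power of |x| remains.\<close>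
  define E where "E i x = of_real g * (?p x * (ucomp i x * (ucomp i x * (v x * cnj (w x)))))
     + (?p x * (v x * cnj (w x)) + (?p x * (ucomp i x * (gr i v x * cnj (w x))) + ?p x * (ucomp i x * (v x * cnj (gr i w x)))))" for i x
  have E: "rapid (E i)" for i
    unfolding E_def[abs_def] by (intro rapid_add rapid_scale rapid_powr rapid_ucomp rapid_mult_cnj rv rw g)
  have z: "(LINT x|lborel. E i x) = 0" for i
  proof (rule integral_partial_eq_0[OF N _ rapid_integrable[OF E] rapid_continuous[OF E]])
    show "integrable lborel (\<lambda>x. ?p x * (of_real (x $ i) * (v x * cnj (w x))))"
      by (intro rapid_integrable rapid_powr rapid_component rapid_mult_cnj rv rw g)
    have "has_partial i (\<lambda>x. ?p x * (of_real (x $ i) * (v x * cnj (w x))))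
      (\<lambda>x. of_real (g * norm x powr (g - 2) * x $ i) * (of_real (x $ i) * (v x * cnj (w x))) +
        ?p x * ((if i = i then 1 else 0) * (v x * cnj (w x)) + of_real (x $ i) * ((gr i v x / of_real (norm x)) * cnj (w x) + v x * cnj (gr i w x / of_real (norm x)))))"
      by (intro has_partial_mult has_partial_norm_powr has_partial_component has_partial_cnj form_domain_partial v w)
    then show "has_partial i (\<lambda>x. ?p x * (of_real (x $ i) * (v x * cnj (w x)))) (E i)"
    proof (rule has_partial_cong)
      fix x :: "real^'n" assume "x \<noteq> 0"
      then have eq: "norm x powr (g - 2) = norm x powr g / (norm x)\<^sup>2" by (simp add: powr_diff)
      show "of_real (g * norm x powr (g - 2) * x $ i) * (of_real (x $ i) * (v x * cnj (w x))) +
        ?p x * ((if i = i then 1 else 0) * (v x * cnj (w x)) + of_real (x $ i) * ((gr i v x / of_real (norm x)) * cnj (w x) + v x * cnj (gr i w x / of_real (norm x)))) = E i x"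
        unfolding eq using \<open>x \<noteq> 0\<close> by (simp add: E_def ucomp_def power2_eq_square field_simps)
    qed simp
  qed
  have "0 = (\<Sum>i\<in>UNIV. LINT x|lborel. E i x)" by (simp add: z)
  also have "\<dots> = (LINT x|lborel. (\<Sum>i\<in>UNIV. E i x))"
    by (intro Bochner_Integration.integral_sum[symmetric] rapid_integrable E)
  also have "\<dots> = (LINT x|lborel. of_real (real CARD('n) + g) * (?p x * (v x * cnj (w x))) + (?p x * (eul v x * cnj (w x)) + ?p x * (v x * cnj (eul w x))))"
  proof (rule Bochner_Integration.integral_cong[OF refl])
    fix x :: "real^'n"
    show "(\<Sum>i\<in>UNIV. E i x) = of_real (real CARD('n) + g) * (?p x * (v x * cnj (w x))) + (?p x * (eul v x * cnj (w x)) + ?p x * (v x * cnj (eul w x)))"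
    proof (cases "x = 0")
      case False
      have "(\<Sum>i\<in>UNIV. E i x) = of_real g * (?p x * ((\<Sum>i\<in>UNIV. ucomp i x * ucomp i x) * (v x * cnj (w x))))
         + (of_nat CARD('n) * (?p x * (v x * cnj (w x))) + (?p x * (eul v x * cnj (w x)) + ?p x * (v x * cnj (eul w x))))"
        unfolding E_def eul_def sum.distrib by (simp add: sum_distrib_left sum_distrib_right mult_ac)
      then show ?thesis by (simp add: sum_ucomp_square[OF False] distrib_right)
    qed (simp add: E_def)
  qed
  also have "\<dots> = of_real (real CARD('n) + g) * (LINT x|lborel. ?p x * (v x * cnj (w x))) +
    ((LINT x|lborel. ?p x * (eul v x * cnj (w x))) + (LINT x|lborel. ?p x * (v x * cnj (eul w x))))"
  proof -
    have "integrable lborel (\<lambda>x. ?p x * (v x * cnj (w x)))" "integrable lborel (\<lambda>x. ?p x * (eul v x * cnj (w x)))"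
      "integrable lborel (\<lambda>x. ?p x * (v x * cnj (eul w x)))"
      by (intro rapid_integrable rapid_powr rapid_mult_cnj rv rw rapid_eul v w g)+
    then show ?thesis by simp
  qed
  finally show ?thesis by (simp only: mult_minus_left eq_neg_iff_add_eq_0) (simp only: add_ac)
qed

section \<open>Weighted inner products and the form\<close>

definition wip :: "real \<Rightarrow> (real^'n \<Rightarrow> complex) \<Rightarrow> (real^'n \<Rightarrow> complex) \<Rightarrow> complex" where
  "wip g v w = (LINT x|lborel. of_real (norm x powr g) * (v x * cnj (w x)))"

text \<open>The Dirichlet form with weight |x|^2, the weight being hidden in the two factors
  \<open>gr\<close>.\<close>

definition gip :: "(real^'n \<Rightarrow> complex) \<Rightarrow> (real^'n \<Rightarrow> complex) \<Rightarrow> complex" where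
  "gip v w = (\<Sum>i\<in>UNIV. LINT x|lborel. gr i v x * cnj (gr i w x))"

definition qform :: "real \<Rightarrow> real \<Rightarrow> (real^'n \<Rightarrow> complex) \<Rightarrow> (real^'n \<Rightarrow> complex) \<Rightarrow> complex" where
  "qform s l v w = of_real (1 / (2*l)) * gip v w + of_real (l / 2) * wip (2 * s) v w - of_real ((real CARD('n) + s) / 2) * wip s v w"

lemma integrable_wip:
  "g \<ge> 0 \<Longrightarrow> rapid v \<Longrightarrow> rapid w \<Longrightarrow> integrable lborel (\<lambda>x. of_real (norm x powr g) * (v x * cnj (w x)))"
  by (intro rapid_integrable rapid_powr rapid_mult_cnj)

lemma wip_add:
  assumes "g \<ge> 0" "rapid v" "rapid v'" "rapid w"
  shows "wip g (\<lambda>x. v x + v' x) w = wip g v w + wip g v' w"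
  unfolding wip_def
  using Bochner_Integration.integral_add[OF integrable_wip[OF assms(1,2,4)] integrable_wip[OF assms(1,3,4)]]
  by (simp add: algebra_simps)

lemma wip_scale: "wip g (\<lambda>x. c * v x) w = c * wip g v w"
  unfolding wip_def by (subst integral_mult_right_zero[symmetric]) (simp add: mult_ac)

lemma wip_cnj: "wip g w v = cnj (wip g v w)"
  unfolding wip_def by (subst lebesgue_integral_cnj[symmetric]) (simp add: mult_ac)

lemma wip_self: "wip g v v = of_real (LINT x|lborel. norm x powr g * (cmod (v x))\<^sup>2)"
proof -
  have "of_real (norm x powr g) * (v x * cnj (v x)) = complex_of_real (norm x powr g * (cmod (v x))\<^sup>2)" for x
    by (simp only: of_real_mult complex_norm_square)
  then show ?thesis unfolding wip_def by (simp only: integral_complex_of_real)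
qed

lemma wip_nonneg: "Re (wip g v v) \<ge> 0"
  by (simp add: wip_self)

lemma integrable_gip: "v \<in> form_domain \<Longrightarrow> w \<in> form_domain \<Longrightarrow> integrable lborel (\<lambda>x. gr i v x * cnj (gr i w x))"
  by (intro rapid_integrable rapid_mult_cnj form_domain_gr)

lemma gip_add:
  assumes "v \<in> form_domain" "v' \<in> form_domain" "w \<in> form_domain"
  shows "gip (\<lambda>x. v x + v' x) w = gip v w + gip v' w"
  unfolding gip_def sum.distrib[symmetric]
  by (intro sum.cong refl, subst Bochner_Integration.integral_add[symmetric])
     (auto intro: integrable_gip assms simp: algebra_simps form_domain_add(2)[OF assms(1,2)])

lemma gip_scale: "v \<in> form_domain \<Longrightarrow> gip (\<lambda>x. c * v x) w = c * gip v w"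
  unfolding gip_def form_domain_scale(2) sum_distrib_left
  by (intro sum.cong refl, subst integral_mult_right_zero[symmetric]) (simp add: mult_ac)

lemma gip_cnj: "gip w v = cnj (gip v w)"
  unfolding gip_def cnj_sum
  by (intro sum.cong refl, subst lebesgue_integral_cnj[symmetric]) (simp add: mult_ac)

lemma gip_self: "gip v v = of_real (\<Sum>i\<in>UNIV. LINT x|lborel. (cmod (gr i v x))\<^sup>2)"
  unfolding gip_def of_real_sum by (simp only: complex_norm_square[symmetric] integral_complex_of_real)

lemma qform_add:
  assumes "s \<ge> 0" "v \<in> form_domain" "v' \<in> form_domain" "w \<in> form_domain"
  shows "qform s l (\<lambda>x. v x + v' x) w = qform s l v w + qform s l v' w"
  using assms by (simp add: qform_def gip_add wip_add form_domain_rapid algebra_simps add_divide_distrib)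

lemma qform_scale: "v \<in> form_domain \<Longrightarrow> qform s l (\<lambda>x. c * v x) w = c * qform s l v w"
  by (simp add: qform_def gip_scale wip_scale algebra_simps)

lemma qform_cnj: "qform s l w v = cnj (qform s l v w)"
  by (simp add: qform_def gip_cnj[of w v] wip_cnj[of _ w v])

text \<open>Completing the square: the first order expressions \<open>A i\<close> vanish on the
  ground state exp (- l |x|^s / s), and the sum of their square norms is 2 l times the form. The
  mixed terms, integrated by parts, produce the constant (N + s) / 2.\<close>

lemma qform_nonneg:
  fixes v :: "real^'n \<Rightarrow> complex"
  assumes N: "CARD('n) \<ge> 2" and v: "v \<in> form_domain" and s: "s \<ge> 0" and l: "l > 0"
  shows "Re (qform s l v v) \<ge> 0"
proof -
  note rv = form_domain_rapid[OF v] form_domain_gr[OF v]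
  let ?p = "\<lambda>x. complex_of_real (norm x powr s)" and ?pp = "\<lambda>x. complex_of_real (norm x powr (2 * s))"
  define A where "A i x = gr i v x + of_real l * (?p x * (ucomp i x * v x))" for i x
  have pp: "?p x * ?p x = ?pp x" for x by (simp flip: of_real_mult powr_add)
  have expand: "A i x * cnj (A i x) = gr i v x * cnj (gr i v x) + of_real l * (?p x * (ucomp i x * (gr i v x * cnj (v x))) + ?p x * (ucomp i x * (v x * cnj (gr i v x))))
     + of_real (l\<^sup>2) * (?pp x * (ucomp i x * (ucomp i x * (v x * cnj (v x)))))" for i x
    unfolding A_def pp[symmetric] by (simp add: power2_eq_square algebra_simps)
  have i: "integrable lborel (\<lambda>x. gr i v x * cnj (gr i v x))" "integrable lborel (\<lambda>x. ?p x * (ucomp i x * (gr i v x * cnj (v x))))"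
    "integrable lborel (\<lambda>x. ?p x * (ucomp i x * (v x * cnj (gr i v x))))" "integrable lborel (\<lambda>x. ?pp x * (ucomp i x * (ucomp i x * (v x * cnj (v x)))))" for i
    using s by (intro rapid_integrable rapid_powr rapid_ucomp rapid_mult_cnj rv; simp)+
  have "(\<Sum>i\<in>UNIV. LINT x|lborel. A i x * cnj (A i x)) = gip v v + of_real l * ((\<Sum>i\<in>UNIV. LINT x|lborel. ?p x * (ucomp i x * (gr i v x * cnj (v x)))) + (\<Sum>i\<in>UNIV. LINT x|lborel. ?p x * (ucomp i x * (v x * cnj (gr i v x)))))
    + of_real (l\<^sup>2) * (\<Sum>i\<in>UNIV. LINT x|lborel. ?pp x * (ucomp i x * (ucomp i x * (v x * cnj (v x)))))"
    unfolding expand gip_def using i by (simp add: sum.distrib sum_distrib_left[symmetric] del: complex_cnj_mult)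
  also have "(\<Sum>i\<in>UNIV. LINT x|lborel. ?p x * (ucomp i x * (gr i v x * cnj (v x)))) = (LINT x|lborel. ?p x * (eul v x * cnj (v x)))"
    unfolding eul_def using i(2) by (subst Bochner_Integration.integral_sum[symmetric]) (auto simp: sum_distrib_left sum_distrib_right mult.assoc)
  also have "(\<Sum>i\<in>UNIV. LINT x|lborel. ?p x * (ucomp i x * (v x * cnj (gr i v x)))) = (LINT x|lborel. ?p x * (v x * cnj (eul v x)))"
    unfolding eul_def using i(3) by (subst Bochner_Integration.integral_sum[symmetric]) (auto simp: sum_distrib_left sum_distrib_right mult_ac)
  also have "(LINT x|lborel. ?p x * (eul v x * cnj (v x))) + (LINT x|lborel. ?p x * (v x * cnj (eul v x))) = - of_real (real CARD('n) + s) * wip s v v"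
    unfolding wip_def by (rule radial_integration_by_parts[OF N v v s])
  also have "(\<Sum>i\<in>UNIV. LINT x|lborel. ?pp x * (ucomp i x * (ucomp i x * (v x * cnj (v x))))) = wip (2 * s) v v"
    unfolding wip_def
  proof (subst Bochner_Integration.integral_sum[symmetric, OF i(4)], rule Bochner_Integration.integral_cong[OF refl])
    fix x :: "real^'n"
    have "(\<Sum>i\<in>UNIV. ?pp x * (ucomp i x * (ucomp i x * (v x * cnj (v x))))) = ?pp x * ((\<Sum>i\<in>UNIV. ucomp i x * ucomp i x) * (v x * cnj (v x)))"
      by (simp add: sum_distrib_left sum_distrib_right mult.assoc)
    then show "(\<Sum>i\<in>UNIV. ?pp x * (ucomp i x * (ucomp i x * (v x * cnj (v x))))) = ?pp x * (v x * cnj (v x))"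
      by (cases "x = 0") (simp_all add: sum_ucomp_square)
  qed
  finally have calc: "(\<Sum>i\<in>UNIV. LINT x|lborel. A i x * cnj (A i x)) =
     gip v v + of_real l * (- of_real (real CARD('n) + s) * wip s v v) + of_real (l\<^sup>2) * wip (2 * s) v v" .
  have "(\<Sum>i\<in>UNIV. LINT x|lborel. A i x * cnj (A i x)) = of_real (2 * l) * qform s l v v"
  proof -
    have "S = 2 * L * (1 / (2 * L) * G + L / 2 * W2 - C / 2 * W)" if "S = G + L * (- C * W) + L\<^sup>2 * W2" "L \<noteq> 0" for S G L C W W2 :: complex
      using that by (simp add: distrib_left right_diff_distrib power2_eq_square)
    from this[OF calc[unfolded of_real_power]] l show ?thesis
      by (simp add: qform_def)
  qed
  moreover have "(\<Sum>i\<in>UNIV. LINT x|lborel. A i x * cnj (A i x)) = of_real (\<Sum>i\<in>UNIV. LINT x|lborel. (cmod (A i x))\<^sup>2)"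
    unfolding of_real_sum by (simp only: complex_norm_square[symmetric] integral_complex_of_real)
  ultimately have "of_real (2 * l) * qform s l v v = of_real (\<Sum>i\<in>UNIV. LINT x|lborel. (cmod (A i x))\<^sup>2)" by simp
  then have "2 * l * Re (qform s l v v) = (\<Sum>i\<in>UNIV. LINT x|lborel. (cmod (A i x))\<^sup>2)"
    by (metis Re_complex_of_real Re_complex_of_real times_complex.sel(1) Im_complex_of_real mult_zero_left diff_zero)
  also have "\<dots> \<ge> 0" by (intro sum_nonneg) simp
  finally show ?thesis using l by (simp add: zero_le_mult_iff)
qed

text \<open>\<open>hess i j v\<close> is the \<open>j\<close>-th partial derivative of \<open>x \<mapsto> x\<^sub>i v(x)\<close>.\<close>

definition hess :: "'n \<Rightarrow> 'n \<Rightarrow> (real^'n \<Rightarrow> complex) \<Rightarrow> real^'n \<Rightarrow> complex" where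
  "hess i j v x = (if j = i then 1 else 0) * v x + ucomp i x * gr j v x"

lemma rapid_hess: "v \<in> form_domain \<Longrightarrow> rapid (hess i j v)"
  unfolding hess_def[abs_def] by (intro rapid_add rapid_ucomp rapid_scale form_domain_rapid form_domain_gr)

lemma has_partial_hess:
  assumes "v \<in> form_domain"
  shows "has_partial j (\<lambda>x. of_real (x $ i) * v x) (hess i j v)"
  by (rule has_partial_cong[OF has_partial_mult[OF has_partial_component form_domain_partial[OF assms]]])
     (auto simp: hess_def ucomp_def)

text \<open>Expanding the squares gives |x|^2 |grad v|^2 and the extra terms N |v|^2 + 2 Re (eul v
  cnj(v)), whose integral vanishes by radial integration by parts with exponent 0.\<close>

lemma hess_norm:
  fixes v :: "real^'n \<Rightarrow> complex"
  assumes N: "CARD('n) \<ge> 2" and v: "v \<in> form_domain"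
  shows "(\<Sum>i\<in>UNIV. \<Sum>j\<in>UNIV. LINT x|lborel. (cmod (hess i j v x))\<^sup>2) = Re (gip v v)"
proof -
  note rv = form_domain_rapid[OF v] form_domain_gr[OF v]
  let ?d = "\<lambda>i j. (if j = i then 1 else 0) :: complex"
  \<comment> \<open>The weight with exponent 0 is 1 except at the origin; it is kept so that the
    integration by parts applies literally.\<close>
  let ?p = "\<lambda>x. complex_of_real (norm x powr 0)"
  have p: "?p x = 1" if "x \<noteq> 0" for x :: "real^'n" using that by simp
  have "(\<Sum>i\<in>UNIV. \<Sum>j\<in>UNIV. LINT x|lborel. hess i j v x * cnj (hess i j v x)) = (LINT x|lborel. (\<Sum>i\<in>UNIV. \<Sum>j\<in>UNIV. hess i j v x * cnj (hess i j v x)))"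
    by (simp add: Bochner_Integration.integral_sum Bochner_Integration.integrable_sum rapid_integrable rapid_mult_cnj rapid_hess v del: complex_mult_cnj)
  also have "\<dots> = (LINT x|lborel. of_real (real CARD('n)) * (?p x * (v x * cnj (v x))) + (?p x * (eul v x * cnj (v x)) + ?p x * (v x * cnj (eul v x))) + (\<Sum>j\<in>UNIV. gr j v x * cnj (gr j v x)))"
  proof (rule integral_cong_AE)
    show "AE x in lborel. (\<Sum>i\<in>UNIV. \<Sum>j\<in>UNIV. hess i j v x * cnj (hess i j v x)) =
       of_real (real CARD('n)) * (?p x * (v x * cnj (v x))) + (?p x * (eul v x * cnj (v x)) + ?p x * (v x * cnj (eul v x))) + (\<Sum>j\<in>UNIV. gr j v x * cnj (gr j v x))"
      using AE_lborel_neq[of 0]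
    proof eventually_elim
      case (elim x)
      have "(\<Sum>i\<in>UNIV. \<Sum>j\<in>UNIV. hess i j v x * cnj (hess i j v x)) =
        (\<Sum>i\<in>UNIV. \<Sum>j\<in>UNIV. ?d i j * (v x * cnj (v x)) + ?d i j * (ucomp i x * gr j v x * cnj (v x) + v x * cnj (ucomp i x * gr j v x)) + ucomp i x * ucomp i x * (gr j v x * cnj (gr j v x)))"
        by (intro sum.cong refl) (simp add: hess_def algebra_simps)
      also have "\<dots> = (\<Sum>i\<in>UNIV. (v x * cnj (v x)) + (ucomp i x * gr i v x * cnj (v x) + v x * cnj (ucomp i x * gr i v x)) + ucomp i x * ucomp i x * (\<Sum>j\<in>UNIV. gr j v x * cnj (gr j v x)))"
        by (intro sum.cong refl) (simp add: sum.distrib sum_distrib_left if_distrib[of "\<lambda>c. c * _"] cong: if_cong del: complex_mult_cnj)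
      also have "\<dots> = of_nat CARD('n) * (v x * cnj (v x)) + (eul v x * cnj (v x) + v x * cnj (eul v x)) + (\<Sum>i\<in>UNIV. ucomp i x * ucomp i x) * (\<Sum>j\<in>UNIV. gr j v x * cnj (gr j v x))"
        by (simp add: sum.distrib eul_def sum_distrib_right[symmetric] sum_distrib_left[symmetric] cnj_sum del: complex_mult_cnj)
      finally show ?case using elim by (simp add: sum_ucomp_square p)
    qed
  qed (use rapid_measurable rapid_hess[OF v] rapid_eul[OF v] rv in \<open>measurable\<close>)
  also have "\<dots> = of_real (real CARD('n)) * wip 0 v v + ((LINT x|lborel. ?p x * (eul v x * cnj (v x))) + (LINT x|lborel. ?p x * (v x * cnj (eul v x)))) + gip v v"
  proof -
    have "integrable lborel (\<lambda>x. ?p x * (v x * cnj (v x)))" "integrable lborel (\<lambda>x. ?p x * (eul v x * cnj (v x)))"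
      "integrable lborel (\<lambda>x. ?p x * (v x * cnj (eul v x)))" "integrable lborel (\<lambda>x. gr j v x * cnj (gr j v x))" for j
      by (intro rapid_integrable rapid_powr rapid_mult_cnj rv rapid_eul v order_refl)+
    then show ?thesis by (simp add: wip_def gip_def Bochner_Integration.integral_sum Bochner_Integration.integrable_sum Bochner_Integration.integrable_add del: complex_mult_cnj powr_zero_eq_one)
  qed
  also have "(LINT x|lborel. ?p x * (eul v x * cnj (v x))) + (LINT x|lborel. ?p x * (v x * cnj (eul v x))) = - of_real (real CARD('n) + 0) * wip 0 v v"
    unfolding wip_def by (rule radial_integration_by_parts[OF N v v]) simp
  finally have "(\<Sum>i\<in>UNIV. \<Sum>j\<in>UNIV. LINT x|lborel. hess i j v x * cnj (hess i j v x)) = gip v v" by simp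
  then have "complex_of_real (\<Sum>i\<in>UNIV. \<Sum>j\<in>UNIV. LINT x|lborel. (cmod (hess i j v x))\<^sup>2) = gip v v"
    unfolding of_real_sum by (simp only: complex_norm_square[symmetric] integral_complex_of_real)
  then show ?thesis by (metis Re_complex_of_real)
qed

text \<open>Plancherel for each x_j times the i-th partial of \<open>u\<close>, whose transform is,
  up to sign, the j-th partial of \<xi>_i v. The two orders of multiplying and differentiating give
  the same total by \<open>hess_norm\<close>.\<close>

lemma weighted_gradient_identity:
  fixes u :: "real^'n \<Rightarrow> complex"
  assumes N: "CARD('n) \<ge> 2" and u: "u \<in> C0_infinity"
  shows "(LINT x|lborel. (norm x)\<^sup>2 * grad_norm_sq u x) = Re (gip (fourier_integral u) (fourier_integral u))"
proof -
  let ?v = "fourier_integral u"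
  have v: "?v \<in> form_domain" by (rule fourier_integral_form_domain[OF N u])
  let ?h = "\<lambda>i j x. of_real (x $ j) * partial_deriv i u x"
  have h: "?h i j \<in> C0_infinity" for i j by (intro C0_infinity_component C0_infinity_partial u)
  have t: "tame (?h i j)" for i j by (intro rapid_tame C0_infinity_rapid h)
  have "(norm x)\<^sup>2 * grad_norm_sq u x = (\<Sum>i\<in>UNIV. \<Sum>j\<in>UNIV. (cmod (?h i j x))\<^sup>2)" for x
    unfolding grad_norm_sq_def norm_vec_power2 sum_distrib_left sum_distrib_right
    by (simp add: norm_mult power_mult_distrib)
  then have "(LINT x|lborel. (norm x)\<^sup>2 * grad_norm_sq u x) = (\<Sum>i\<in>UNIV. \<Sum>j\<in>UNIV. LINT x|lborel. (cmod (?h i j x))\<^sup>2)"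
    by (simp add: Bochner_Integration.integral_sum Bochner_Integration.integrable_sum tame_square_integrable t)
  also have "\<dots> = (\<Sum>i\<in>UNIV. \<Sum>j\<in>UNIV. LINT x|lborel. (cmod (fourier_integral (?h i j) x))\<^sup>2)"
    by (simp only: plancherel(2)[OF t])
  also have "\<dots> = (\<Sum>i\<in>UNIV. \<Sum>j\<in>UNIV. LINT x|lborel. (cmod (hess i j ?v x))\<^sup>2)"
  proof (intro sum.cong refl integral_cong_AE)
    fix i j
    have "has_partial j (fourier_integral (partial_deriv i u)) (fourier_integral (\<lambda>x. - 2 * of_real pi * \<i> * (of_real (x $ j) * partial_deriv i u x)))"
      by (intro has_partial_fourier_integral C0_infinity_rapid C0_infinity_partial u)
    then have 1: "has_partial j (\<lambda>\<xi>. (2 * of_real pi * \<i>) * (of_real (\<xi> $ i) * ?v \<xi>)) (\<lambda>\<xi>. - 2 * of_real pi * \<i> * fourier_integral (?h i j) \<xi>)"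
      by (rule has_partial_cong) (simp add: fourier_partial_deriv[OF N u] mult.assoc, rule fourier_integral_cmult)
    have 2: "has_partial j (\<lambda>\<xi>. (2 * of_real pi * \<i>) * (of_real (\<xi> $ i) * ?v \<xi>)) (\<lambda>\<xi>. (2 * of_real pi * \<i>) * hess i j ?v \<xi>)"
      by (intro has_partial_cmult has_partial_hess v)
    \<comment> \<open>Both sides are, up to a factor, the j-th partial derivative of one function,
      and derivatives are unique.\<close>
    have eq: "fourier_integral (?h i j) \<xi> = - hess i j ?v \<xi>" if "\<xi> \<noteq> 0" for \<xi>
    proof -
      have cancel: "a = - b" if "- 2 * p * q * a = (2 * p * q) * b" "p \<noteq> 0" "q \<noteq> 0" for a b p q :: complex
      proof -
        have "2 * p * q * (a + b) = 0" using that(1) by algebra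
        then show ?thesis using that(2,3) by (simp add: eq_neg_iff_add_eq_0)
      qed
      show ?thesis by (rule cancel[OF has_partial_unique[OF 1 2 that]]) auto
    qed
    show "AE x in lborel. (cmod (fourier_integral (?h i j) x))\<^sup>2 = (cmod (hess i j ?v x))\<^sup>2"
      using AE_lborel_neq[of 0] by eventually_elim (simp add: eq)
    have "?v \<in> borel_measurable borel" "fourier_integral (?h i j) \<in> borel_measurable borel" "hess i j ?v \<in> borel_measurable borel"
      using rapid_measurable[OF rapid_hess[OF v]] measurable_fourier_integral[OF tame_integrable[OF t]] form_domain_rapid[OF v] by auto
    then show "(\<lambda>x. (cmod (fourier_integral (?h i j) x))\<^sup>2) \<in> borel_measurable lborel" "(\<lambda>x. (cmod (hess i j ?v x))\<^sup>2) \<in> borel_measurable lborel"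
      by measurable
  qed
  also have "\<dots> = Re (gip ?v ?v)" by (rule hess_norm[OF N v])
  finally show ?thesis .
qed

section \<open>Harmonic polynomials\<close>

text \<open>Complex polynomials with an induction rule along which partial derivatives can be
  computed. They coincide with the complex-valued instances of
  \<open>polynomial_function\<close>.\<close>

inductive_set cpoly :: "(real^'n \<Rightarrow> complex) set" where
  cpoly_const: "(\<lambda>x. c) \<in> cpoly"
| cpoly_component: "(\<lambda>x. of_real (x $ i)) \<in> cpoly"
| cpoly_add: "f \<in> cpoly \<Longrightarrow> g \<in> cpoly \<Longrightarrow> (\<lambda>x. f x + g x) \<in> cpoly"
| cpoly_mult: "f \<in> cpoly \<Longrightarrow> g \<in> cpoly \<Longrightarrow> (\<lambda>x. f x * g x) \<in> cpoly"

lemma cpoly_C_k: "p \<in> cpoly \<Longrightarrow> C_k k p"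
  by (induction rule: cpoly.induct) (auto intro: C_k_const C_k_component C_k_add C_k_mult)

lemma cpoly_differentiable: "p \<in> cpoly \<Longrightarrow> p differentiable (at x)"
  using cpoly_C_k[of p 1] by simp

lemma cpoly_continuous: "p \<in> cpoly \<Longrightarrow> continuous_on A p"
  using cpoly_C_k[of p 0] continuous_on_subset by force

lemma partial_deriv_const: "partial_deriv i (\<lambda>x::real^'n. c) = (\<lambda>x. 0)"
  by (intro ext) (simp add: partial_deriv_eq[OF has_derivative_const])

lemma partial_deriv_component: "partial_deriv i (\<lambda>x::real^'n. of_real (x $ j)) = (\<lambda>x. if i = j then 1 else 0)"
proof -
  have d: "((\<lambda>x::real^'n. complex_of_real (x $ j)) has_derivative (\<lambda>h. of_real (h $ j))) (at x)" for x
    by (auto intro!: derivative_eq_intros bounded_linear.has_derivative[OF bounded_linear_vec_nth])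
  show ?thesis by (rule ext) (simp add: partial_deriv_eq[OF d] axis_def)
qed

lemma cpoly_partial_deriv_add:
  "f \<in> cpoly \<Longrightarrow> g \<in> cpoly \<Longrightarrow> partial_deriv i (\<lambda>x. f x + g x) = (\<lambda>x. partial_deriv i f x + partial_deriv i g x)"
  by (intro ext partial_deriv_add cpoly_differentiable)

lemma cpoly_partial_deriv_mult:
  "f \<in> cpoly \<Longrightarrow> g \<in> cpoly \<Longrightarrow> partial_deriv i (\<lambda>x. f x * g x) = (\<lambda>x. f x * partial_deriv i g x + partial_deriv i f x * g x)"
  by (intro ext partial_deriv_mult cpoly_differentiable)

lemma cpoly_partial_deriv: "p \<in> cpoly \<Longrightarrow> partial_deriv i p \<in> cpoly"
  by (induction rule: cpoly.induct)
     (auto simp: partial_deriv_const partial_deriv_component cpoly_partial_deriv_add cpoly_partial_deriv_mult intro: cpoly.intros)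

lemma cpoly_partial_deriv_commute:
  "p \<in> cpoly \<Longrightarrow> partial_deriv i (partial_deriv j p) = partial_deriv j (partial_deriv i p)"
proof (induction rule: cpoly.induct)
  case (cpoly_mult f g)
  then show ?case
    by (simp add: cpoly_partial_deriv_mult cpoly_partial_deriv_add cpoly_partial_deriv cpoly.intros algebra_simps fun_eq_iff)
qed (auto simp: partial_deriv_const partial_deriv_component cpoly_partial_deriv_add cpoly_partial_deriv)

lemma cpoly_scale: "f \<in> cpoly \<Longrightarrow> (\<lambda>x. c * f x) \<in> cpoly"
  by (intro cpoly.intros)

lemma cpoly_diff: "f \<in> cpoly \<Longrightarrow> g \<in> cpoly \<Longrightarrow> (\<lambda>x. f x - g x) \<in> cpoly"
  using cpoly_add[of f "\<lambda>x. (-1) * g x"] cpoly_scale[of g "-1"] by simp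

lemma cpoly_sum: "(\<And>i. i \<in> I \<Longrightarrow> f i \<in> cpoly) \<Longrightarrow> (\<lambda>x. \<Sum>i\<in>I. f i x) \<in> cpoly"
  by (induction I rule: infinite_finite_induct) (auto intro: cpoly.intros)

lemma cpoly_power: "f \<in> cpoly \<Longrightarrow> (\<lambda>x. f x ^ k) \<in> cpoly"
  by (induction k) (auto intro: cpoly.intros)

lemma cpoly_cnj: "f \<in> cpoly \<Longrightarrow> (\<lambda>x. cnj (f x)) \<in> cpoly"
  by (induction rule: cpoly.induct) (auto intro: cpoly.intros)

lemma cpoly_partial_deriv_scale:
  "f \<in> cpoly \<Longrightarrow> partial_deriv i (\<lambda>x. c * f x) = (\<lambda>x. c * partial_deriv i f x)"
  by (simp add: cpoly_partial_deriv_mult cpoly_const partial_deriv_const)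

lemma cpoly_has_partial: "p \<in> cpoly \<Longrightarrow> has_partial i p (partial_deriv i p)"
  by (rule has_partial_partial_deriv[OF cpoly_differentiable])

lemma cpoly_partial_deriv_cnj:
  assumes "p \<in> cpoly"
  shows "partial_deriv i (\<lambda>x. cnj (p x)) = (\<lambda>x. cnj (partial_deriv i p x))"
proof
  fix x
  obtain p' where p': "(p has_derivative p') (at x)"
    using cpoly_differentiable[OF assms, of x] by (auto simp: differentiable_def)
  from bounded_linear.has_derivative[OF bounded_linear_cnj this]
  show "partial_deriv i (\<lambda>x. cnj (p x)) x = cnj (partial_deriv i p x)"
    by (simp add: partial_deriv_eq partial_deriv_eq[OF p'])
qed

lemma real_polynomial_function_cpoly:
  fixes f :: "real^'n \<Rightarrow> real"
  shows "real_polynomial_function f \<Longrightarrow> (\<lambda>x. of_real (f x)) \<in> cpoly"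
proof (induction rule: real_polynomial_function.induct)
  case (linear f)
  have "complex_of_real (f x) = (\<Sum>i\<in>UNIV. of_real (f (axis i 1)) * of_real (x $ i))" for x
  proof -
    have "f x = f (\<Sum>i\<in>UNIV. x $ i *\<^sub>R axis i 1)" by (simp add: basis_expansion flip: scalar_mult_eq_scaleR)
    also have "\<dots> = (\<Sum>i\<in>UNIV. x $ i *\<^sub>R f (axis i 1))"
      using bounded_linear.linear[OF linear] by (simp add: linear_sum linear_cmul)
    finally show ?thesis by (simp add: mult.commute)
  qed
  then have eq: "(\<lambda>x. \<Sum>i\<in>UNIV. of_real (f (axis i 1)) * of_real (x $ i)) = (\<lambda>x. complex_of_real (f x))" by metis
  have "(\<lambda>x. \<Sum>i\<in>UNIV. complex_of_real (f (axis i 1)) * of_real (x $ i)) \<in> cpoly"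
    by (intro cpoly_sum cpoly_scale cpoly_component)
  then show ?case by (rule back_subst[OF _ eq, where P="\<lambda>f. f \<in> cpoly"])
qed (auto intro: cpoly.intros)

lemma polynomial_function_cpoly:
  fixes p :: "real^'n \<Rightarrow> complex"
  assumes "polynomial_function p"
  shows "p \<in> cpoly"
proof -
  have "real_polynomial_function (\<lambda>x. Re (p x))" "real_polynomial_function (\<lambda>x. Im (p x))"
    using assms[unfolded polynomial_function_def o_def, rule_format, OF bounded_linear_Re]
      assms[unfolded polynomial_function_def o_def, rule_format, OF bounded_linear_Im] .
  then have "(\<lambda>x. of_real (Re (p x)) + \<i> * of_real (Im (p x))) \<in> cpoly"
    by (intro cpoly_add cpoly_scale real_polynomial_function_cpoly)
  then show ?thesis by (simp flip: complex_eq)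
qed

lemma cpoly_polynomial_function:
  fixes p :: "real^'n \<Rightarrow> complex"
  shows "p \<in> cpoly \<Longrightarrow> polynomial_function p"
proof (induction rule: cpoly.induct)
  case (cpoly_component i)
  have "real_polynomial_function (\<lambda>x::real^'n. x $ i)"
    by (rule real_polynomial_function.intros(1)) (rule bounded_linear_vec_nth)
  then show ?case
    by (simp add: polynomial_function_iff_Basis_inner Basis_complex_def inner_complex_def real_polynomial_function.intros(2))
next
  case (cpoly_mult f g)
  then have "real_polynomial_function (\<lambda>x. Re (f x))" "real_polynomial_function (\<lambda>x. Im (f x))"
     "real_polynomial_function (\<lambda>x. Re (g x))" "real_polynomial_function (\<lambda>x. Im (g x))"
    using cpoly_mult.IH[unfolded polynomial_function_def o_def, rule_format, OF bounded_linear_Re]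
      cpoly_mult.IH[unfolded polynomial_function_def o_def, rule_format, OF bounded_linear_Im] by auto
  then show ?case
    by (auto simp: polynomial_function_iff_Basis_inner Basis_complex_def inner_complex_def
      intro!: real_polynomial_function.intros(3,4) real_polynomial_function_diff)
qed auto

section \<open>Laplacian, homogeneity and Euler's identity\<close>

definition lap :: "(real^'n \<Rightarrow> complex) \<Rightarrow> real^'n \<Rightarrow> complex" where
  "lap p x = (\<Sum>i\<in>UNIV. partial_deriv i (partial_deriv i p) x)"

definition hom :: "nat \<Rightarrow> (real^'n \<Rightarrow> complex) \<Rightarrow> bool" where
  "hom k p \<longleftrightarrow> (\<forall>t x. p (t *\<^sub>R x) = of_real (t ^ k) * p x)"

lemma harmonic_iff: "harmonic_homogeneous_poly k p \<longleftrightarrow> p \<in> cpoly \<and> hom k p \<and> (\<forall>x. lap p x = 0)"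
  using cpoly_polynomial_function polynomial_function_cpoly
  unfolding harmonic_homogeneous_poly_def hom_def lap_def by blast

lemma homD: "hom k p \<Longrightarrow> p (t *\<^sub>R x) = of_real (t ^ k) * p x"
  by (simp add: hom_def)

lemma hom_0_const: 
  assumes "hom 0 p"
  shows "p = (\<lambda>x. p 0)"
proof
  show "p x = p 0" for x using homD[OF assms, of 0 x] by simp
qed

lemma hom_partial_deriv_0: "hom 0 p \<Longrightarrow> partial_deriv i p = (\<lambda>x. 0)"
  using hom_0_const[of p] partial_deriv_const[of i "p 0"] by metis

lemma cpoly_has_derivative:
  assumes "p \<in> cpoly"
  shows "(p has_derivative (\<lambda>h. \<Sum>i\<in>UNIV. of_real (h $ i) * partial_deriv i p x)) (at x)"
proof -
  obtain p' where p': "(p has_derivative p') (at x)"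
    using cpoly_differentiable[OF assms, of x] by (auto simp: differentiable_def)
  interpret bounded_linear p' using p' by (rule has_derivative_bounded_linear)
  have "p' h = (\<Sum>i\<in>UNIV. of_real (h $ i) * partial_deriv i p x)" for h
  proof -
    have "p' h = p' (\<Sum>i\<in>UNIV. h $ i *\<^sub>R axis i 1)" by (simp add: basis_expansion flip: scalar_mult_eq_scaleR)
    also have "\<dots> = (\<Sum>i\<in>UNIV. h $ i *\<^sub>R p' (axis i 1))" by (simp add: sum scaleR)
    finally show ?thesis by (simp add: partial_deriv_eq[OF p'] scaleR_conv_of_real)
  qed
  with p' show ?thesis by (metis (no_types, lifting) ext)
qed

lemma hom_partial_deriv:
  fixes p :: "real^'n \<Rightarrow> complex"
  assumes p: "p \<in> cpoly" and h: "hom (Suc k) p"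
  shows "hom k (partial_deriv i p)"
proof -
  have nz: "partial_deriv i p (t *\<^sub>R x) = of_real (t ^ k) * partial_deriv i p x" if "t \<noteq> 0" for t x
  proof -
    have "((\<lambda>y. p (t *\<^sub>R y)) has_derivative (\<lambda>h. \<Sum>i\<in>UNIV. of_real ((t *\<^sub>R h) $ i) * partial_deriv i p (t *\<^sub>R x))) (at x)"
      by (rule has_derivative_compose[OF _ cpoly_has_derivative[OF p], of _ "\<lambda>h. t *\<^sub>R h"]) (auto intro!: derivative_eq_intros)
    from partial_deriv_eq[OF this, of i]
    have "partial_deriv i (\<lambda>y. p (t *\<^sub>R y)) x = (\<Sum>j\<in>UNIV. of_real (axis i 1 $ j) * (of_real t * partial_deriv j p (t *\<^sub>R x)))"
      by (simp add: mult_ac)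
    also have "\<dots> = of_real t * partial_deriv i p (t *\<^sub>R x)" by (rule sum_axis)
    also have "(\<lambda>y. p (t *\<^sub>R y)) = (\<lambda>y. of_real (t ^ Suc k) * p y)" using homD[OF h] by blast
    finally have "of_real (t ^ Suc k) * partial_deriv i p x = of_real t * partial_deriv i p (t *\<^sub>R x)"
      by (simp only: cpoly_partial_deriv_scale[OF p])
    then show ?thesis using that by simp
  qed
  \<comment> \<open>At t = 0 the factor t cannot be cancelled; the limit along t = 1 / (n + 1)
    settles this case, including 0 ^ 0 = 1 for k = 0.\<close>
  have "partial_deriv i p (0 *\<^sub>R x) = of_real (0 ^ k) * partial_deriv i p x" for x
  proof (rule LIMSEQ_unique)
    let ?t = "\<lambda>n. inverse (real (Suc n))"
    have t: "?t \<longlonglongrightarrow> 0" by (rule LIMSEQ_inverse_real_of_nat)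
    have "continuous_on UNIV (partial_deriv i p)" by (intro cpoly_continuous cpoly_partial_deriv p)
    then have "isCont (partial_deriv i p) (0 *\<^sub>R x)" by (simp add: continuous_on_eq_continuous_at)
    moreover have "(\<lambda>n. ?t n *\<^sub>R x) \<longlonglongrightarrow> 0 *\<^sub>R x" by (intro tendsto_intros t)
    ultimately show "(\<lambda>n. partial_deriv i p (?t n *\<^sub>R x)) \<longlonglongrightarrow> partial_deriv i p (0 *\<^sub>R x)"
      by (rule isCont_tendsto_compose)
    have "(\<lambda>n. of_real (?t n ^ k) * partial_deriv i p x) \<longlonglongrightarrow> of_real (0 ^ k) * partial_deriv i p x"
      by (intro tendsto_intros t)
    then show "(\<lambda>n. partial_deriv i p (?t n *\<^sub>R x)) \<longlonglongrightarrow> of_real (0 ^ k) * partial_deriv i p x"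
      by (subst nz) auto
  qed
  with nz show ?thesis unfolding hom_def by metis
qed

lemma hom_mult: "hom k p \<Longrightarrow> hom l q \<Longrightarrow> hom (k + l) (\<lambda>x. p x * q x)"
  by (simp add: hom_def power_add)

lemma hom_component: "hom 1 (\<lambda>x. of_real (x $ i))"
  by (simp add: hom_def)

lemma hom_diff: "hom k p \<Longrightarrow> hom k q \<Longrightarrow> hom k (\<lambda>x. p x - q x)"
  by (simp add: hom_def algebra_simps)

lemma hom_scale: "hom k p \<Longrightarrow> hom k (\<lambda>x. c * p x)"
  by (simp add: hom_def algebra_simps)

lemma hom_cnj: "hom k p \<Longrightarrow> hom k (\<lambda>x. cnj (p x))"
  by (simp add: hom_def)

lemma hom_power: "hom 1 p \<Longrightarrow> hom k (\<lambda>x. p x ^ k)"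
  by (simp add: hom_def power_mult_distrib)

lemma hom_norm_square: "hom 2 (\<lambda>x::real^'n. of_real ((norm x)\<^sup>2))"
  unfolding hom_def norm_scaleR power_mult_distrib power2_abs of_real_mult by simp

text \<open>The derivative of t -> p (t x) at t = 1, computed by the chain rule and by
  homogeneity.\<close>

lemma euler_identity:
  fixes p :: "real^'n \<Rightarrow> complex"
  assumes p: "p \<in> cpoly" and h: "hom k p"
  shows "(\<Sum>i\<in>UNIV. of_real (x $ i) * partial_deriv i p x) = of_nat k * p x"
proof -
  have "((\<lambda>t. p (t *\<^sub>R x)) has_derivative (\<lambda>t. \<Sum>i\<in>UNIV. of_real ((t *\<^sub>R x) $ i) * partial_deriv i p (1 *\<^sub>R x))) (at 1)"
    by (rule has_derivative_compose[OF _ cpoly_has_derivative[OF p], of _ "\<lambda>t. t *\<^sub>R x"]) (auto intro!: derivative_eq_intros)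
  then have 1: "((\<lambda>t. p (t *\<^sub>R x)) has_vector_derivative (\<Sum>i\<in>UNIV. of_real (x $ i) * partial_deriv i p x)) (at 1)"
    by (simp add: has_vector_derivative_def scaleR_conv_of_real[where 'a=complex] sum_distrib_left mult.assoc)
  have "((\<lambda>t. of_real (t ^ k) * p x) has_vector_derivative of_real (real k * 1 ^ (k - 1)) * p x) (at 1)"
    by (intro has_vector_derivative_mult_left has_vector_derivative_of_real) (auto intro!: derivative_eq_intros)
  then have 2: "((\<lambda>t. p (t *\<^sub>R x)) has_vector_derivative of_nat k * p x) (at 1)"
    by (simp add: homD[OF h])
  from vector_derivative_unique_at[OF 1 2] show ?thesis .
qed

lemma cpoly_norm_square: "(\<lambda>x::real^'n. of_real ((norm x)\<^sup>2)) \<in> cpoly"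
  unfolding norm_vec_power2 of_real_sum by (simp add: cpoly_sum cpoly_power cpoly_component)

lemma cpoly_partial_deriv_sum:
  "(\<And>i. i \<in> I \<Longrightarrow> f i \<in> cpoly) \<Longrightarrow> partial_deriv j (\<lambda>x. \<Sum>i\<in>I. f i x) = (\<lambda>x. \<Sum>i\<in>I. partial_deriv j (f i) x)"
  by (induction I rule: infinite_finite_induct) (auto simp: partial_deriv_const cpoly_partial_deriv_add cpoly_sum)

lemma partial_deriv_norm_square: "partial_deriv j (\<lambda>x::real^'n. of_real ((norm x)\<^sup>2)) = (\<lambda>x. 2 * of_real (x $ j))"
proof -
  have sq: "(\<lambda>x::real^'n. complex_of_real ((norm x)\<^sup>2)) = (\<lambda>x. \<Sum>i\<in>UNIV. of_real (x $ i) * of_real (x $ i))"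
    by (simp only: norm_vec_power2) (simp only: power2_eq_square of_real_sum of_real_mult)
  have "(\<Sum>i\<in>UNIV. complex_of_real (x $ i) * (if j = i then 1 else 0) + (if j = i then 1 else 0) * of_real (x $ i)) =
     (\<Sum>i\<in>UNIV. if j = i then 2 * complex_of_real (x $ i) else 0)" for x :: "real^'n"
    by (intro sum.cong) auto
  then show ?thesis
    unfolding sq
    by (subst cpoly_partial_deriv_sum)
       (auto intro: cpoly.intros simp: cpoly_partial_deriv_mult cpoly_component partial_deriv_component)
qed

lemma lap_mult:
  assumes "f \<in> cpoly" "g \<in> cpoly"
  shows "lap (\<lambda>x. f x * g x) x = lap f x * g x + 2 * (\<Sum>i\<in>UNIV. partial_deriv i f x * partial_deriv i g x) + f x * lap g x"
proof -
  have "partial_deriv i (partial_deriv i (\<lambda>x. f x * g x)) x = partial_deriv i (partial_deriv i f) x * g x + 2 * (partial_deriv i f x * partial_deriv i g x) + f x * partial_deriv i (partial_deriv i g) x" for i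
    using assms by (simp add: cpoly_partial_deriv_mult cpoly_partial_deriv_add cpoly_partial_deriv cpoly.intros)
  then show ?thesis
    by (simp add: lap_def sum.distrib sum_distrib_left sum_distrib_right)
qed

lemma lap_diff:
  assumes "f \<in> cpoly" "g \<in> cpoly"
  shows "lap (\<lambda>x. f x - c * g x) x = lap f x - c * lap g x"
proof -
  have e: "(\<lambda>x. f x - c * g x) = (\<lambda>x. f x + (- c) * g x)" by simp
  have "partial_deriv i (partial_deriv i (\<lambda>x. f x + (- c) * g x)) x = partial_deriv i (partial_deriv i f) x + (- c) * partial_deriv i (partial_deriv i g) x" for i
    using assms by (simp only: cpoly_partial_deriv_add cpoly_partial_deriv_scale cpoly_scale cpoly_partial_deriv)
  then show ?thesis
    unfolding e by (simp add: lap_def sum_subtractf sum_distrib_left)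
qed

lemma lap_component: "lap (\<lambda>x. of_real (x $ i)) x = 0"
  by (simp add: lap_def partial_deriv_component partial_deriv_const)

lemma lap_norm_square: "lap (\<lambda>x::real^'n. of_real ((norm x)\<^sup>2)) x = 2 * of_nat CARD('n)"
  by (simp add: lap_def partial_deriv_norm_square cpoly_partial_deriv_scale cpoly_component partial_deriv_component del: of_real_power)

lemma lap_partial_deriv:
  assumes "p \<in> cpoly" "\<And>x. lap p x = 0"
  shows "lap (partial_deriv i p) x = 0"
proof -
  have "lap (partial_deriv i p) x = (\<Sum>j\<in>UNIV. partial_deriv i (partial_deriv j (partial_deriv j p)) x)"
    using assms(1) by (simp add: lap_def cpoly_partial_deriv_commute[of _ _ i] cpoly_partial_deriv)
  also have "\<dots> = partial_deriv i (\<lambda>x. \<Sum>j\<in>UNIV. partial_deriv j (partial_deriv j p) x) x"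
    using assms(1) by (simp add: cpoly_partial_deriv_sum cpoly_partial_deriv)
  also have "(\<lambda>x. \<Sum>j\<in>UNIV. partial_deriv j (partial_deriv j p) x) = (\<lambda>x. 0)"
    using assms(2) by (simp add: lap_def)
  finally show ?thesis by (simp add: partial_deriv_const)
qed

lemma harmonic_partial_deriv:
  assumes "harmonic_homogeneous_poly (Suc k) p"
  shows "harmonic_homogeneous_poly k (partial_deriv i p)"
  using assms unfolding harmonic_iff by (auto intro: cpoly_partial_deriv hom_partial_deriv lap_partial_deriv)

text \<open>With \<open>p\<close> of degree k + 1, the Laplacian of x_i p is twice the i-th partial
  of \<open>p\<close>, and the Laplacian of |x|^2 times this partial is 2 (N + 2k) times it. This
  dictates the constant \<open>c\<close>.\<close>

lemma harmonic_component_mult: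
  fixes p :: "real^'n \<Rightarrow> complex"
  assumes N: "CARD('n) \<ge> 2" and p: "harmonic_homogeneous_poly (Suc k) p"
  defines "c \<equiv> 1 / of_nat (CARD('n) + 2 * k)"
  shows "harmonic_homogeneous_poly (Suc (Suc k)) (\<lambda>x. of_real (x $ i) * p x - c * (of_real ((norm x)\<^sup>2) * partial_deriv i p x))"
  unfolding harmonic_iff
proof (intro conjI allI)
  have pc: "p \<in> cpoly" "hom (Suc k) p" "\<And>x. lap p x = 0" using p by (auto simp: harmonic_iff)
  have dp: "partial_deriv i p \<in> cpoly" "hom k (partial_deriv i p)" "\<And>x. lap (partial_deriv i p) x = 0"
    using pc by (auto intro: cpoly_partial_deriv hom_partial_deriv lap_partial_deriv)
  show "(\<lambda>x. of_real (x $ i) * p x - c * (of_real ((norm x)\<^sup>2) * partial_deriv i p x)) \<in> cpoly"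
    by (intro cpoly_diff cpoly_scale cpoly_mult cpoly_component cpoly_norm_square dp pc)
  show "hom (Suc (Suc k)) (\<lambda>x. of_real (x $ i) * p x - c * (of_real ((norm x)\<^sup>2) * partial_deriv i p x))"
    using hom_mult[OF hom_component pc(2)] hom_mult[OF hom_norm_square dp(2)] by (intro hom_diff hom_scale) auto
  fix x
  have 1: "lap (\<lambda>x. of_real (x $ i) * p x) x = 2 * partial_deriv i p x"
  proof -
    have "(\<Sum>j\<in>UNIV. (if j = i then 1 else 0) * partial_deriv j p x) = (\<Sum>j\<in>UNIV. if j = i then partial_deriv j p x else 0)"
      by (intro sum.cong) auto
    then show ?thesis
      by (simp add: lap_mult cpoly_component pc lap_component partial_deriv_component)
  qed
  have 2: "lap (\<lambda>x. of_real ((norm x)\<^sup>2) * partial_deriv i p x) x = 2 * of_nat (CARD('n) + 2 * k) * partial_deriv i p x"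
  proof -
    have "lap (\<lambda>x. of_real ((norm x)\<^sup>2) * partial_deriv i p x) x = 2 * of_nat CARD('n) * partial_deriv i p x + 4 * (\<Sum>j\<in>UNIV. of_real (x $ j) * partial_deriv j (partial_deriv i p) x)"
      by (subst lap_mult[OF cpoly_norm_square dp(1)])
         (simp add: lap_norm_square dp(3) partial_deriv_norm_square sum_distrib_left mult.assoc del: of_real_power)
    then show ?thesis by (simp add: euler_identity[OF dp(1,2)] algebra_simps)
  qed
  have "c * of_nat (CARD('n) + 2 * k) = 1" using N by (simp add: c_def del: of_nat_add)
  then show "lap (\<lambda>x. of_real (x $ i) * p x - c * (of_real ((norm x)\<^sup>2) * partial_deriv i p x)) x = 0"
    by (subst lap_diff) (auto intro: cpoly_mult cpoly_component cpoly_norm_square dp pc simp: 1 2 simp del: of_nat_add of_real_power)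
qed

lemma harmonic_component: "harmonic_homogeneous_poly 1 (\<lambda>x. of_real (x $ i))"
  unfolding harmonic_iff using hom_component cpoly_component lap_component by auto

lemma harmonic_const: "harmonic_homogeneous_poly 0 (\<lambda>x. c)"
  unfolding harmonic_iff by (auto simp: hom_def lap_def partial_deriv_const intro: cpoly.intros)

lemma harmonic_scale: "harmonic_homogeneous_poly k p \<Longrightarrow> harmonic_homogeneous_poly k (\<lambda>x. c * p x)"
  unfolding harmonic_iff by (auto simp: lap_def cpoly_partial_deriv_scale cpoly_partial_deriv simp flip: sum_distrib_left intro: cpoly_scale hom_scale)

lemma harmonic_cnj: "harmonic_homogeneous_poly k p \<Longrightarrow> harmonic_homogeneous_poly k (\<lambda>x. cnj (p x))"
  unfolding harmonic_iff by (auto simp: lap_def cpoly_partial_deriv_cnj cpoly_partial_deriv simp flip: cnj_sum intro: cpoly_cnj hom_cnj)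

text \<open>The gradient of z = x_a + i x_b is a constant vector whose bilinear square 1 + i^2 is 0,
  so every power of z is harmonic. This supplies a nonzero harmonic polynomial in each
  degree.\<close>

lemma harmonic_complex_power:
  assumes "a \<noteq> b"
  shows "harmonic_homogeneous_poly k (\<lambda>x. (of_real (x $ a) + \<i> * of_real (x $ b)) ^ k)"
proof -
  let ?z = "\<lambda>x. complex_of_real (x $ a) + \<i> * of_real (x $ b)"
  let ?c = "\<lambda>i. (if i = a then 1 else 0) + \<i> * (if i = b then 1 else 0) :: complex"
  have z: "?z \<in> cpoly" by (intro cpoly_add cpoly_scale cpoly_component)
  have dz: "partial_deriv i ?z = (\<lambda>x. ?c i)" for i
    by (simp add: cpoly_partial_deriv_add cpoly_partial_deriv_scale cpoly_component cpoly_scale partial_deriv_component)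
  have d: "partial_deriv i (\<lambda>x. ?z x ^ k) = (\<lambda>x. (of_nat k * ?c i) * ?z x ^ (k - 1))" for i k
  proof (induction k)
    case (Suc k)
    have "partial_deriv i (\<lambda>x. ?z x ^ Suc k) = (\<lambda>x. ?z x * partial_deriv i (\<lambda>x. ?z x ^ k) x + ?c i * ?z x ^ k)"
      using cpoly_partial_deriv_mult[OF z cpoly_power[OF z, of k], of i] by (simp only: power_Suc dz)
    also have "\<dots> = (\<lambda>x. (of_nat (Suc k) * ?c i) * ?z x ^ (Suc k - 1))"
      unfolding Suc.IH by (cases k) (auto simp: algebra_simps fun_eq_iff)
    finally show ?case .
  qed (simp add: partial_deriv_const)
  have dd: "partial_deriv i (partial_deriv i (\<lambda>x. ?z x ^ k)) = (\<lambda>x. of_nat k * (of_nat (k - 1) * ?z x ^ (k - 1 - 1)) * (?c i * ?c i))" for i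
    unfolding d[of _ k] by (subst cpoly_partial_deriv_scale[OF cpoly_power[OF z]]) (simp only: d, simp add: fun_eq_iff mult_ac)
  have "(\<Sum>i\<in>UNIV. ?c i * ?c i) = (\<Sum>i\<in>UNIV. (if i = a then 1 else 0) + (if i = b then -1 else 0))"
    using assms by (intro sum.cong) auto
  also have "\<dots> = 0" by (simp add: sum.distrib)
  finally have "lap (\<lambda>x. ?z x ^ k) x = 0" for x
    unfolding lap_def dd by (simp flip: sum_distrib_left)
  moreover have "hom k (\<lambda>x. ?z x ^ k)"
    by (rule hom_power) (simp add: hom_def algebra_simps)
  ultimately show ?thesis using cpoly_power[OF z] by (simp add: harmonic_iff)
qed

text \<open>Every polynomial is a sum of terms \<open>c(|x|) p(x)\<close> with \<open>p\<close> harmonic: multiplication by \<open>x\<^sub>i\<close>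
  maps \<open>p\<close> to a harmonic polynomial plus a multiple of \<open>|x|\<^sup>2 \<partial>\<^sub>i p\<close>.\<close>

inductive_set hspan :: "(real^'n \<Rightarrow> complex) set" where
  hspan_zero: "(\<lambda>x. 0) \<in> hspan"
| hspan_step: "f \<in> hspan \<Longrightarrow> continuous_on UNIV c \<Longrightarrow> harmonic_homogeneous_poly k p
    \<Longrightarrow> (\<lambda>x. c (norm x) * p x + f x) \<in> hspan"

lemma hspan_add: "f \<in> hspan \<Longrightarrow> g \<in> hspan \<Longrightarrow> (\<lambda>x. f x + g x) \<in> hspan"
proof (induction rule: hspan.induct)
  case (hspan_step f c k p)
  from hspan.hspan_step[OF hspan_step.IH[OF hspan_step.prems] hspan_step.hyps(2,3)]
  show ?case by (simp add: add.assoc)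
qed simp

lemma hspan_single: "continuous_on UNIV c \<Longrightarrow> harmonic_homogeneous_poly k p \<Longrightarrow> (\<lambda>x. c (norm x) * p x) \<in> hspan"
  using hspan_step[OF hspan_zero] by simp

lemma hspan_component:
  fixes f :: "real^'n \<Rightarrow> complex"
  assumes N: "CARD('n) \<ge> 2"
  shows "f \<in> hspan \<Longrightarrow> (\<lambda>x. of_real (x $ i) * f x) \<in> hspan"
proof (induction rule: hspan.induct)
  case (hspan_step f c k p)
  have "(\<lambda>x. of_real (x $ i) * (c (norm x) * p x)) \<in> hspan"
  proof (cases k)
    case 0
    then have "hom 0 p" using hspan_step.hyps(3) by (simp add: harmonic_iff)
    then have "p = (\<lambda>x. p 0)" by (rule hom_0_const)
    then have "(\<lambda>x. of_real (x $ i) * (c (norm x) * p x)) = (\<lambda>x. c (norm x) * (p 0 * of_real (x $ i)))"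
      by (metis (no_types) mult.commute mult.left_commute)
    then show ?thesis
      using hspan_single[OF hspan_step.hyps(2) harmonic_scale[OF harmonic_component]] by simp
  next
    case (Suc l)
    let ?a = "1 / of_nat (CARD('n) + 2 * l) :: complex"
    have h: "harmonic_homogeneous_poly (Suc l) p" using hspan_step.hyps(3) Suc by simp
    have 1: "(\<lambda>x. c (norm x) * (of_real (x $ i) * p x - ?a * (of_real ((norm x)\<^sup>2) * partial_deriv i p x))) \<in> hspan"
      by (rule hspan_single[OF hspan_step.hyps(2) harmonic_component_mult[OF N h]])
    \<comment> \<open>The factor |x|^2 is radial and moves into the coefficient, so the correction
      is a summand whose harmonic part has degree one less than \<open>p\<close>.\<close>
    have 2: "(\<lambda>x. (\<lambda>r. c r * (?a * of_real (r\<^sup>2))) (norm x) * partial_deriv i p x) \<in> hspan"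
      by (rule hspan_single[OF _ harmonic_partial_deriv[OF h]]) (intro continuous_intros hspan_step.hyps(2))
    from hspan_add[OF 1 2] show ?thesis
      by (rule back_subst[of "\<lambda>f. f \<in> hspan"]) (simp add: fun_eq_iff algebra_simps)
  qed
  from hspan_add[OF this hspan_step.IH] show ?case by (simp add: distrib_left)
qed (simp add: hspan_zero)

lemma hspan_scale: "f \<in> hspan \<Longrightarrow> (\<lambda>x. a * f x) \<in> hspan"
proof (induction rule: hspan.induct)
  case (hspan_step f c k p)
  from hspan.hspan_step[OF hspan_step.IH hspan_step.hyps(2) harmonic_scale[OF hspan_step.hyps(3)], of a]
  show ?case by (simp add: algebra_simps)
qed (simp add: hspan_zero)

text \<open>The induction is on multiplication operators: multiplying by \<open>p\<close> preserves
  the span. Applied to the constant 1 this gives \<open>p\<close> itself.\<close>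

lemma cpoly_hspan:
  fixes p :: "real^'n \<Rightarrow> complex"
  assumes N: "CARD('n) \<ge> 2" and p: "p \<in> cpoly"
  shows "p \<in> hspan"
proof -
  have "f \<in> hspan \<Longrightarrow> (\<lambda>x. p x * f x) \<in> hspan" for f
    using p
  proof (induction arbitrary: f rule: cpoly.induct)
    case (cpoly_add g h)
    then show ?case using hspan_add[of "\<lambda>x. g x * f x" "\<lambda>x. h x * f x"] by (simp add: distrib_right)
  next
    case (cpoly_mult g h)
    from cpoly_mult.IH(1)[OF cpoly_mult.IH(2)[OF cpoly_mult.prems]] show ?case by (simp add: mult.assoc)
  qed (auto intro: hspan_scale hspan_component[OF N])
  moreover have "(\<lambda>x. 1) \<in> hspan"
    using hspan_single[of "\<lambda>x. 1", OF _ harmonic_const[of 1]] by simp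
  ultimately show ?thesis by fastforce
qed

section \<open>Generators and the eigenvalue relation\<close>

definition wexp :: "real \<Rightarrow> real \<Rightarrow> real^'n \<Rightarrow> complex" where
  "wexp s l x = of_real (exp (- l * norm x powr s / s))"

text \<open>For \<open>p\<close> homogeneous of degree k the order at the origin is b + k. The
  exponent \<open>b\<close> alone may be negative, as it is for k >= 1 in the eigenfunctions, where
  b = D_k / 2 - k.\<close>

definition atom :: "real \<Rightarrow> real \<Rightarrow> real \<Rightarrow> (real^'n \<Rightarrow> complex) \<Rightarrow> real^'n \<Rightarrow> complex" where
  "atom s l b p x = of_real (norm x powr b) * (p x * wexp s l x)"

text \<open>The partial derivative off the origin, kept as a combination of atoms so that decay
  estimates and a second differentiation apply to it again.\<close>

definition atom_partial :: "real \<Rightarrow> real \<Rightarrow> real \<Rightarrow> 'n \<Rightarrow> (real^'n \<Rightarrow> complex) \<Rightarrow> real^'n \<Rightarrow> complex" where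
  "atom_partial s l b i p x = of_real b * atom s l (b - 2) (\<lambda>x. of_real (x $ i) * p x) x
     + atom s l b (partial_deriv i p) x
     - of_real l * atom s l (b + s - 2) (\<lambda>x. of_real (x $ i) * p x) x"

lemma sum_component_square: "(\<Sum>i\<in>UNIV. complex_of_real (x $ i) * of_real (x $ i)) = of_real ((norm x)\<^sup>2)"
  by (simp only: norm_vec_power2) (simp only: power2_eq_square of_real_sum of_real_mult)

lemma wexp_mult: "wexp s l x * wexp s l' x = wexp s (l + l') x"
proof -
  have "exp (- l * norm x powr s / s) * exp (- l' * norm x powr s / s) = exp (- (l + l') * norm x powr s / s)"
    by (simp add: algebra_simps diff_divide_distrib add_divide_distrib flip: exp_add)
  then show ?thesis by (simp only: wexp_def of_real_mult[symmetric])
qed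

lemma cnj_wexp [simp]: "cnj (wexp s l x) = wexp s l x"
  by (simp add: wexp_def)

lemma rapid_wexp:
  assumes s: "s > 0" and l: "l > 0"
  shows "rapid (wexp s l :: real^'n \<Rightarrow> complex)"
  unfolding rapid_def
proof (intro conjI allI)
  show "continuous_on (-{0}) (wexp s l :: real^'n \<Rightarrow> complex)"
    unfolding wexp_def[abs_def] using s by (intro continuous_intros) auto
  fix M :: nat
  \<comment> \<open>Chosen with M <= s n: for r > 1 this gives r^M <= (r^s)^n, and y^n <= n! e^y
    absorbs the power into the exponential.\<close>
  define n where "n = nat \<lceil>real M / s\<rceil>"
  have n: "real M \<le> s * real n"
  proof -
    have "real M / s \<le> real n" unfolding n_def by linarith
    then show ?thesis using s by (simp add: divide_le_eq mult.commute)
  qed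
  define C where "C = 2 ^ M * max 1 ((s / l) ^ n * fact n)"
  have "(1 + norm x) ^ M * cmod (wexp s l x) \<le> C" for x :: "real^'n"
  proof -
    let ?r = "norm x"
    define y where "y = l * ?r powr s / s"
    have y0: "y \<ge> 0" using s l by (simp add: y_def)
    have w: "cmod (wexp s l x) = exp (- y)" by (simp add: wexp_def y_def)
    show ?thesis
    proof (cases "?r \<le> 1")
      case True
      have "(1 + ?r) ^ M * exp (- y) \<le> 2 ^ M * 1"
        using True y0 by (intro mult_mono power_mono) auto
      also have "\<dots> \<le> C" unfolding C_def by (intro mult_left_mono) auto
      finally show ?thesis by (simp add: w)
    next
      case False
      have "?r ^ M = ?r powr (real M)" using False by (subst powr_realpow) auto
      also have "\<dots> \<le> ?r powr (s * real n)" using False n by (intro powr_mono) auto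
      also have "\<dots> = (?r powr s) ^ n" proof -
        have "?r powr s > 0" using False by auto
        then show ?thesis by (simp add: powr_powr[symmetric] powr_realpow)
      qed
      also have "\<dots> = (s / l) ^ n * y ^ n"
        using s l by (simp add: y_def power_mult_distrib[symmetric])
      also have "\<dots> \<le> (s / l) ^ n * (fact n * exp y)"
      proof (intro mult_left_mono)
        have "y ^ n / fact n \<le> exp y"
        proof -
          have "(\<Sum>k\<in>{n}. y ^ k /\<^sub>R fact k) \<le> (\<Sum>k. y ^ k /\<^sub>R fact k)"
            by (rule sum_le_suminf[OF summable_exp_generic]) (use y0 in auto)
          then show ?thesis by (simp add: exp_def divide_inverse mult.commute)
        qed
        then show "y ^ n \<le> fact n * exp y" by (simp add: divide_le_eq mult.commute)
      qed (use s l in auto)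
      finally have rM: "?r ^ M \<le> (s / l) ^ n * fact n * exp y" by simp
      have "(1 + ?r) ^ M \<le> (2 * ?r) ^ M" using False by (intro power_mono) auto
      also have "\<dots> = 2 ^ M * ?r ^ M" by (simp add: power_mult_distrib)
      also have "\<dots> \<le> 2 ^ M * ((s / l) ^ n * fact n * exp y)" using rM by simp
      finally have "(1 + ?r) ^ M * exp (- y) \<le> 2 ^ M * ((s / l) ^ n * fact n * exp y) * exp (- y)"
        by (rule mult_right_mono) simp
      also have "\<dots> = 2 ^ M * ((s / l) ^ n * fact n)" by (simp add: exp_minus)
      also have "\<dots> \<le> C" unfolding C_def by (intro mult_left_mono) auto
      finally show ?thesis by (simp add: w)
    qed
  qed
  then show "\<exists>C. \<forall>x::real^'n. (1 + norm x) ^ M * cmod (wexp s l x) \<le> C" by blast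
qed

lemma hom_bound:
  fixes p :: "real^'n \<Rightarrow> complex"
  assumes p: "p \<in> cpoly" and h: "hom k p"
  obtains C where "C \<ge> 0" "\<And>x. cmod (p x) \<le> C * norm x ^ k"
proof -
  have "compact (p ` sphere 0 1)"
    by (intro compact_continuous_image cpoly_continuous p) simp
  then obtain C where C: "\<And>x. norm x = 1 \<Longrightarrow> cmod (p x) \<le> C"
    using compact_imp_bounded by (fastforce simp: bounded_iff)
  have C0: "C \<ge> 0" using C[of "axis undefined 1"] norm_ge_zero order_trans by (metis norm_axis_1)
  have "cmod (p x) \<le> C * norm x ^ k" for x
  proof (cases "x = 0")
    case True
    have "p 0 = of_real (0 ^ k) * p (axis undefined 1)" using homD[OF h, of 0 "axis undefined 1"] by simp
    then have "cmod (p 0) = 0 ^ k * cmod (p (axis undefined 1))" by (simp add: norm_mult norm_power)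
    also have "\<dots> \<le> 0 ^ k * C" by (intro mult_left_mono C) auto
    finally show ?thesis using True by (simp add: mult.commute)
  next
    case False
    have "p x = p (norm x *\<^sub>R (x /\<^sub>R norm x))" using False by simp
    also have "\<dots> = of_real (norm x ^ k) * p (x /\<^sub>R norm x)" by (rule homD[OF h])
    finally have "cmod (p x) = norm x ^ k * cmod (p (x /\<^sub>R norm x))" by (simp add: norm_mult norm_power)
    also have "\<dots> \<le> norm x ^ k * C" by (intro mult_left_mono C) (use False in auto)
    finally show ?thesis by (simp add: mult.commute)
  qed
  with C0 show thesis using that by blast
qed

lemma rapid_atom:
  fixes p :: "real^'n \<Rightarrow> complex"
  assumes s: "s > 0" and l: "l > 0" and p: "p \<in> cpoly" and h: "hom k p" and b: "b + real k \<ge> 0"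
  shows "rapid (atom s l b p)"
proof -
  obtain C where C: "C \<ge> 0" "\<And>x. cmod (p x) \<le> C * norm x ^ k" using hom_bound[OF p h] by blast
  obtain K M where K: "\<And>x::real^'n. cmod (of_real (norm x powr (b + real k))) \<le> K * (1 + norm x) ^ M"
    using polygrowthE[OF polygrowth_powr[OF b]] by blast
  have "polygrowth (\<lambda>x. of_real (norm x powr b) * p x)"
  proof (rule polygrowthI[where C="C * K" and M=M])
    show "continuous_on (-{0}) (\<lambda>x. of_real (norm x powr b) * p x)"
      by (intro continuous_intros cpoly_continuous p) auto
    fix x :: "real^'n"
    have "cmod (of_real (norm x powr b) * p x) \<le> norm x powr b * (C * norm x ^ k)"
      by (simp add: norm_mult C mult_left_mono)
    also have "\<dots> = C * norm x powr (b + real k)"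
      by (cases "x = 0") (auto simp: powr_add powr_realpow)
    also have "\<dots> \<le> C * (K * (1 + norm x) ^ M)" using K[of x] C(1) by (intro mult_left_mono) auto
    finally show "cmod (of_real (norm x powr b) * p x) \<le> C * K * (1 + norm x) ^ M" by (simp add: mult.assoc)
  qed
  from rapid_mult_polygrowth[OF this rapid_wexp[OF s l]] show ?thesis
    by (rule rapid_cong) (simp add: atom_def mult.assoc)
qed

lemma has_partial_wexp:
  assumes s: "s > 0"
  shows "has_partial i (wexp s l :: real^'n \<Rightarrow> complex) (\<lambda>x. of_real (- l * norm x powr (s - 2) * x $ i) * wexp s l x)"
  unfolding has_partial_def
proof (intro allI impI)
  fix x :: "real^'n" assume x: "x \<noteq> 0"
  let ?y = "\<lambda>t. x + t *\<^sub>R axis i 1"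
  have "has_partial i (\<lambda>x. of_real (- l / s) * complex_of_real (norm x powr s)) (\<lambda>x. of_real (- l / s) * of_real (s * norm x powr (s - 2) * x $ i))"
    by (intro has_partial_cmult has_partial_norm_powr)
  then have "((\<lambda>t. of_real (- l / s) * complex_of_real (norm (?y t) powr s)) has_vector_derivative of_real (- l / s) * of_real (s * norm x powr (s - 2) * x $ i)) (at 0)"
    using x by (simp add: has_partial_def)
  moreover have "(exp has_field_derivative exp (of_real (- l / s) * complex_of_real (norm (?y 0) powr s))) (at (of_real (- l / s) * complex_of_real (norm (?y 0) powr s)))"
    by (rule DERIV_exp)
  ultimately have "((exp \<circ> (\<lambda>t. of_real (- l / s) * complex_of_real (norm (?y t) powr s))) has_vector_derivative
    of_real (- l / s) * of_real (s * norm x powr (s - 2) * x $ i) * exp (of_real (- l / s) * complex_of_real (norm (?y 0) powr s))) (at 0)"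
    by (rule field_vector_diff_chain_at)
  moreover have "exp (of_real (- l / s) * complex_of_real (norm y powr s)) = wexp s l y" for y :: "real^'n"
    unfolding wexp_def by (simp flip: exp_of_real)
  ultimately show "((\<lambda>t. wexp s l (?y t)) has_vector_derivative of_real (- l * norm x powr (s - 2) * x $ i) * wexp s l x) (at 0)"
    using s by (simp add: o_def mult.assoc)
qed

lemma has_partial_atom:
  assumes s: "s > 0" and p: "p \<in> cpoly"
  shows "has_partial i (atom s l b p) (atom_partial s l b i p)"
proof -
  have "has_partial i (\<lambda>x. of_real (norm x powr b) * (p x * wexp s l x))
    (\<lambda>x. of_real (b * norm x powr (b - 2) * x $ i) * (p x * wexp s l x) + of_real (norm x powr b) * (partial_deriv i p x * wexp s l x + p x * (of_real (- l * norm x powr (s - 2) * x $ i) * wexp s l x)))"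
    by (intro has_partial_mult has_partial_norm_powr cpoly_has_partial[OF p] has_partial_wexp[OF s])
  then show ?thesis
  proof (rule has_partial_cong)
    fix x :: "real^'a" assume "x \<noteq> 0"
    then have 1: "norm x powr (b + s - 2) = norm x powr b * norm x powr (s - 2)" by (simp flip: powr_add add: algebra_simps)
    show "of_real (b * norm x powr (b - 2) * x $ i) * (p x * wexp s l x) + of_real (norm x powr b) * (partial_deriv i p x * wexp s l x + p x * (of_real (- l * norm x powr (s - 2) * x $ i) * wexp s l x)) = atom_partial s l b i p x"
      unfolding atom_partial_def atom_def 1 by (simp add: algebra_simps)
  qed (simp add: atom_def)
qed

lemma atom_zero_poly: "atom s l b (\<lambda>x. 0) = (\<lambda>x. 0)"
  by (simp add: atom_def fun_eq_iff)

lemma rapid_atom_deriv: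
  fixes p :: "real^'n \<Rightarrow> complex"
  assumes "s > 0" "l > 0" "p \<in> cpoly" "hom k p" "b + real k \<ge> 1"
  shows "rapid (atom s l b (partial_deriv i p))"
proof (cases k)
  case 0
  then show ?thesis using assms by (simp add: hom_partial_deriv_0 atom_zero_poly)
next
  case (Suc m)
  then have "hom m (partial_deriv i p)" using assms hom_partial_deriv by blast
  then show ?thesis using assms Suc by (intro rapid_atom[where k=m] cpoly_partial_deriv) auto
qed

lemma hom_component_mult: "hom k p \<Longrightarrow> hom (Suc k) (\<lambda>x. of_real (x $ i) * p x)"
  using hom_mult[OF hom_component] by fastforce

lemma cpoly_component_mult: "p \<in> cpoly \<Longrightarrow> (\<lambda>x. of_real (x $ i) * p x) \<in> cpoly"
  by (intro cpoly.intros)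

lemma rapid_atom_partial:
  fixes p :: "real^'n \<Rightarrow> complex"
  assumes "s > 0" "l > 0" "p \<in> cpoly" "hom k p" "b + real k \<ge> 1"
  shows "rapid (atom_partial s l b i p)"
  unfolding atom_partial_def[abs_def] using assms
  by (intro rapid_diff rapid_add rapid_scale rapid_atom[where k="Suc k"] rapid_atom_deriv[where k=k] cpoly_component_mult hom_component_mult) auto

lemma integral_atom_partial:
  fixes p :: "real^'n \<Rightarrow> complex"
  assumes "CARD('n) \<ge> 2" "s > 0" "l > 0" "p \<in> cpoly" "hom k p" "b + real k \<ge> 1"
  shows "(LINT x|lborel. atom_partial s l b i p x) = 0"
  by (rule integral_partial_eq_0[OF assms(1) rapid_integrable[OF rapid_atom] rapid_integrable rapid_continuous has_partial_atom])
     (use assms rapid_atom_partial in auto)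

lemma norm_mult_atom: "of_real (norm x) * atom s l b p x = atom s l (b + 1) p x"
  by (cases "x = 0") (auto simp: atom_def powr_add)

lemma norm_powr_mult_atom: "of_real (norm x powr g) * atom s l b p x = atom s l (b + g) p x"
  by (cases "x = 0") (auto simp: atom_def powr_add)

lemma norm_mult_component_atom:
  "of_real (norm x) * atom s l (b - 2) (\<lambda>x. of_real (x $ i) * p x) x = ucomp i x * atom s l b p x"
proof (cases "x = 0")
  case False
  then have eq: "norm x powr (b - 2) = norm x powr b / (norm x * norm x)" by (simp add: powr_diff power2_eq_square)
  show ?thesis unfolding atom_def ucomp_def eq using False by (simp add: field_simps)
qed (simp add: atom_def)

lemma norm_mult_atom_partial:
  "of_real (norm x) * atom_partial s l b i p x =
     of_real b * (ucomp i x * atom s l b p x) + atom s l (b + 1) (partial_deriv i p) x - of_real l * (ucomp i x * atom s l (b + s) p x)"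
  unfolding atom_partial_def norm_mult_atom[symmetric] norm_mult_component_atom[symmetric] by (simp add: algebra_simps)

lemma atom_form_domain:
  fixes p :: "real^'n \<Rightarrow> complex"
  assumes s: "s > 0" and l: "l > 0" and p: "p \<in> cpoly" and h: "hom k p" and b: "b + real k \<ge> 0"
  shows "atom s l b p \<in> form_domain"
proof (rule form_domainI[OF rapid_atom[OF assms] has_partial_atom[OF s p]])
  show "rapid (\<lambda>x. of_real (norm x) * atom_partial s l b i p x)" for i
    unfolding norm_mult_atom_partial using assms
    by (intro rapid_diff rapid_add rapid_scale rapid_ucomp rapid_atom[where k=k] rapid_atom_deriv[where k=k]) auto
qed

lemma gr_atom:
  assumes "s > 0" "p \<in> cpoly"
  shows "gr i (atom s l b p) x = of_real (norm x) * atom_partial s l b i p x"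
  by (rule gr_eq[OF has_partial_atom[OF assms]])

text \<open>In terms of a = b + k this is a (N + a) - c_k, the indicial polynomial of the operator
  div (|x|^2 grad) on |x|^a times a spherical harmonic of degree k.\<close>

definition eigen_defect :: "nat \<Rightarrow> nat \<Rightarrow> real \<Rightarrow> real" where
  "eigen_defect N k b = b * b + b * (real N + real k) + (b + 2) * real k"

text \<open>In the weighted space, \<open>atom s l b p\<close> is an eigenfunction up to a multiple of
  \<open>|x|\<^sup>-\<^sup>s\<close> times itself, and an eigenfunction if \<open>b + k\<close> solves the indicial equation.\<close>

lemma qform_atom:
  fixes p :: "real^'n \<Rightarrow> complex"
  assumes N: "CARD('n) \<ge> 2" and s: "s > 0" and l: "l > 0" and p: "harmonic_homogeneous_poly k p"
    and b: "b + real k \<ge> 0" and v: "v \<in> form_domain"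
  shows "qform s l v (atom s l b p) = of_real (b + real k) * wip s v (atom s l b p)
     - of_real (eigen_defect CARD('n) k b / (2 * l)) * (LINT x|lborel. v x * cnj (atom s l b p x))"
proof -
  have pc: "p \<in> cpoly" "hom k p" "\<And>x. lap p x = 0" using p by (auto simp: harmonic_iff)
  let ?e = "atom s l b p"
  have e: "?e \<in> form_domain" by (rule atom_form_domain[OF s l pc(1,2) b])
  note rv = form_domain_rapid[OF v] form_domain_gr[OF v] and re = form_domain_rapid[OF e] form_domain_gr[OF e]
  let ?xp = "\<lambda>i x. of_real (x $ i) * p x"
  have xp: "?xp i \<in> cpoly" "hom (Suc k) (?xp i)" for i
    by (intro cpoly_component_mult pc, intro hom_component_mult pc)
  have dp: "partial_deriv i p \<in> cpoly" for i by (intro cpoly_partial_deriv pc)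
  \<comment> \<open>\<open>W i\<close> is |x|^2 times the i-th partial of the atom, expressed by
    atoms of positive order; \<open>D i\<close> is its i-th partial, so the \<open>D i\<close> add
    up to div (|x|^2 grad) of the atom.\<close>
  define W where "W i x = of_real b * atom s l b (?xp i) x + atom s l (b + 2) (partial_deriv i p) x - of_real l * atom s l (b + s) (?xp i) x" for i x
  define D where "D i x = of_real b * atom_partial s l b i (?xp i) x + atom_partial s l (b + 2) i (partial_deriv i p) x - of_real l * atom_partial s l (b + s) i (?xp i) x" for i x
  have W: "rapid (W i)" for i
    unfolding W_def[abs_def]
    using s l b by (intro rapid_diff rapid_add rapid_scale rapid_atom[where k="Suc k"] rapid_atom_deriv[where k=k] xp pc) auto
  have dD: "rapid (atom_partial s l (b + 2) i (partial_deriv i p))" for i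
  proof (cases k)
    case 0
    then have "partial_deriv i p = (\<lambda>x. 0)" using pc hom_partial_deriv_0 by blast
    then show ?thesis by (simp add: atom_partial_def[abs_def] atom_zero_poly partial_deriv_const)
  next
    case (Suc m)
    then show ?thesis using s l b pc by (intro rapid_atom_partial[where k=m] dp hom_partial_deriv) auto
  qed
  have D: "rapid (D i)" for i
    unfolding D_def[abs_def]
    using s l b by (intro rapid_diff rapid_add rapid_scale rapid_atom_partial[where k="Suc k"] dD xp) auto
  have WD: "has_partial i (W i) (D i)" for i
    unfolding W_def[abs_def] D_def[abs_def]
    by (intro has_partial_diff has_partial_add has_partial_cmult has_partial_atom s xp dp)
  have Wgr: "W i x = of_real (norm x) * gr i ?e x" for i x
  proof (cases "x = 0")
    case False
    have "norm x powr (u - 2) * (norm x)\<^sup>2 = norm x powr u" "norm x powr (u + 2) = norm x powr u * (norm x)\<^sup>2" for u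
      using False by (auto simp: powr_diff powr_add)
    from this(1)[of b, symmetric] this(2)[of b] this(1)[of "b + s", symmetric] have "atom s l b (?xp i) x = (of_real (norm x))\<^sup>2 * atom s l (b - 2) (?xp i) x"
      "atom s l (b + 2) (partial_deriv i p) x = (of_real (norm x))\<^sup>2 * atom s l b (partial_deriv i p) x"
      "atom s l (b + s) (?xp i) x = (of_real (norm x))\<^sup>2 * atom s l (b + s - 2) (?xp i) x"
      unfolding atom_def by (simp_all only: of_real_mult of_real_power mult_ac)
    then have "W i x = (of_real (norm x))\<^sup>2 * atom_partial s l b i p x"
      unfolding W_def atom_partial_def by (simp add: algebra_simps)
    then show ?thesis by (simp add: gr_atom[OF s pc(1)] power2_eq_square mult.assoc)
  qed (simp add: W_def atom_def)
  have ibp: "(LINT x|lborel. gr i v x * cnj (gr i ?e x)) = - (LINT x|lborel. v x * cnj (D i x))" for i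
  proof -
    have int: "integrable lborel (\<lambda>x. gr i v x * cnj (gr i ?e x))" "integrable lborel (\<lambda>x. v x * cnj (D i x))"
      by (intro rapid_integrable rapid_mult_cnj rv re D)+
    have "(LINT x|lborel. gr i v x * cnj (gr i ?e x) + v x * cnj (D i x)) = 0"
    proof (rule integral_partial_eq_0[OF N])
      show "integrable lborel (\<lambda>x. v x * cnj (W i x))" by (intro rapid_integrable rapid_mult_cnj rv W)
      show "integrable lborel (\<lambda>x. gr i v x * cnj (gr i ?e x) + v x * cnj (D i x))" using int by simp
      show "continuous_on (-{0}) (\<lambda>x. gr i v x * cnj (gr i ?e x) + v x * cnj (D i x))"
        by (intro rapid_continuous rapid_add rapid_mult_cnj rv re D)
      have "has_partial i (\<lambda>x. v x * cnj (W i x)) (\<lambda>x. gr i v x / of_real (norm x) * cnj (W i x) + v x * cnj (D i x))"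
        by (intro has_partial_mult has_partial_cnj form_domain_partial v WD)
      then show "has_partial i (\<lambda>x. v x * cnj (W i x)) (\<lambda>x. gr i v x * cnj (gr i ?e x) + v x * cnj (D i x))"
        by (rule has_partial_cong) (auto simp: Wgr)
    qed
    then show ?thesis using int by (simp add: eq_neg_iff_add_eq_0)
  qed
  let ?k = "eigen_defect CARD('n) k b"
  \<comment> \<open>Three orders in |x|: the indicial term, a term in |x|^s from which the
    eigenvalue arises, and a term in |x|^(2s) that cancels the potential in the form.\<close>
  have sumD: "(\<Sum>i\<in>UNIV. D i x) = of_real ?k * ?e x - of_real (l * (2 * b + 2 * real k + s + real CARD('n))) * (of_real (norm x powr s) * ?e x)
     + of_real (l\<^sup>2) * (of_real (norm x powr (2 * s)) * ?e x)" for x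
  proof (cases "x = 0")
    case False
    let ?r = "norm x"
    define R where "R = complex_of_real (?r powr b)"
    define S where "S = complex_of_real (?r powr s)"
    have pm: "?r powr (u - 2) = ?r powr u / ?r\<^sup>2" "?r powr (u + 2) = ?r powr u * ?r\<^sup>2" "?r powr (u + s) = ?r powr u * ?r powr s" for u
      using False by (auto simp: powr_diff powr_add)
    have pw: "complex_of_real (?r powr (b - 2)) = R / of_real (?r\<^sup>2)" "complex_of_real (?r powr (b + 2)) = R * of_real (?r\<^sup>2)"
      "complex_of_real (?r powr (b + s - 2)) = R * S / of_real (?r\<^sup>2)" "complex_of_real (?r powr (b + s)) = R * S"
      "complex_of_real (?r powr (b + s + s - 2)) = R * S * S / of_real (?r\<^sup>2)" "complex_of_real (?r powr (2 * s)) = S * S"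
      "b + 2 - 2 = b" "b + 2 + s - 2 = b + s"
      by (simp_all only: R_def S_def pm mult_2 of_real_mult of_real_divide)
    have "?r \<noteq> 0" using False by simp
    have dxp: "partial_deriv i (?xp i) x = p x + of_real (x $ i) * partial_deriv i p x" for i
      using cpoly_partial_deriv_mult[OF cpoly_component pc(1)] by (simp add: partial_deriv_component)
    define A where "A i = complex_of_real (x $ i) * of_real (x $ i)" for i
    define B where "B i = complex_of_real (x $ i) * partial_deriv i p x" for i
    define C where "C i = partial_deriv i (partial_deriv i p) x" for i
    have A: "(\<Sum>i\<in>UNIV. A i) = of_real (?r\<^sup>2)" unfolding A_def by (rule sum_component_square)
    have B: "(\<Sum>i\<in>UNIV. B i) = of_nat k * p x" unfolding B_def by (rule euler_identity[OF pc(1,2)])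
    have C: "(\<Sum>i\<in>UNIV. C i) = 0" using pc(3)[of x] by (simp add: C_def lap_def)
    define E where "E = wexp s l x"
    have Di: "D i x = (of_real b * R * E) * (of_real b / of_real (?r\<^sup>2) * A i * p x + (p x + B i) - of_real l * S / of_real (?r\<^sup>2) * A i * p x)
       + (R * E) * (of_real (b + 2) * B i + of_real (?r\<^sup>2) * C i - of_real l * S * B i)
       - (of_real l * R * S * E) * (of_real (b + s) / of_real (?r\<^sup>2) * A i * p x + (p x + B i) - of_real l * S / of_real (?r\<^sup>2) * A i * p x)" for i
      unfolding D_def atom_partial_def atom_def pw R_def[symmetric] E_def[symmetric] dxp A_def B_def C_def
      by (simp add: algebra_simps)
    have "(\<Sum>i\<in>UNIV. D i x) = (of_real b * R * E) * (of_real b / of_real (?r\<^sup>2) * (\<Sum>i\<in>UNIV. A i) * p x + (of_nat CARD('n) * p x + (\<Sum>i\<in>UNIV. B i)) - of_real l * S / of_real (?r\<^sup>2) * (\<Sum>i\<in>UNIV. A i) * p x)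
       + (R * E) * (of_real (b + 2) * (\<Sum>i\<in>UNIV. B i) + of_real (?r\<^sup>2) * (\<Sum>i\<in>UNIV. C i) - of_real l * S * (\<Sum>i\<in>UNIV. B i))
       - (of_real l * R * S * E) * (of_real (b + s) / of_real (?r\<^sup>2) * (\<Sum>i\<in>UNIV. A i) * p x + (of_nat CARD('n) * p x + (\<Sum>i\<in>UNIV. B i)) - of_real l * S / of_real (?r\<^sup>2) * (\<Sum>i\<in>UNIV. A i) * p x)"
      unfolding Di by (simp only: sum.distrib sum_subtractf sum_distrib_left[symmetric] sum_distrib_right[symmetric] sum_constant)
    also have "\<dots> = (of_real b * R * E) * (of_real b * p x + (of_nat CARD('n) * p x + of_nat k * p x) - of_real l * S * p x)
       + (R * E) * (of_real (b + 2) * (of_nat k * p x) - of_real l * S * (of_nat k * p x))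
       - (of_real l * R * S * E) * (of_real (b + s) * p x + (of_nat CARD('n) * p x + of_nat k * p x) - of_real l * S * p x)"
      unfolding A B C using \<open>?r \<noteq> 0\<close> by simp
    also have "\<dots> = of_real ?k * ?e x - of_real (l * (2 * b + 2 * real k + s + real CARD('n))) * (of_real (norm x powr s) * ?e x)
     + of_real (l\<^sup>2) * (of_real (norm x powr (2 * s)) * ?e x)"
      unfolding atom_def pw R_def[symmetric] S_def[symmetric] E_def[symmetric] eigen_defect_def
      by (simp add: algebra_simps power2_eq_square)
    finally show ?thesis .
  qed (simp add: D_def atom_partial_def atom_def)
  have cint: "integrable lborel (\<lambda>x. v x * cnj (?e x))" by (intro rapid_integrable rapid_mult_cnj rv re)
  have wint: "integrable lborel (\<lambda>x. of_real (norm x powr s) * (v x * cnj (?e x)))" "integrable lborel (\<lambda>x. of_real (norm x powr (2 * s)) * (v x * cnj (?e x)))"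
    using s by (intro integrable_wip rv re; simp)+
  let ?c = "l * (2 * b + 2 * real k + s + real CARD('n))"
  have "gip v ?e = - (LINT x|lborel. (\<Sum>i\<in>UNIV. v x * cnj (D i x)))"
    unfolding gip_def ibp by (subst Bochner_Integration.integral_sum) (auto intro: rapid_integrable rapid_mult_cnj rv D simp: sum_negf)
  also have "(LINT x|lborel. (\<Sum>i\<in>UNIV. v x * cnj (D i x))) = (LINT x|lborel. of_real ?k * (v x * cnj (?e x)) - of_real ?c * (of_real (norm x powr s) * (v x * cnj (?e x))) + of_real (l\<^sup>2) * (of_real (norm x powr (2 * s)) * (v x * cnj (?e x))))"
  proof (rule Bochner_Integration.integral_cong[OF refl])
    fix x
    have "(\<Sum>i\<in>UNIV. v x * cnj (D i x)) = v x * cnj (\<Sum>i\<in>UNIV. D i x)" by (simp add: sum_distrib_left)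
    then show "(\<Sum>i\<in>UNIV. v x * cnj (D i x)) = of_real ?k * (v x * cnj (?e x)) - of_real ?c * (of_real (norm x powr s) * (v x * cnj (?e x))) + of_real (l\<^sup>2) * (of_real (norm x powr (2 * s)) * (v x * cnj (?e x)))"
      unfolding sumD by (simp only: complex_cnj_add complex_cnj_diff complex_cnj_mult complex_cnj_complex_of_real) (simp only: ring_distribs mult_ac)
  qed
  also have "\<dots> = of_real ?k * (LINT x|lborel. v x * cnj (?e x)) - of_real ?c * wip s v ?e + of_real (l\<^sup>2) * wip (2 * s) v ?e"
    unfolding wip_def using cint wint by (simp del: of_real_mult of_real_power)
  finally have g: "gip v ?e = - (of_real ?k * (LINT x|lborel. v x * cnj (?e x)) - of_real ?c * wip s v ?e + of_real (l\<^sup>2) * wip (2 * s) v ?e)" .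
  have alg: "1 / (2 * L) * (- (K * J - L * (2 * B + 2 * k + S + N) * W + L\<^sup>2 * W2)) + L / 2 * W2 - (N + S) / 2 * W = (B + k) * W - K / (2 * L) * J"
    if "L \<noteq> 0" for L K J B k S N W W2 :: complex
    using that by (simp add: field_simps power2_eq_square)
  show ?thesis
    unfolding qform_def g using alg[of "of_real l" "of_real ?k" _ "of_real b" "of_nat k" "of_real s" "of_nat CARD('n)"] l by simp
qed

lemma hom_mult_partial:
  assumes "q \<in> cpoly" "hom k p" "hom l q" "k + l = Suc M"
  shows "hom M (\<lambda>x. p x * partial_deriv i q x)"
proof (cases l)
  case 0
  then show ?thesis using assms hom_partial_deriv_0[of q i] by (simp add: hom_def)
next
  case (Suc m)
  then have "hom m (partial_deriv i q)" "M = k + m" using assms hom_partial_deriv by auto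
  then show ?thesis using hom_mult[OF assms(2)] by blast
qed

text \<open>Green's identity on the whole space for the field |x|^(g+2) (p grad q - q grad p) + (k -
  j) |x|^g x p q, times the exponential. The second part cancels what the derivatives of the radial
  factors leave of the first, and the divergence is (k - j) (N + k + j - 2) times the
  integrand.\<close>

lemma harmonic_orthogonal:
  fixes p q :: "real^'n \<Rightarrow> complex"
  assumes N: "CARD('n) \<ge> 2" and s: "s > 0" and l: "l > 0"
    and hp: "harmonic_homogeneous_poly k p" and hq: "harmonic_homogeneous_poly j q" and kj: "k \<noteq> j"
    and g: "g + real k + real j \<ge> 0"
  shows "(LINT x|lborel. atom s l g (\<lambda>x. p x * q x) x) = 0"
proof -
  have p: "p \<in> cpoly" "hom k p" "\<And>x. lap p x = 0" and q: "q \<in> cpoly" "hom j q" "\<And>x. lap q x = 0"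
    using hp hq by (auto simp: harmonic_iff)
  have "k + j \<noteq> 0" using kj by arith
  then obtain M where M: "k + j = Suc M" using not0_implies_Suc by blast
  then have rM: "real k + real j = 1 + real M" by linarith
  let ?P = "\<lambda>i x. p x * partial_deriv i q x - q x * partial_deriv i p x"
  let ?X = "\<lambda>i x. of_real (x $ i) * (p x * q x)"
  have P: "?P i \<in> cpoly" "hom M (?P i)" for i
  proof -
    show "?P i \<in> cpoly" by (intro cpoly_diff cpoly_mult cpoly_partial_deriv p q)
    have "j + k = Suc M" using M by simp
    then show "hom M (?P i)"
      by (intro hom_diff hom_mult_partial[OF q(1) p(2) q(2) M] hom_mult_partial[OF p(1) q(2) p(2)])
  qed
  have X: "?X i \<in> cpoly" "hom (Suc (k + j)) (?X i)" for i
    by (intro cpoly_component_mult cpoly_mult p q, intro hom_component_mult hom_mult p q)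
  define c where "c = complex_of_real (real k - real j)"
  define F where "F i x = atom_partial s l (g + 2) i (?P i) x + c * atom_partial s l g i (?X i) x" for i x
  have i: "integrable lborel (atom_partial s l (g + 2) i (?P i))" "integrable lborel (atom_partial s l g i (?X i))" for i
    using s l g M rM by (intro rapid_integrable rapid_atom_partial[OF _ _ P] rapid_atom_partial[OF _ _ X]; simp)+
  have z: "(LINT x|lborel. atom_partial s l (g + 2) i (?P i) x) = 0" "(LINT x|lborel. atom_partial s l g i (?X i) x) = 0" for i
    using s l g M rM by (intro integral_atom_partial[OF N _ _ P] integral_atom_partial[OF N _ _ X]; simp)+
  have Fi: "integrable lborel (F i)" for i unfolding F_def using i by simp
  have "(LINT x|lborel. F i x) = 0" for i
    unfolding F_def using i[of i] z[of i] by simp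
  then have "0 = (\<Sum>i\<in>UNIV. LINT x|lborel. F i x)" by simp
  also have "\<dots> = (LINT x|lborel. (\<Sum>i\<in>UNIV. F i x))" by (rule Bochner_Integration.integral_sum[symmetric, OF Fi])
  also have "\<dots> = (LINT x|lborel. (c * of_real (real CARD('n) + real k + real j - 2)) * atom s l g (\<lambda>x. p x * q x) x)"
  proof (rule Bochner_Integration.integral_cong[OF refl])
    fix x :: "real^'n"
    show "(\<Sum>i\<in>UNIV. F i x) = (c * of_real (real CARD('n) + real k + real j - 2)) * atom s l g (\<lambda>x. p x * q x) x"
    proof (cases "x = 0")
      case False
      let ?r = "norm x"
      define R where "R = complex_of_real (?r powr g)"
      define S where "S = complex_of_real (?r powr s)"
      have pm: "?r powr (u - 2) = ?r powr u / ?r\<^sup>2" "?r powr (u + 2) = ?r powr u * ?r\<^sup>2" "?r powr (u + s) = ?r powr u * ?r powr s" for u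
        using False by (auto simp: powr_diff powr_add)
      have pw: "complex_of_real (?r powr (g - 2)) = R / of_real (?r\<^sup>2)" "complex_of_real (?r powr (g + 2)) = R * of_real (?r\<^sup>2)"
        "complex_of_real (?r powr (g + s - 2)) = R * S / of_real (?r\<^sup>2)" "complex_of_real (?r powr (g + s)) = R * S"
        "g + 2 - 2 = g" "g + 2 + s - 2 = g + s"
        by (simp_all only: R_def S_def pm mult_2 of_real_mult of_real_divide)
      have "?r \<noteq> 0" using False by simp
      have dP: "partial_deriv i (?P i) x = p x * partial_deriv i (partial_deriv i q) x - q x * partial_deriv i (partial_deriv i p) x" for i
      proof -
        have e: "?P i = (\<lambda>x. p x * partial_deriv i q x + (-1) * (q x * partial_deriv i p x))" by simp
        have "partial_deriv i (?P i) = (\<lambda>x. (p x * partial_deriv i (partial_deriv i q) x + partial_deriv i p x * partial_deriv i q x)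
           + (-1) * (q x * partial_deriv i (partial_deriv i p) x + partial_deriv i q x * partial_deriv i p x))"
          unfolding e using p q
          by (simp only: cpoly_partial_deriv_add cpoly_partial_deriv_scale cpoly_partial_deriv_mult cpoly_partial_deriv cpoly_mult cpoly_scale)
        then show ?thesis by simp
      qed
      have dX: "partial_deriv i (?X i) x = p x * q x + of_real (x $ i) * (p x * partial_deriv i q x + partial_deriv i p x * q x)" for i
        using cpoly_partial_deriv_mult[OF cpoly_component cpoly_mult[OF p(1) q(1)]] cpoly_partial_deriv_mult[OF p(1) q(1)]
        by (simp add: partial_deriv_component)
      define A where "A i = complex_of_real (x $ i) * of_real (x $ i)" for i
      define B where "B i = complex_of_real (x $ i) * partial_deriv i p x" for i
      define B' where "B' i = complex_of_real (x $ i) * partial_deriv i q x" for i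
      define C where "C i = partial_deriv i (partial_deriv i p) x" for i
      define C' where "C' i = partial_deriv i (partial_deriv i q) x" for i
      have A: "(\<Sum>i\<in>UNIV. A i) = of_real (?r\<^sup>2)" unfolding A_def by (rule sum_component_square)
      have B: "(\<Sum>i\<in>UNIV. B i) = of_nat k * p x" "(\<Sum>i\<in>UNIV. B' i) = of_nat j * q x"
        unfolding B_def B'_def by (rule euler_identity p q)+
      have C: "(\<Sum>i\<in>UNIV. C i) = 0" "(\<Sum>i\<in>UNIV. C' i) = 0" using p(3)[of x] q(3)[of x] by (simp_all add: C_def C'_def lap_def)
      define E where "E = wexp s l x"
      have Fi: "F i x = R * E * (of_real (g + 2) * (p x * B' i - q x * B i) + of_real (?r\<^sup>2) * (p x * C' i - q x * C i) - of_real l * S * (p x * B' i - q x * B i))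
        + c * R * E * (of_real g / of_real (?r\<^sup>2) * A i * (p x * q x) + (p x * q x + (p x * B' i + q x * B i)) - of_real l * S / of_real (?r\<^sup>2) * A i * (p x * q x))" for i
        unfolding F_def atom_partial_def atom_def pw R_def[symmetric] E_def[symmetric] dP dX A_def B_def C_def B'_def C'_def
        by (simp add: algebra_simps)
      have "(\<Sum>i\<in>UNIV. F i x) = R * E * (of_real (g + 2) * (p x * (\<Sum>i\<in>UNIV. B' i) - q x * (\<Sum>i\<in>UNIV. B i)) + of_real (?r\<^sup>2) * (p x * (\<Sum>i\<in>UNIV. C' i) - q x * (\<Sum>i\<in>UNIV. C i)) - of_real l * S * (p x * (\<Sum>i\<in>UNIV. B' i) - q x * (\<Sum>i\<in>UNIV. B i)))
        + c * R * E * (of_real g / of_real (?r\<^sup>2) * (\<Sum>i\<in>UNIV. A i) * (p x * q x) + (of_nat CARD('n) * (p x * q x) + (p x * (\<Sum>i\<in>UNIV. B' i) + q x * (\<Sum>i\<in>UNIV. B i))) - of_real l * S / of_real (?r\<^sup>2) * (\<Sum>i\<in>UNIV. A i) * (p x * q x))"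
        unfolding Fi by (simp only: sum.distrib sum_subtractf sum_distrib_left[symmetric] sum_distrib_right[symmetric] sum_constant)
          (simp only: mult.left_commute[of "p x" "of_nat CARD('n)"])
      also have "\<dots> = R * E * (of_real (g + 2) * (- c * (p x * q x)) - of_real l * S * (- c * (p x * q x)))
        + c * R * E * (of_real g * (p x * q x) + (of_nat CARD('n) * (p x * q x) + (of_nat j + of_nat k) * (p x * q x)) - of_real l * S * (p x * q x))"
        unfolding A B C using \<open>?r \<noteq> 0\<close> by (simp add: c_def algebra_simps)
      also have "\<dots> = (c * of_real (real CARD('n) + real k + real j - 2)) * atom s l g (\<lambda>x. p x * q x) x"
        unfolding atom_def R_def[symmetric] E_def[symmetric] by (simp add: algebra_simps)
      finally show ?thesis .
    qed (simp add: F_def atom_partial_def atom_def)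
  qed
  also have "\<dots> = (c * of_real (real CARD('n) + real k + real j - 2)) * (LINT x|lborel. atom s l g (\<lambda>x. p x * q x) x)"
    by (rule integral_mult_right_zero)
  finally have "(c * of_real (real CARD('n) + real k + real j - 2)) * (LINT x|lborel. atom s l g (\<lambda>x. p x * q x) x) = 0" by simp
  moreover have "c \<noteq> 0" using kj by (simp add: c_def)
  moreover have "complex_of_real (real CARD('n) + real k + real j - 2) \<noteq> 0"
    using N \<open>k + j \<noteq> 0\<close> by (simp only: of_real_eq_0_iff)
  ultimately show ?thesis by simp
qed

section \<open>Hermitian forms and spectral stability\<close>

inductive_set cspan :: "('a \<Rightarrow> complex) set \<Rightarrow> ('a \<Rightarrow> complex) set" for E where
  cspan_zero: "(\<lambda>x. 0) \<in> cspan E"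
| cspan_step: "w \<in> cspan E \<Longrightarrow> e \<in> E \<Longrightarrow> (\<lambda>x. c * e x + w x) \<in> cspan E"

lemma cspan_add: "v \<in> cspan E \<Longrightarrow> w \<in> cspan E \<Longrightarrow> (\<lambda>x. v x + w x) \<in> cspan E"
proof (induction rule: cspan.induct)
  case (cspan_step v e c)
  from cspan.cspan_step[OF cspan_step.IH[OF cspan_step.prems] cspan_step.hyps(2), of c]
  show ?case by (simp add: add.assoc)
qed simp

lemma cspan_scale: "v \<in> cspan E \<Longrightarrow> (\<lambda>x. a * v x) \<in> cspan E"
proof (induction rule: cspan.induct)
  case (cspan_step v e c)
  from cspan.cspan_step[OF cspan_step.IH cspan_step.hyps(2), of "a * c"]
  show ?case by (simp add: distrib_left mult.assoc)
qed (simp add: cspan_zero)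

lemma cspan_base: "e \<in> E \<Longrightarrow> e \<in> cspan E"
  using cspan_step[OF cspan_zero, of e E 1] by simp

lemma cspan_diff: "v \<in> cspan E \<Longrightarrow> w \<in> cspan E \<Longrightarrow> (\<lambda>x. v x - w x) \<in> cspan E"
  using cspan_add[of v E "\<lambda>x. (-1) * w x"] cspan_scale[of w E "-1"] by simp

lemma cspan_sum: "(\<And>i. i \<in> I \<Longrightarrow> f i \<in> cspan E) \<Longrightarrow> (\<lambda>x. \<Sum>i\<in>I. f i x) \<in> cspan E"
  by (induction I rule: infinite_finite_induct) (auto intro: cspan_zero cspan_add)

lemma cspan_trans: "v \<in> cspan E \<Longrightarrow> E \<subseteq> cspan F \<Longrightarrow> v \<in> cspan F"
  by (induction rule: cspan.induct) (auto intro!: cspan_zero cspan_add cspan_scale)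

lemma cspan_mono: "v \<in> cspan E \<Longrightarrow> E \<subseteq> F \<Longrightarrow> v \<in> cspan F"
  using cspan_trans cspan_base by blast

lemma cspan_finite: "v \<in> cspan E \<Longrightarrow> \<exists>F. finite F \<and> F \<subseteq> E \<and> v \<in> cspan F"
proof (induction rule: cspan.induct)
  case (cspan_step v e c)
  then obtain F where "finite F" "F \<subseteq> E" "v \<in> cspan F" by blast
  then have "(\<lambda>x. c * e x + v x) \<in> cspan (insert e F)"
    by (intro cspan.cspan_step) (auto intro: cspan_mono)
  with \<open>finite F\<close> \<open>F \<subseteq> E\<close> cspan_step.hyps(2) show ?case by (intro exI[of _ "insert e F"]) auto
qed (auto intro: cspan_zero)

text \<open>Only semidefinite: the weighted product ignores the value at the origin, and the
  quadratic form vanishes on the ground state.\<close>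

locale hermitian_form =
  fixes V :: "('a \<Rightarrow> complex) set" and B :: "('a \<Rightarrow> complex) \<Rightarrow> ('a \<Rightarrow> complex) \<Rightarrow> complex"
  assumes V_zero: "(\<lambda>x. 0) \<in> V"
    and V_add: "v \<in> V \<Longrightarrow> w \<in> V \<Longrightarrow> (\<lambda>x. v x + w x) \<in> V"
    and V_scale: "v \<in> V \<Longrightarrow> (\<lambda>x. c * v x) \<in> V"
    and B_add: "v \<in> V \<Longrightarrow> w \<in> V \<Longrightarrow> u \<in> V \<Longrightarrow> B (\<lambda>x. v x + w x) u = B v u + B w u"
    and B_scale: "v \<in> V \<Longrightarrow> u \<in> V \<Longrightarrow> B (\<lambda>x. c * v x) u = c * B v u"
    and B_cnj: "v \<in> V \<Longrightarrow> u \<in> V \<Longrightarrow> B u v = cnj (B v u)"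
    and B_nonneg: "v \<in> V \<Longrightarrow> 0 \<le> Re (B v v)"
begin

lemma V_diff: "v \<in> V \<Longrightarrow> w \<in> V \<Longrightarrow> (\<lambda>x. v x - w x) \<in> V"
  using V_add[of v "\<lambda>x. (-1) * w x"] V_scale[of w "-1"] by simp

lemma V_sum: "(\<And>i. i \<in> I \<Longrightarrow> f i \<in> V) \<Longrightarrow> (\<lambda>x. \<Sum>i\<in>I. f i x) \<in> V"
  by (induction I rule: infinite_finite_induct) (auto intro: V_zero V_add)

lemma cspan_V: "v \<in> cspan E \<Longrightarrow> E \<subseteq> V \<Longrightarrow> v \<in> V"
  by (induction rule: cspan.induct) (auto intro!: V_zero V_add V_scale)

lemma B_zero: "u \<in> V \<Longrightarrow> B (\<lambda>x. 0) u = 0"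
  using B_scale[OF V_zero, of u 0] by simp

lemma B_diff: "v \<in> V \<Longrightarrow> w \<in> V \<Longrightarrow> u \<in> V \<Longrightarrow> B (\<lambda>x. v x - w x) u = B v u - B w u"
  using B_add[of v "\<lambda>x. (-1) * w x" u] B_scale[of w u "-1"] V_scale[of w "-1"] by simp

lemma B_add_right: "v \<in> V \<Longrightarrow> w \<in> V \<Longrightarrow> u \<in> V \<Longrightarrow> B u (\<lambda>x. v x + w x) = B u v + B u w"
  using B_add[of v w u] B_cnj[of u] V_add by (metis complex_cnj_add complex_cnj_cnj)

lemma B_scale_right: "v \<in> V \<Longrightarrow> u \<in> V \<Longrightarrow> B u (\<lambda>x. c * v x) = cnj c * B u v"
  using B_scale[of v u c] B_cnj[of u] V_scale by (metis complex_cnj_mult complex_cnj_cnj)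

lemma B_diff_right: "v \<in> V \<Longrightarrow> w \<in> V \<Longrightarrow> u \<in> V \<Longrightarrow> B u (\<lambda>x. v x - w x) = B u v - B u w"
  using B_diff[of v w u] B_cnj[of u] V_diff by (metis complex_cnj_diff complex_cnj_cnj)

lemma B_zero_right: "u \<in> V \<Longrightarrow> B u (\<lambda>x. 0) = 0"
  using B_zero[of u] B_cnj[OF V_zero, of u] by simp

lemma B_real: "v \<in> V \<Longrightarrow> B v v = of_real (Re (B v v))"
  using B_cnj[of v v] by (simp add: complex_eq_iff)

lemma B_self_diff:
  assumes "v \<in> V" "w \<in> V"
  shows "Re (B (\<lambda>x. v x - w x) (\<lambda>x. v x - w x)) = Re (B v v) - 2 * Re (B v w) + Re (B w w)"
proof -
  have "B (\<lambda>x. v x - w x) (\<lambda>x. v x - w x) = B v v - B v w - (B w v - B w w)"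
    using assms by (simp add: B_diff B_diff_right V_diff)
  moreover have "Re (B w v) = Re (B v w)" using B_cnj[OF assms] by simp
  ultimately show ?thesis by simp
qed

lemma B_orth_cspan: "w \<in> cspan E \<Longrightarrow> E \<subseteq> V \<Longrightarrow> v \<in> V \<Longrightarrow> (\<And>e. e \<in> E \<Longrightarrow> B v e = 0) \<Longrightarrow> B v w = 0"
proof (induction rule: cspan.induct)
  case (cspan_step w e c)
  then have "e \<in> V" "w \<in> V" using cspan_V by blast+
  with cspan_step show ?case by (simp add: B_add_right B_scale_right V_scale)
qed (simp add: B_zero_right)

text \<open>The degenerate case of the Cauchy-Schwarz inequality: along a null vector the expansion
  of the square norm is affine, so a nonzero mixed term would make it negative.\<close>

lemma B_null:
  assumes r: "r \<in> V" "Re (B r r) = 0" and v: "v \<in> V"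
  shows "B v r = 0"
proof (rule ccontr)
  assume "B v r \<noteq> 0"
  let ?q = "(cmod (B v r))\<^sup>2"
  have q: "?q > 0" using \<open>B v r \<noteq> 0\<close> by simp
  \<comment> \<open>Makes the expansion below equal to - 1.\<close>
  define t where "t = (Re (B v v) + 1) / (2 * ?q)"
  define w where "w = (\<lambda>x. (of_real t * B v r) * r x)"
  have w: "w \<in> V" unfolding w_def by (intro V_scale r)
  have "B v w = cnj (of_real t * B v r) * B v r"
    unfolding w_def by (rule B_scale_right[OF r(1) v])
  also have "\<dots> = of_real (t * ?q)"
    by (simp only: of_real_mult complex_norm_square) (simp add: mult_ac)
  finally have Bvw: "B v w = of_real (t * ?q)" .
  have "B r r = 0" using B_real[OF r(1)] r(2) by simp
  then have Bww: "B w w = 0"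
    using r w unfolding w_def by (simp add: B_scale_right B_scale V_scale)
  have "0 \<le> Re (B (\<lambda>x. v x - w x) (\<lambda>x. v x - w x))" by (intro B_nonneg V_diff v w)
  also have "\<dots> = Re (B v v) - 2 * (t * ?q)"
    using B_self_diff[OF v w] by (simp add: Bvw Bww)
  also have "\<dots> = - 1"
  proof -
    have "2 * (t * ?q) = Re (B v v) + 1" using q by (simp add: t_def)
    then show ?thesis by linarith
  qed
  finally show False by simp
qed

text \<open>Gram-Schmidt by induction over \<open>F\<close>, for all \<open>v\<close> at once
  because the new vector \<open>e\<close> has to be projected too.\<close>

lemma projection_exists:
  assumes "finite F" "F \<subseteq> V" "v \<in> V"
  shows "\<exists>w \<in> cspan F. \<forall>e\<in>F. B (\<lambda>x. v x - w x) e = 0"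
  using assms
proof (induction F arbitrary: v rule: finite_induct)
  case empty
  show ?case by (rule bexI[OF _ cspan_zero]) simp
next
  case (insert e F)
  then have F: "F \<subseteq> V" and e: "e \<in> V" by auto
  obtain w0 where w0: "w0 \<in> cspan F" "\<And>f. f \<in> F \<Longrightarrow> B (\<lambda>x. v x - w0 x) f = 0"
    using insert.IH[OF F insert.prems(2)] by blast
  obtain z where z: "z \<in> cspan F" "\<And>f. f \<in> F \<Longrightarrow> B (\<lambda>x. e x - z x) f = 0"
    using insert.IH[OF F e] by blast
  have V: "w0 \<in> V" "z \<in> V" using cspan_V w0 z F by blast+
  define r where "r = (\<lambda>x. e x - z x)"
  have r: "r \<in> V" unfolding r_def by (intro V_diff V e)
  have e_eq: "e = (\<lambda>x. z x + r x)" by (simp add: r_def)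
  \<comment> \<open>If the residual \<open>r\<close> of \<open>e\<close> is a null vector,
    everything is orthogonal to it and the coefficient 0 will do.\<close>
  define c where "c = (if Re (B r r) = 0 then 0 else B v r / B r r)"
  define w where "w = (\<lambda>x. c * r x + w0 x)"
  have w: "w \<in> V" unfolding w_def by (intro V_add V_scale r V)
  have orthF: "B (\<lambda>x. v x - w x) f = 0" if "f \<in> F" for f
  proof -
    have f: "f \<in> V" using that F by auto
    have "(\<lambda>x. v x - w x) = (\<lambda>x. (v x - w0 x) - c * r x)" by (simp add: w_def algebra_simps)
    then have "B (\<lambda>x. v x - w x) f = B (\<lambda>x. v x - w0 x) f - c * B r f"
      using insert.prems(2) V r f by (simp add: B_diff B_scale V_diff V_scale)
    then show ?thesis using w0(2)[OF that] z(2)[OF that] by (simp add: r_def)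
  qed
  have vw: "(\<lambda>x. v x - w x) \<in> V" by (intro V_diff w insert.prems)
  have "B (\<lambda>x. v x - w x) r = 0"
  proof (cases "Re (B r r) = 0")
    case True
    then show ?thesis using B_null[OF r _ vw] by simp
  next
    case False
    have "B r w0 = 0"
      by (rule B_orth_cspan[OF w0(1) F r]) (use z(2) in \<open>simp add: r_def\<close>)
    then have "B w0 r = 0" using B_cnj[OF r V(1)] by simp
    then have "B w r = c * B r r"
      unfolding w_def using B_add[OF V_scale[OF r] V(1) r] B_scale[OF r r] by simp
    also have "\<dots> = B v r" using False by (auto simp: c_def)
    finally have "B w r = B v r" .
    then show ?thesis using insert.prems(2) w r by (simp add: B_diff)
  qed
  moreover have "B (\<lambda>x. v x - w x) z = 0"
    by (rule B_orth_cspan[OF z(1) F vw orthF])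
  ultimately have "B (\<lambda>x. v x - w x) e = 0"
    using vw V r by (subst e_eq) (simp add: B_add_right)
  moreover have "w \<in> cspan (insert e F)"
  proof -
    have "r \<in> cspan (insert e F)"
      unfolding r_def by (intro cspan_diff cspan_base cspan_mono[OF z(1)]) auto
    then show ?thesis
      unfolding w_def by (intro cspan_add cspan_scale cspan_mono[OF w0(1)]) auto
  qed
  ultimately show ?case using orthF by blast
qed

end

section \<open>Common eigenvectors of two forms\<close>

locale form_pair = B: hermitian_form V B + Q: hermitian_form V Q
  for V :: "('a \<Rightarrow> complex) set" and B Q
begin

text \<open>The weak formulation with a real eigenvalue. The zero function is allowed, which spares
  case distinctions for projections that vanish.\<close>

definition eigvec :: "real \<Rightarrow> ('a \<Rightarrow> complex) \<Rightarrow> bool" where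
  "eigvec \<nu> e \<longleftrightarrow> e \<in> V \<and> (\<forall>x\<in>V. Q x e = of_real \<nu> * B x e)"

lemma eigvec_orth:
  assumes "eigvec \<nu> e" "eigvec \<mu> f" "\<nu> \<noteq> \<mu>"
  shows "B e f = 0"
proof -
  have V: "e \<in> V" "f \<in> V" using assms by (auto simp: eigvec_def)
  have "of_real \<mu> * B e f = Q e f" using assms V by (auto simp: eigvec_def)
  also have "\<dots> = cnj (Q f e)" using Q.B_cnj[OF V(2,1)] .
  also have "\<dots> = of_real \<nu> * cnj (B f e)" using assms V by (auto simp: eigvec_def)
  also have "cnj (B f e) = B e f" using B.B_cnj[OF V(2,1)] by simp
  finally show ?thesis using assms(3) by simp
qed

lemma eigvec_cspan: "w \<in> cspan E \<Longrightarrow> (\<And>e. e \<in> E \<Longrightarrow> eigvec \<nu> e) \<Longrightarrow> eigvec \<nu> w"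
proof (induction rule: cspan.induct)
  case cspan_zero
  then show ?case by (simp add: eigvec_def B.V_zero B.B_zero_right Q.B_zero_right)
next
  case (cspan_step w e c)
  then have "eigvec \<nu> w" "eigvec \<nu> e" by auto
  then show ?case
    by (auto simp: eigvec_def B.B_add_right B.B_scale_right Q.B_add_right Q.B_scale_right B.V_add B.V_scale algebra_simps)
qed

text \<open>Let n(\<mu>) be the square norm of the projection of \<open>v\<close> to the
  eigenvectors in \<open>F\<close> with eigenvalue \<mu>, and t_j = b_0 + ... + b_j. Then Q(v) is at
  least the sum of \<mu> n(\<mu>), whereas d_j is at most \<epsilon> plus the sum of those n(\<mu>)
  with \<mu> >= t_j. So n(\<mu>) enters the left-hand side with the sum of the b_j for which t_j <=
  \<mu>, and this sum is at most \<mu>.\<close>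

theorem spectral_stability:
  fixes F :: "('a \<Rightarrow> complex) set" and \<nu> :: "('a \<Rightarrow> complex) \<Rightarrow> real" and b d :: "nat \<Rightarrow> real"
  assumes F: "finite F" "\<And>e. e \<in> F \<Longrightarrow> eigvec (\<nu> e) e" "\<And>e. e \<in> F \<Longrightarrow> \<nu> e \<ge> 0"
    and v: "v \<in> V" and w0: "w0 \<in> cspan F" "Re (B (\<lambda>x. v x - w0 x) (\<lambda>x. v x - w0 x)) \<le> \<epsilon>"
    and b: "\<And>j. j \<le> M \<Longrightarrow> b j \<ge> 0"
    and d: "\<And>j h. j \<le> M \<Longrightarrow> h \<in> cspan {e\<in>F. \<nu> e < (\<Sum>i\<le>j. b i)} \<Longrightarrow> d j \<le> Re (B (\<lambda>x. v x - h x) (\<lambda>x. v x - h x))"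
  shows "(\<Sum>j\<le>M. b j * d j) \<le> Re (Q v v) + (\<Sum>j\<le>M. b j) * \<epsilon>"
proof -
  let ?E = "\<lambda>\<mu>. {e\<in>F. \<nu> e = \<mu>}"
  have FV: "F \<subseteq> V" using F(2) by (auto simp: eigvec_def)
  have "\<exists>w \<in> cspan (?E \<mu>). \<forall>e\<in>?E \<mu>. B (\<lambda>x. v x - w x) e = 0" for \<mu>
    by (rule B.projection_exists) (use F FV v in auto)
  then have "\<forall>\<mu>. \<exists>w. w \<in> cspan (?E \<mu>) \<and> (\<forall>e\<in>?E \<mu>. B (\<lambda>x. v x - w x) e = 0)" by blast
  from choice[OF this] obtain P where PP: "\<forall>\<mu>. P \<mu> \<in> cspan (?E \<mu>) \<and> (\<forall>e\<in>?E \<mu>. B (\<lambda>x. v x - P \<mu> x) e = 0)" ..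
  have P: "P \<mu> \<in> cspan (?E \<mu>)" "e \<in> ?E \<mu> \<Longrightarrow> B (\<lambda>x. v x - P \<mu> x) e = 0" for \<mu> e
    using PP by blast+
  have eP: "eigvec \<mu> (P \<mu>)" for \<mu> by (rule eigvec_cspan[OF P(1)]) (use F(2) in auto)
  then have PV: "P \<mu> \<in> V" for \<mu> by (simp add: eigvec_def)
  define n where "n \<mu> = Re (B (P \<mu>) (P \<mu>))" for \<mu>
  have n0: "n \<mu> \<ge> 0" for \<mu> unfolding n_def by (rule B.B_nonneg[OF PV])
  have vP: "B v (P \<mu>) = of_real (n \<mu>)" for \<mu>
  proof -
    have "B (\<lambda>x. v x - P \<mu> x) (P \<mu>) = 0"
      by (rule B.B_orth_cspan[OF P(1) _ _ P(2)]) (use FV B.V_diff[OF v PV] in auto)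
    then show ?thesis using B.B_real[OF PV, of \<mu>] by (simp add: B.B_diff v PV n_def)
  qed
  let ?h = "\<lambda>A x. \<Sum>\<mu>\<in>A. P \<mu> x"
  have hV: "?h A \<in> V" for A by (rule B.V_sum) (rule PV)
  have hP: "B (?h A) (P \<mu>) = 0" if "finite A" "\<mu> \<notin> A" for A \<mu>
    using that
  proof (induction A rule: finite_induct)
    case empty
    then show ?case by (simp add: B.B_zero PV)
  next
    case (insert \<kappa> A)
    then show ?case using eigvec_orth[OF eP eP, of \<kappa> \<mu>] by (simp add: B.B_add PV hV)
  qed
  \<comment> \<open>Removing the projections one eigenvalue at a time is orthogonal for both
    forms.\<close>
  have split: "Re (B (\<lambda>x. v x - ?h A x) (\<lambda>x. v x - ?h A x)) = Re (B v v) - (\<Sum>\<mu>\<in>A. n \<mu>)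
     \<and> Re (Q (\<lambda>x. v x - ?h A x) (\<lambda>x. v x - ?h A x)) = Re (Q v v) - (\<Sum>\<mu>\<in>A. \<mu> * n \<mu>)" if "finite A" for A
    using that
  proof (induction A rule: finite_induct)
    case (insert \<mu> A)
    let ?a = "\<lambda>x. v x - ?h A x"
    have a: "?a \<in> V" by (intro B.V_diff v hV)
    have aP: "B ?a (P \<mu>) = of_real (n \<mu>)"
      using insert.hyps hP by (simp add: B.B_diff v hV PV vP)
    have e: "(\<lambda>x. v x - ?h (insert \<mu> A) x) = (\<lambda>x. ?a x - P \<mu> x)"
      using insert.hyps by (simp add: algebra_simps)
    have "Q x (P \<mu>) = of_real \<mu> * B x (P \<mu>)" if "x \<in> V" for x using eP[of \<mu>] that by (simp add: eigvec_def)
    then have q: "Q ?a (P \<mu>) = of_real (\<mu> * n \<mu>)" "Re (Q (P \<mu>) (P \<mu>)) = \<mu> * n \<mu>"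
      using a aP PV by (simp_all add: n_def)
    show ?case
      unfolding e B.B_self_diff[OF a PV] Q.B_self_diff[OF a PV]
      using insert by (simp add: aP q n_def[symmetric])
  qed simp
  define L where "L = \<nu> ` F"
  have L: "finite L" using F by (simp add: L_def)
  have Qv: "(\<Sum>\<mu>\<in>L. \<mu> * n \<mu>) \<le> Re (Q v v)"
    using split[OF L] Q.B_nonneg[OF B.V_diff[OF v hV[of L]]] by simp
  \<comment> \<open>Best approximation: the residual of \<open>v\<close> after all projections is
    orthogonal to the span of \<open>F\<close>, hence no longer than v - w0.\<close>
  have eps: "Re (B v v) - (\<Sum>\<mu>\<in>L. n \<mu>) \<le> \<epsilon>"
  proof -
    let ?a = "\<lambda>x. v x - ?h L x" and ?c = "\<lambda>x. w0 x - ?h L x"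
    have hL: "?h L \<in> cspan F"
      by (rule cspan_sum) (rule cspan_mono[OF P(1)], auto)
    have c: "?c \<in> cspan F" by (rule cspan_diff[OF w0(1) hL])
    have a: "?a \<in> V" by (intro B.V_diff v hV)
    have cV: "?c \<in> V" by (rule B.cspan_V[OF c FV])
    have "B ?a e = 0" if "e \<in> F" for e
    proof -
      have eV: "e \<in> V" using that FV by auto
      let ?\<mu> = "\<nu> e"
      have "?\<mu> \<in> L" using that by (simp add: L_def)
      then have e1: "?h L x = P ?\<mu> x + ?h (L - {?\<mu>}) x" for x using L by (simp add: sum.remove)
      have "B (?h (L - {?\<mu>})) e = 0"
      proof -
        have "B e (?h (L - {?\<mu>})) = 0"
        proof (rule B.B_orth_cspan[of _ "P ` (L - {?\<mu>})"])
          show "?h (L - {?\<mu>}) \<in> cspan (P ` (L - {?\<mu>}))" by (rule cspan_sum) (auto intro: cspan_base)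
          show "B e f = 0" if f: "f \<in> P ` (L - {?\<mu>})" for f
          proof -
            obtain \<kappa> where "f = P \<kappa>" "?\<mu> \<noteq> \<kappa>" using f by auto
            then show ?thesis using eigvec_orth[OF F(2)[OF \<open>e \<in> F\<close>] eP] by simp
          qed
        qed (use PV eV in auto)
        then show ?thesis using B.B_cnj[OF eV hV] by simp
      qed
      moreover have "B (\<lambda>x. v x - P ?\<mu> x) e = 0" using P(2)[of e ?\<mu>] that by simp
      moreover have "?a = (\<lambda>x. (v x - P ?\<mu> x) - ?h (L - {?\<mu>}) x)" by (simp add: fun_eq_iff e1)
      ultimately show ?thesis using v PV hV eV by (simp add: B.B_diff B.V_diff)
    qed
    then have "B ?a ?c = 0" using B.B_orth_cspan[OF c FV a] by blast
    moreover have "(\<lambda>x. v x - w0 x) = (\<lambda>x. ?a x - ?c x)" by simp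
    ultimately have "Re (B (\<lambda>x. v x - w0 x) (\<lambda>x. v x - w0 x)) = Re (B ?a ?a) + Re (B ?c ?c)"
      using B.B_self_diff[OF a cV] by simp
    then have "Re (B ?a ?a) \<le> \<epsilon>" using w0(2) B.B_nonneg[OF cV] by linarith
    then show ?thesis using split[OF L] by simp
  qed
  define t where "t j = (\<Sum>i\<le>j. b i)" for j
  have dj: "d j \<le> \<epsilon> + (\<Sum>\<mu>\<in>L. if t j \<le> \<mu> then n \<mu> else 0)" if "j \<le> M" for j
  proof -
    let ?A = "{\<mu>\<in>L. \<mu> < t j}"
    have "?h ?A \<in> cspan {e\<in>F. \<nu> e < (\<Sum>i\<le>j. b i)}"
      by (rule cspan_sum) (rule cspan_mono[OF P(1)], auto simp: t_def)
    from d[OF that this] have "d j \<le> Re (B v v) - (\<Sum>\<mu>\<in>?A. n \<mu>)" using split[of ?A] L by simp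
    also have "\<dots> \<le> \<epsilon> + ((\<Sum>\<mu>\<in>L. n \<mu>) - (\<Sum>\<mu>\<in>?A. n \<mu>))" using eps by simp
    also have "(\<Sum>\<mu>\<in>L. n \<mu>) - (\<Sum>\<mu>\<in>?A. n \<mu>) = (\<Sum>\<mu>\<in>L - ?A. n \<mu>)" using L by (simp add: sum_diff)
    also have "\<dots> = (\<Sum>\<mu>\<in>L. if t j \<le> \<mu> then n \<mu> else 0)"
      using L by (intro sum.mono_neutral_cong_left) auto
    finally show ?thesis .
  qed
  have "(\<Sum>j\<le>M. b j * d j) \<le> (\<Sum>j\<le>M. b j * (\<epsilon> + (\<Sum>\<mu>\<in>L. if t j \<le> \<mu> then n \<mu> else 0)))"
    by (intro sum_mono mult_left_mono dj b) auto
  also have "\<dots> = (\<Sum>j\<le>M. b j) * \<epsilon> + (\<Sum>j\<le>M. \<Sum>\<mu>\<in>L. (if t j \<le> \<mu> then b j else 0) * n \<mu>)"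
  proof -
    have "b j * (\<Sum>\<mu>\<in>L. if t j \<le> \<mu> then n \<mu> else 0) = (\<Sum>\<mu>\<in>L. (if t j \<le> \<mu> then b j else 0) * n \<mu>)" for j
      unfolding sum_distrib_left by (intro sum.cong) auto
    then show ?thesis by (simp only: distrib_left sum.distrib sum_distrib_right)
  qed
  also have "(\<Sum>j\<le>M. \<Sum>\<mu>\<in>L. (if t j \<le> \<mu> then b j else 0) * n \<mu>) = (\<Sum>\<mu>\<in>L. (\<Sum>j\<le>M. if t j \<le> \<mu> then b j else 0) * n \<mu>)"
    by (subst sum.swap) (simp add: sum_distrib_right)
  also have "\<dots> \<le> (\<Sum>\<mu>\<in>L. \<mu> * n \<mu>)"
  proof (intro sum_mono mult_right_mono n0)
    fix \<mu> assume "\<mu> \<in> L"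
    then have "\<mu> \<ge> 0" using F(3) by (auto simp: L_def)
    \<comment> \<open>The largest index in \<open>?J\<close> bounds the sum, because its threshold
      is itself a partial sum not exceeding \<mu>.\<close>
    let ?J = "{j. j \<le> M \<and> t j \<le> \<mu>}"
    have "(\<Sum>j\<le>M. if t j \<le> \<mu> then b j else 0) = (\<Sum>j\<in>?J. b j)"
      by (intro sum.mono_neutral_cong_right) auto
    also have "\<dots> \<le> \<mu>"
    proof (cases "?J = {}")
      case True
      then show ?thesis using \<open>\<mu> \<ge> 0\<close> by (simp only: sum.empty)
    next
      case False
      have fin: "finite ?J" by simp
      then have J: "Max ?J \<in> ?J" using False by (rule Max_in)
      have "(\<Sum>j\<in>?J. b j) \<le> (\<Sum>j\<le>Max ?J. b j)"
        using Max_ge[OF fin] J b by (intro sum_mono2) auto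
      also have "\<dots> \<le> \<mu>" using J by (simp add: t_def)
      finally show ?thesis .
    qed
    finally show "(\<Sum>j\<le>M. if t j \<le> \<mu> then b j else 0) \<le> \<mu>" .
  qed
  finally show ?thesis using Qv by linarith
qed

text \<open>Away from the eigenvalue \<nu> the equation is solved on each eigenvector by dividing
  its coefficient by \<mu> - \<nu>.\<close>

lemma resolvent:
  assumes "w \<in> cspan E" "\<And>e. e \<in> E \<Longrightarrow> \<exists>\<mu>. \<mu> \<noteq> \<nu> \<and> eigvec \<mu> e"
  shows "\<exists>w'\<in>cspan E. \<forall>x\<in>V. Q x w' - of_real \<nu> * B x w' = B x w"
  using assms
proof (induction rule: cspan.induct)
  case cspan_zero
  show ?case by (rule bexI[OF _ cspan.cspan_zero]) (simp add: B.B_zero_right Q.B_zero_right)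
next
  case (cspan_step w e c)
  then obtain w' where w': "w' \<in> cspan E" "\<And>x. x \<in> V \<Longrightarrow> Q x w' - of_real \<nu> * B x w' = B x w" by blast
  obtain \<mu> where \<mu>: "\<mu> \<noteq> \<nu>" "eigvec \<mu> e" using cspan_step by blast
  have EV: "E \<subseteq> V" using cspan_step.prems by (auto simp: eigvec_def)
  have V: "e \<in> V" "w' \<in> V" "w \<in> V" using \<mu> B.cspan_V[OF _ EV] w' cspan_step.hyps by (auto simp: eigvec_def)
  define a where "a = c / (of_real \<mu> - of_real \<nu>)"
  have a: "cnj a * (of_real \<mu> - of_real \<nu>) = cnj c" using \<mu>(1) by (simp add: a_def)
  show ?case
  proof (rule bexI[OF _ cspan.cspan_step[OF w'(1) cspan_step.hyps(2), of a]], rule ballI)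
    fix x assume x: "x \<in> V"
    have "Q x e = of_real \<mu> * B x e" using \<mu> x by (simp add: eigvec_def)
    then have "Q x (\<lambda>x. a * e x + w' x) - of_real \<nu> * B x (\<lambda>x. a * e x + w' x) =
      cnj a * (of_real \<mu> * B x e) + Q x w' - of_real \<nu> * (cnj a * B x e + B x w')"
      using V x by (simp add: B.B_add_right B.B_scale_right Q.B_add_right Q.B_scale_right B.V_scale)
    also have "\<dots> = (cnj a * (of_real \<mu> - of_real \<nu>)) * B x e + (Q x w' - of_real \<nu> * B x w')"
      by (simp add: algebra_simps)
    also have "\<dots> = B x (\<lambda>x. c * e x + w x)"
      unfolding a w'(2)[OF x] using V x by (simp add: B.B_add_right B.B_scale_right B.V_scale)
    finally show "Q x (\<lambda>x. a * e x + w' x) - of_real \<nu> * B x (\<lambda>x. a * e x + w' x) = B x (\<lambda>x. c * e x + w x)" .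
  qed
qed

text \<open>Keeps the leading term along with the eigenvalue: the shape of g_p plus lower terms
  later decides in which class an eigenvector lies.\<close>

definition eigset :: "(nat \<Rightarrow> 'a \<Rightarrow> complex) \<Rightarrow> (nat \<Rightarrow> real) \<Rightarrow> nat \<Rightarrow> ('a \<Rightarrow> complex) set" where
  "eigset g \<nu> p = {e. eigvec (\<nu> p) e \<and> (\<exists>h\<in>cspan (g ` {..<p}). e = (\<lambda>x. g p x + h x))}"

text \<open>Diagonalization of a bidiagonal operator with distinct diagonal entries. The
  off-diagonal term, by induction a combination of eigenvectors with smaller eigenvalues, is removed
  by the resolvent at \<open>\<nu> p\<close>.\<close>

lemma triangular_eigenvectors:
  assumes g: "\<And>p. g p \<in> V" and \<nu>: "strict_mono \<nu>" and \<gamma>: "\<gamma> 0 = 0"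
    and tri: "\<And>p x. x \<in> V \<Longrightarrow> Q x (g p) = of_real (\<nu> p) * B x (g p) - of_real (\<gamma> p) * B x (g (p - 1))"
  shows "g p \<in> cspan (\<Union>q\<le>p. eigset g \<nu> q)"
proof (induction p rule: less_induct)
  case (less p)
  let ?E = "\<Union>q<p. eigset g \<nu> q"
  \<comment> \<open>For p = 0 the predecessor p - 1 is 0 again and not a lower index; there \<gamma>
    0 = 0 makes the equation trivial.\<close>
  have "\<exists>w\<in>cspan ?E. \<forall>x\<in>V. of_real (\<gamma> p) * B x (g (p - 1)) = of_real (\<gamma> p) * B x w"
  proof (cases p)
    case 0
    then show ?thesis using \<gamma> cspan_zero by auto
  next
    case (Suc q)
    then have "g (p - 1) \<in> cspan ?E" using less.IH[of q] by (simp add: lessThan_Suc_atMost)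
    then show ?thesis by blast
  qed
  then obtain w where w: "w \<in> cspan ?E" "\<And>x. x \<in> V \<Longrightarrow> of_real (\<gamma> p) * B x (g (p - 1)) = of_real (\<gamma> p) * B x w" by blast
  have "\<exists>\<mu>. \<mu> \<noteq> \<nu> p \<and> eigvec \<mu> e" if "e \<in> ?E" for e
    using that \<nu> by (auto simp: eigset_def strict_mono_def dest: less_imp_neq)
  from resolvent[OF w(1) this] obtain w' where w': "w' \<in> cspan ?E" "\<And>x. x \<in> V \<Longrightarrow> Q x w' - of_real (\<nu> p) * B x w' = B x w"
    by blast
  have EV: "?E \<subseteq> V" by (auto simp: eigset_def eigvec_def)
  have V: "w' \<in> V" by (rule B.cspan_V[OF w'(1) EV])
  define e where "e = (\<lambda>x. g p x + of_real (\<gamma> p) * w' x)"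
  have Eg: "?E \<subseteq> cspan (g ` {..<p})"
  proof
    fix f assume "f \<in> ?E"
    then obtain q h where q: "q < p" "h \<in> cspan (g ` {..<q})" "f = (\<lambda>x. g q x + h x)" by (auto simp: eigset_def)
    then have "h \<in> cspan (g ` {..<p})" by (intro cspan_mono[OF q(2)]) auto
    moreover have "g q \<in> cspan (g ` {..<p})" using q(1) by (intro cspan_base) auto
    ultimately show "f \<in> cspan (g ` {..<p})" unfolding q(3) by (intro cspan_add)
  qed
  have "eigvec (\<nu> p) e"
    unfolding eigvec_def
  proof (intro conjI ballI)
    show "e \<in> V" unfolding e_def by (intro B.V_add B.V_scale g V)
    fix x assume x: "x \<in> V"
    have "Q x e = of_real (\<nu> p) * B x (g p) - of_real (\<gamma> p) * B x w + of_real (\<gamma> p) * Q x w'"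
      unfolding e_def using x g V tri[OF x, of p] w(2)[OF x] by (simp add: Q.B_add_right Q.B_scale_right B.V_scale)
    also have "Q x w' = B x w + of_real (\<nu> p) * B x w'" using w'(2)[OF x] by (simp add: algebra_simps)
    also have "of_real (\<nu> p) * B x (g p) - of_real (\<gamma> p) * B x w + of_real (\<gamma> p) * (B x w + of_real (\<nu> p) * B x w') = of_real (\<nu> p) * B x e"
    proof -
      have "B x e = B x (g p) + of_real (\<gamma> p) * B x w'"
        unfolding e_def using x g V by (simp add: B.B_add_right B.B_scale_right B.V_scale)
      then show ?thesis by (simp add: algebra_simps)
    qed
    finally show "Q x e = of_real (\<nu> p) * B x e" .
  qed
  moreover have "(\<lambda>x. of_real (\<gamma> p) * w' x) \<in> cspan (g ` {..<p})"
    by (intro cspan_scale cspan_trans[OF w'(1) Eg])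
  ultimately have "e \<in> eigset g \<nu> p"
    unfolding eigset_def by (intro CollectI conjI bexI[where x="\<lambda>x. of_real (\<gamma> p) * w' x"]) (simp_all add: e_def)
  then have "e \<in> cspan (\<Union>q\<le>p. eigset g \<nu> q)" by (intro cspan_base) auto
  moreover have "w' \<in> cspan (\<Union>q\<le>p. eigset g \<nu> q)" by (rule cspan_mono[OF w'(1)]) force
  ultimately have "(\<lambda>x. e x - of_real (\<gamma> p) * w' x) \<in> cspan (\<Union>q\<le>p. eigset g \<nu> q)"
    by (intro cspan_diff cspan_scale)
  then show ?case by (simp add: e_def)
qed

end

section \<open>Closure in a weighted space\<close>

definition l2sq :: "'a measure \<Rightarrow> ('a \<Rightarrow> complex) \<Rightarrow> ennreal" where
  "l2sq M f = (\<integral>\<^sup>+x. ennreal ((cmod (f x))\<^sup>2) \<partial>M)"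

text \<open>Distances take values in \<open>ennreal\<close>; measurability is demanded of the
  approximants too, so that \<open>l2sq_add_le\<close> applies to them.\<close>

definition l2closure :: "'a measure \<Rightarrow> ('a \<Rightarrow> complex) set \<Rightarrow> ('a \<Rightarrow> complex) set" where
  "l2closure M E = {f \<in> borel_measurable M. \<forall>\<epsilon>>0. \<exists>w\<in>cspan E. w \<in> borel_measurable M \<and> l2sq M (\<lambda>x. f x - w x) < ennreal \<epsilon>}"

lemma l2sq_add_le:
  assumes [measurable]: "f \<in> borel_measurable M" "g \<in> borel_measurable M"
  shows "l2sq M (\<lambda>x. f x + g x) \<le> 2 * l2sq M f + 2 * l2sq M g"
proof -
  have "l2sq M (\<lambda>x. f x + g x) \<le> (\<integral>\<^sup>+x. 2 * ennreal ((cmod (f x))\<^sup>2) + 2 * ennreal ((cmod (g x))\<^sup>2) \<partial>M)"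
    unfolding l2sq_def
  proof (rule nn_integral_mono)
    fix x
    have "(cmod (f x + g x))\<^sup>2 \<le> (cmod (f x) + cmod (g x))\<^sup>2" by (intro power_mono norm_triangle_ineq) auto
    also have "\<dots> \<le> 2 * (cmod (f x))\<^sup>2 + 2 * (cmod (g x))\<^sup>2"
      using sum_squares_bound[of "cmod (f x)" "cmod (g x)"] by (simp add: power2_sum)
    finally have "ennreal ((cmod (f x + g x))\<^sup>2) \<le> ennreal (2 * (cmod (f x))\<^sup>2 + 2 * (cmod (g x))\<^sup>2)" by (rule ennreal_leI)
    then show "ennreal ((cmod (f x + g x))\<^sup>2) \<le> 2 * ennreal ((cmod (f x))\<^sup>2) + 2 * ennreal ((cmod (g x))\<^sup>2)"
      by (simp add: ennreal_mult)
  qed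
  also have "\<dots> = 2 * l2sq M f + 2 * l2sq M g"
    by (simp add: nn_integral_add nn_integral_cmult l2sq_def)
  finally show ?thesis .
qed

lemma l2sq_scale:
  assumes [measurable]: "f \<in> borel_measurable M"
  shows "l2sq M (\<lambda>x. c * f x) = ennreal ((cmod c)\<^sup>2) * l2sq M f"
  unfolding l2sq_def by (subst nn_integral_cmult[symmetric]) (auto simp: norm_mult power_mult_distrib ennreal_mult)

lemma l2sq_mono: "(\<And>x. x \<in> space M \<Longrightarrow> cmod (f x) \<le> cmod (g x)) \<Longrightarrow> l2sq M f \<le> l2sq M g"
  unfolding l2sq_def by (intro nn_integral_mono ennreal_leI power_mono) auto

lemma l2closure_measurable: "f \<in> l2closure M E \<Longrightarrow> f \<in> borel_measurable M"
  by (simp add: l2closure_def)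

lemma l2closureD:
  "f \<in> l2closure M E \<Longrightarrow> \<epsilon> > 0 \<Longrightarrow> \<exists>w\<in>cspan E. w \<in> borel_measurable M \<and> l2sq M (\<lambda>x. f x - w x) < ennreal \<epsilon>"
  by (simp add: l2closure_def)

lemma l2closure_trans:
  assumes [measurable]: "f \<in> borel_measurable M"
    and "\<And>\<epsilon>. \<epsilon> > 0 \<Longrightarrow> \<exists>g\<in>l2closure M E. l2sq M (\<lambda>x. f x - g x) < ennreal \<epsilon>"
  shows "f \<in> l2closure M E"
  unfolding l2closure_def
proof (intro CollectI conjI allI impI)
  show "f \<in> borel_measurable M" by fact
  fix \<epsilon> :: real assume "\<epsilon> > 0"
  \<comment> \<open>The inequality for the square norm of a sum costs a factor 2, so two errors of
    \<epsilon> / 8 add up to \<epsilon> / 2.\<close>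
  then have e4: "\<epsilon> / 8 > 0" by simp
  obtain g where g: "g \<in> l2closure M E" "l2sq M (\<lambda>x. f x - g x) < ennreal (\<epsilon> / 8)"
    using assms(2)[OF e4] by blast
  then obtain w where w: "w \<in> cspan E" "w \<in> borel_measurable M" "l2sq M (\<lambda>x. g x - w x) < ennreal (\<epsilon> / 8)"
    using l2closureD[OF _ e4] by blast
  note [measurable] = l2closure_measurable[OF g(1)] w(2)
  have "l2sq M (\<lambda>x. f x - w x) = l2sq M (\<lambda>x. (f x - g x) + (g x - w x))" by simp
  also have "\<dots> \<le> 2 * l2sq M (\<lambda>x. f x - g x) + 2 * l2sq M (\<lambda>x. g x - w x)"
    by (rule l2sq_add_le) measurable
  also have "\<dots> \<le> 2 * ennreal (\<epsilon> / 8) + 2 * ennreal (\<epsilon> / 8)"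
    by (intro add_mono mult_left_mono less_imp_le[OF g(2)] less_imp_le[OF w(3)]) auto
  also have "\<dots> < ennreal \<epsilon>"
  proof -
    have "2 * ennreal (\<epsilon> / 8) = ennreal (2 * (\<epsilon> / 8))" using ennreal_mult'[of 2 "\<epsilon> / 8"] by (simp only: ennreal_numeral zero_le_numeral)
    then have "2 * ennreal (\<epsilon> / 8) + 2 * ennreal (\<epsilon> / 8) = ennreal (2 * (\<epsilon> / 8) + 2 * (\<epsilon> / 8))"
      using e4 by (subst ennreal_plus) auto
    also have "\<dots> < ennreal \<epsilon>" by (rule ennreal_lessI) (use \<open>\<epsilon> > 0\<close> in auto)
    finally show ?thesis .
  qed
  finally show "\<exists>w\<in>cspan E. w \<in> borel_measurable M \<and> l2sq M (\<lambda>x. f x - w x) < ennreal \<epsilon>"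
    using w by blast
qed

lemma l2closure_limit:
  assumes f: "f \<in> borel_measurable M" and g: "\<And>n::nat. g n \<in> l2closure M E"
    and lim: "(\<lambda>n. l2sq M (\<lambda>x. f x - g n x)) \<longlonglongrightarrow> 0"
  shows "f \<in> l2closure M E"
proof (rule l2closure_trans[OF f])
  fix \<epsilon> :: real assume "\<epsilon> > 0"
  then have "ennreal \<epsilon> > 0" by simp
  then have "\<forall>\<^sub>F n in sequentially. l2sq M (\<lambda>x. f x - g n x) < ennreal \<epsilon>"
    by (rule order_tendstoD(2)[OF lim])
  then show "\<exists>g\<in>l2closure M E. l2sq M (\<lambda>x. f x - g x) < ennreal \<epsilon>"
    using g eventually_happens'[OF sequentially_bot] by blast
qed

lemma l2sq_zero [simp]: "l2sq M (\<lambda>x. 0) = 0"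
  by (simp add: l2sq_def)

lemma cspan_l2closure: "w \<in> cspan E \<Longrightarrow> w \<in> borel_measurable M \<Longrightarrow> w \<in> l2closure M E"
  unfolding l2closure_def by (auto intro!: bexI[of _ w])

lemma l2closure_add:
  assumes "f \<in> l2closure M E" "g \<in> l2closure M E"
  shows "(\<lambda>x. f x + g x) \<in> l2closure M E"
  unfolding l2closure_def
proof (intro CollectI conjI allI impI)
  note [measurable] = l2closure_measurable[OF assms(1)] l2closure_measurable[OF assms(2)]
  show "(\<lambda>x. f x + g x) \<in> borel_measurable M" by measurable
  fix \<epsilon> :: real assume "\<epsilon> > 0"
  then have e4: "\<epsilon> / 8 > 0" by simp
  obtain v where v: "v \<in> cspan E" "v \<in> borel_measurable M" "l2sq M (\<lambda>x. f x - v x) < ennreal (\<epsilon> / 8)"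
    using l2closureD[OF assms(1) e4] by blast
  obtain w where w: "w \<in> cspan E" "w \<in> borel_measurable M" "l2sq M (\<lambda>x. g x - w x) < ennreal (\<epsilon> / 8)"
    using l2closureD[OF assms(2) e4] by blast
  note [measurable] = v(2) w(2)
  have "l2sq M (\<lambda>x. f x + g x - (v x + w x)) = l2sq M (\<lambda>x. (f x - v x) + (g x - w x))" by (simp add: algebra_simps)
  also have "\<dots> \<le> 2 * l2sq M (\<lambda>x. f x - v x) + 2 * l2sq M (\<lambda>x. g x - w x)"
    by (rule l2sq_add_le) measurable
  also have "\<dots> \<le> 2 * ennreal (\<epsilon> / 8) + 2 * ennreal (\<epsilon> / 8)"
    by (intro add_mono mult_left_mono less_imp_le[OF v(3)] less_imp_le[OF w(3)]) auto
  also have "\<dots> < ennreal \<epsilon>"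
  proof -
    have "2 * ennreal (\<epsilon> / 8) = ennreal (2 * (\<epsilon> / 8))" using ennreal_mult'[of 2 "\<epsilon> / 8"] by (simp only: ennreal_numeral zero_le_numeral)
    then have "2 * ennreal (\<epsilon> / 8) + 2 * ennreal (\<epsilon> / 8) = ennreal (2 * (\<epsilon> / 8) + 2 * (\<epsilon> / 8))"
      using e4 by (subst ennreal_plus) auto
    also have "\<dots> < ennreal \<epsilon>" by (rule ennreal_lessI) (use \<open>\<epsilon> > 0\<close> in auto)
    finally show ?thesis .
  qed
  finally show "\<exists>w\<in>cspan E. w \<in> borel_measurable M \<and> l2sq M (\<lambda>x. f x + g x - w x) < ennreal \<epsilon>"
    using cspan_add[OF v(1) w(1)] by (intro bexI[of _ "\<lambda>x. v x + w x"]) auto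
qed

lemma l2closure_scale:
  assumes "f \<in> l2closure M E"
  shows "(\<lambda>x. c * f x) \<in> l2closure M E"
  unfolding l2closure_def
proof (intro CollectI conjI allI impI)
  note [measurable] = l2closure_measurable[OF assms]
  show "(\<lambda>x. c * f x) \<in> borel_measurable M" by measurable
  fix \<epsilon> :: real assume e: "\<epsilon> > 0"
  define \<delta> where "\<delta> = \<epsilon> / ((cmod c)\<^sup>2 + 1)"
  have pos: "(cmod c)\<^sup>2 + 1 > 0" by (simp add: add_nonneg_pos)
  have \<delta>: "\<delta> > 0" using e pos by (simp add: \<delta>_def)
  obtain v where v: "v \<in> cspan E" "v \<in> borel_measurable M" "l2sq M (\<lambda>x. f x - v x) < ennreal \<delta>"
    using l2closureD[OF assms \<delta>] by blast
  note [measurable] = v(2)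
  have "l2sq M (\<lambda>x. c * f x - c * v x) = ennreal ((cmod c)\<^sup>2) * l2sq M (\<lambda>x. f x - v x)"
    using l2sq_scale[of "\<lambda>x. f x - v x" M c] by (simp add: right_diff_distrib)
  also have "\<dots> \<le> ennreal ((cmod c)\<^sup>2) * ennreal \<delta>" using v(3) by (intro mult_left_mono) auto
  also have "\<dots> = ennreal ((cmod c)\<^sup>2 * \<delta>)" using \<delta> by (simp add: ennreal_mult)
  also have "\<dots> < ennreal \<epsilon>"
  proof (rule ennreal_lessI[OF e])
    have "(cmod c)\<^sup>2 * \<delta> < ((cmod c)\<^sup>2 + 1) * \<delta>" using \<delta> by simp
    also have "\<dots> = \<epsilon>" using pos by (simp add: \<delta>_def)
    finally show "(cmod c)\<^sup>2 * \<delta> < \<epsilon>" .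
  qed
  finally show "\<exists>w\<in>cspan E. w \<in> borel_measurable M \<and> l2sq M (\<lambda>x. c * f x - w x) < ennreal \<epsilon>"
    using cspan_scale[OF v(1), of c] by (intro bexI[of _ "\<lambda>x. c * v x"]) auto
qed

lemma l2closure_zero: "(\<lambda>x. 0) \<in> l2closure M E"
  by (rule cspan_l2closure[OF cspan_zero]) simp

lemma l2closure_sum: "(\<And>i. i \<in> I \<Longrightarrow> f i \<in> l2closure M E) \<Longrightarrow> (\<lambda>x. \<Sum>i\<in>I. f i x) \<in> l2closure M E"
  by (induction I rule: infinite_finite_induct) (auto intro: l2closure_zero l2closure_add)

section \<open>Exponential sums in a radial variable\<close>

lemma l2sq_dominated_convergence:
  assumes m: "f \<in> borel_measurable M" "\<And>n::nat. g n \<in> borel_measurable M"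
    and lim: "AE x in M. (\<lambda>n. g n x) \<longlonglongrightarrow> f x"
    and bound: "\<And>n x. cmod (f x - g n x) \<le> cmod (h x)" and h: "h \<in> borel_measurable M" "l2sq M h < \<infinity>"
  shows "(\<lambda>n. l2sq M (\<lambda>x. f x - g n x)) \<longlonglongrightarrow> 0"
proof -
  note [measurable] = m h(1)
  have "(\<lambda>n. \<integral>\<^sup>+x. ennreal ((cmod (f x - g n x))\<^sup>2) \<partial>M) \<longlonglongrightarrow> (\<integral>\<^sup>+x. 0 \<partial>M)"
  proof (rule nn_integral_dominated_convergence[where w="\<lambda>x. ennreal ((cmod (h x))\<^sup>2)"])
    show "AE x in M. ennreal ((cmod (f x - g n x))\<^sup>2) \<le> ennreal ((cmod (h x))\<^sup>2)" for n
      by (intro AE_I2 ennreal_leI power_mono bound) auto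
    show "(\<integral>\<^sup>+x. ennreal ((cmod (h x))\<^sup>2) \<partial>M) < \<infinity>" using h(2) by (simp add: l2sq_def)
    show "AE x in M. (\<lambda>n. ennreal ((cmod (f x - g n x))\<^sup>2)) \<longlonglongrightarrow> 0"
      using lim
    proof eventually_elim
      case (elim x)
      have "(\<lambda>n. (cmod (f x - g n x))\<^sup>2) \<longlonglongrightarrow> (cmod (f x - f x))\<^sup>2" by (intro tendsto_intros elim)
      then have "(\<lambda>n. ennreal ((cmod (f x - g n x))\<^sup>2)) \<longlonglongrightarrow> ennreal ((cmod (f x - f x))\<^sup>2)" by (rule tendsto_ennrealI)
      then show ?case by simp
    qed
  qed measurable
  then show ?thesis by (simp add: l2sq_def)
qed

text \<open>The closure of the functions \<open>h t\<^sup>q e\<^sup>-\<^sup>t\<close> contains \<open>h t\<^sup>q e\<^sup>-\<^sup>c\<^sup>t\<close> for \<open>c = 1, 3/2, 2, \<dots>\<close>: the Taylor series of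
  \<open>e\<^sup>-\<^sup>t\<^sup>/\<^sup>2\<close>, multiplied by \<open>e\<^sup>-\<^sup>c\<^sup>t\<close>, converges dominatedly.\<close>

lemma exp_moments_closure:
  fixes t :: "'a \<Rightarrow> real"
  assumes [measurable]: "t \<in> borel_measurable M" "h \<in> borel_measurable M" and t: "\<And>x. t x \<ge> 0"
    and E: "\<And>q. (\<lambda>x. h x * of_real (t x ^ q * exp (- t x))) \<in> l2closure M E"
    and fin: "\<And>q c. c > 0 \<Longrightarrow> l2sq M (\<lambda>x. h x * of_real (t x ^ q * exp (- c * t x))) < \<infinity>"
  shows "(\<lambda>x. h x * of_real (t x ^ q * exp (- (1 + real n / 2) * t x))) \<in> l2closure M E"
proof (induction n arbitrary: q)
  case 0
  then show ?case using E by simp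
next
  case (Suc n)
  let ?c = "1 + real n / 2"
  let ?g = "\<lambda>N x. h x * of_real (t x ^ q * exp (- ?c * t x) * (\<Sum>j<N. (- (t x / 2)) ^ j / fact j))"
  show ?case
  proof (rule l2closure_limit)
    show "?g N \<in> l2closure M E" for N
    proof -
      have "(\<lambda>x. \<Sum>j<N. of_real ((- (1/2)) ^ j / fact j) * (h x * of_real (t x ^ (q + j) * exp (- ?c * t x)))) \<in> l2closure M E"
        by (intro l2closure_sum l2closure_scale Suc.IH)
      also have "(\<lambda>x. \<Sum>j<N. of_real ((- (1/2)) ^ j / fact j) * (h x * of_real (t x ^ (q + j) * exp (- ?c * t x)))) = ?g N"
      proof
        fix x
        have "((- (1/2)) ^ j / fact j) * (t x ^ (q + j) * exp (- ?c * t x)) = t x ^ q * exp (- ?c * t x) * ((- (t x / 2)) ^ j / fact j)" for j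
        proof -
          have "(- (t x / 2)) ^ j = (- (1/2)) ^ j * t x ^ j" by (simp flip: power_mult_distrib)
          then show ?thesis by (simp add: power_add)
        qed
        from this[symmetric] have "h x * of_real (t x ^ q * exp (- ?c * t x) * ((- (t x / 2)) ^ j / fact j)) = of_real ((- (1/2)) ^ j / fact j) * (h x * of_real (t x ^ (q + j) * exp (- ?c * t x)))" for j
          by (simp only: of_real_mult mult.left_commute[of "h x"])
        then show "(\<Sum>j<N. of_real ((- (1/2)) ^ j / fact j) * (h x * of_real (t x ^ (q + j) * exp (- ?c * t x)))) = ?g N x"
          by (simp only: sum_distrib_left of_real_sum)
      qed
      finally show ?thesis .
    qed
    let ?f = "\<lambda>x. h x * of_real (t x ^ q * exp (- (1 + real (Suc n) / 2) * t x))"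
    \<comment> \<open>The partial sums of the series for e^(-t/2) are bounded by e^(t/2) only. The
      factor e^(-ct) with c >= 1 pays for this and leaves e^(-t/2), which explains the step size 1/2
      in the exponent.\<close>
    show "(\<lambda>N. l2sq M (\<lambda>x. ?f x - ?g N x)) \<longlonglongrightarrow> 0"
    proof (rule l2sq_dominated_convergence[where h="\<lambda>x. 2 * (h x * of_real (t x ^ q * exp (- (1/2) * t x)))"])
      have ex: "exp (- (1 + real (Suc n) / 2) * t x) = exp (- ?c * t x) * exp (- (t x / 2))" for x
        by (simp add: field_simps flip: exp_add)
      have ser: "(\<lambda>N. \<Sum>j<N. (- (t x / 2)) ^ j / fact j) \<longlonglongrightarrow> exp (- (t x / 2))" for x
      proof -
        have eq: "y ^ j / fact j = y ^ j /\<^sub>R fact j" for y :: real and j by (simp add: divide_inverse mult.commute)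
        show ?thesis unfolding eq using exp_converges[of "- (t x / 2)"] unfolding sums_def .
      qed
      show "AE x in M. (\<lambda>N. ?g N x) \<longlonglongrightarrow> ?f x"
        unfolding ex mult.assoc[symmetric] by (intro AE_I2 tendsto_intros ser)
      fix N x
      have "\<bar>exp (- (t x / 2)) - (\<Sum>j<N. (- (t x / 2)) ^ j / fact j)\<bar> \<le> 2 * exp (t x / 2)"
      proof -
        have "\<bar>\<Sum>j<N. (- (t x / 2)) ^ j / fact j\<bar> \<le> (\<Sum>j<N. \<bar>(- (t x / 2)) ^ j / fact j\<bar>)" by (rule sum_abs)
        also have "\<dots> = (\<Sum>j<N. (t x / 2) ^ j /\<^sub>R fact j)"
        proof (rule sum.cong[OF refl])
          fix j
          have "\<bar>- (t x / 2)\<bar> = t x / 2" using t[of x] by simp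
          then have "\<bar>(- (t x / 2)) ^ j\<bar> = (t x / 2) ^ j" by (simp only: power_abs)
          moreover have "\<bar>a / fact j\<bar> = inverse (fact j) * \<bar>a\<bar>" for a :: real by (simp add: divide_inverse abs_mult)
          ultimately show "\<bar>(- (t x / 2)) ^ j / fact j\<bar> = (t x / 2) ^ j /\<^sub>R fact j" by (simp only: real_scaleR_def)
        qed
        also have "\<dots> \<le> (\<Sum>j. (t x / 2) ^ j /\<^sub>R fact j)"
          by (rule sum_le_suminf[OF summable_exp_generic]) (use t in auto)
        also have "\<dots> = exp (t x / 2)" by (simp add: exp_def)
        finally have 1: "\<bar>\<Sum>j<N. (- (t x / 2)) ^ j / fact j\<bar> \<le> exp (t x / 2)" .
        have "\<bar>exp (- (t x / 2))\<bar> \<le> exp (t x / 2)" using t[of x] by simp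
        with 1 show ?thesis using abs_triangle_ineq4[of "exp (- (t x / 2))" "\<Sum>j<N. (- (t x / 2)) ^ j / fact j"] by linarith
      qed
      then have "exp (- ?c * t x) * \<bar>exp (- (t x / 2)) - (\<Sum>j<N. (- (t x / 2)) ^ j / fact j)\<bar> \<le> exp (- ?c * t x) * (2 * exp (t x / 2))"
        by (intro mult_left_mono) auto
      also have "\<dots> = 2 * exp (- (?c - 1/2) * t x)" by (simp add: algebra_simps flip: exp_add)
      also have "\<dots> \<le> 2 * exp (- (1/2) * t x)"
      proof -
        have "(1/2) * t x \<le> (?c - 1/2) * t x" using t[of x] by (intro mult_right_mono) auto
        then have "- (?c - 1/2) * t x \<le> - (1/2) * t x" by (simp only: mult_minus_left neg_le_iff_le)
        then show ?thesis by (simp only: exp_le_cancel_iff mult_le_cancel_left) simp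
      qed
      finally have b: "exp (- ?c * t x) * \<bar>exp (- (t x / 2)) - (\<Sum>j<N. (- (t x / 2)) ^ j / fact j)\<bar> \<le> 2 * exp (- (1/2) * t x)" .
      have "?f x - ?g N x = h x * of_real (t x ^ q * (exp (- ?c * t x) * (exp (- (t x / 2)) - (\<Sum>j<N. (- (t x / 2)) ^ j / fact j))))"
        unfolding ex by (simp add: algebra_simps)
      then have "cmod (?f x - ?g N x) = cmod (h x) * (t x ^ q * (exp (- ?c * t x) * \<bar>exp (- (t x / 2)) - (\<Sum>j<N. (- (t x / 2)) ^ j / fact j)\<bar>))"
        using t[of x] by (simp only: norm_mult norm_of_real abs_mult) simp
      also have "\<dots> \<le> cmod (h x) * (t x ^ q * (2 * exp (- (1/2) * t x)))"
        by (intro mult_left_mono b) (use t in auto)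
      also have "\<dots> = cmod (2 * (h x * of_real (t x ^ q * exp (- (1/2) * t x))))"
        using t[of x] by (simp add: norm_mult abs_mult norm_power)
      finally show "cmod (?f x - ?g N x) \<le> cmod (2 * (h x * of_real (t x ^ q * exp (- (1/2) * t x))))" .
    next
      show "l2sq M (\<lambda>x. 2 * (h x * of_real (t x ^ q * exp (- (1/2) * t x)))) < \<infinity>"
        using fin[of "1/2" q] by (subst l2sq_scale) (auto simp: ennreal_mult_less_top)
    qed measurable
  qed measurable
qed

text \<open>In the variable y = e^(-t) the function d(t) e^t becomes continuous on [0, 1] and
  vanishes near 0. A polynomial \<open>B\<close> approximates it uniformly, and e^(-t) B(e^(-t)) is
  a combination of the exponentials e^(-(1+i)t) already in the closure.\<close>

lemma radial_closure_real:
  fixes t :: "'a \<Rightarrow> real" and d :: "real \<Rightarrow> real"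
  assumes [measurable]: "t \<in> borel_measurable M" "h \<in> borel_measurable M" and t: "\<And>x. t x \<ge> 0"
    and E: "\<And>q. (\<lambda>x. h x * of_real (t x ^ q * exp (- t x))) \<in> l2closure M E"
    and fin: "\<And>q c. c > 0 \<Longrightarrow> l2sq M (\<lambda>x. h x * of_real (t x ^ q * exp (- c * t x))) < \<infinity>"
    and d: "continuous_on UNIV d" "\<And>u. u \<ge> T \<Longrightarrow> d u = 0"
  shows "(\<lambda>x. h x * of_real (d (t x))) \<in> l2closure M E"
proof (rule l2closure_trans)
  have [measurable]: "d \<in> borel_measurable borel" using d(1) by (rule borel_measurable_continuous_onI)
  show "(\<lambda>x. h x * of_real (d (t x))) \<in> borel_measurable M" by measurable
  fix \<epsilon> :: real assume \<epsilon>: "\<epsilon> > 0"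
  define S where "S = l2sq M (\<lambda>x. h x * of_real (exp (- t x)))"
  have S: "S < \<infinity>" using fin[of 1 0] by (simp add: S_def)
  then obtain S' where S': "S = ennreal S'" "S' \<ge> 0" by (cases S) auto
  define \<delta> where "\<delta> = sqrt (\<epsilon> / (S' + 1))"
  have \<delta>: "\<delta> > 0" "\<delta>\<^sup>2 * S' < \<epsilon>"
  proof -
    show "\<delta> > 0" using \<epsilon> S' by (simp add: \<delta>_def)
    have "\<delta>\<^sup>2 * S' = \<epsilon> * (S' / (S' + 1))" using \<epsilon> S' by (simp add: \<delta>_def)
    also have "\<dots> < \<epsilon> * 1" using \<epsilon> S' by (intro mult_strict_left_mono) auto
    finally show "\<delta>\<^sup>2 * S' < \<epsilon>" by simp
  qed
  \<comment> \<open>The maximum with e^(-T) avoids the logarithm of 0; below e^(-T) the function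
    keeps its value at e^(-T), which is 0 because d(T) = 0.\<close>
  define D where "D x = d (- ln (max x (exp (- T)))) / max x (exp (- T))" for x
  have mp: "max x (exp (- T)) > 0" for x by (simp add: less_max_iff_disj)
  have "continuous_on {0..1} D"
    unfolding D_def using mp
    by (intro continuous_intros continuous_on_compose2[OF d(1)]) (auto simp: less_imp_neq[symmetric])
  then obtain B where B: "real_polynomial_function B" "\<And>x. x \<in> {0..1} \<Longrightarrow> \<bar>D x - B x\<bar> < \<delta>"
    using Stone_Weierstrass_real_polynomial_function[of "{0..1}" D \<delta>] \<delta>(1) by auto
  then obtain a n where B_eq: "B = (\<lambda>x. \<Sum>i\<le>n. a i * x ^ i)"
    using real_polynomial_function_iff_sum by blast
  have dD: "d u = exp (- u) * D (exp (- u))" if "u \<ge> 0" for u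
  proof (cases "u \<le> T")
    case True
    then show ?thesis by (simp add: D_def max_def)
  next
    case False
    then have "max (exp (- u)) (exp (- T)) = exp (- T)" by simp
    then show ?thesis using False d(2)[of u] d(2)[of T] by (simp add: D_def)
  qed
  let ?g = "\<lambda>x. h x * of_real (exp (- t x) * B (exp (- t x)))"
  \<comment> \<open>The exponent 1 + i is reached after 2 i steps of size 1/2.\<close>
  have "(\<lambda>x. \<Sum>i\<le>n. of_real (a i) * (h x * of_real (t x ^ 0 * exp (- (1 + real (2 * i) / 2) * t x)))) \<in> l2closure M E"
    by (intro l2closure_sum l2closure_scale exp_moments_closure t E fin) measurable
  also have "(\<lambda>x. \<Sum>i\<le>n. of_real (a i) * (h x * of_real (t x ^ 0 * exp (- (1 + real (2 * i) / 2) * t x)))) = ?g"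
  proof
    fix x
    have "exp (- (1 + real (2 * i) / 2) * t x) = exp (- t x) * exp (- t x) ^ i" for i
      by (simp add: algebra_simps flip: exp_of_nat_mult exp_add)
    then show "(\<Sum>i\<le>n. of_real (a i) * (h x * of_real (t x ^ 0 * exp (- (1 + real (2 * i) / 2) * t x)))) = ?g x"
      by (simp add: B_eq sum_distrib_left mult_ac)
  qed
  finally have g: "?g \<in> l2closure M E" .
  have "l2sq M (\<lambda>x. h x * of_real (d (t x)) - ?g x) \<le> l2sq M (\<lambda>x. of_real \<delta> * (h x * of_real (exp (- t x))))"
  proof (rule l2sq_mono)
    fix x
    have "exp (- t x) \<in> {0..1}" using t[of x] by simp
    then have "\<bar>D (exp (- t x)) - B (exp (- t x))\<bar> \<le> \<delta>" using B(2) by (simp add: less_imp_le del: atLeastAtMost_iff)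
    then have "cmod (h x) * (exp (- t x) * \<bar>D (exp (- t x)) - B (exp (- t x))\<bar>) \<le> cmod (h x) * (exp (- t x) * \<delta>)"
      by (intro mult_left_mono) auto
    moreover have "h x * of_real (d (t x)) - ?g x = h x * of_real (exp (- t x) * (D (exp (- t x)) - B (exp (- t x))))"
      unfolding dD[OF t] by (simp add: algebra_simps)
    then have "cmod (h x * of_real (d (t x)) - ?g x) = cmod (h x) * (exp (- t x) * \<bar>D (exp (- t x)) - B (exp (- t x))\<bar>)"
      by (simp only: norm_mult norm_of_real abs_mult) simp
    ultimately show "cmod (h x * of_real (d (t x)) - ?g x) \<le> cmod (of_real \<delta> * (h x * of_real (exp (- t x))))"
      using \<delta>(1) by (simp add: norm_mult mult_ac)
  qed
  also have "\<dots> = ennreal (\<delta>\<^sup>2) * S"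
    unfolding S_def using \<delta>(1) by (subst l2sq_scale) auto
  also have "\<dots> = ennreal (\<delta>\<^sup>2 * S')" using S' by (simp add: ennreal_mult)
  also have "\<dots> < ennreal \<epsilon>" by (rule ennreal_lessI[OF \<epsilon> \<delta>(2)])
  finally show "\<exists>g\<in>l2closure M E. l2sq M (\<lambda>x. h x * of_real (d (t x)) - g x) < ennreal \<epsilon>"
    by (intro bexI[OF _ g])
qed

lemma radial_closure:
  fixes t :: "'a \<Rightarrow> real" and d :: "real \<Rightarrow> complex"
  assumes m: "t \<in> borel_measurable M" "h \<in> borel_measurable M" and t: "\<And>x. t x \<ge> 0"
    and E: "\<And>q. (\<lambda>x. h x * of_real (t x ^ q * exp (- t x))) \<in> l2closure M E"
    and fin: "\<And>q c. c > 0 \<Longrightarrow> l2sq M (\<lambda>x. h x * of_real (t x ^ q * exp (- c * t x))) < \<infinity>"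
    and d: "continuous_on UNIV d" "\<And>u. u \<ge> T \<Longrightarrow> d u = 0"
  shows "(\<lambda>x. h x * d (t x)) \<in> l2closure M E"
proof -
  have "(\<lambda>x. h x * of_real (Re (d (t x)))) \<in> l2closure M E"
    by (rule radial_closure_real[OF m t E fin, where T=T]) (use d in \<open>auto intro: continuous_intros\<close>)
  moreover have "(\<lambda>x. h x * of_real (Im (d (t x)))) \<in> l2closure M E"
    by (rule radial_closure_real[OF m t E fin, where T=T]) (use d in \<open>auto intro: continuous_intros\<close>)
  ultimately have "(\<lambda>x. h x * of_real (Re (d (t x))) + \<i> * (h x * of_real (Im (d (t x))))) \<in> l2closure M E"
    by (intro l2closure_add l2closure_scale)
  moreover have "h x * of_real (Re (d (t x))) + \<i> * (h x * of_real (Im (d (t x)))) = h x * d (t x)" for x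
    using complex_eq[of "d (t x)"] by (metis distrib_left mult.left_commute)
  ultimately show ?thesis by simp
qed

section \<open>Density of the generators\<close>

definition wmeas :: "real \<Rightarrow> (real^'n) measure" where
  "wmeas s = density lborel (\<lambda>x. ennreal (norm x powr s))"

definition generators :: "real \<Rightarrow> real \<Rightarrow> (nat \<Rightarrow> real) \<Rightarrow> (real^'n \<Rightarrow> complex) set" where
  "generators s l a = {atom s l (a k - real k + s * real p) q | k p q. harmonic_homogeneous_poly k q}"

lemma measurable_wmeas [simp]: "borel_measurable (wmeas s) = borel_measurable borel"
  by (rule measurable_cong_sets) (simp_all add: wmeas_def)

lemma l2sq_wmeas:
  assumes [measurable]: "f \<in> borel_measurable borel"
  shows "l2sq (wmeas s) f = (\<integral>\<^sup>+x. ennreal (norm x powr s * (cmod (f x))\<^sup>2) \<partial>lborel)"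
  unfolding l2sq_def wmeas_def by (subst nn_integral_density) (auto simp: ennreal_mult)

lemma l2sq_rapid:
  assumes f: "rapid f" and s: "s \<ge> 0"
  shows "l2sq (wmeas s) f = ennreal (Re (wip s f f))"
proof -
  have "integrable lborel (\<lambda>x. of_real (norm x powr s) * (f x * cnj (f x)))" by (rule integrable_wip[OF s f f])
  moreover have "of_real (norm x powr s) * (f x * cnj (f x)) = complex_of_real (norm x powr s * (cmod (f x))\<^sup>2)" for x
    by (simp only: of_real_mult complex_norm_square)
  ultimately have "integrable lborel (\<lambda>x. norm x powr s * (cmod (f x))\<^sup>2)"
    by (simp only: integrable_complex_of_real_iff)
  then show ?thesis
    by (subst l2sq_wmeas[OF rapid_measurable[OF f]], subst nn_integral_eq_integral) (auto simp: wip_self)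
qed

lemma l2sq_rapid_finite: "rapid f \<Longrightarrow> s \<ge> 0 \<Longrightarrow> l2sq (wmeas s) f < \<infinity>"
  by (simp add: l2sq_rapid)

text \<open>With t = l |x|^s / s the generators built on \<open>q\<close> are, up to constants, h
  t^p e^(-t) for the fixed function h = |x|^(a_k - k) q, so the radial result applies.\<close>

lemma generator_closure:
  fixes q :: "real^'n \<Rightarrow> complex" and c :: "real \<Rightarrow> complex"
  assumes s: "s > 0" and l: "l > 0" and a: "a k \<ge> 0" and q: "harmonic_homogeneous_poly k q"
    and c: "continuous_on UNIV c" "\<And>r. r < \<delta> \<Longrightarrow> c r = 0" "\<And>r. r > R \<Longrightarrow> c r = 0" and \<delta>: "\<delta> > 0" and R: "R \<ge> 0"
  shows "(\<lambda>x. c (norm x) * q x) \<in> l2closure (wmeas s) (generators s l a)"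
proof -
  have qc: "q \<in> cpoly" "hom k q" using q by (auto simp: harmonic_iff)
  have [measurable]: "q \<in> borel_measurable borel" using cpoly_continuous[OF qc(1)] by (rule borel_measurable_continuous_onI)
  define h where "h x = of_real (norm x powr (a k - real k)) * q x" for x
  define t where "t x = l * norm x powr s / s" for x :: "real^'n"
  \<comment> \<open>The inverse of |x| -> t. The maximum with \<delta> in \<open>d\<close> keeps the
    power continuous for either sign of its exponent and changes nothing, since \<open>c\<close>
    vanishes below \<delta>.\<close>
  define \<rho> where "\<rho> u = (max 0 (s * u / l)) powr (1 / s)" for u
  define d where "d u = c (\<rho> u) * of_real (max \<delta> (\<rho> u) powr (real k - a k))" for u
  have atom: "h x * of_real (t x ^ j * exp (- c * t x)) = of_real ((l / s) ^ j) * atom s (c * l) (a k - real k + s * real j) q x" for j x c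
  proof (cases "x = 0")
    case False
    have "(norm x powr s) ^ j = norm x powr (s * real j)"
      using False by (subst powr_realpow[symmetric]) (auto simp: powr_powr)
    then have "t x ^ j = (l / s) ^ j * norm x powr (s * real j)"
      by (simp add: t_def power_mult_distrib power_divide)
    then have e1: "complex_of_real (t x ^ j) = of_real ((l / s) ^ j) * of_real (norm x powr (s * real j))"
      by (simp only: of_real_mult)
    have e2: "complex_of_real (exp (- c * t x)) = wexp s (c * l) x" by (simp add: wexp_def t_def)
    have e3: "complex_of_real (norm x powr (a k - real k + s * real j)) = of_real (norm x powr (a k - real k)) * of_real (norm x powr (s * real j))"
      by (simp add: powr_add)
    show ?thesis unfolding of_real_mult e1 e2 atom_def e3 h_def by (simp add: mult_ac)
  qed (simp add: h_def atom_def)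
  have eq: "c (norm x) * q x = h x * d (t x)" for x
  proof (cases "x = 0")
    case True
    then show ?thesis using c(2)[OF \<delta>] by (simp add: h_def)
  next
    case False
    have "\<rho> (t x) = norm x"
      using s l False by (simp add: \<rho>_def t_def powr_powr)
    then have dt: "d (t x) = c (norm x) * of_real (max \<delta> (norm x) powr (real k - a k))" by (simp add: d_def)
    show ?thesis
    proof (cases "norm x < \<delta>")
      case True
      then show ?thesis using c(2) by (simp add: dt)
    next
      case False
      then have "max \<delta> (norm x) = norm x" by simp
      moreover have "norm x powr (a k - real k) * norm x powr (real k - a k) = 1"
        using \<open>x \<noteq> 0\<close> by (simp flip: powr_add)
      then have "complex_of_real (norm x powr (a k - real k)) * of_real (norm x powr (real k - a k)) = 1"
        by (simp flip: of_real_mult)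
      ultimately show ?thesis unfolding dt h_def by (simp add: mult_ac)
    qed
  qed
  have "(\<lambda>x. h x * d (t x)) \<in> l2closure (wmeas s) (generators s l a)"
  proof (rule radial_closure[where T="l * (R + 1) powr s / s"])
    show "t \<in> borel_measurable (wmeas s)" "h \<in> borel_measurable (wmeas s)"
      unfolding t_def[abs_def] h_def[abs_def] measurable_wmeas by measurable
    show "t x \<ge> 0" for x using s l by (simp add: t_def)
    show "(\<lambda>x. h x * of_real (t x ^ j * exp (- t x))) \<in> l2closure (wmeas s) (generators s l a)" for j
    proof -
      have "atom s l (a k - real k + s * real j) q \<in> generators s l a" using q unfolding generators_def by blast
      then have "(\<lambda>x. of_real ((l / s) ^ j) * atom s l (a k - real k + s * real j) q x) \<in> cspan (generators s l a)"
        by (intro cspan_scale cspan_base)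
      moreover have "rapid (\<lambda>x. of_real ((l / s) ^ j) * atom s l (a k - real k + s * real j) q x)"
        by (intro rapid_scale rapid_atom[OF s l qc]) (use a s in auto)
      ultimately have "(\<lambda>x. of_real ((l / s) ^ j) * atom s l (a k - real k + s * real j) q x) \<in> l2closure (wmeas s) (generators s l a)"
        by (intro cspan_l2closure) (auto simp: rapid_measurable)
      then show ?thesis using atom[of _ j 1] by simp
    qed
    show "l2sq (wmeas s) (\<lambda>x. h x * of_real (t x ^ j * exp (- c * t x))) < \<infinity>" if "c > 0" for j c
      unfolding atom using s l a that
      by (intro l2sq_rapid_finite rapid_scale rapid_atom[OF _ _ qc]) auto
    show "continuous_on UNIV d"
      unfolding d_def \<rho>_def using s l \<delta>
      by (intro continuous_intros continuous_on_compose2[OF c(1)] continuous_on_powr') (auto simp: less_max_iff_disj)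
    fix u assume u: "u \<ge> l * (R + 1) powr s / s"
    then have "s * u / l \<ge> (R + 1) powr s" using s l by (simp add: field_simps)
    then have "max 0 (s * u / l) \<ge> (R + 1) powr s" by simp
    then have "\<rho> u \<ge> ((R + 1) powr s) powr (1 / s)"
      unfolding \<rho>_def using s by (intro powr_mono2) auto
    then have "\<rho> u \<ge> R + 1" using s R by (simp add: powr_powr)
    then show "d u = 0" using c(3)[of "\<rho> u"] by (simp add: d_def)
  qed
  then show ?thesis by (simp add: eq)
qed

lemma hspan_closure:
  fixes f :: "real^'n \<Rightarrow> complex" and \<psi> :: "real \<Rightarrow> complex"
  assumes s: "s > 0" and l: "l > 0" and a: "\<And>k. a k \<ge> 0"
    and c: "continuous_on UNIV \<psi>" "\<And>r. r < \<delta> \<Longrightarrow> \<psi> r = 0" "\<And>r. r > R \<Longrightarrow> \<psi> r = 0" and \<delta>: "\<delta> > 0" and R: "R \<ge> 0"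
  shows "f \<in> hspan \<Longrightarrow> (\<lambda>x. \<psi> (norm x) * f x) \<in> l2closure (wmeas s) (generators s l a)"
proof (induction rule: hspan.induct)
  case (hspan_step f b k p)
  have "(\<lambda>x. (\<psi> (norm x) * b (norm x)) * p x) \<in> l2closure (wmeas s) (generators s l a)"
    using c by (intro generator_closure[OF s l a hspan_step.hyps(3) _ _ _ \<delta> R]) (auto intro: continuous_on_mult hspan_step.hyps)
  from l2closure_add[OF this hspan_step.IH] show ?case by (simp add: distrib_left mult.assoc)
qed (simp add: l2closure_zero)

text \<open>Equal to 1 on [2/(n+1), n+1] and to 0 outside [1/(n+1), n+2]. A neighbourhood of the
  origin is cut away as well, because a rapid function may be discontinuous there.\<close>

definition cutoff :: "nat \<Rightarrow> real \<Rightarrow> real" where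
  "cutoff n r = max 0 (min 1 (real (Suc n) * r - 1)) * max 0 (min 1 (real (Suc n) + 1 - r))"

lemma cutoff_range: "0 \<le> cutoff n r" "cutoff n r \<le> 1"
  unfolding cutoff_def by (auto intro!: mult_nonneg_nonneg mult_le_one)

lemma continuous_cutoff: "continuous_on A (cutoff n)"
  unfolding cutoff_def by (intro continuous_intros)

lemma cutoff_support: "r < 1 / real (Suc n) \<Longrightarrow> cutoff n r = 0" "r > real (Suc n) + 1 \<Longrightarrow> cutoff n r = 0"
  by (auto simp: cutoff_def field_simps)

lemma cutoff_tendsto:
  assumes "r > 0"
  shows "(\<lambda>n. cutoff n r) \<longlonglongrightarrow> 1"
proof (rule tendsto_eventually)
  show "\<forall>\<^sub>F n in sequentially. cutoff n r = 1"
    using eventually_ge_at_top[of "nat \<lceil>max r (2 / r)\<rceil>"]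
  proof eventually_elim
    case (elim n)
    then have "max r (2 / r) \<le> real n" by linarith
    then have n: "r \<le> real n" "2 / r \<le> real n" by auto
    then have "2 \<le> real n * r" using assms by (simp add: divide_le_eq)
    then have "real (Suc n) * r - 1 \<ge> 1" using assms by (simp add: algebra_simps)
    then show ?case using n(1) by (simp add: cutoff_def min_def)
  qed
qed

text \<open>The cutoff confines the function to an annulus, a compact set on which it is continuous.
  Polynomials approximate it there by Stone-Weierstrass and belong to \<open>hspan\<close>;
  multiplying them by the same cutoff extends the estimate to the whole space.\<close>

lemma rapid_in_closure:
  fixes v :: "real^'n \<Rightarrow> complex"
  assumes N: "CARD('n) \<ge> 2" and s: "s > 0" and l: "l > 0" and a: "\<And>k. a k \<ge> 0" and v: "rapid v"
  shows "v \<in> l2closure (wmeas s) (generators s l a)"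
proof (rule l2closure_limit)
  note [measurable] = rapid_measurable[OF v]
  have cm [measurable]: "cutoff n \<in> borel_measurable borel" for n
    using continuous_cutoff by (rule borel_measurable_continuous_onI)
  show "v \<in> borel_measurable (wmeas s)" by simp
  let ?g = "\<lambda>n x. of_real (cutoff n (norm x)) * v x"
  show "(\<lambda>n. l2sq (wmeas s) (\<lambda>x. v x - ?g n x)) \<longlonglongrightarrow> 0"
  proof (rule l2sq_dominated_convergence[where h=v])
    have "AE x in (lborel :: (real^'n) measure). (\<lambda>n. ?g n x) \<longlonglongrightarrow> v x"
      using AE_lborel_neq[of 0]
    proof eventually_elim
      case (elim x)
      then have "(\<lambda>n. ?g n x) \<longlonglongrightarrow> of_real 1 * v x" by (intro tendsto_intros cutoff_tendsto) auto
      then show ?case by simp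
    qed
    then show "AE x in wmeas s. (\<lambda>n. ?g n x) \<longlonglongrightarrow> v x"
      unfolding wmeas_def by (subst AE_density) auto
    fix n x
    have "v x - ?g n x = of_real (1 - cutoff n (norm x)) * v x" by (simp add: algebra_simps)
    then have "cmod (v x - ?g n x) = \<bar>1 - cutoff n (norm x)\<bar> * cmod (v x)" by (simp only: norm_mult norm_of_real)
    also have "\<dots> \<le> 1 * cmod (v x)" using cutoff_range[of n "norm x"] by (intro mult_right_mono) auto
    finally show "cmod (v x - ?g n x) \<le> cmod (v x)" by simp
  qed (use l2sq_rapid_finite[OF v] s in auto)
  fix n
  show "?g n \<in> l2closure (wmeas s) (generators s l a)"
  proof (rule l2closure_trans)
    show "?g n \<in> borel_measurable (wmeas s)" by simp
    fix \<epsilon> :: real assume \<epsilon>: "\<epsilon> > 0"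
    define A where "A = cball (0::real^'n) (real (Suc n) + 1) - ball 0 (1 / real (Suc n))"
    have A: "compact A" unfolding A_def by (intro compact_diff) auto
    have cv: "continuous_on A v" by (rule continuous_on_subset[OF rapid_continuous[OF v]]) (auto simp: A_def)
    define S where "S = l2sq (wmeas s) (\<lambda>x::real^'n. indicator A x)"
    have Am [measurable]: "A \<in> sets borel" using A by (simp add: borel_compact)
    have S: "S < \<infinity>"
    proof -
      have "S = (\<integral>\<^sup>+x. ennreal (norm x powr s * (cmod (indicator A x))\<^sup>2) \<partial>lborel)"
        unfolding S_def by (rule l2sq_wmeas) simp
      also have "\<dots> \<le> (\<integral>\<^sup>+x. ennreal ((real (Suc n) + 1) powr s) * indicator A x \<partial>lborel)"
      proof (rule nn_integral_mono)
        fix x :: "real^'n"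
        show "ennreal (norm x powr s * (cmod (indicator A x))\<^sup>2) \<le> ennreal ((real (Suc n) + 1) powr s) * indicator A x"
        proof (cases "x \<in> A")
          case True
          then have "norm x powr s \<le> (real (Suc n) + 1) powr s" using s by (intro powr_mono2) (auto simp: A_def)
          then show ?thesis using True by (simp add: ennreal_leI)
        qed simp
      qed
      also have "\<dots> = ennreal ((real (Suc n) + 1) powr s) * emeasure lborel A" by (simp add: nn_integral_cmult_indicator)
      also have "\<dots> < \<infinity>" using emeasure_bounded_finite[OF compact_imp_bounded[OF A]] by (simp add: ennreal_mult_less_top)
      finally show ?thesis .
    qed
    then obtain S' where S': "S = ennreal S'" "S' \<ge> 0" by (cases S) auto
    define \<delta> where "\<delta> = sqrt (\<epsilon> / (S' + 1))"
    have \<delta>: "\<delta> > 0" "\<delta>\<^sup>2 * S' < \<epsilon>"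
    proof -
      show "\<delta> > 0" using \<epsilon> S' by (simp add: \<delta>_def)
      have "\<delta>\<^sup>2 * S' = \<epsilon> * (S' / (S' + 1))" using \<epsilon> S' by (simp add: \<delta>_def)
      also have "\<dots> < \<epsilon> * 1" using \<epsilon> S' by (intro mult_strict_left_mono) auto
      finally show "\<delta>\<^sup>2 * S' < \<epsilon>" by simp
    qed
    obtain f where f: "polynomial_function f" "\<And>x. x \<in> A \<Longrightarrow> cmod (v x - f x) < \<delta>"
      using Stone_Weierstrass_polynomial_function[OF A cv \<delta>(1)] by blast
    have fh: "f \<in> hspan" by (rule cpoly_hspan[OF N polynomial_function_cpoly[OF f(1)]])
    have c1: "complex_of_real (cutoff n r) = 0" if "r < 1 / real (Suc n)" for r
      by (simp only: cutoff_support(1)[OF that] of_real_0)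
    have c2: "complex_of_real (cutoff n r) = 0" if "r > real (Suc n) + 1" for r
      by (simp only: cutoff_support(2)[OF that] of_real_0)
    have g: "(\<lambda>x. (\<lambda>r. of_real (cutoff n r)) (norm x) * f x) \<in> l2closure (wmeas s) (generators s l a)"
      by (rule hspan_closure[where a=a and \<delta>="1 / real (Suc n)" and R="real (Suc n) + 1", OF s l a _ c1 c2 _ _ fh])
         (auto intro!: continuous_on_of_real continuous_cutoff)
    have "l2sq (wmeas s) (\<lambda>x. ?g n x - of_real (cutoff n (norm x)) * f x) \<le> l2sq (wmeas s) (\<lambda>x. of_real \<delta> * indicator A x)"
    proof (rule l2sq_mono)
      fix x :: "real^'n"
      have e: "?g n x - of_real (cutoff n (norm x)) * f x = of_real (cutoff n (norm x)) * (v x - f x)" by (simp add: algebra_simps)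
      show "cmod (?g n x - of_real (cutoff n (norm x)) * f x) \<le> cmod (of_real \<delta> * indicator A x)"
      proof (cases "x \<in> A")
        case True
        have "cutoff n (norm x) * cmod (v x - f x) \<le> 1 * \<delta>"
          using f(2)[OF True] cutoff_range[of n "norm x"] \<delta>(1) by (intro mult_mono) auto
        then show ?thesis unfolding e using True cutoff_range[of n "norm x"] \<delta>(1) by (simp add: norm_mult)
      next
        case False
        then have "cutoff n (norm x) = 0" using cutoff_support[where r="norm x" and n=n] by (auto simp: A_def not_le)
        then show ?thesis unfolding e by simp
      qed
    qed
    also have "\<dots> = ennreal (\<delta>\<^sup>2) * S"
      unfolding S_def using \<delta>(1) by (subst l2sq_scale) auto
    also have "\<dots> = ennreal (\<delta>\<^sup>2 * S')" using S' by (simp add: ennreal_mult)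
    also have "\<dots> < ennreal \<epsilon>" by (rule ennreal_lessI[OF \<epsilon> \<delta>(2)])
    finally show "\<exists>g\<in>l2closure (wmeas s) (generators s l a). l2sq (wmeas s) (\<lambda>x. ?g n x - g x) < ennreal \<epsilon>"
      by (intro bexI[OF _ g])
  qed
qed

theorem generators_dense:
  fixes v :: "real^'n \<Rightarrow> complex"
  assumes N: "CARD('n) \<ge> 2" and s: "s > 0" and l: "l > 0" and a: "\<And>k. a k \<ge> 0" and v: "rapid v" and \<epsilon>: "\<epsilon> > 0"
  shows "\<exists>w\<in>cspan (generators s l a). Re (wip s (\<lambda>x. v x - w x) (\<lambda>x. v x - w x)) \<le> \<epsilon>"
proof -
  obtain w where w: "w \<in> cspan (generators s l a)" "l2sq (wmeas s) (\<lambda>x. v x - w x) < ennreal \<epsilon>"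
    using l2closureD[OF rapid_in_closure[where a=a, OF N s l a v] \<epsilon>] by blast
  have "rapid w"
    using w(1)
  proof (induction rule: cspan.induct)
    case (cspan_step w e c)
    then obtain k p q where "e = atom s l (a k - real k + s * real p) q" "q \<in> cpoly" "hom k q"
      by (auto simp: generators_def harmonic_iff)
    then have "rapid e" using a[of k] s by (auto intro!: rapid_atom[OF s l])
    then show ?case using cspan_step by (intro rapid_add rapid_scale)
  qed simp
  then have "l2sq (wmeas s) (\<lambda>x. v x - w x) = ennreal (Re (wip s (\<lambda>x. v x - w x) (\<lambda>x. v x - w x)))"
    using s v by (intro l2sq_rapid rapid_diff) auto
  with w(2) have "Re (wip s (\<lambda>x. v x - w x) (\<lambda>x. v x - w x)) < \<epsilon>"
    by (simp add: ennreal_less_iff wip_nonneg)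
  with w(1) show ?thesis by (intro bexI[of _ w]) auto
qed

section \<open>The spectral inequality\<close>

lemma D_const_0 [simp]: "D_const N 0 = 0"
  by (simp add: D_const_def c_const_def)

lemma c_const_nonneg: "N \<ge> 2 \<Longrightarrow> c_const N k \<ge> 0"
  by (simp add: c_const_def)

lemma c_const_strict_mono:
  assumes "N \<ge> 2" "j < k"
  shows "c_const N j < c_const N k"
proof -
  have "real j * (real N + real j - 2) \<le> real j * (real N + real k - 2)" using assms by (intro mult_left_mono) auto
  also have "\<dots> < real k * (real N + real k - 2)" using assms by (intro mult_strict_right_mono) auto
  finally show ?thesis by (simp add: c_const_def)
qed

lemma D_const_strict_mono: "N \<ge> 2 \<Longrightarrow> j < k \<Longrightarrow> D_const N j < D_const N k"
  using c_const_strict_mono[of N j k] by (simp add: D_const_def)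

lemma D_const_mono: "N \<ge> 2 \<Longrightarrow> j \<le> k \<Longrightarrow> D_const N j \<le> D_const N k"
  using D_const_strict_mono[of N j k] by (cases "j = k") auto

lemma D_const_nonneg: "N \<ge> 2 \<Longrightarrow> D_const N k \<ge> 0"
  using D_const_mono[of N 0 k] by simp

text \<open>By the quadratic formula. This is the equation that makes |x|^(D_k/2) times a spherical
  harmonic of degree k, times the exponential, an eigenfunction.\<close>

lemma D_const_indicial:
  assumes "N \<ge> 2"
  shows "D_const N k / 2 * (real N + D_const N k / 2) = c_const N k"
proof -
  let ?r = "sqrt ((real N)\<^sup>2 + 4 * c_const N k)"
  have "?r\<^sup>2 = (real N)\<^sup>2 + 4 * c_const N k" using c_const_nonneg[OF assms, of k] by simp
  moreover have "D_const N k / 2 * (real N + D_const N k / 2) = (?r\<^sup>2 - (real N)\<^sup>2) / 4"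
    by (simp add: D_const_def field_simps power2_eq_square)
  ultimately show ?thesis by simp
qed

lemma eigen_defect_indicial:
  assumes "N \<ge> 2"
  shows "eigen_defect N k (D_const N k / 2 - real k) = 0"
proof -
  let ?a = "D_const N k / 2"
  have "eigen_defect N k (?a - real k) = ?a * (real N + ?a) - c_const N k"
    by (simp add: eigen_defect_def c_const_def field_simps)
  then show ?thesis using D_const_indicial[OF assms, of k] by simp
qed

text \<open>From c_k >= k^2. The linear growth bounds the indices admissible for \<open>m\<close>,
  so that a greatest one exists.\<close>

lemma D_const_ge: 
  assumes "N \<ge> 2"
  shows "D_const N k \<ge> 2 * real k - real N"
proof -
  have "real k * real k \<le> c_const N k" unfolding c_const_def using assms by (intro mult_left_mono) auto
  moreover have "(2 * real k)\<^sup>2 = 4 * (real k * real k)" by (simp add: power2_eq_square)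
  moreover have "0 \<le> (real N)\<^sup>2" by simp
  ultimately have "(2 * real k)\<^sup>2 \<le> (real N)\<^sup>2 + 4 * c_const N k" by linarith
  then show ?thesis by (simp add: D_const_def real_le_rsqrt)
qed

text \<open>Turns the hypothesis on s into D_1 <= 2s, so that m = 1 is admissible. With u = N + D_1
  and w = N + D_2 the claim is 2u <= N + w, and squaring reduces it to N^2 + 4N - 8 <= N w.\<close>

lemma D_const_1_le: 
  assumes "N \<ge> 2"
  shows "D_const N 1 \<le> D_const N 2 - D_const N 1"
proof -
  let ?N = "real N"
  define u where "u = sqrt (?N\<^sup>2 + 4 * ?N - 4)"
  define w where "w = sqrt (?N\<^sup>2 + 8 * ?N)"
  have N: "?N \<ge> 2" using assms by simp
  have u: "D_const N 1 = u - ?N" by (simp add: D_const_def c_const_def u_def algebra_simps)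
  have w: "D_const N 2 = w - ?N" by (simp add: D_const_def c_const_def w_def algebra_simps)
  have "4 \<le> ?N\<^sup>2" using power_mono[of 2 ?N 2] N by simp
  then have sq: "u\<^sup>2 = ?N\<^sup>2 + 4 * ?N - 4" "w\<^sup>2 = ?N\<^sup>2 + 8 * ?N"
    using N by (simp_all add: u_def w_def)
  have w0: "w \<ge> 0" using N by (simp add: w_def)
  have "?N + 2 \<le> w" unfolding w_def using N by (intro real_le_rsqrt) (simp add: power2_eq_square algebra_simps)
  \<comment> \<open>A rational lower bound for w = sqrt ((N + 4)^2 - 16). With the denominator N + 2
    the product exceeds the required N^2 + 4N - 8 by exactly 16 / (N + 2).\<close>
  have "?N * (?N + 4 - 8 / (?N + 2)) \<le> ?N * w"
  proof (intro mult_left_mono)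
    have "(?N + 4 - 8 / (?N + 2))\<^sup>2 \<le> ?N\<^sup>2 + 8 * ?N"
    proof -
      define z where "z = 8 / (?N + 2)"
      have cancel: "8 / y * y = 8" if "y \<noteq> 0" for y :: real using that by simp
      have z: "z * (?N + 2) = 8" unfolding z_def by (rule cancel) (use N in linarith)
      have z': "z \<ge> 0" "z \<le> 2" using N by (simp_all add: z_def divide_le_eq)
      have "(?N + 4 - z)\<^sup>2 = ?N\<^sup>2 + 8 * ?N + 16 - 2 * (z * (?N + 2)) - 4 * z + z * z"
        by (simp add: power2_eq_square algebra_simps)
      also have "\<dots> = ?N\<^sup>2 + 8 * ?N - 4 * z + z * z" unfolding z by simp
      also have "\<dots> \<le> ?N\<^sup>2 + 8 * ?N" using z' mult_right_mono[of z 4 z] by simp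
      finally show ?thesis by (simp add: z_def)
    qed
    then show "?N + 4 - 8 / (?N + 2) \<le> w" unfolding w_def by (rule real_le_rsqrt)
  qed (use N in auto)
  moreover have "?N * (?N + 4 - 8 / (?N + 2)) = ?N\<^sup>2 + 4 * ?N - 8 + 16 / (?N + 2)"
    using N by (simp add: field_simps power2_eq_square)
  moreover have "16 / (?N + 2) \<ge> 0" using N by simp
  ultimately have Nw: "?N\<^sup>2 + 4 * ?N - 8 \<le> ?N * w" by linarith
  have "(2 * u)\<^sup>2 \<le> (?N + w)\<^sup>2"
    using Nw by (simp add: power_mult_distrib sq power2_sum)
  then have "2 * u \<le> ?N + w" using N w0 by (intro power2_le_imp_le[of "2 * u"]) auto
  then show ?thesis unfolding u w by linarith
qed

lemma greatest_index:
  fixes s :: real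
  assumes N: "N \<ge> 2" and s: "s \<ge> (D_const N 2 - D_const N 1) / 2"
    and m: "m = (GREATEST m. m \<ge> 1 \<and> D_const N m \<le> 2 * s \<and> D_const N (m + 1) - D_const N 1 \<le> 2 * s)"
  shows "m \<ge> 1" "D_const N m \<le> 2 * s" "D_const N (m + 1) - D_const N 1 \<le> 2 * s"
proof -
  let ?P = "\<lambda>m. m \<ge> 1 \<and> D_const N m \<le> 2 * s \<and> D_const N (m + 1) - D_const N 1 \<le> 2 * s"
  have "?P 1" using s D_const_1_le[OF N] by (simp add: numeral_2_eq_2)
  moreover have "\<forall>k. ?P k \<longrightarrow> k \<le> nat \<lceil>(2 * s + real N) / 2\<rceil>"
  proof (intro allI impI)
    fix k assume "?P k"
    then have "2 * real k \<le> 2 * s + real N" using D_const_ge[OF N, of k] by linarith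
    then have "real k \<le> (2 * s + real N) / 2" by simp
    then show "k \<le> nat \<lceil>(2 * s + real N) / 2\<rceil>" by linarith
  qed
  ultimately have "?P (Greatest ?P)" by (intro GreatestI_nat[where P="?P" and k=1]) blast+
  then show "m \<ge> 1" "D_const N m \<le> 2 * s" "D_const N (m + 1) - D_const N 1 \<le> 2 * s"
    unfolding m by blast+
qed

lemma sum_beta_lt: "j < m \<Longrightarrow> (\<Sum>i\<le>j. \<beta> N s m i) = D_const N (j + 1)"
  by (induction j) (auto simp: \<beta>_def)

lemma sum_beta:
  assumes "m \<ge> 1"
  shows "(\<Sum>i\<le>m. \<beta> N s m i) = min (2 * s) (D_const N (m + 1))"
    "(\<Sum>i\<le>m + 1. \<beta> N s m i) = D_const N (m + 1)"
proof -
  obtain k where k: "m = Suc k" using assms by (cases m) auto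
  have "(\<Sum>i\<le>m. \<beta> N s m i) = (\<Sum>i\<le>k. \<beta> N s m i) + \<beta> N s m m" by (simp add: k)
  also have "\<dots> = D_const N m + \<beta> N s m m" using sum_beta_lt[of k m N s] by (simp add: k)
  finally show 1: "(\<Sum>i\<le>m. \<beta> N s m i) = min (2 * s) (D_const N (m + 1))" by (simp add: \<beta>_def)
  have "(\<Sum>i\<le>m + 1. \<beta> N s m i) = (\<Sum>i\<le>m. \<beta> N s m i) + \<beta> N s m (m + 1)" by simp
  then show "(\<Sum>i\<le>m + 1. \<beta> N s m i) = D_const N (m + 1)" unfolding 1 by (simp add: \<beta>_def)
qed

lemma beta_nonneg:
  assumes "N \<ge> 2" "D_const N m \<le> 2 * s"
  shows "\<beta> N s m j \<ge> 0"
  using assms D_const_mono[of N j "j+1"] D_const_mono[of N m "m+1"] by (auto simp: \<beta>_def)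

text \<open>For \<open>a k = D\<^sub>k / 2\<close> and \<open>j \<le> m + 1\<close>, the union over \<open>l > 0\<close> of these spaces consists of the transforms
  of the elements of the class \<open>\<H>\<close> with index \<open>j\<close>.\<close>

definition stable_space :: "real \<Rightarrow> real \<Rightarrow> (nat \<Rightarrow> real) \<Rightarrow> nat \<Rightarrow> nat \<Rightarrow> (real^'n \<Rightarrow> complex) set" where
  "stable_space s l a m j = cspan ({atom s l (a k - real k) q | k q. k \<le> j \<and> k \<le> m \<and> harmonic_homogeneous_poly k q}
     \<union> (if j \<le> m then {} else {atom s l s (\<lambda>x. 1)}))"

lemma form_domain_zero: "(\<lambda>x::real^'n. 0) \<in> form_domain"
  by (rule form_domainI[OF _ has_partial_const]) auto

lemma form_pair_qform:
  assumes N: "CARD('n::finite) \<ge> 2" and s: "s > 0" and l: "l > 0"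
  shows "form_pair (form_domain :: (real^'n \<Rightarrow> complex) set) (wip s) (qform s l)"
proof -
  have "hermitian_form (form_domain :: (real^'n \<Rightarrow> complex) set) (wip s)"
    using s by unfold_locales
      (auto intro: form_domain_zero form_domain_add(1) form_domain_scale(1) wip_add wip_scale wip_cnj wip_nonneg simp: form_domain_rapid)
  moreover have "hermitian_form (form_domain :: (real^'n \<Rightarrow> complex) set) (qform s l)"
    using s by unfold_locales
      (auto intro: form_domain_zero form_domain_add(1) form_domain_scale(1) qform_add qform_scale qform_cnj qform_nonneg[OF N _ _ l])
  ultimately show ?thesis by (simp add: form_pair_def)
qed

text \<open>The abstract inequality with b_j = \<beta>_j / 2, whose partial sums are D_1/2, ...,
  D_m/2, min (s, D_(m+1)/2), D_(m+1)/2. It remains to see that all eigenfunctions below the j-th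
  partial sum lie in the j-th space.\<close>

theorem spectral_inequality:
  fixes v :: "real^'n \<Rightarrow> complex"
  assumes N: "CARD('n) \<ge> 2" and s: "s > 0" and l: "l > 0" and v: "v \<in> form_domain"
    and m: "m \<ge> 1" "D_const CARD('n) m \<le> 2 * s" "D_const CARD('n) (m + 1) - D_const CARD('n) 1 \<le> 2 * s"
    and d: "\<And>j h. j \<le> m + 1 \<Longrightarrow> h \<in> stable_space s l (\<lambda>k. D_const CARD('n) k / 2) m j \<Longrightarrow> d j \<le> Re (wip s (\<lambda>x. v x - h x) (\<lambda>x. v x - h x))"
  shows "(\<Sum>j\<le>m + 1. \<beta> CARD('n) s m j / 2 * d j) \<le> Re (qform s l v v)"
proof -
  let ?N = "CARD('n)"
  define a where "a k = D_const ?N k / 2" for k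
  define b where "b j = \<beta> ?N s m j / 2" for j
  interpret form_pair "form_domain :: (real^'n \<Rightarrow> complex) set" "wip s" "qform s l"
    by (rule form_pair_qform[OF N s l])
  have a0: "a k \<ge> 0" for k using D_const_nonneg[OF N] by (simp add: a_def)
  have az: "a 0 = 0" by (simp add: a_def)
  have amono: "a j \<le> a k" if "j \<le> k" for j k using D_const_mono[OF N that] by (simp add: a_def)
  have am: "a m \<le> s" "a (m + 1) \<le> a 1 + s" "a 1 \<le> s"
    using m(2,3) amono[OF m(1)] by (auto simp: a_def)
  have bsum: "(\<Sum>i\<le>j. b i) = a (j + 1)" if "j < m" for j
    using sum_beta_lt[OF that, of ?N s] by (simp add: b_def a_def flip: sum_divide_distrib)
  have bsum_m: "(\<Sum>i\<le>m. b i) = min s (a (m + 1))" "(\<Sum>i\<le>m + 1. b i) = a (m + 1)"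
    using sum_beta[OF m(1), of ?N s] by (simp_all add: b_def a_def min_def del: sum.atMost_Suc flip: sum_divide_distrib)
  define g where "g k q p = atom s l (a k - real k + s * real p) (q :: real^'n \<Rightarrow> complex)" for k q p
  define \<nu> where "\<nu> k p = a k + s * real p" for k p
  define E where "E k q = (\<Union>p. eigset (g k q) (\<nu> k) p)" for k q
  have g_in: "g k q p \<in> form_domain" if "harmonic_homogeneous_poly k q" for k q p
    unfolding g_def using that s a0[of k] by (intro atom_form_domain[OF s l, of _ k]) (auto simp: harmonic_iff)
  have g_span: "g k q p \<in> cspan (E k q)" if hq: "harmonic_homogeneous_poly k q" for k q p
  proof -
    \<comment> \<open>The off-diagonal entry: the defect term in \<open>qform_atom\<close> is an
      unweighted integral, and moving |x|^s out of the atom turns it into the weighted product with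
      the generator of index p - 1. It vanishes for p = 0 by the indicial equation.\<close>
    define \<gamma> where "\<gamma> p = eigen_defect ?N k (a k - real k + s * real p) / (2 * l)" for p
    have "g k q p \<in> cspan (\<Union>p'\<le>p. eigset (g k q) (\<nu> k) p')"
    proof (rule triangular_eigenvectors[where \<gamma>=\<gamma>])
      show "strict_mono (\<nu> k)" using s by (simp add: strict_mono_def \<nu>_def)
      show z: "\<gamma> 0 = 0" using eigen_defect_indicial[OF N, of k] by (simp add: \<gamma>_def a_def)
      fix p and x :: "real^'n \<Rightarrow> complex" assume x: "x \<in> form_domain"
      have b: "a k - real k + s * real p + real k \<ge> 0" using a0[of k] s by simp
      have "of_real (\<gamma> p) * (LINT y|lborel. x y * cnj (g k q p y)) = of_real (\<gamma> p) * wip s x (g k q (p - 1))"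
      proof (cases p)
        case 0
        then show ?thesis by (simp add: z)
      next
        case (Suc p')
        have "g k q p y = of_real (norm y powr s) * g k q p' y" for y
          unfolding g_def norm_powr_mult_atom using Suc by (simp add: algebra_simps)
        then show ?thesis using Suc by (simp add: wip_def mult_ac)
      qed
      moreover have "qform s l x (g k q p) = of_real (\<nu> k p) * wip s x (g k q p) - of_real (\<gamma> p) * (LINT y|lborel. x y * cnj (g k q p y))"
        unfolding g_def qform_atom[OF N s l hq b x] by (simp add: \<nu>_def \<gamma>_def)
      ultimately show "qform s l x (g k q p) = of_real (\<nu> k p) * wip s x (g k q p) - of_real (\<gamma> p) * wip s x (g k q (p - 1))"
        by simp
    qed (rule g_in[OF hq])
    then show ?thesis by (rule cspan_mono) (auto simp: E_def)
  qed
  define EE where "EE = (\<Union>k. \<Union>q\<in>{q. harmonic_homogeneous_poly k q}. E k q)"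
  have "\<exists>t. \<exists>k q p. t = a k + s * real p \<and> harmonic_homogeneous_poly k q \<and> e \<in> eigset (g k q) (\<nu> k) p" if "e \<in> EE" for e
    using that by (auto simp: EE_def E_def)
  then have "\<forall>e. \<exists>t. e \<in> EE \<longrightarrow> (\<exists>k q p. t = a k + s * real p \<and> harmonic_homogeneous_poly k q \<and> e \<in> eigset (g k q) (\<nu> k) p)"
    by blast
  from choice[OF this] obtain \<mu> where \<mu>: "\<And>e. e \<in> EE \<Longrightarrow> \<exists>k q p. \<mu> e = a k + s * real p \<and> harmonic_homogeneous_poly k q \<and> e \<in> eigset (g k q) (\<nu> k) p"
    by blast
  have eig: "eigvec (\<mu> e) e" "\<mu> e \<ge> 0" if "e \<in> EE" for e
  proof -
    from \<mu>[OF that] obtain k q p where "\<mu> e = a k + s * real p" "e \<in> eigset (g k q) (\<nu> k) p" by blast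
    then show "eigvec (\<mu> e) e" "\<mu> e \<ge> 0" using a0[of k] s by (auto simp: eigset_def \<nu>_def)
  qed
  \<comment> \<open>The eigenvalue is a_k + s p with a_k = D_k / 2. Either p = 0, and a_k lying
    below the threshold limits k; or p >= 1, and the eigenvalue is at least s, which forces the last
    index j = m + 1.\<close>
  have low: "e \<in> stable_space s l a m j" if e: "e \<in> EE" and j: "j \<le> m + 1" and lt: "\<mu> e < (\<Sum>i\<le>j. b i)" for e j
  proof -
    obtain k q p where kqp: "\<mu> e = a k + s * real p" "harmonic_homogeneous_poly k q" "e \<in> eigset (g k q) (\<nu> k) p" using \<mu>[OF e] by blast
    then obtain h where h: "h \<in> cspan (g k q ` {..<p})" "e = (\<lambda>x. g k q p x + h x)" by (auto simp: eigset_def)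
    have bs: "(\<Sum>i\<le>j. b i) \<le> a (m + 1)" "j \<le> m \<Longrightarrow> (\<Sum>i\<le>j. b i) \<le> s" "j < m \<Longrightarrow> (\<Sum>i\<le>j. b i) = a (j + 1)"
    proof -
      show "j < m \<Longrightarrow> (\<Sum>i\<le>j. b i) = a (j + 1)" by (rule bsum)
      consider "j < m" | "j = m" | "j = m + 1" using j by linarith
      then have "(\<Sum>i\<le>j. b i) \<le> a (m + 1) \<and> (j \<le> m \<longrightarrow> (\<Sum>i\<le>j. b i) \<le> s)"
      proof cases
        case 1
        then show ?thesis using bsum[OF 1] amono[of "j+1" m] amono[of m "m+1"] am(1) by simp
      next
        case 2
        then show ?thesis using bsum_m(1) by simp
      next
        case 3
        then show ?thesis using bsum_m(2) by simp
      qed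
      then show "(\<Sum>i\<le>j. b i) \<le> a (m + 1)" "j \<le> m \<Longrightarrow> (\<Sum>i\<le>j. b i) \<le> s" by auto
    qed
    consider "p = 0" | "p \<ge> 1" by linarith
    then show ?thesis
    proof cases
      case 1
      then have "h = (\<lambda>x. 0)" using h(1) by (auto elim: cspan.cases)
      then have e_eq: "e = atom s l (a k - real k) q" using 1 h(2) by (simp add: g_def)
      have "a k < (\<Sum>i\<le>j. b i)" using lt kqp(1) 1 by simp
      then have km: "a k < a (m + 1)" "j < m \<Longrightarrow> a k < a (j + 1)" using bs by auto
      have "k \<le> m" using km(1) amono[of "m+1" k] by (cases "k \<le> m") auto
      moreover have "k \<le> j"
      proof (cases "j < m")
        case True
        then show ?thesis using km(2) amono[of "j+1" k] by (cases "k \<le> j") auto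
      next
        case False
        then show ?thesis using \<open>k \<le> m\<close> by simp
      qed
      ultimately show ?thesis unfolding e_eq stable_space_def using kqp(2) by (intro cspan_base) blast
    next
      case 2
      have sp: "s * real p \<ge> s" using 2 s by simp
      then have "\<mu> e \<ge> s" using kqp(1) a0[of k] by simp
      then have jm: "j = m + 1" using lt bs(2) j by (cases "j \<le> m") auto
      have lt': "a k + s * real p < a (m + 1)" using lt kqp(1) bs(1) by simp
      \<comment> \<open>For k >= 1 and p >= 1 the eigenvalue is at least a_1 + s, hence at least
        a_(m+1).\<close>
      have k0: "k = 0"
      proof (rule ccontr)
        assume "k \<noteq> 0"
        then have "a 1 \<le> a k" by (intro amono) simp
        then show False using lt' sp am(2) by linarith
      qed
      \<comment> \<open>For p >= 2 the eigenvalue is at least 2s >= a_1 + s >= a_(m+1).\<close>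
      have "p = 1"
      proof (rule ccontr)
        assume "p \<noteq> 1"
        then have "s * real p \<ge> s * 2" using 2 s by (intro mult_left_mono) auto
        moreover have "a k = 0" using k0 az by simp
        ultimately show False using lt' am(2,3) by linarith
      qed
      have "hom 0 q" using kqp(2) k0 by (simp add: harmonic_iff)
      then have q0: "q = (\<lambda>x. q 0)" by (rule hom_0_const)
      have g1: "g k q p = (\<lambda>x. q 0 * atom s l s (\<lambda>x. 1) x)"
      proof
        fix x :: "real^'n"
        have qx: "q x = q 0" using q0 by metis
        have "g k q p x = of_real (norm x powr s) * (q x * wexp s l x)"
          by (simp add: g_def k0 \<open>p = 1\<close> az atom_def)
        then show "g k q p x = q 0 * atom s l s (\<lambda>x. 1) x" unfolding qx by (simp add: atom_def)
      qed
      have A: "atom s l s (\<lambda>x. 1) \<in> stable_space s l a m j" unfolding stable_space_def jm by (intro cspan_base) simp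
      have B: "g k q ` {..<p} \<subseteq> stable_space s l a m j"
      proof
        fix f assume "f \<in> g k q ` {..<p}"
        then have "f = atom s l (a k - real k) q" using \<open>p = 1\<close> by (auto simp: g_def)
        moreover have "k \<le> j" "k \<le> m" using k0 by auto
        ultimately show "f \<in> stable_space s l a m j"
          unfolding stable_space_def using kqp(2) by (intro cspan_base UnI1) blast
      qed
      have "h \<in> stable_space s l a m j"
        using cspan_trans[OF h(1)] B unfolding stable_space_def by blast
      then show ?thesis using A unfolding h(2) g1 stable_space_def by (intro cspan_add cspan_scale)
    qed
  qed
  have gen: "generators s l a \<subseteq> cspan EE"
  proof
    fix f :: "real^'n \<Rightarrow> complex" assume "f \<in> generators s l a"
    then obtain k p q where "f = g k q p" "harmonic_homogeneous_poly k q" by (auto simp: generators_def g_def)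
    then have "f \<in> cspan (E k q)" "E k q \<subseteq> EE" using g_span by (auto simp: EE_def)
    then show "f \<in> cspan EE" by (rule cspan_mono)
  qed
  have b0: "b j \<ge> 0" for j using beta_nonneg[OF N m(2), of j] by (simp add: b_def)
  have est: "(\<Sum>j\<le>m + 1. b j * d j) \<le> Re (qform s l v v) + (\<Sum>j\<le>m + 1. b j) * \<epsilon>" if \<epsilon>: "\<epsilon> > 0" for \<epsilon>
  proof -
    obtain w where w: "w \<in> cspan (generators s l a)" "Re (wip s (\<lambda>x. v x - w x) (\<lambda>x. v x - w x)) \<le> \<epsilon>"
      using generators_dense[where a=a, OF N s l a0 form_domain_rapid[OF v] \<epsilon>] by blast
    from cspan_finite[OF cspan_trans[OF w(1) gen]] obtain F where F: "finite F" "F \<subseteq> EE" "w \<in> cspan F" by blast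
    show ?thesis
    proof (rule spectral_stability[where F=F and \<nu>=\<mu> and b=b and d=d])
      fix j h assume j: "j \<le> m + 1" and h: "h \<in> cspan {e \<in> F. \<mu> e < (\<Sum>i\<le>j. b i)}"
      have "{e \<in> F. \<mu> e < (\<Sum>i\<le>j. b i)} \<subseteq> stable_space s l a m j" using low F(2) j by blast
      then have "h \<in> stable_space s l a m j" using cspan_trans[OF h] unfolding stable_space_def by blast
      then show "d j \<le> Re (wip s (\<lambda>x. v x - h x) (\<lambda>x. v x - h x))" using d[OF j] by (simp add: a_def[abs_def])
    qed (use F eig v w b0 in auto)
  qed
  have "(\<Sum>j\<le>m + 1. b j * d j) \<le> Re (qform s l v v)"
  proof (rule field_le_epsilon)
    fix e :: real assume e: "e > 0"
    define B where "B = (\<Sum>j\<le>m + 1. b j)"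
    have B: "B \<ge> 0" unfolding B_def by (intro sum_nonneg b0)
    have "B * (e / (B + 1)) \<le> e" using B e by (simp add: field_simps)
    then show "(\<Sum>j\<le>m + 1. b j * d j) \<le> Re (qform s l v v) + e"
      using est[of "e / (B + 1)"] B e unfolding B_def[symmetric] by simp
  qed
  then show ?thesis by (simp add: b_def)
qed

section \<open>The deficit and the quadratic form\<close>

lemma C0_infinity_inversion:
  fixes u :: "real^'n \<Rightarrow> complex"
  assumes N: "CARD('n) \<ge> 2" and u: "u \<in> C0_infinity"
  shows "AE x in lborel. u x = fourier_integral (fourier_integral u) (- x)"
proof -
  let ?v = "fourier_integral u"
  have v: "rapid ?v" by (rule rapid_fourier_integral[OF N u])
  have "AE \<xi> in lborel. fourier_integral (\<lambda>x. ?v (- x)) \<xi> = u \<xi>"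
    by (intro fourier_integral_inverse rapid_tame C0_infinity_rapid u rapid_reflect v)
  then show ?thesis
    by eventually_elim (simp add: fourier_integral_reflect[OF rapid_measurable[OF v]])
qed

lemma inv_fourier_rapid: "rapid g \<Longrightarrow> inv_fourier g x = fourier_integral g (- x)"
  by (simp add: inv_fourier_def fourier_def rapid_integrable)

lemma inv_fourier_measurable:
  fixes g :: "real^'n \<Rightarrow> complex"
  assumes "rapid g"
  shows "inv_fourier g \<in> borel_measurable borel"
proof -
  have [measurable]: "fourier_integral g \<in> borel_measurable borel"
    by (rule measurable_fourier_integral[OF rapid_integrable[OF assms]])
  have "inv_fourier g = (\<lambda>x. fourier_integral g (- x))" using inv_fourier_rapid[OF assms] by auto
  then show ?thesis by simp
qed

lemma energy_wip:
  fixes g f :: "real^'n \<Rightarrow> complex"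
  assumes g: "rapid g" and f: "AE x in lborel. f x = fourier_integral g (- x)" "f \<in> borel_measurable borel" and a: "a \<ge> 0"
  shows "energy a f = (2 * pi) powr (4 * a) * Re (wip (4 * a) g g)"
proof -
  have eq: "complex_of_real ((2 * pi * norm \<xi>) powr (2 * a)) * g \<xi> = of_real ((2 * pi) powr (2 * a)) * (of_real (norm \<xi> powr (2 * a)) * g \<xi>)" for \<xi>
    by (simp add: powr_mult)
  have "rapid (\<lambda>\<xi>. complex_of_real ((2 * pi * norm \<xi>) powr (2 * a)) * g \<xi>)"
    unfolding eq using a by (intro rapid_scale rapid_powr g) auto
  from energy_eq[OF rapid_tame[OF g] f rapid_tame[OF this]]
  have "energy a f = (LINT \<xi>|lborel. (cmod (of_real ((2 * pi) powr (2 * a)) * (of_real (norm \<xi> powr (2 * a)) * g \<xi>)))\<^sup>2)"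
    unfolding eq .
  also have "\<dots> = (LINT \<xi>|lborel. (2 * pi) powr (4 * a) * (norm \<xi> powr (4 * a) * (cmod (g \<xi>))\<^sup>2))"
  proof (rule Bochner_Integration.integral_cong[OF refl])
    fix \<xi> :: "real^'n"
    have p: "(y powr (2 * a))\<^sup>2 = y powr (4 * a)" for y :: real
      by (simp add: power2_eq_square flip: powr_add)
    show "(cmod (of_real ((2 * pi) powr (2 * a)) * (of_real (norm \<xi> powr (2 * a)) * g \<xi>)))\<^sup>2 = (2 * pi) powr (4 * a) * (norm \<xi> powr (4 * a) * (cmod (g \<xi>))\<^sup>2)"
      by (simp add: norm_mult power_mult_distrib p)
  qed
  also have "\<dots> = (2 * pi) powr (4 * a) * Re (wip (4 * a) g g)" by (simp add: wip_self)
  finally show ?thesis .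
qed

text \<open>The distance of \<open>u\<close> to a class becomes a weighted distance between
  transforms, also where the inverse transform of \<open>g\<close> is neither a test function nor
  integrable.\<close>

lemma energy_diff:
  fixes u g :: "real^'n \<Rightarrow> complex"
  assumes N: "CARD('n) \<ge> 2" and u: "u \<in> C0_infinity" and g: "rapid g" and s: "s > 0"
  shows "energy (s/4) (\<lambda>x. u x - inv_fourier g x) =
    (2 * pi) powr s * Re (wip s (\<lambda>\<xi>. fourier_integral u \<xi> - g \<xi>) (\<lambda>\<xi>. fourier_integral u \<xi> - g \<xi>))"
proof -
  let ?v = "fourier_integral u"
  have v: "rapid ?v" by (rule rapid_fourier_integral[OF N u])
  have [measurable]: "u \<in> borel_measurable borel" "inv_fourier g \<in> borel_measurable borel"
    using rapid_measurable[OF C0_infinity_rapid[OF u]] inv_fourier_measurable[OF g] .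
  have "AE x in lborel. u x - inv_fourier g x = fourier_integral (\<lambda>\<xi>. ?v \<xi> - g \<xi>) (- x)"
    using C0_infinity_inversion[OF N u]
    by eventually_elim (simp add: inv_fourier_rapid[OF g] fourier_integral_diff rapid_integrable v g)
  from energy_wip[OF rapid_diff[OF v g] this, of "s/4"] s show ?thesis by simp
qed

text \<open>The factor (2 pi)^s is common to both terms: in the first it is the root of (2 pi)^(2s),
  the gradient integral contributing no power of 2 pi, and in the second it belongs to the
  energy.\<close>

lemma deficit_eq:
  fixes u :: "real^'n \<Rightarrow> complex"
  assumes N: "CARD('n) \<ge> 2" and u: "u \<in> C0_infinity" and s: "s > 0"
  defines "v \<equiv> fourier_integral u"
  shows "deficit s u = (2 * pi) powr s * (sqrt (Re (wip (2 * s) v v)) * sqrt (Re (gip v v)) - (real CARD('n) + s) / 2 * Re (wip s v v))"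
proof -
  have v: "rapid v" unfolding v_def by (rule rapid_fourier_integral[OF N u])
  have um: "u \<in> borel_measurable borel" using rapid_measurable[OF C0_infinity_rapid[OF u]] .
  note inv = C0_infinity_inversion[OF N u, folded v_def]
  have e1: "energy (s/2) u = (2 * pi) powr (2 * s) * Re (wip (2 * s) v v)"
    using energy_wip[OF v inv um, of "s/2"] s by simp
  have e2: "energy (s/4) u = (2 * pi) powr s * Re (wip s v v)"
    using energy_wip[OF v inv um, of "s/4"] s by simp
  have "sqrt ((2 * pi) powr (2 * s)) = (2 * pi) powr s"
  proof (rule real_sqrt_unique)
    show "((2 * pi) powr s)\<^sup>2 = (2 * pi) powr (2 * s)" by (simp add: power2_eq_square flip: powr_add)
  qed simp
  then have "sqrt (energy (s/2) u) = (2 * pi) powr s * sqrt (Re (wip (2 * s) v v))"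
    unfolding e1 real_sqrt_mult by simp
  then show ?thesis
    unfolding deficit_def e2 weighted_gradient_identity[OF N u] v_def[symmetric] by (simp add: algebra_simps)
qed

text \<open>The minimizing l is sqrt B / sqrt A. Since \<open>A\<close> or \<open>B\<close> may be
  zero, both roots are enlarged by a small t > 0.\<close>

lemma optimal_scale:
  fixes S A B C :: real
  assumes A: "A \<ge> 0" and B: "B \<ge> 0" and le: "\<And>l. l > 0 \<Longrightarrow> S \<le> 1 / (2 * l) * B + l / 2 * A - C"
  shows "S \<le> sqrt A * sqrt B - C"
proof (rule field_le_epsilon)
  fix e :: real assume e: "e > 0"
  let ?a = "sqrt A" and ?b = "sqrt B"
  have "((\<lambda>t. (?a + t) * (?b + t)) \<longlongrightarrow> (?a + 0) * (?b + 0)) (at_right 0)" by (intro tendsto_intros)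
  then have "\<forall>\<^sub>F t in at_right 0. (?a + t) * (?b + t) < (?a + 0) * (?b + 0) + e"
    using e by (intro order_tendstoD(2)) auto
  then have "\<forall>\<^sub>F t in at_right (0::real). (?a + t) * (?b + t) < ?a * ?b + e \<and> t > 0"
    by (auto intro: eventually_conj eventually_at_right_less)
  then obtain t where t: "(?a + t) * (?b + t) < ?a * ?b + e" "t > 0"
    using eventually_happens'[OF trivial_limit_at_right_real] by blast
  let ?l = "(?b + t) / (?a + t)"
  have pos: "?a + t > 0" "?b + t > 0" using t A B by (simp_all add: add_nonneg_pos)
  have alg: "1 / (2 * (y / x)) * y\<^sup>2 = x * y / 2" "y / x / 2 * x\<^sup>2 = x * y / 2" if "x > 0" "y > 0" for x y :: real
    using that by (simp_all add: power2_eq_square field_simps)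
  have "1 / (2 * ?l) * B \<le> 1 / (2 * ?l) * (?b + t)\<^sup>2"
    using pos B t by (intro mult_left_mono) (auto simp: power2_sum)
  also have "\<dots> = (?a + t) * (?b + t) / 2" by (rule alg[OF pos])
  finally have 1: "1 / (2 * ?l) * B \<le> (?a + t) * (?b + t) / 2" .
  have "?l / 2 * A \<le> ?l / 2 * (?a + t)\<^sup>2"
    using pos A t by (intro mult_left_mono) (auto simp: power2_sum)
  also have "\<dots> = (?a + t) * (?b + t) / 2" by (rule alg[OF pos])
  finally have 2: "?l / 2 * A \<le> (?a + t) * (?b + t) / 2" .
  have "S \<le> 1 / (2 * ?l) * B + ?l / 2 * A - C" using pos by (intro le) simp
  also have "\<dots> \<le> (?a + t) * (?b + t) - C" using 1 2 by linarith
  finally show "S \<le> ?a * ?b - C + e" using t by linarith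
qed

lemma qform_Re:
  fixes v :: "real^'n \<Rightarrow> complex"
  shows "Re (qform s l v v) = 1 / (2 * l) * Re (gip v v) + l / 2 * Re (wip (2 * s) v v) - (real CARD('n) + s) / 2 * Re (wip s v v)"
  unfolding qform_def by (simp add: gip_self wip_self)

lemma gip_nonneg: "Re (gip v v) \<ge> 0"
  by (simp add: gip_self sum_nonneg)

lemma stable_space_rapid:
  fixes h :: "real^'n \<Rightarrow> complex"
  assumes s: "s > 0" and l: "l > 0" and a: "\<And>k. a k \<ge> 0"
  shows "h \<in> stable_space s l a m j \<Longrightarrow> rapid h"
  unfolding stable_space_def
proof (induction rule: cspan.induct)
  case (cspan_step w e c)
  have "rapid e"
  proof -
    consider k q where "e = atom s l (a k - real k) q" "harmonic_homogeneous_poly k q" | "e = atom s l s (\<lambda>x. 1)"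
      using cspan_step.hyps(2) by (auto split: if_splits)
    then show ?thesis
    proof cases
      case 1
      then show ?thesis using a by (auto intro!: rapid_atom[OF s l] simp: harmonic_iff)
    next
      case 2
      then show ?thesis using s by (auto intro!: rapid_atom[OF s l, of _ 0] cpoly_const simp: hom_def)
    qed
  qed
  then show ?case using cspan_step by (intro rapid_add rapid_scale)
qed simp

section \<open>The classes \<H> as inverse transforms of the stable spaces\<close>

lemma Y_star_zero: "(\<lambda>\<xi>. 0) \<in> Y_star n \<phi> j"
  unfolding Y_star_def by (rule CollectI, rule exI[of _ "\<lambda>k i. 0"]) simp

lemma Y_star_add: "P \<in> Y_star n \<phi> j \<Longrightarrow> Q \<in> Y_star n \<phi> j \<Longrightarrow> (\<lambda>\<xi>. P \<xi> + Q \<xi>) \<in> Y_star n \<phi> j"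
proof -
  assume "P \<in> Y_star n \<phi> j" "Q \<in> Y_star n \<phi> j"
  then obtain d e where P: "P = (\<lambda>\<xi>. \<Sum>k=0..j. of_real (norm \<xi> powr (D_const CARD('a) k / 2)) * (\<Sum>i=1..n k. d k i * \<phi> k i (\<xi> /\<^sub>R norm \<xi>)))"
    and Q: "Q = (\<lambda>\<xi>. \<Sum>k=0..j. of_real (norm \<xi> powr (D_const CARD('a) k / 2)) * (\<Sum>i=1..n k. e k i * \<phi> k i (\<xi> /\<^sub>R norm \<xi>)))"
    unfolding Y_star_def by blast
  show ?thesis
    unfolding Y_star_def P Q
    by (rule CollectI, rule exI[of _ "\<lambda>k i. d k i + e k i"])
       (simp add: sum.distrib distrib_left distrib_right fun_eq_iff)
qed

lemma Y_star_scale: "P \<in> Y_star n \<phi> j \<Longrightarrow> (\<lambda>\<xi>. c * P \<xi>) \<in> Y_star n \<phi> j"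
proof -
  assume "P \<in> Y_star n \<phi> j"
  then obtain d where P: "P = (\<lambda>\<xi>. \<Sum>k=0..j. of_real (norm \<xi> powr (D_const CARD('a) k / 2)) * (\<Sum>i=1..n k. d k i * \<phi> k i (\<xi> /\<^sub>R norm \<xi>)))"
    unfolding Y_star_def by blast
  show ?thesis
    unfolding Y_star_def P
    by (rule CollectI, rule exI[of _ "\<lambda>k i. c * d k i"])
       (simp add: sum_distrib_left mult_ac fun_eq_iff)
qed

lemma hom_radial:
  assumes "hom k q"
  shows "of_real (norm x powr (a - real k)) * q x = of_real (norm x powr a) * q (x /\<^sub>R norm x)"
proof (cases "x = 0")
  case False
  have "q x = q (norm x *\<^sub>R (x /\<^sub>R norm x))" using False by simp
  also have "\<dots> = of_real (norm x ^ k) * q (x /\<^sub>R norm x)" by (rule homD[OF assms])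
  finally have "q x = of_real (norm x ^ k) * q (x /\<^sub>R norm x)" .
  moreover have "norm x powr (a - real k) * norm x ^ k = norm x powr a"
    using False by (simp add: powr_diff powr_realpow)
  then have "complex_of_real (norm x powr (a - real k)) * of_real (norm x ^ k) = of_real (norm x powr a)"
    by (simp only: of_real_mult[symmetric])
  ultimately show ?thesis by (metis mult.assoc)
qed simp

text \<open>On the sphere \<open>q\<close> is a combination of the basis, and homogeneity extends
  this to all \<xi>.\<close>

lemma atom_Y_star:
  fixes \<phi> :: "nat \<Rightarrow> nat \<Rightarrow> real^'n \<Rightarrow> complex"
  assumes basis: "orthonormal_harmonic_basis k (n k) (\<phi> k)" and q: "harmonic_homogeneous_poly k q" and kj: "k \<le> j"
  shows "\<exists>P\<in>Y_star n \<phi> j. atom s l (D_const CARD('n) k / 2 - real k) q = (\<lambda>\<xi>. P \<xi> * wexp s l \<xi>)"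
proof -
  have "spherical_harmonic k q" using q by (auto simp: spherical_harmonic_def)
  then obtain d :: "nat \<Rightarrow> complex" where d: "\<And>x. x \<in> sphere 0 1 \<Longrightarrow> q x = (\<Sum>i=1..n k. d i * \<phi> k i x)"
    using basis unfolding orthonormal_harmonic_basis_def by meson
  define P where "P \<xi> = (\<Sum>k'=0..j. of_real (norm \<xi> powr (D_const CARD('n) k' / 2)) * (\<Sum>i=1..n k'. (if k' = k then d i else 0) * \<phi> k' i (\<xi> /\<^sub>R norm \<xi>)))" for \<xi>
  have "P \<xi> = of_real (norm \<xi> powr (D_const CARD('n) k / 2)) * (\<Sum>i=1..n k. d i * \<phi> k i (\<xi> /\<^sub>R norm \<xi>))" for \<xi>
  proof -
    have "P \<xi> = (\<Sum>k'=0..j. if k' = k then of_real (norm \<xi> powr (D_const CARD('n) k' / 2)) * (\<Sum>i=1..n k'. d i * \<phi> k' i (\<xi> /\<^sub>R norm \<xi>)) else 0)"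
      unfolding P_def by (intro sum.cong) auto
    then show ?thesis using kj by simp
  qed
  moreover have "of_real (norm \<xi> powr (D_const CARD('n) k / 2 - real k)) * q \<xi> = of_real (norm \<xi> powr (D_const CARD('n) k / 2)) * (\<Sum>i=1..n k. d i * \<phi> k i (\<xi> /\<^sub>R norm \<xi>))" for \<xi>
  proof (cases "\<xi> = 0")
    case False
    have "hom k q" using q by (simp add: harmonic_iff)
    from hom_radial[OF this] show ?thesis using d[of "\<xi> /\<^sub>R norm \<xi>"] False by simp
  qed simp
  ultimately have "atom s l (D_const CARD('n) k / 2 - real k) q \<xi> = P \<xi> * wexp s l \<xi>" for \<xi>
    by (simp add: atom_def mult.assoc[symmetric])
  moreover have "P \<in> Y_star n \<phi> j"
    unfolding Y_star_def P_def[abs_def] by (rule CollectI, rule exI[of _ "\<lambda>k' i. if k' = k then d i else 0"]) simp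
  ultimately show ?thesis by (intro bexI[of _ P]) auto
qed

lemma Y_star_stable_space:
  fixes \<phi> :: "nat \<Rightarrow> nat \<Rightarrow> real^'n \<Rightarrow> complex"
  assumes basis: "\<And>k. orthonormal_harmonic_basis k (n k) (\<phi> k)" and P: "P \<in> Y_star n \<phi> j'" and jm: "j' \<le> m" "j' \<le> j"
  shows "(\<lambda>\<xi>. P \<xi> * wexp s l \<xi>) \<in> stable_space s l (\<lambda>k. D_const CARD('n) k / 2) m j"
proof -
  obtain d where d: "P = (\<lambda>\<xi>. \<Sum>k=0..j'. of_real (norm \<xi> powr (D_const CARD('n) k / 2)) * (\<Sum>i=1..n k. d k i * \<phi> k i (\<xi> /\<^sub>R norm \<xi>)))"
    using P unfolding Y_star_def by blast
  \<comment> \<open>Harmonic polynomials that extend the basis elements off the sphere.\<close>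
  define q where "q k i = (SOME q. harmonic_homogeneous_poly k q \<and> (\<forall>x\<in>sphere 0 1. \<phi> k i x = q x))" for k i
  have qq: "harmonic_homogeneous_poly k (q k i) \<and> (\<forall>x\<in>sphere 0 1. \<phi> k i x = q k i x)" if "i \<in> {1..n k}" for k i
  proof -
    have "\<exists>q. harmonic_homogeneous_poly k q \<and> (\<forall>x\<in>sphere 0 1. \<phi> k i x = q x)"
      using basis[of k] that unfolding orthonormal_harmonic_basis_def spherical_harmonic_def by blast
    from someI_ex[OF this] show ?thesis unfolding q_def .
  qed
  then have q: "i \<in> {1..n k} \<Longrightarrow> harmonic_homogeneous_poly k (q k i)"
    "i \<in> {1..n k} \<Longrightarrow> x \<in> sphere 0 1 \<Longrightarrow> \<phi> k i x = q k i x" for k i x by blast+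
  let ?a = "\<lambda>k. D_const CARD('n) k / 2"
  have "(\<lambda>\<xi>. \<Sum>k=0..j'. \<Sum>i=1..n k. d k i * atom s l (?a k - real k) (q k i) \<xi>) \<in> stable_space s l ?a m j"
    unfolding stable_space_def
  proof (intro cspan_sum cspan_scale cspan_base UnI1 CollectI exI conjI refl)
    fix k i assume "k \<in> {0..j'}" "i \<in> {1..n k}"
    then show "k \<le> j" "k \<le> m" "harmonic_homogeneous_poly k (q k i)" using jm q by auto
  qed auto
  moreover have "(\<Sum>k=0..j'. \<Sum>i=1..n k. d k i * atom s l (?a k - real k) (q k i) \<xi>) = P \<xi> * wexp s l \<xi>" for \<xi>
  proof (cases "\<xi> = 0")
    case True
    then show ?thesis by (simp add: d atom_def)
  next
    case False
    have "d k i * atom s l (?a k - real k) (q k i) \<xi> = of_real (norm \<xi> powr ?a k) * (d k i * \<phi> k i (\<xi> /\<^sub>R norm \<xi>)) * wexp s l \<xi>"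
      if "i \<in> {1..n k}" for k i
    proof -
      have "hom k (q k i)" using q(1)[OF that] by (simp add: harmonic_iff)
      from hom_radial[OF this, of \<xi> "?a k"] q(2)[OF that, of "\<xi> /\<^sub>R norm \<xi>"] False
      have "of_real (norm \<xi> powr (?a k - real k)) * q k i \<xi> = of_real (norm \<xi> powr ?a k) * \<phi> k i (\<xi> /\<^sub>R norm \<xi>)" by simp
      then show ?thesis by (simp add: atom_def mult.assoc[symmetric])
    qed
    then show ?thesis unfolding d sum_distrib_right sum_distrib_left by (intro sum.cong) auto
  qed
  ultimately show ?thesis by simp
qed

lemma wexp_def': "of_real (exp (- l * norm \<xi> powr s / s)) = wexp s l \<xi>"
  by (simp add: wexp_def)

text \<open>From here on the classes are described by all harmonic polynomials and no longer by the
  chosen bases.\<close>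

lemma H_eq:
  fixes \<phi> :: "nat \<Rightarrow> nat \<Rightarrow> real^'n \<Rightarrow> complex"
  assumes basis: "\<And>k. orthonormal_harmonic_basis k (n k) (\<phi> k)"
  shows "\<H> n \<phi> s m j = {inv_fourier h | h l. l > 0 \<and> h \<in> stable_space s l (\<lambda>k. D_const CARD('n) k / 2) m j}"
proof (intro set_eqI iffI)
  let ?a = "\<lambda>k. D_const CARD('n) k / 2"
  fix w :: "real^'n \<Rightarrow> complex" assume "w \<in> \<H> n \<phi> s m j"
  then consider P l where "j \<le> m" "w = inv_fourier (\<lambda>\<xi>. P \<xi> * wexp s l \<xi>)" "P \<in> Y_star n \<phi> j" "l > 0"
    | P d l where "\<not> j \<le> m" "w = inv_fourier (\<lambda>\<xi>. (P \<xi> + d * of_real (norm \<xi> powr s)) * wexp s l \<xi>)" "P \<in> Y_star n \<phi> m" "l > 0"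
    unfolding \<H>_def wexp_def' by (auto split: if_splits)
  then show "w \<in> {inv_fourier h | h l. l > 0 \<and> h \<in> stable_space s l ?a m j}"
  proof cases
    case 1
    then show ?thesis using Y_star_stable_space[OF basis 1(3) 1(1) order_refl] by blast
  next
    case (2 P d l)
    have A: "(\<lambda>\<xi>. P \<xi> * wexp s l \<xi>) \<in> stable_space s l ?a m j"
      using Y_star_stable_space[OF basis 2(3)] 2(1) by simp
    have B: "atom s l s (\<lambda>x. 1) \<in> stable_space s l ?a m j"
      unfolding stable_space_def using 2(1) by (intro cspan_base) simp
    have "(\<lambda>\<xi>. P \<xi> * wexp s l \<xi> + d * atom s l s (\<lambda>x. 1) \<xi>) \<in> stable_space s l ?a m j"
      using A B unfolding stable_space_def by (intro cspan_add cspan_scale)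
    moreover have "(\<lambda>\<xi>. P \<xi> * wexp s l \<xi> + d * atom s l s (\<lambda>x. 1) \<xi>) = (\<lambda>\<xi>. (P \<xi> + d * of_real (norm \<xi> powr s)) * wexp s l \<xi>)"
      by (simp add: atom_def algebra_simps)
    ultimately show ?thesis using 2 by auto
  qed
next
  let ?a = "\<lambda>k. D_const CARD('n) k / 2"
  fix w :: "real^'n \<Rightarrow> complex" assume "w \<in> {inv_fourier h | h l. l > 0 \<and> h \<in> stable_space s l ?a m j}"
  then obtain h l where hl: "w = inv_fourier h" "l > 0" "h \<in> stable_space s l ?a m j" by blast
  show "w \<in> \<H> n \<phi> s m j"
  proof (cases "j \<le> m")
    case True
    have "\<exists>P\<in>Y_star n \<phi> j. h = (\<lambda>\<xi>. P \<xi> * wexp s l \<xi>)"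
      using hl(3) unfolding stable_space_def
    proof (induction rule: cspan.induct)
      case cspan_zero
      show ?case by (rule bexI[OF _ Y_star_zero]) simp
    next
      case (cspan_step w e c)
      then obtain k q where e: "e = atom s l (?a k - real k) q" "k \<le> j" "harmonic_homogeneous_poly k q" using True by auto
      obtain Q where Q: "Q \<in> Y_star n \<phi> j" "e = (\<lambda>\<xi>. Q \<xi> * wexp s l \<xi>)" using atom_Y_star[of k n \<phi> q j s l] basis e by blast
      obtain P where P: "P \<in> Y_star n \<phi> j" "w = (\<lambda>\<xi>. P \<xi> * wexp s l \<xi>)" using cspan_step by blast
      show ?case
        by (rule bexI[OF _ Y_star_add[OF Y_star_scale[OF Q(1), of c] P(1)]]) (simp add: P(2) Q(2) algebra_simps)
    qed
    then show ?thesis using hl True unfolding \<H>_def wexp_def' by auto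
  next
    case False
    have "\<exists>P\<in>Y_star n \<phi> m. \<exists>d. h = (\<lambda>\<xi>. (P \<xi> + d * of_real (norm \<xi> powr s)) * wexp s l \<xi>)"
      using hl(3) unfolding stable_space_def
    proof (induction rule: cspan.induct)
      case cspan_zero
      show ?case by (rule bexI[OF _ Y_star_zero]) (auto intro: exI[of _ 0])
    next
      case (cspan_step w e c)
      obtain P d where P: "P \<in> Y_star n \<phi> m" "w = (\<lambda>\<xi>. (P \<xi> + d * of_real (norm \<xi> powr s)) * wexp s l \<xi>)" using cspan_step by blast
      consider k q where "e = atom s l (?a k - real k) q" "k \<le> m" "harmonic_homogeneous_poly k q" | "e = atom s l s (\<lambda>x. 1)"
        using cspan_step.hyps(2) False by auto
      then show ?case
      proof cases
        case (1 k q)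
        obtain Q where Q: "Q \<in> Y_star n \<phi> m" "e = (\<lambda>\<xi>. Q \<xi> * wexp s l \<xi>)" using atom_Y_star[of k n \<phi> q m s l] basis 1 by blast
        show ?thesis
          by (rule bexI[OF _ Y_star_add[OF Y_star_scale[OF Q(1), of c] P(1)]], rule exI[of _ d]) (simp add: P(2) Q(2) algebra_simps)
      next
        case 2
        show ?thesis
          by (rule bexI[OF _ P(1)], rule exI[of _ "c + d"]) (simp add: P(2) 2 atom_def algebra_simps)
      qed
    qed
    then show ?thesis using hl False unfolding \<H>_def wexp_def' by auto
  qed
qed

section \<open>From the quadratic form to energy distances\<close>

lemma energy_nonneg: "energy a f \<ge> 0"
  by (simp add: energy_def)

lemma energy_dist_le: "w \<in> W \<Longrightarrow> energy_dist s W u \<le> energy (s/4) (\<lambda>x. u x - w x)"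
  unfolding energy_dist_def by (rule cINF_lower) (auto intro!: bdd_belowI[of _ 0] energy_nonneg)

lemma energy_dist_nonneg: "W \<noteq> {} \<Longrightarrow> energy_dist s W u \<ge> 0"
  unfolding energy_dist_def by (rule cINF_greatest) (auto intro: energy_nonneg)

lemma energy_dist_ge: "W \<noteq> {} \<Longrightarrow> (\<And>w. w \<in> W \<Longrightarrow> c \<le> energy (s/4) (\<lambda>x. u x - w x)) \<Longrightarrow> c \<le> energy_dist s W u"
  unfolding energy_dist_def by (rule cINF_greatest) auto

text \<open>The numbers \<open>d j\<close> do not depend on \<open>l\<close>: they bound the
  distance to the j-th space for every \<open>l\<close>, as an infimum over all \<lambda> does. So
  the spectral inequality has the same left-hand side for every \<open>l\<close>, and its right-hand
  side may be minimized over \<open>l\<close>. Leaving \<open>d\<close> free serves the full sum as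
  well as its first term alone.\<close>

lemma stability_from_spectral:
  fixes u :: "real^'n \<Rightarrow> complex" and d :: "nat \<Rightarrow> real"
  assumes N: "CARD('n) \<ge> 2" and s: "s > 0" and u: "u \<in> C0_infinity"
    and m: "m \<ge> 1" "D_const CARD('n) m \<le> 2 * s" "D_const CARD('n) (m + 1) - D_const CARD('n) 1 \<le> 2 * s"
    and d: "\<And>l j h. l > 0 \<Longrightarrow> j \<le> m + 1 \<Longrightarrow> h \<in> stable_space s l (\<lambda>k. D_const CARD('n) k / 2) m j \<Longrightarrow> d j \<le> energy (s/4) (\<lambda>x. u x - inv_fourier h x)"
  shows "deficit s u \<ge> (\<Sum>j=0..m+1. \<beta> CARD('n) s m j / 2 * d j)"
proof -
  let ?v = "fourier_integral u"
  define c where "c = (2 * pi) powr s"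
  have c: "c > 0" by (simp add: c_def)
  have v: "?v \<in> form_domain" by (rule fourier_integral_form_domain[OF N u])
  have "(\<Sum>j\<le>m + 1. \<beta> CARD('n) s m j / 2 * (d j / c)) \<le> sqrt (Re (wip (2 * s) ?v ?v)) * sqrt (Re (gip ?v ?v)) - (real CARD('n) + s) / 2 * Re (wip s ?v ?v)"
  proof (rule optimal_scale)
    fix l :: real assume l: "l > 0"
    have "(\<Sum>j\<le>m + 1. \<beta> CARD('n) s m j / 2 * (d j / c)) \<le> Re (qform s l ?v ?v)"
    proof (rule spectral_inequality[OF N s l v m])
      fix j and h :: "real^'n \<Rightarrow> complex" assume j: "j \<le> m + 1" and h: "h \<in> stable_space s l (\<lambda>k. D_const CARD('n) k / 2) m j"
      have "rapid h" by (rule stable_space_rapid[OF s l _ h]) (use D_const_nonneg[OF N] in auto)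
      then have "d j \<le> c * Re (wip s (\<lambda>x. ?v x - h x) (\<lambda>x. ?v x - h x))"
        using d[OF l j h] energy_diff[OF N u _ s, of h] by (simp add: c_def)
      then show "d j / c \<le> Re (wip s (\<lambda>x. ?v x - h x) (\<lambda>x. ?v x - h x))" using c by (simp add: pos_divide_le_eq mult.commute)
    qed
    then show "(\<Sum>j\<le>m + 1. \<beta> CARD('n) s m j / 2 * (d j / c)) \<le> 1 / (2 * l) * Re (gip ?v ?v) + l / 2 * Re (wip (2 * s) ?v ?v) - (real CARD('n) + s) / 2 * Re (wip s ?v ?v)"
      unfolding qform_Re .
  qed (auto intro: wip_nonneg gip_nonneg)
  then have "c * (\<Sum>j\<le>m + 1. \<beta> CARD('n) s m j / 2 * (d j / c)) \<le> deficit s u"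
    unfolding deficit_eq[OF N u s] c_def[symmetric] using c by (intro mult_left_mono) auto
  moreover have "c * (\<Sum>j\<le>m + 1. \<beta> CARD('n) s m j / 2 * (d j / c)) = (\<Sum>j\<le>m + 1. \<beta> CARD('n) s m j / 2 * d j)"
    unfolding sum_distrib_left using c by (intro sum.cong) auto
  ultimately show ?thesis by (simp only: atMost_atLeast0)
qed

text \<open>The origin is excluded because \<open>0 powr 0 = 0\<close>, so the atom with exponent 0
  vanishes there while \<open>wexp\<close> does not.\<close>

lemma stable_space_0:
  fixes h :: "real^'n \<Rightarrow> complex"
  assumes "h \<in> stable_space s l (\<lambda>k. D_const CARD('n) k / 2) m 0"
  shows "\<exists>c. \<forall>x. x \<noteq> 0 \<longrightarrow> h x = c * wexp s l x"
  using assms unfolding stable_space_def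
proof (induction rule: cspan.induct)
  case cspan_zero
  show ?case by (rule exI[of _ 0]) simp
next
  case (cspan_step w e a)
  then obtain c where c: "\<And>x. x \<noteq> 0 \<Longrightarrow> w x = c * wexp s l x" by blast
  obtain q where q: "e = atom s l 0 q" "hom 0 q"
    using cspan_step.hyps(2) by (auto simp: harmonic_iff)
  have "q x = q 0" for x using hom_0_const[OF q(2)] by metis
  then have "e x = q 0 * wexp s l x" if "x \<noteq> 0" for x
    unfolding q(1) atom_def using that by (metis powr_zero_eq_one norm_eq_zero of_real_1 mult_1)
  with c have "a * e x + w x = (a * q 0 + c) * wexp s l x" if "x \<noteq> 0" for x using that by (simp add: algebra_simps)
  then show ?case by blast
qed

lemma wip_cong_off_0:
  assumes "\<And>x. x \<noteq> 0 \<Longrightarrow> v x = v' x" "\<And>x. x \<noteq> 0 \<Longrightarrow> w x = w' x"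
  shows "wip g v w = wip g v' w'"
proof -
  have "of_real (norm x powr g) * (v x * cnj (w x)) = of_real (norm x powr g) * (v' x * cnj (w' x))" for x
    using assms by (cases "x = 0") auto
  then show ?thesis unfolding wip_def by (intro Bochner_Integration.integral_cong refl)
qed

lemma G_fun_eq:
  assumes "s > 0" "l > 0"
  shows "\<alpha> * G_fun s l x = inv_fourier (\<lambda>\<xi>. \<alpha> * wexp s l \<xi>) x"
  using assms unfolding G_fun_def wexp_def'
  by (simp add: inv_fourier_rapid rapid_wexp rapid_scale fourier_integral_cmult)

section \<open>Cutoff functions\<close>

text \<open>The functions p(1/t) e^(-1/t), extended by 0, form a family closed under
  differentiation, so smoothness at 0 follows for all of them at once.\<close>

definition flat_exp :: "real poly \<Rightarrow> real \<Rightarrow> real" where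
  "flat_exp p t = (if t > 0 then poly p (1 / t) * exp (- (1 / t)) else 0)"

text \<open>With y = 1/t, the derivative of p(y) e^(-y) with respect to t is y^2 (p - p')(y)
  e^(-y).\<close>

definition flat_poly :: "real poly \<Rightarrow> real poly" where
  "flat_poly p = monom 1 2 * (p - pderiv p)"

lemma poly_exp_tendsto_0: "((\<lambda>y::real. poly p y * exp (- y)) \<longlongrightarrow> 0) at_top"
proof -
  have "((\<lambda>y. \<Sum>i\<le>degree p. coeff p i * (y ^ i / exp y)) \<longlongrightarrow> (\<Sum>i\<le>degree p. coeff p i * 0)) at_top"
    by (intro tendsto_intros tendsto_power_div_exp_0)
  then show ?thesis
    by (simp add: poly_altdef sum_distrib_right exp_minus divide_inverse mult.assoc)
qed

text \<open>This is the difference quotient at 0. On the right, dividing by t only raises the degree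
  of the polynomial, and the exponential still wins.\<close>

lemma flat_exp_over_t: "((\<lambda>t. flat_exp p t / t) \<longlongrightarrow> 0) (at 0)"
proof (rule filterlim_split_at)
  show "((\<lambda>t. flat_exp p t / t) \<longlongrightarrow> 0) (at_left 0)"
    by (rule tendsto_eventually) (auto simp: flat_exp_def eventually_at_left_real intro: eventually_at_leftI[of "-1"])
  have "((\<lambda>t. poly (pCons 0 p) (inverse t) * exp (- inverse t)) \<longlongrightarrow> 0) (at_right (0::real))"
    by (rule filterlim_compose[OF poly_exp_tendsto_0 filterlim_inverse_at_top_right])
  then show "((\<lambda>t. flat_exp p t / t) \<longlongrightarrow> 0) (at_right 0)"
    by (rule Lim_transform_eventually)
       (rule eventually_at_rightI[of 0 1], auto simp: flat_exp_def divide_inverse mult_ac)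
qed

lemma flat_exp_has_derivative: "(flat_exp p has_real_derivative flat_exp (flat_poly p) t) (at t)"
proof -
  consider "t > 0" | "t < 0" | "t = 0" by linarith
  then show ?thesis
  proof cases
    case 1
    have "((\<lambda>t. poly p (1 / t) * exp (- (1 / t))) has_real_derivative
      poly (pderiv p) (1 / t) * (- (1 / t\<^sup>2)) * exp (- (1 / t)) + poly p (1 / t) * (exp (- (1 / t)) * (1 / t\<^sup>2))) (at t)"
      using 1 by (auto intro!: derivative_eq_intros DERIV_chain'[OF _ poly_DERIV] simp: power2_eq_square)
    also have "poly (pderiv p) (1 / t) * (- (1 / t\<^sup>2)) * exp (- (1 / t)) + poly p (1 / t) * (exp (- (1 / t)) * (1 / t\<^sup>2)) = flat_exp (flat_poly p) t"
      using 1 by (simp add: flat_exp_def flat_poly_def poly_monom power_divide algebra_simps)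
    finally show ?thesis
      by (rule has_field_derivative_transform_within_open[of _ _ _ "{0<..}"]) (use 1 in \<open>auto simp: flat_exp_def\<close>)
  next
    case 2
    have "((\<lambda>t. 0) has_real_derivative 0) (at t)" by simp
    then have "(flat_exp p has_real_derivative 0) (at t)"
      by (rule has_field_derivative_transform_within_open[of _ _ _ "{..<0}"]) (use 2 in \<open>auto simp: flat_exp_def\<close>)
    then show ?thesis using 2 by (simp add: flat_exp_def)
  next
    case 3
    then show ?thesis using flat_exp_over_t[of p] by (simp add: DERIV_def flat_exp_def)
  qed
qed

definition bump :: "real poly \<Rightarrow> real \<Rightarrow> real^'n \<Rightarrow> complex" where
  "bump p k x = of_real (flat_exp p (1 - k * (norm x)\<^sup>2))"

lemma bump_has_derivative:
  "(bump p k has_derivative (\<lambda>h. of_real (flat_exp (flat_poly p) (1 - k * (norm x)\<^sup>2) * (- 2 * k * (x \<bullet> h))))) (at x)"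
proof -
  have "((\<lambda>x. 1 - k * (x \<bullet> x)) has_derivative (\<lambda>h. - (k * (x \<bullet> h + h \<bullet> x)))) (at x)"
    by (auto intro!: derivative_eq_intros)
  moreover have "(\<lambda>h. - (k * (x \<bullet> h + h \<bullet> x))) = (\<lambda>h. - 2 * k * (x \<bullet> h))"
    by (simp add: fun_eq_iff inner_commute)
  ultimately have "((\<lambda>x. 1 - k * (norm x)\<^sup>2) has_derivative (\<lambda>h. - 2 * k * (x \<bullet> h))) (at x)"
    unfolding power2_norm_eq_inner by (simp only:)
  from has_derivative_compose[OF this has_field_derivative_imp_has_derivative[OF flat_exp_has_derivative[of p]]]
  have "((\<lambda>x. flat_exp p (1 - k * (norm x)\<^sup>2)) has_derivative (\<lambda>h. flat_exp (flat_poly p) (1 - k * (norm x)\<^sup>2) * (- 2 * k * (x \<bullet> h)))) (at x)" .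
  from has_derivative_of_real[OF this] show ?thesis by (simp add: bump_def[abs_def])
qed

lemma bump_differentiable: "bump p k differentiable (at x)"
  unfolding differentiable_def by (rule exI, rule bump_has_derivative)

lemma partial_deriv_bump: "partial_deriv i (bump p k) x = of_real (- 2 * k) * (of_real (x $ i) * bump (flat_poly p) k x)"
  unfolding partial_deriv_eq[OF bump_has_derivative] by (simp add: bump_def inner_axis mult_ac)

lemma C_k_bump: "C_k j (bump p k)"
proof (induction j arbitrary: p)
  case 0
  have "isCont (bump p k) x" for x using has_derivative_continuous[OF bump_has_derivative] .
  then show ?case unfolding C_k.simps by (intro continuous_at_imp_continuous_on ballI)
next
  case (Suc j)
  have "partial_deriv i (bump p k) = (\<lambda>x. of_real (- 2 * k) * (of_real (x $ i) * bump (flat_poly p) k x))" for i :: 'a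
    by (intro ext partial_deriv_bump)
  moreover have "C_k j (\<lambda>x. of_real (- 2 * k) * (of_real (x $ i) * bump (flat_poly p) k x))" for i :: 'a
    by (intro C_k_mult C_k_const C_k_component Suc.IH)
  ultimately show ?case by (simp add: bump_differentiable del: of_real_mult of_real_minus)
qed

lemma bump_C0_infinity:
  assumes "k > 0"
  shows "bump p k \<in> C0_infinity"
proof -
  have "{x::real^'a. bump p k x \<noteq> 0} \<subseteq> cball 0 (sqrt (1 / k))"
  proof
    fix x :: "real^'a" assume "x \<in> {x. bump p k x \<noteq> 0}"
    then have "k * (norm x)\<^sup>2 < 1" by (auto simp: bump_def flat_exp_def split: if_splits)
    then have "(norm x)\<^sup>2 \<le> 1 / k" using assms by (simp add: field_simps)
    then show "x \<in> cball 0 (sqrt (1 / k))" by (simp add: real_le_rsqrt)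
  qed
  then have "bounded {x::real^'a. bump p k x \<noteq> 0}" by (rule bounded_subset[OF bounded_cball])
  then show ?thesis by (auto simp: C0_infinity_def C_k_bump)
qed

text \<open>A smooth cutoff supported in the ball of radius 1 / sqrt k; the factor
  \<open>exp 1\<close> normalizes its value at 0. For k = 1 / R^2 it is the dilate of
  \<open>psi 1\<close> by R.\<close>

definition psi :: "real \<Rightarrow> real^'n \<Rightarrow> complex" where
  "psi k x = of_real (exp 1) * bump 1 k x"

lemma psi_C0_infinity: "k > 0 \<Longrightarrow> psi k \<in> C0_infinity"
  unfolding psi_def[abs_def] by (intro C0_infinity_scale bump_C0_infinity)

lemma psi_0 [simp]: "psi k 0 = 1"
  by (simp add: psi_def bump_def flat_exp_def exp_minus)

lemma psi_scale: "R > 0 \<Longrightarrow> psi (1 / R\<^sup>2) x = psi 1 (x /\<^sub>R R)"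
  by (simp add: psi_def bump_def power_mult_distrib divide_inverse power_inverse mult.commute)

text \<open>Multiplying by x_j and differentiating in x_i together commute with dilations. The
  derivative of the cutoff thus stays bounded uniformly in R despite the weight |x| in the gradient
  norm.\<close>

lemma psi_partial:
  assumes "R > 0"
  shows "of_real (x $ j) * partial_deriv i (psi (1 / R\<^sup>2)) x = of_real ((x /\<^sub>R R) $ j) * partial_deriv i (psi 1) (x /\<^sub>R R)"
proof -
  have p: "partial_deriv i (psi k) y = of_real (exp 1) * (of_real (- 2 * k) * (of_real (y $ i) * bump (flat_poly 1) k y))" for k and y :: "real^'a"
    unfolding psi_def[abs_def] by (subst partial_deriv_mult) (auto simp: bump_differentiable partial_deriv_const partial_deriv_bump)
  have b: "bump (flat_poly 1) (1 / R\<^sup>2) x = bump (flat_poly 1) 1 (x /\<^sub>R R)"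
    using assms by (simp add: bump_def power_mult_distrib divide_inverse power_inverse mult.commute)
  show ?thesis unfolding p b using assms by (simp add: power2_eq_square divide_inverse)
qed

lemma continuous_AE_eq:
  fixes f g :: "real^'n \<Rightarrow> complex"
  assumes "continuous_on UNIV f" "continuous_on UNIV g" "AE x in lborel. f x = g x"
  shows "f x = g x"
proof (rule ccontr)
  assume "f x \<noteq> g x"
  let ?U = "{x. f x \<noteq> g x}"
  have "open ?U" using assms by (intro open_Collect_neq) auto
  moreover have "?U \<in> null_sets lborel"
    using assms(3) \<open>open ?U\<close> by (subst AE_iff_null_sets) (auto simp: borel_open)
  then have "negligible ?U" by (simp add: negligible_iff_null_sets null_sets_completionI)
  ultimately have "?U = {}" using open_not_negligible by blast
  with \<open>f x \<noteq> g x\<close> show False by blast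
qed

text \<open>Inversion at the origin. For \<open>psi 1\<close> it says that its transform, which
  serves as a mollifier, has integral 1.\<close>

lemma integral_fourier_eq_value:
  fixes u :: "real^'n \<Rightarrow> complex"
  assumes N: "CARD('n) \<ge> 2" and u: "u \<in> C0_infinity"
  shows "(LINT \<xi>|lborel. fourier_integral u \<xi>) = u 0"
proof -
  have "u 0 = fourier_integral (fourier_integral u) (- 0)"
  proof (rule continuous_AE_eq[where x=0])
    show "continuous_on UNIV u" by (rule C0_infinityD[OF u])
    show "continuous_on UNIV (\<lambda>x. fourier_integral (fourier_integral u) (- x))"
      by (intro continuous_on_compose2[OF continuous_fourier_integral] rapid_integrable rapid_fourier_integral N u continuous_intros) auto
    show "AE x in lborel. u x = fourier_integral (fourier_integral u) (- x)" by (rule C0_infinity_inversion[OF N u])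
  qed
  then show ?thesis by (simp add: fourier_integral_fker fker_def)
qed

section \<open>Approximation by test functions\<close>

text \<open>The inverse transform of \<open>e\<close> is smooth but in general not compactly
  supported, hence the cutoff at radius R. In Fourier space it acts as a mollification at scale 1 /
  R.\<close>

definition cut_inverse :: "(real^'n \<Rightarrow> complex) \<Rightarrow> real \<Rightarrow> real^'n \<Rightarrow> complex" where
  "cut_inverse e R x = fourier_integral (\<lambda>y. e (- y)) x * psi (1 / R\<^sup>2) x"

lemma cut_inverse_C0_infinity: "rapid e \<Longrightarrow> R > 0 \<Longrightarrow> cut_inverse e R \<in> C0_infinity"
  unfolding cut_inverse_def[abs_def]
  by (intro C0_infinity_mult C_k_fourier_integral rapid_reflect psi_C0_infinity) auto

lemma C0_infinity_integrable: "u \<in> C0_infinity \<Longrightarrow> integrable lborel u"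
  by (intro rapid_integrable C0_infinity_rapid)

lemma C0_infinity_measurable: "u \<in> C0_infinity \<Longrightarrow> u \<in> borel_measurable borel"
  by (intro rapid_measurable C0_infinity_rapid)

lemma fourier_integral_dilate:
  fixes f :: "real^'n \<Rightarrow> complex"
  assumes R: "R > 0" and [measurable]: "f \<in> borel_measurable borel"
  shows "fourier_integral (\<lambda>x. f (x /\<^sub>R R)) z = of_real (R ^ CARD('n)) * fourier_integral f (R *\<^sub>R z)"
proof -
  have "(LINT x|lborel. f (x /\<^sub>R R) * fker x z) = of_real (\<bar>R\<bar> ^ CARD('n)) * (LINT x|lborel. f ((0 + R *\<^sub>R x) /\<^sub>R R) * fker (0 + R *\<^sub>R x) z)"
    using R by (intro lborel_integral_affine) auto
  then show ?thesis using R by (simp add: fourier_integral_fker fker_def)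
qed

lemma fker_add_right: "fker x (y + z) = fker x y * fker x z"
  by (simp add: fker_sym[of x] fker_add)

text \<open>Duality moves the transform from the reflected \<open>e\<close> to the modulated cutoff;
  a translation and the substitution z = \<eta> / R give the mollified form.\<close>

lemma fourier_cut_inverse:
  fixes e :: "real^'n \<Rightarrow> complex"
  assumes N: "CARD('n) \<ge> 2" and e: "rapid e" and R: "R > 0"
  shows "fourier_integral (cut_inverse e R) \<xi> = (LINT \<eta>|lborel. e (\<xi> - \<eta> /\<^sub>R R) * fourier_integral (psi 1) \<eta>)"
proof -
  note [measurable] = rapid_measurable[OF e] rapid_measurable[OF rapid_reflect[OF e]]
  define P where "P = fourier_integral (psi 1 :: real^'n \<Rightarrow> complex)"
  have psi: "psi k \<in> C0_infinity" if "k > 0" for k using psi_C0_infinity[OF that] .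
  have [measurable]: "P \<in> borel_measurable borel"
    unfolding P_def by (intro measurable_fourier_integral C0_infinity_integrable psi) simp
  define PR where "PR = fourier_integral (psi (1 / R\<^sup>2) :: real^'n \<Rightarrow> complex)"
  have PR: "PR z = of_real (R ^ CARD('n)) * P (R *\<^sub>R z)" for z
  proof -
    have "PR = fourier_integral (\<lambda>x. psi 1 (x /\<^sub>R R))"
      unfolding PR_def using psi_scale[OF R] by (metis (no_types))
    then show ?thesis
      using fourier_integral_dilate[OF R C0_infinity_measurable[OF psi[of 1]]] by (simp add: P_def)
  qed
  have [measurable]: "PR \<in> borel_measurable borel" unfolding PR[abs_def] by measurable
  have i: "integrable lborel (psi (1 / R\<^sup>2) :: real^'n \<Rightarrow> complex)" using R by (intro C0_infinity_integrable psi) simp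
  have "fourier_integral (cut_inverse e R) \<xi> = (LINT x|lborel. fourier_integral (\<lambda>y. e (- y)) x * (psi (1 / R\<^sup>2) x * fker x \<xi>))"
    by (simp add: fourier_integral_fker[of "cut_inverse e R"] cut_inverse_def mult.assoc)
  also have "\<dots> = (LINT y|lborel. e (- y) * fourier_integral (\<lambda>x. psi (1 / R\<^sup>2) x * fker x \<xi>) y)"
    by (intro fourier_multiplication_formula rapid_integrable rapid_reflect e integrable_fker i)
  also have "(\<lambda>y. fourier_integral (\<lambda>x. psi (1 / R\<^sup>2) x * fker x \<xi>) y) = (\<lambda>y. PR (\<xi> + y))"
    by (intro ext) (simp add: PR_def fourier_integral_fker fker_add_right mult.assoc)
  also have "(LINT y|lborel. e (- y) * PR (\<xi> + y)) = of_real (\<bar>1\<bar> ^ CARD('n)) * (LINT z|lborel. e (- (- \<xi> + 1 *\<^sub>R z)) * PR (\<xi> + (- \<xi> + 1 *\<^sub>R z)))"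
    by (intro lborel_integral_affine) auto
  also have "\<dots> = (LINT z|lborel. e (\<xi> - z) * PR z)" by simp
  also have "\<dots> = of_real (\<bar>1 / R\<bar> ^ CARD('n)) * (LINT \<eta>|lborel. e (\<xi> - (0 + (1 / R) *\<^sub>R \<eta>)) * PR (0 + (1 / R) *\<^sub>R \<eta>))"
    using R by (intro lborel_integral_affine) auto
  also have "\<dots> = of_real ((1 / R) ^ CARD('n)) * (LINT \<eta>|lborel. of_real (R ^ CARD('n)) * (e (\<xi> - \<eta> /\<^sub>R R) * P \<eta>))"
    using R by (simp add: PR divide_inverse mult_ac)
  also have "\<dots> = (LINT \<eta>|lborel. e (\<xi> - \<eta> /\<^sub>R R) * P \<eta>)"
    using R by (simp add: power_divide)
  finally show ?thesis unfolding P_def .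
qed

text \<open>The inequality 1 + |\<xi>| <= (1 + |\<xi> - \<eta>/R|) (1 + |\<eta>|), valid for R >= 1,
  transfers the decay of \<open>e\<close> to its mollifications uniformly in R.\<close>

lemma fourier_cut_inverse_bound:
  fixes e :: "real^'n \<Rightarrow> complex"
  assumes N: "CARD('n) \<ge> 2" and e: "rapid e"
  shows "\<exists>C. \<forall>R\<ge>1. \<forall>\<xi>. cmod (fourier_integral (cut_inverse e R) \<xi>) \<le> C / (1 + norm \<xi>) ^ M"
proof -
  note [measurable] = rapid_measurable[OF e]
  define P where "P = fourier_integral (psi 1 :: real^'n \<Rightarrow> complex)"
  have P: "rapid P" unfolding P_def by (intro rapid_fourier_integral N psi_C0_infinity) simp
  obtain C where C: "C \<ge> 0" "\<And>x. (1 + norm x) ^ M * cmod (e x) \<le> C" using rapidE[OF e] by blast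
  obtain D where D: "D \<ge> 0" "\<And>x. (1 + norm x) ^ (M + 2 * CARD('n)) * cmod (P x) \<le> D" using rapidE[OF P] by blast
  define I where "I = (LINT x::real^'n|lborel. 1 / (1 + norm x) ^ (2 * CARD('n)))"
  have ii: "integrable lborel (\<lambda>x::real^'n. 1 / (1 + norm x) ^ (2 * CARD('n)))"
    by (rule integrable_inverse_power) simp
  have "cmod (fourier_integral (cut_inverse e R) \<xi>) \<le> (C * D * I) / (1 + norm \<xi>) ^ M" if R: "R \<ge> 1" for R \<xi>
  proof -
    have pt: "norm (e (\<xi> - \<eta> /\<^sub>R R) * P \<eta>) \<le> C * D / (1 + norm \<xi>) ^ M * (1 / (1 + norm \<eta>) ^ (2 * CARD('n)))" for \<eta>
    proof -
      let ?a = "\<xi> - \<eta> /\<^sub>R R"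
      have "norm \<xi> \<le> norm ?a + norm (\<eta> /\<^sub>R R)" by (metis diff_add_cancel norm_triangle_ineq)
      also have "norm (\<eta> /\<^sub>R R) \<le> norm \<eta>" using R by (simp add: mult_left_le_one_le inverse_le_1_iff)
      finally have "norm \<xi> \<le> norm ?a + norm \<eta>" by simp
      also have "\<dots> \<le> norm ?a + norm \<eta> + norm ?a * norm \<eta>" by simp
      finally have "1 + norm \<xi> \<le> (1 + norm ?a) * (1 + norm \<eta>)" by (simp add: algebra_simps)
      then have "(1 + norm \<xi>) ^ M \<le> ((1 + norm ?a) * (1 + norm \<eta>)) ^ M" by (intro power_mono) auto
      then have "(1 + norm \<xi>) ^ M * ((1 + norm \<eta>) ^ (2 * CARD('n)) * (cmod (e ?a) * cmod (P \<eta>)))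
        \<le> ((1 + norm ?a) * (1 + norm \<eta>)) ^ M * ((1 + norm \<eta>) ^ (2 * CARD('n)) * (cmod (e ?a) * cmod (P \<eta>)))"
        by (intro mult_right_mono) auto
      also have "\<dots> = ((1 + norm ?a) ^ M * cmod (e ?a)) * ((1 + norm \<eta>) ^ (M + 2 * CARD('n)) * cmod (P \<eta>))"
        by (simp add: power_mult_distrib power_add mult_ac)
      also have "\<dots> \<le> C * D" using C D by (intro mult_mono) auto
      finally have "cmod (e ?a) * cmod (P \<eta>) * ((1 + norm \<xi>) ^ M * (1 + norm \<eta>) ^ (2 * CARD('n))) \<le> C * D"
        by (simp only: mult_ac)
      moreover have "(1 + norm \<xi>) ^ M * (1 + norm \<eta>) ^ (2 * CARD('n)) > 0"
        by (intro mult_pos_pos zero_less_power) (auto simp: add_pos_nonneg)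
      ultimately have "cmod (e ?a) * cmod (P \<eta>) \<le> C * D / ((1 + norm \<xi>) ^ M * (1 + norm \<eta>) ^ (2 * CARD('n)))"
        by (simp only: pos_le_divide_eq)
      then show ?thesis by (simp add: norm_mult)
    qed
    have "cmod (LINT \<eta>|lborel. e (\<xi> - \<eta> /\<^sub>R R) * P \<eta>) \<le> (LINT \<eta>|lborel. C * D / (1 + norm \<xi>) ^ M * (1 / (1 + norm (\<eta>::real^'n)) ^ (2 * CARD('n))))"
      by (rule Bochner_Integration.integral_norm_bound_integral[OF _ _ pt])
         (use ii P C(1) D(1) in \<open>auto intro!: Bochner_Integration.integrable_bound[OF integrable_mult_right[OF ii, of "C * D / (1 + norm \<xi>) ^ M"] _ AE_I2] order_trans[OF pt]\<close>)
    also have "\<dots> = (C * D * I) / (1 + norm \<xi>) ^ M"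
      by (subst integral_mult_right_zero) (simp add: I_def)
    finally show ?thesis using R by (simp add: fourier_cut_inverse[OF N e] P_def)
  qed
  then show ?thesis by blast
qed

lemma fourier_cut_inverse_tendsto:
  fixes e :: "real^'n \<Rightarrow> complex"
  assumes N: "CARD('n) \<ge> 2" and e: "rapid e" and \<xi>: "\<xi> \<noteq> 0"
  shows "(\<lambda>n. fourier_integral (cut_inverse e (real n + 1)) \<xi>) \<longlonglongrightarrow> e \<xi>"
proof -
  note [measurable] = rapid_measurable[OF e]
  define P where "P = fourier_integral (psi 1 :: real^'n \<Rightarrow> complex)"
  have P: "rapid P" unfolding P_def by (intro rapid_fourier_integral N psi_C0_infinity) simp
  note [measurable] = rapid_measurable[OF P]
  obtain B where B: "\<And>x. cmod (e x) \<le> B" using rapid_bounded[OF e] by blast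
  have "isCont e \<xi>" using rapid_continuous[OF e] \<xi> by (simp add: continuous_on_eq_continuous_at open_Compl)
  have lim: "(\<lambda>n. e (\<xi> - \<eta> /\<^sub>R (real n + 1)) * P \<eta>) \<longlonglongrightarrow> e \<xi> * P \<eta>" for \<eta>
  proof -
    have "(\<lambda>n. inverse (real n + 1)) \<longlonglongrightarrow> 0" using LIMSEQ_inverse_real_of_nat by (simp add: add.commute)
    then have "(\<lambda>n. \<xi> - inverse (real n + 1) *\<^sub>R \<eta>) \<longlonglongrightarrow> \<xi> - 0 *\<^sub>R \<eta>" by (intro tendsto_intros)
    then have "(\<lambda>n. \<xi> - \<eta> /\<^sub>R (real n + 1)) \<longlonglongrightarrow> \<xi>" by simp
    from isCont_tendsto_compose[OF \<open>isCont e \<xi>\<close> this] show ?thesis by (intro tendsto_intros)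
  qed
  have "(\<lambda>n. LINT \<eta>|lborel. e (\<xi> - \<eta> /\<^sub>R (real n + 1)) * P \<eta>) \<longlonglongrightarrow> (LINT \<eta>|lborel. e \<xi> * P \<eta>)"
  proof (rule integral_dominated_convergence[where w="\<lambda>\<eta>. B * cmod (P \<eta>)"])
    show "integrable lborel (\<lambda>\<eta>. B * cmod (P \<eta>))" using rapid_integrable[OF P] by simp
    show "AE \<eta> in lborel. norm (e (\<xi> - \<eta> /\<^sub>R (real n + 1)) * P \<eta>) \<le> B * cmod (P \<eta>)" for n
      by (intro AE_I2) (auto simp: norm_mult intro!: mult_right_mono B)
  qed (use lim in auto)
  moreover have "(LINT \<eta>|lborel. P \<eta>) = 1"
    using integral_fourier_eq_value[OF N psi_C0_infinity[of 1, where 'a='n]] by (simp add: P_def)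
  ultimately show ?thesis by (simp add: fourier_cut_inverse[OF N e] P_def)
qed

lemma wip_tendsto:
  fixes h :: "nat \<Rightarrow> real^'n \<Rightarrow> complex"
  assumes g: "g \<ge> 0" and [measurable]: "\<And>n. h n \<in> borel_measurable borel" "k \<in> borel_measurable borel"
    and bd: "\<And>M. \<exists>C. \<forall>n x. cmod (h n x) \<le> C / (1 + norm x) ^ M"
    and lim: "\<And>x. x \<noteq> 0 \<Longrightarrow> (\<lambda>n. h n x) \<longlonglongrightarrow> k x"
  shows "(\<lambda>n. Re (wip g (h n) (h n))) \<longlonglongrightarrow> Re (wip g k k)"
proof -
  obtain K :: nat where K: "real K \<ge> g" using real_arch_simple by blast
  obtain C where C: "\<And>n x. cmod (h n x) \<le> C / (1 + norm x) ^ (K + 2 * CARD('n))" using bd by blast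
  have ii: "integrable lborel (\<lambda>x::real^'n. 1 / (1 + norm x) ^ (2 * CARD('n)))"
    by (rule integrable_inverse_power) simp
  have le: "norm x powr g * (cmod (h n x))\<^sup>2 \<le> C\<^sup>2 * (1 / (1 + norm x) ^ (2 * CARD('n)))" for n x
  proof -
    let ?r = "1 + norm x"
    have r: "?r \<ge> 1" by simp
    have a: "norm x powr g \<le> ?r ^ K"
    proof -
      have "norm x powr g \<le> ?r powr g" using g by (intro powr_mono2) auto
      also have "\<dots> \<le> ?r powr real K" using K r by (intro powr_mono) auto
      also have "\<dots> = ?r ^ K" by (rule powr_realpow) (simp add: add_pos_nonneg)
      finally show ?thesis .
    qed
    have b: "(cmod (h n x))\<^sup>2 \<le> (C / ?r ^ (K + 2 * CARD('n)))\<^sup>2" using C by (intro power_mono) auto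
    have "norm x powr g * (cmod (h n x))\<^sup>2 \<le> ?r ^ K * (C / ?r ^ (K + 2 * CARD('n)))\<^sup>2"
      by (intro mult_mono a b) auto
    also have "\<dots> = C\<^sup>2 * (1 / (?r ^ K * ?r ^ (2 * CARD('n)) * ?r ^ (2 * CARD('n))))"
    proof -
      have "?r \<noteq> 0" using r by linarith
      then show ?thesis by (simp add: power_divide power_add power2_eq_square)
    qed
    also have "\<dots> \<le> C\<^sup>2 * (1 / ?r ^ (2 * CARD('n)))"
    proof (intro mult_left_mono divide_left_mono)
      have "1 * 1 * ?r ^ (2 * CARD('n)) \<le> ?r ^ K * ?r ^ (2 * CARD('n)) * ?r ^ (2 * CARD('n))"
        using r by (intro mult_mono one_le_power) auto
      then show "?r ^ (2 * CARD('n)) \<le> ?r ^ K * ?r ^ (2 * CARD('n)) * ?r ^ (2 * CARD('n))" by simp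
    qed (auto simp: add_pos_nonneg zero_less_mult_iff)
    finally show ?thesis .
  qed
  have "(\<lambda>n. LINT x|lborel. norm x powr g * (cmod (h n x))\<^sup>2) \<longlonglongrightarrow> (LINT x|lborel. norm x powr g * (cmod (k x))\<^sup>2)"
  proof (rule integral_dominated_convergence[where w="\<lambda>x. C\<^sup>2 * (1 / (1 + norm x) ^ (2 * CARD('n)))"])
    show "integrable lborel (\<lambda>x::real^'n. C\<^sup>2 * (1 / (1 + norm x) ^ (2 * CARD('n))))" by (intro integrable_mult_right ii)
    show "AE x in lborel. (\<lambda>n. norm x powr g * (cmod (h n x))\<^sup>2) \<longlonglongrightarrow> norm x powr g * (cmod (k x))\<^sup>2"
      using AE_lborel_neq[of 0] by eventually_elim (intro tendsto_intros lim)
  qed (use le in auto)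
  then show ?thesis by (simp add: wip_self)
qed

text \<open>The counterpart for inverse transforms of the computation in
  \<open>weighted_gradient_identity\<close>: both operations are transferred to \<open>e\<close>,
  where they combine to the j-th partial of x_i e.\<close>

lemma partial_inverse_hess:
  fixes e :: "real^'n \<Rightarrow> complex"
  assumes N: "CARD('n) \<ge> 2" and e: "e \<in> form_domain"
  shows "of_real (x $ j) * partial_deriv i (fourier_integral (\<lambda>y. e (- y))) x = - fourier_integral (hess i j e) (- x)"
proof -
  note re = form_domain_rapid[OF e]
  have [measurable]: "e \<in> borel_measurable borel" by (rule rapid_measurable[OF re])
  have "partial_deriv i (fourier_integral (\<lambda>y. e (- y))) x = fourier_integral (\<lambda>y. - 2 * of_real pi * \<i> * (of_real (y $ i) * e (- y))) x"
    unfolding partial_deriv_eq[OF has_derivative_fourier_integral[OF rapid_reflect[OF re]]] by (rule sum_axis)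
  also have "\<dots> = fourier_integral (\<lambda>y. 2 * of_real pi * \<i> * (of_real ((- y) $ i) * e (- y))) x" by simp
  also have "\<dots> = fourier_integral (\<lambda>y. 2 * of_real pi * \<i> * (of_real (y $ i) * e y)) (- x)"
    by (rule fourier_integral_reflect[symmetric]) measurable
  also have "\<dots> = 2 * of_real pi * \<i> * fourier_integral (\<lambda>y. of_real (y $ i) * e y) (- x)" by (rule fourier_integral_cmult)
  finally show ?thesis
    using fourier_integral_partial[OF N rapid_component[OF re] rapid_hess[OF e] has_partial_hess[OF e], of i j "- x"]
    by simp
qed

lemma C0_infinity_bounded:
  assumes "u \<in> C0_infinity"
  shows "\<exists>B\<ge>0. \<forall>x. cmod (u x) \<le> B"
  using rapid_bounded[OF C0_infinity_rapid[OF assms]] by (metis norm_ge_zero order_trans)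

text \<open>Convergence is shown before the transform, where the singularity of the gradient of
  \<open>e\<close> at the origin is invisible. There the weighted derivatives are w \<theta>(x/R) -
  F \<psi>(x/R) with square integrable \<open>w\<close> and \<open>F\<close>, test functions
  \<theta> with \<theta>(0) = 0, and \<psi>(0) = 1; so the first part disappears and dominated
  convergence applies.\<close>

lemma gip_cut_inverse_tendsto:
  fixes e :: "real^'n \<Rightarrow> complex"
  assumes N: "CARD('n) \<ge> 2" and e: "e \<in> form_domain"
  defines "v \<equiv> \<lambda>n::nat. fourier_integral (cut_inverse e (real n + 1))"
  shows "(\<lambda>n. Re (gip (v n) (v n))) \<longlonglongrightarrow> Re (gip e e)"
proof -
  note re = form_domain_rapid[OF e]
  define w where "w = fourier_integral (\<lambda>y. e (- y))"
  define F where "F i j x = fourier_integral (hess i j e) (- x)" for i j x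
  define \<theta> where "\<theta> i j y = of_real (y $ j) * partial_deriv i (psi 1) y" for i j and y :: "real^'n"
  have psi1: "psi 1 \<in> C0_infinity" by (rule psi_C0_infinity) simp
  have \<theta>: "\<theta> i j \<in> C0_infinity" for i j
    unfolding \<theta>_def[abs_def] by (intro C0_infinity_component C0_infinity_partial psi1)
  have dw: "w differentiable (at x)" for x
    unfolding w_def differentiable_def by (rule exI, rule has_derivative_fourier_integral[OF rapid_reflect[OF re]])
  have w_eq: "w x = fourier_integral e (- x)" for x
    unfolding w_def by (rule fourier_integral_reflect[symmetric]) (rule rapid_measurable[OF re])
  have cut: "cut_inverse e R \<in> C0_infinity" if "R > 0" for R by (rule cut_inverse_C0_infinity[OF re that])
  have part: "of_real (x $ j) * partial_deriv i (cut_inverse e R) x = w x * \<theta> i j (x /\<^sub>R R) - F i j x * psi 1 (x /\<^sub>R R)"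
    if R: "R > 0" for R x i j
  proof -
    have "partial_deriv i (cut_inverse e R) x = w x * partial_deriv i (psi (1 / R\<^sup>2)) x + partial_deriv i w x * psi (1 / R\<^sup>2) x"
      unfolding cut_inverse_def[abs_def] w_def[symmetric] using R by (intro partial_deriv_mult dw C0_infinityD psi_C0_infinity) simp
    then have "of_real (x $ j) * partial_deriv i (cut_inverse e R) x = w x * (of_real (x $ j) * partial_deriv i (psi (1 / R\<^sup>2)) x) + (of_real (x $ j) * partial_deriv i w x) * psi (1 / R\<^sup>2) x"
      by (simp only: distrib_left mult_ac)
    then show ?thesis
      unfolding psi_partial[OF R] psi_scale[OF R] w_def partial_inverse_hess[OF N e] by (simp add: \<theta>_def F_def)
  qed
  obtain B where B: "B \<ge> 0" "\<And>x::real^'n. cmod (psi 1 x) \<le> B" using C0_infinity_bounded[OF psi1] by blast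
  define T where "T i j = (SOME B. B \<ge> 0 \<and> (\<forall>x. cmod (\<theta> i j x) \<le> B))" for i j
  have T: "T i j \<ge> 0" "cmod (\<theta> i j x) \<le> T i j" for i j x
    using someI_ex[OF C0_infinity_bounded[OF \<theta>[of i j]]] by (simp_all add: T_def)
  have [measurable]: "w \<in> borel_measurable borel" "F i j \<in> borel_measurable borel" "\<theta> i j \<in> borel_measurable borel"
    "psi 1 \<in> borel_measurable (borel :: (real^'n) measure)" for i j
    unfolding w_def F_def[abs_def]
    using measurable_fourier_integral[OF rapid_integrable[OF rapid_reflect[OF re]]]
      borel_measurable_uminus_comp[OF measurable_fourier_integral[OF rapid_integrable[OF rapid_hess[OF e]]]]
      C0_infinity_measurable[OF \<theta>] C0_infinity_measurable[OF psi1] by blast+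
  have iw: "integrable lborel (\<lambda>x. (cmod (w x))\<^sup>2)"
    unfolding w_eq by (rule plancherel_inverse(1)[OF rapid_tame[OF re]])
  have iF: "integrable lborel (\<lambda>x. (cmod (F i j x))\<^sup>2)" for i j
    unfolding F_def by (rule plancherel_inverse(1)[OF rapid_tame[OF rapid_hess[OF e]]])
  define S where "S n x = (\<Sum>i\<in>UNIV. \<Sum>j\<in>UNIV. (cmod (w x * \<theta> i j (x /\<^sub>R (real n + 1)) - F i j x * psi 1 (x /\<^sub>R (real n + 1))))\<^sup>2)" for n :: nat and x
  have S: "(norm x)\<^sup>2 * grad_norm_sq (cut_inverse e (real n + 1)) x = S n x" for n x
  proof -
    have "S n x = (\<Sum>i\<in>UNIV. \<Sum>j\<in>UNIV. (cmod (of_real (x $ j) * partial_deriv i (cut_inverse e (real n + 1)) x))\<^sup>2)"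
      unfolding S_def by (subst part) auto
    also have "\<dots> = (\<Sum>i\<in>UNIV. (\<Sum>j\<in>UNIV. (x $ j)\<^sup>2) * (cmod (partial_deriv i (cut_inverse e (real n + 1)) x))\<^sup>2)"
      by (simp add: norm_mult power_mult_distrib sum_distrib_right)
    finally show ?thesis by (simp add: grad_norm_sq_def norm_vec_power2 sum_distrib_left)
  qed
  have "Re (gip (v n) (v n)) = (LINT x|lborel. S n x)" for n
    unfolding v_def S[symmetric] by (rule weighted_gradient_identity[OF N, symmetric]) (rule cut, simp)
  moreover have "(\<lambda>n. LINT x|lborel. S n x) \<longlonglongrightarrow> (LINT x|lborel. (\<Sum>i\<in>UNIV. \<Sum>j\<in>UNIV. (cmod (F i j x))\<^sup>2))"
  proof (rule integral_dominated_convergence[where w="\<lambda>x. \<Sum>i\<in>UNIV. \<Sum>j\<in>UNIV. 2 * (T i j)\<^sup>2 * (cmod (w x))\<^sup>2 + 2 * B\<^sup>2 * (cmod (F i j x))\<^sup>2"])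
    show "integrable lborel (\<lambda>x. \<Sum>i\<in>UNIV. \<Sum>j\<in>UNIV. 2 * (T i j)\<^sup>2 * (cmod (w x))\<^sup>2 + 2 * B\<^sup>2 * (cmod (F i j x))\<^sup>2)"
      using iw iF by (intro Bochner_Integration.integrable_sum Bochner_Integration.integrable_add integrable_mult_right)
    have lim: "(\<lambda>n. S n x) \<longlonglongrightarrow> (\<Sum>i\<in>UNIV. \<Sum>j\<in>UNIV. (cmod (F i j x))\<^sup>2)" for x
    proof -
      have "(\<lambda>n. inverse (real n + 1)) \<longlonglongrightarrow> 0" using LIMSEQ_inverse_real_of_nat by (simp add: add.commute)
      then have "(\<lambda>n. inverse (real n + 1) *\<^sub>R x) \<longlonglongrightarrow> 0 *\<^sub>R x" by (intro tendsto_intros)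
      then have z: "(\<lambda>n. x /\<^sub>R (real n + 1)) \<longlonglongrightarrow> 0" by simp
      have c: "(\<lambda>n. u (x /\<^sub>R (real n + 1))) \<longlonglongrightarrow> u 0" if "u \<in> C0_infinity" for u :: "real^'n \<Rightarrow> complex"
        using C0_infinityD(3)[OF that] z by (intro isCont_tendsto_compose[of 0 u]) (auto simp: continuous_on_eq_continuous_at)
      have t: "(\<lambda>n. \<theta> i j (x /\<^sub>R (real n + 1))) \<longlonglongrightarrow> 0" for i j using c[OF \<theta>[of i j]] by (simp add: \<theta>_def)
      have p: "(\<lambda>n. psi 1 (x /\<^sub>R (real n + 1))) \<longlonglongrightarrow> 1" using c[OF psi1] by simp
      have "(\<lambda>n. S n x) \<longlonglongrightarrow> (\<Sum>i\<in>UNIV. \<Sum>j\<in>UNIV. (cmod (w x * 0 - F i j x * 1))\<^sup>2)"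
        unfolding S_def by (intro tendsto_intros t p)
      then show ?thesis by simp
    qed
    then show "AE x in lborel. (\<lambda>n. S n x) \<longlonglongrightarrow> (\<Sum>i\<in>UNIV. \<Sum>j\<in>UNIV. (cmod (F i j x))\<^sup>2)" by simp
    have sq: "(cmod (a * t - b * p))\<^sup>2 \<le> 2 * U\<^sup>2 * (cmod a)\<^sup>2 + 2 * V\<^sup>2 * (cmod b)\<^sup>2" if "cmod t \<le> U" "cmod p \<le> V" for a b t p U V
    proof -
      have "cmod (a * t - b * p) \<le> cmod a * cmod t + cmod b * cmod p" by (metis norm_mult norm_triangle_ineq4)
      also have "\<dots> \<le> cmod a * U + cmod b * V" using that by (intro add_mono mult_left_mono) auto
      finally have "(cmod (a * t - b * p))\<^sup>2 \<le> (cmod a * U + cmod b * V)\<^sup>2" by (intro power_mono) auto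
      also have "\<dots> \<le> 2 * U\<^sup>2 * (cmod a)\<^sup>2 + 2 * V\<^sup>2 * (cmod b)\<^sup>2"
        using zero_le_power2[of "cmod a * U - cmod b * V"] by (simp add: power2_eq_square algebra_simps)
      finally show ?thesis .
    qed
    show "AE x in lborel. norm (S n x) \<le> (\<Sum>i\<in>UNIV. \<Sum>j\<in>UNIV. 2 * (T i j)\<^sup>2 * (cmod (w x))\<^sup>2 + 2 * B\<^sup>2 * (cmod (F i j x))\<^sup>2)" for n
    proof (intro AE_I2)
      fix x
      have "S n x \<ge> 0" unfolding S_def by (intro sum_nonneg) simp
      moreover have "S n x \<le> (\<Sum>i\<in>UNIV. \<Sum>j\<in>UNIV. 2 * (T i j)\<^sup>2 * (cmod (w x))\<^sup>2 + 2 * B\<^sup>2 * (cmod (F i j x))\<^sup>2)"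
        unfolding S_def by (intro sum_mono sq T B)
      ultimately show "norm (S n x) \<le> (\<Sum>i\<in>UNIV. \<Sum>j\<in>UNIV. 2 * (T i j)\<^sup>2 * (cmod (w x))\<^sup>2 + 2 * B\<^sup>2 * (cmod (F i j x))\<^sup>2)" by simp
    qed
    show "S n \<in> borel_measurable lborel" for n unfolding S_def[abs_def] by measurable
    show "(\<lambda>x. \<Sum>i\<in>UNIV. \<Sum>j\<in>UNIV. (cmod (F i j x))\<^sup>2) \<in> borel_measurable lborel" by measurable
  qed
  moreover have "(LINT x|lborel. (\<Sum>i\<in>UNIV. \<Sum>j\<in>UNIV. (cmod (F i j x))\<^sup>2)) = Re (gip e e)"
  proof -
    have "(LINT x|lborel. (\<Sum>i\<in>UNIV. \<Sum>j\<in>UNIV. (cmod (F i j x))\<^sup>2)) = (\<Sum>i\<in>UNIV. \<Sum>j\<in>UNIV. LINT x|lborel. (cmod (F i j x))\<^sup>2)"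
      using iF by (simp add: Bochner_Integration.integral_sum Bochner_Integration.integrable_sum)
    also have "\<dots> = (\<Sum>i\<in>UNIV. \<Sum>j\<in>UNIV. LINT x|lborel. (cmod (hess i j e x))\<^sup>2)"
      unfolding F_def by (simp add: plancherel_inverse(2)[OF rapid_tame[OF rapid_hess[OF e]]])
    finally show ?thesis by (simp add: hess_norm[OF N e])
  qed
  ultimately show ?thesis by simp
qed

theorem form_domain_approximation:
  fixes e :: "real^'n \<Rightarrow> complex"
  assumes N: "CARD('n) \<ge> 2" and e: "e \<in> form_domain"
  obtains u :: "nat \<Rightarrow> real^'n \<Rightarrow> complex" where "\<And>n. u n \<in> C0_infinity"
    "\<And>g. g \<ge> 0 \<Longrightarrow> (\<lambda>n. Re (wip g (fourier_integral (u n)) (fourier_integral (u n)))) \<longlonglongrightarrow> Re (wip g e e)"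
    "\<And>g. g \<ge> 0 \<Longrightarrow> (\<lambda>n. Re (wip g (\<lambda>\<xi>. fourier_integral (u n) \<xi> - e \<xi>) (\<lambda>\<xi>. fourier_integral (u n) \<xi> - e \<xi>))) \<longlonglongrightarrow> 0"
    "(\<lambda>n. Re (gip (fourier_integral (u n)) (fourier_integral (u n)))) \<longlonglongrightarrow> Re (gip e e)"
proof
  note re = form_domain_rapid[OF e]
  let ?u = "\<lambda>n::nat. cut_inverse e (real n + 1)"
  let ?v = "\<lambda>n. fourier_integral (?u n)"
  show u: "?u n \<in> C0_infinity" for n by (rule cut_inverse_C0_infinity[OF re]) simp
  have bd: "\<exists>C. \<forall>n x. cmod (?v n x) \<le> C / (1 + norm x) ^ M" for M
    using fourier_cut_inverse_bound[OF N re, of M] by (metis le_add_same_cancel2 of_nat_0_le_iff)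
  have [measurable]: "?v n \<in> borel_measurable borel" for n
    by (intro rapid_measurable rapid_fourier_integral N u)
  have [measurable]: "e \<in> borel_measurable borel" by (rule rapid_measurable[OF re])
  show "(\<lambda>n. Re (wip g (?v n) (?v n))) \<longlonglongrightarrow> Re (wip g e e)" if "g \<ge> 0" for g
    by (rule wip_tendsto[OF that _ _ bd]) (auto intro: fourier_cut_inverse_tendsto[OF N re])
  show "(\<lambda>n. Re (wip g (\<lambda>\<xi>. ?v n \<xi> - e \<xi>) (\<lambda>\<xi>. ?v n \<xi> - e \<xi>))) \<longlonglongrightarrow> 0" if g: "g \<ge> 0" for g
  proof -
    have "(\<lambda>n. Re (wip g (\<lambda>\<xi>. ?v n \<xi> - e \<xi>) (\<lambda>\<xi>. ?v n \<xi> - e \<xi>))) \<longlonglongrightarrow> Re (wip g (\<lambda>\<xi>::real^'n. 0) (\<lambda>\<xi>. 0))"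
    proof (rule wip_tendsto[OF g])
      fix M
      obtain C where C: "\<And>n x. cmod (?v n x) \<le> C / (1 + norm x) ^ M" using bd by blast
      obtain D where D: "\<And>x. cmod (e x) \<le> D / (1 + norm x) ^ M" using rapid_bound[OF re] by blast
      have "cmod (?v n x - e x) \<le> (C + D) / (1 + norm x) ^ M" for n x
        using norm_triangle_ineq4[of "?v n x" "e x"] C[of n x] D[of x] by (simp add: add_divide_distrib)
      then show "\<exists>C. \<forall>n x. cmod (?v n x - e x) \<le> C / (1 + norm x) ^ M" by blast
    next
      fix x :: "real^'n" assume "x \<noteq> 0"
      then show "(\<lambda>n. ?v n x - e x) \<longlonglongrightarrow> 0"
        using tendsto_diff[OF fourier_cut_inverse_tendsto[OF N re, of x] tendsto_const[of "e x"]] by simp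
    qed measurable
    then show ?thesis by (simp add: wip_def)
  qed
  show "(\<lambda>n. Re (gip (?v n) (?v n))) \<longlonglongrightarrow> Re (gip e e)" by (rule gip_cut_inverse_tendsto[OF N e])
qed

section \<open>Sharpness\<close>

lemma hermitian_form_rapid:
  assumes "s \<ge> 0"
  shows "hermitian_form {f :: real^'n \<Rightarrow> complex. rapid f} (wip s)"
  using assms by unfold_locales (auto simp: rapid_add rapid_scale wip_add wip_scale wip_nonneg intro: wip_cnj)

text \<open>From v - g = (v - e) - (g - e), where g - e is at least as long as \<open>e\<close> by
  orthogonality; the mixed term is split by Young's inequality with parameter t. The bound does not
  depend on \<open>g\<close>, so it survives the infimum over a class.\<close>

lemma wip_distance_ge:
  fixes v e g :: "real^'n \<Rightarrow> complex"
  assumes s: "s \<ge> 0" and r: "rapid v" "rapid e" "rapid g" and orth: "wip s e g = 0" and t: "0 < t" "t < 1"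
  shows "(1 - t) * Re (wip s e e) - Re (wip s (\<lambda>x. v x - e x) (\<lambda>x. v x - e x)) / t \<le> Re (wip s (\<lambda>x. v x - g x) (\<lambda>x. v x - g x))"
proof -
  interpret hermitian_form "{f :: real^'n \<Rightarrow> complex. rapid f}" "wip s" by (rule hermitian_form_rapid[OF s])
  define a where "a x = v x - e x" for x
  define h where "h x = g x - e x" for x
  have ra: "rapid a" and rh: "rapid h" and rth: "rapid (\<lambda>x. of_real t * h x)"
    using r by (auto simp: a_def[abs_def] h_def[abs_def] intro!: rapid_diff rapid_scale)
  define A where "A = Re (wip s a a)"
  define H where "H = Re (wip s h h)"
  define X where "X = Re (wip s a h)"
  have "wip s g e = 0" using wip_cnj[of s g e] orth by simp
  then have H: "H \<ge> Re (wip s e e)"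
    using B_self_diff[of g e] r wip_nonneg[of s g] by (simp add: H_def h_def[abs_def])
  have A: "A \<ge> 0" unfolding A_def by (rule wip_nonneg)
  have "wip s (\<lambda>x. of_real t * h x) (\<lambda>x. of_real t * h x) = of_real (t * t) * wip s h h"
    using rh rth by (simp add: B_scale_right wip_scale)
  moreover have "wip s a (\<lambda>x. of_real t * h x) = of_real t * wip s a h" using ra rh by (simp add: B_scale_right)
  ultimately have "0 \<le> A - 2 * (t * X) + t * t * H"
    using B_self_diff[of a "\<lambda>x. of_real t * h x"] ra rth wip_nonneg[of s "\<lambda>x. a x - of_real t * h x"]
    by (simp add: A_def H_def X_def)
  then have "t * (2 * X) \<le> t * (A / t + t * H)" using t by (simp add: algebra_simps)
  then have "2 * X \<le> A / t + t * H" using t(1) by (rule mult_left_le_imp_le)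
  moreover have "Re (wip s (\<lambda>x. a x - h x) (\<lambda>x. a x - h x)) = A - 2 * X + H"
    using B_self_diff[of a h] ra rh by (simp add: A_def H_def X_def)
  moreover have "(1 - t) * Re (wip s e e) \<le> (1 - t) * H" using H t by (intro mult_left_mono) auto
  moreover have "(\<lambda>x. a x - h x) = (\<lambda>x. v x - g x)" by (simp add: a_def h_def)
  ultimately have "(1 - t) * Re (wip s e e) - A / t \<le> Re (wip s (\<lambda>x. v x - g x) (\<lambda>x. v x - g x))"
    using A by (simp add: algebra_simps)
  then show ?thesis by (simp add: A_def a_def[abs_def])
qed

text \<open>The estimate is applied to test functions whose transforms approximate the eigenfunction
  \<open>e\<close>. In the limit the deficit is at most (2 pi)^s \<nu> |e|^2, by the
  arithmetic-geometric mean inequality at l = 1, while each class in \<open>J\<close>, being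
  orthogonal to \<open>e\<close>, stays at square distance at least (2 pi)^s |e|^2. The other
  classes in \<open>I\<close> contribute nonnegative terms and are dropped.\<close>

lemma coefficient_sum_le:
  fixes e :: "real^'n \<Rightarrow> complex" and c :: "'i \<Rightarrow> real" and W :: "'i \<Rightarrow> (real^'n \<Rightarrow> complex) set"
  assumes N: "CARD('n) \<ge> 2" and s: "s > 0" and e: "e \<in> form_domain"
    and eig: "qform s 1 e e = of_real \<nu> * wip s e e" and pos: "Re (wip s e e) > 0"
    and I: "finite I" "J \<subseteq> I" and c: "\<And>i. i \<in> I \<Longrightarrow> c i \<ge> 0" and ne: "\<And>i. i \<in> I \<Longrightarrow> W i \<noteq> {}"
    and orth: "\<And>i w. i \<in> J \<Longrightarrow> w \<in> W i \<Longrightarrow> \<exists>g. rapid g \<and> w = inv_fourier g \<and> wip s e g = 0"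
    and est: "\<And>u. u \<in> C0_infinity \<Longrightarrow> deficit s u \<ge> (\<Sum>i\<in>I. c i * energy_dist s (W i) u)"
  shows "(\<Sum>i\<in>J. c i) \<le> \<nu>"
proof -
  note re = form_domain_rapid[OF e]
  from form_domain_approximation[OF N e] obtain u where u: "\<And>n. u n \<in> C0_infinity"
    and lw: "\<And>g. g \<ge> 0 \<Longrightarrow> (\<lambda>n. Re (wip g (fourier_integral (u n)) (fourier_integral (u n)))) \<longlonglongrightarrow> Re (wip g e e)"
    and ld: "\<And>g. g \<ge> 0 \<Longrightarrow> (\<lambda>n. Re (wip g (\<lambda>\<xi>. fourier_integral (u n) \<xi> - e \<xi>) (\<lambda>\<xi>. fourier_integral (u n) \<xi> - e \<xi>))) \<longlonglongrightarrow> 0"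
    and lg: "(\<lambda>n. Re (gip (fourier_integral (u n)) (fourier_integral (u n)))) \<longlonglongrightarrow> Re (gip e e)" by blast
  define \<delta> where "\<delta> n = Re (wip s (\<lambda>\<xi>. fourier_integral (u n) \<xi> - e \<xi>) (\<lambda>\<xi>. fourier_integral (u n) \<xi> - e \<xi>))" for n
  define K where "K = (2 * pi) powr s"
  have K: "K > 0" by (simp add: K_def)
  let ?E = "Re (wip s e e)"
  let ?S = "\<Sum>i\<in>J. c i"
  have \<delta>: "\<delta> \<longlonglongrightarrow> 0" using ld[of s] s by (simp add: \<delta>_def[abs_def])
  have lim: "(\<lambda>n. deficit s (u n)) \<longlonglongrightarrow> K * (sqrt (Re (wip (2 * s) e e)) * sqrt (Re (gip e e)) - (real CARD('n) + s) / 2 * ?E)"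
    unfolding deficit_eq[OF N u s] K_def using s by (intro tendsto_intros lw lg) auto
  have "sqrt (Re (wip (2 * s) e e)) * sqrt (Re (gip e e)) \<le> (Re (wip (2 * s) e e) + Re (gip e e)) / 2"
    using arith_geo_mean_sqrt[OF wip_nonneg[of "2 * s" e] gip_nonneg[of e]] by (simp add: real_sqrt_mult)
  then have "sqrt (Re (wip (2 * s) e e)) * sqrt (Re (gip e e)) - (real CARD('n) + s) / 2 * ?E \<le> Re (qform s 1 e e)"
    unfolding qform_Re by (simp add: add_divide_distrib)
  also have "\<dots> = \<nu> * ?E" by (simp add: eig)
  finally have up: "K * (sqrt (Re (wip (2 * s) e e)) * sqrt (Re (gip e e)) - (real CARD('n) + s) / 2 * ?E) \<le> K * (\<nu> * ?E)"
    using K by (intro mult_left_mono) auto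
  \<comment> \<open>The factor z = 1 - t is the loss in the distance estimate; it disappears at the
    end because z < 1 is arbitrary.\<close>
  have "z * ?S \<le> \<nu>" if z: "0 < z" "z < 1" for z
  proof -
    define t where "t = 1 - z"
    have t: "0 < t" "t < 1" using z by (auto simp: t_def)
    have low: "?S * (K * ((1 - t) * ?E - \<delta> n / t)) \<le> deficit s (u n)" for n
    proof -
      have d: "K * ((1 - t) * ?E - \<delta> n / t) \<le> energy_dist s (W i) (u n)" if i: "i \<in> J" for i
      proof (rule energy_dist_ge)
        show "W i \<noteq> {}" using ne i I by blast
      next
        fix w assume "w \<in> W i"
        from orth[OF i this] obtain g where g: "rapid g" "w = inv_fourier g" "wip s e g = 0" by blast
        have "K * ((1 - t) * ?E - \<delta> n / t) \<le> K * Re (wip s (\<lambda>\<xi>. fourier_integral (u n) \<xi> - g \<xi>) (\<lambda>\<xi>. fourier_integral (u n) \<xi> - g \<xi>))"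
          unfolding \<delta>_def using K s wip_distance_ge[OF _ rapid_fourier_integral[OF N u] re g(1) g(3) t, of n]
          by (intro mult_left_mono) auto
        also have "\<dots> = energy (s/4) (\<lambda>x. u n x - w x)"
          unfolding g(2) K_def by (rule energy_diff[OF N u g(1) s, symmetric])
        finally show "K * ((1 - t) * ?E - \<delta> n / t) \<le> energy (s/4) (\<lambda>x. u n x - w x)" .
      qed
      have "?S * (K * ((1 - t) * ?E - \<delta> n / t)) \<le> (\<Sum>i\<in>J. c i * energy_dist s (W i) (u n))"
        unfolding sum_distrib_right using c I by (intro sum_mono mult_left_mono d) auto
      also have "\<dots> \<le> (\<Sum>i\<in>I. c i * energy_dist s (W i) (u n))"
        using c I ne by (intro sum_mono2) (auto intro!: mult_nonneg_nonneg energy_dist_nonneg)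
      also have "\<dots> \<le> deficit s (u n)" by (rule est[OF u])
      finally show ?thesis .
    qed
    have "(\<lambda>n. ?S * (K * ((1 - t) * ?E - \<delta> n / t))) \<longlonglongrightarrow> ?S * (K * ((1 - t) * ?E - 0 / t))"
      using t by (intro tendsto_intros \<delta>) auto
    from LIMSEQ_le[OF this lim] low
    have "?S * (K * ((1 - t) * ?E - 0 / t)) \<le> K * (sqrt (Re (wip (2 * s) e e)) * sqrt (Re (gip e e)) - (real CARD('n) + s) / 2 * ?E)"
      by blast
    with up have "?S * (K * ((1 - t) * ?E)) \<le> K * (\<nu> * ?E)" by simp
    then have "(K * ?E) * (z * ?S) \<le> (K * ?E) * \<nu>" by (simp add: t_def mult_ac)
    then show ?thesis by (rule mult_left_le_imp_le) (use K pos in simp)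
  qed
  then show ?thesis by (rule field_le_mult_one_interval)
qed

lemma harmonic_nontrivial:
  assumes "CARD('n) \<ge> 2"
  shows "\<exists>p. harmonic_homogeneous_poly k p \<and> (\<exists>x::real^'n. x \<noteq> 0 \<and> p x \<noteq> 0)"
proof -
  have "\<exists>a b :: 'n. a \<noteq> b"
  proof (rule ccontr)
    assume "\<not> (\<exists>a b :: 'n. a \<noteq> b)"
    then have "UNIV = {undefined :: 'n}" by auto
    then have "CARD('n) = 1" by (metis card_1_singleton_iff One_nat_def)
    with assms show False by simp
  qed
  then obtain a b :: 'n where ab: "a \<noteq> b" by blast
  let ?p = "\<lambda>x::real^'n. (of_real (x $ a) + \<i> * of_real (x $ b)) ^ k"
  have "?p (axis a 1) \<noteq> 0" using ab by (simp add: axis_def)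
  moreover have "axis a (1::real) \<noteq> 0" by simp
  ultimately show ?thesis using harmonic_complex_power[OF ab, of k] by blast
qed

lemma wip_pos:
  fixes e :: "real^'n \<Rightarrow> complex"
  assumes s: "s \<ge> 0" and e: "rapid e" and x: "x \<noteq> 0" "e x \<noteq> 0"
  shows "Re (wip s e e) > 0"
proof (rule ccontr)
  assume "\<not> Re (wip s e e) > 0"
  then have "Re (wip s e e) = 0" using wip_nonneg[of s e] by simp
  then have z: "(LINT x|lborel. norm x powr s * (cmod (e x))\<^sup>2) = 0" by (simp add: wip_self)
  have eq: "(\<lambda>x. of_real (norm x powr s) * (e x * cnj (e x))) = (\<lambda>x. complex_of_real (norm x powr s * (cmod (e x))\<^sup>2))"
    by (intro ext) (simp only: complex_norm_square of_real_mult)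
  have "integrable lborel (\<lambda>x. norm x powr s * (cmod (e x))\<^sup>2)"
    using integrable_wip[OF s e e] unfolding eq by (simp only: integrable_complex_of_real_iff)
  then have "AE x in lborel. norm x powr s * (cmod (e x))\<^sup>2 = 0"
    using z by (subst (asm) integral_nonneg_eq_0_iff_AE) auto
  then have ae: "AE x in lborel. x \<notin> (- {0}) \<inter> e -` (- {0})" by eventually_elim auto
  let ?U = "(- {0}) \<inter> e -` (- {0})"
  have "open ?U" by (intro continuous_open_preimage rapid_continuous e open_Compl) auto
  moreover have "?U \<in> null_sets lborel"
    using ae \<open>open ?U\<close> by (subst AE_iff_null_sets) (auto simp: borel_open)
  then have "negligible ?U" by (simp add: negligible_iff_null_sets null_sets_completionI)
  ultimately have "?U = {}" using open_not_negligible by blast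
  with x show False by blast
qed

text \<open>The product of the two exponentials is another one, with rate l + l', so the integral is
  covered by \<open>harmonic_orthogonal\<close>. Hence one eigenfunction is orthogonal to a class
  for all its \<lambda> simultaneously.\<close>

lemma atom_orthogonal:
  fixes p q :: "real^'n \<Rightarrow> complex"
  assumes N: "CARD('n) \<ge> 2" and s: "s > 0" and l: "l > 0" "l' > 0"
    and p: "harmonic_homogeneous_poly k p" and q: "harmonic_homogeneous_poly j q" and kj: "k \<noteq> j"
    and b: "b + real k \<ge> 0" "b' + real j \<ge> 0"
  shows "wip s (atom s l b p) (atom s l' b' q) = 0"
proof -
  have "of_real (norm x powr s) * (atom s l b p x * cnj (atom s l' b' q x)) = atom s (l + l') (s + b + b') (\<lambda>x. p x * cnj (q x)) x" for x
    by (simp add: atom_def wexp_mult[symmetric] powr_add mult_ac)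
  moreover have "(LINT x|lborel. atom s (l + l') (s + b + b') (\<lambda>x. p x * cnj (q x)) x) = 0"
    using l s b by (intro harmonic_orthogonal[OF N s _ p harmonic_cnj[OF q] kj]) auto
  ultimately show ?thesis by (simp add: wip_def)
qed

text \<open>The i-th space contains degrees up to min i m, and its possible extra generator has
  degree 0, which is below k as well.\<close>

lemma stable_space_orthogonal:
  fixes p :: "real^'n \<Rightarrow> complex"
  assumes N: "CARD('n) \<ge> 2" and s: "s > 0" and l: "l > 0" "l' > 0" and p: "harmonic_homogeneous_poly k p"
    and a: "\<And>k. a k \<ge> 0" and i: "min i m < k" and h: "h \<in> stable_space s l' a m i"
  shows "wip s (atom s l (a k - real k) p) h = 0"
proof -
  interpret hermitian_form "{f :: real^'n \<Rightarrow> complex. rapid f}" "wip s" using s by (intro hermitian_form_rapid) simp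
  have r: "rapid (atom s l' (a j - real j) q)" if "l' > 0" "harmonic_homogeneous_poly j q" for j l' and q :: "real^'n \<Rightarrow> complex"
    using that a[of j] unfolding harmonic_iff by (intro rapid_atom[OF s, of _ _ j]) auto
  have r1: "rapid (atom s l' s (\<lambda>x::real^'n. 1))"
    using harmonic_const[of 1, where 'a='n] s l unfolding harmonic_iff by (intro rapid_atom[OF s, of _ _ 0]) auto
  show ?thesis
  proof (rule B_orth_cspan[OF h[unfolded stable_space_def]])
    show "atom s l (a k - real k) p \<in> {f. rapid f}" using r[OF l(1) p] by simp
  next
    fix f :: "real^'n \<Rightarrow> complex" assume "f \<in> {atom s l' (a k - real k) q | k q. k \<le> i \<and> k \<le> m \<and> harmonic_homogeneous_poly k q} \<union> (if i \<le> m then {} else {atom s l' s (\<lambda>x. 1)})"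
    then consider j q where "f = atom s l' (a j - real j) q" "harmonic_homogeneous_poly j q" "j \<le> min i m" | "f = atom s l' s (\<lambda>x. 1)"
      by (auto split: if_splits)
    then show "wip s (atom s l (a k - real k) p) f = 0"
    proof cases
      case 1
      then show ?thesis using i a by (auto intro!: atom_orthogonal[OF N s l p])
    next
      case 2
      then show ?thesis using i a s by (auto intro!: atom_orthogonal[OF N s l p harmonic_const])
    qed
  qed (use r[OF l(2)] r1 in \<open>auto split: if_splits\<close>)
qed

text \<open>For the exponent D_k / 2 - k the defect term of \<open>qform_atom\<close> vanishes;
  positivity comes from a point off the origin at which the polynomial is nonzero.\<close>

lemma test_function:
  assumes N: "CARD('n) \<ge> 2" and s: "s > 0"
  obtains e :: "real^'n \<Rightarrow> complex" and p where "harmonic_homogeneous_poly k p"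
    "e = atom s 1 (D_const CARD('n) k / 2 - real k) p" "e \<in> form_domain"
    "qform s 1 e e = of_real (D_const CARD('n) k / 2) * wip s e e" "Re (wip s e e) > 0"
proof -
  obtain p and x :: "real^'n" where p: "harmonic_homogeneous_poly k p" and x: "x \<noteq> 0" "p x \<noteq> 0"
    using harmonic_nontrivial[OF N] by blast
  define e where "e = atom s 1 (D_const CARD('n) k / 2 - real k) p"
  have b: "D_const CARD('n) k / 2 - real k + real k \<ge> 0" using D_const_nonneg[OF N, of k] by simp
  have e: "e \<in> form_domain" unfolding e_def using p b s unfolding harmonic_iff by (intro atom_form_domain[of _ _ _ k]) auto
  have "qform s 1 e e = of_real (D_const CARD('n) k / 2) * wip s e e"
    using qform_atom[OF N s _ p b e, of 1] eigen_defect_indicial[OF N, of k] by (simp add: e_def)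
  moreover have "Re (wip s e e) > 0"
    using x s by (intro wip_pos[of _ _ x] form_domain_rapid e) (auto simp: e_def atom_def wexp_def)
  ultimately show thesis using that p e e_def by blast
qed

theorem theorem1p6:
  fixes s :: real
    and N m :: nat
    and n :: "nat \<Rightarrow> nat"
    and \<phi> :: "nat \<Rightarrow> nat \<Rightarrow> real^'n \<Rightarrow> complex"
  assumes "N = CARD('n)"
    and "N \<ge> 2"
    and "s \<ge> (D_const N 2 - D_const N 1) / 2"
    and "m = (GREATEST m. m \<ge> 1 \<and> D_const N m \<le> 2 * s \<and> D_const N (m + 1) - D_const N 1 \<le> 2 * s)"
    and "\<And>k. orthonormal_harmonic_basis k (n k) (\<phi> k)"
  shows "(\<forall>u\<in>C0_infinity.
            deficit s u \<ge> (\<Sum>j=0..m+1. \<beta> N s m j / 2 * energy_dist s (\<H> n \<phi> s m j) u))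
       \<and> (\<Sum>j=0..m+1. \<beta> N s m j / 2) = D_const N (m + 1) / 2
       \<and> \<beta> N s m 0 / 2 = D_const N 1 / 2
       \<and> stability_estimate TYPE('n) s (\<beta> N s m 0 / 2)
       \<and> (\<forall>K. stability_estimate TYPE('n) s K \<longrightarrow> K \<le> \<beta> N s m 0 / 2)
       \<and> (\<forall>j\<in>{0..m+1} - {m}. \<forall>b.
            multi_stability_estimate n \<phi> s m ((\<lambda>i. \<beta> N s m i / 2)(j := b)) \<longrightarrow> b \<le> \<beta> N s m j / 2)"
proof (intro conjI)
  note N = assms(1) and N2 = assms(2)
  have n2: "CARD('n) \<ge> 2" using assms by simp
  have D12: "D_const N 1 < D_const N 2" by (rule D_const_strict_mono[OF N2]) simp
  then have s: "s > 0" using assms(3) by simp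
  note m = greatest_index[OF assms(2-4)]
  note m' = m[unfolded N]
  let ?a = "\<lambda>k. D_const CARD('n) k / 2"
  have a: "?a k \<ge> 0" for k using D_const_nonneg[OF n2, of k] by simp
  have \<beta>: "\<beta> N s m j \<ge> 0" for j by (rule beta_nonneg[OF N2 m(2)])
  have \<beta>0: "\<beta> N s m 0 = D_const N 1" using m(1) by (simp add: \<beta>_def)
  have H: "\<H> n \<phi> s m j = {inv_fourier h | h l. l > 0 \<and> h \<in> stable_space s l ?a m j}" for j
    by (rule H_eq[OF assms(5)])
  have H_ne: "\<H> n \<phi> s m j \<noteq> {}" for j
  proof -
    have "(\<lambda>x::real^'n. 0) \<in> stable_space s 1 ?a m j" unfolding stable_space_def by (rule cspan_zero)
    then have "inv_fourier (\<lambda>x::real^'n. 0) \<in> \<H> n \<phi> s m j" unfolding H using zero_less_one by blast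
    then show ?thesis by blast
  qed
  let ?G = "{\<lambda>x::real^'n. \<alpha> * G_fun s l x | \<alpha> l. l > 0}"
  have G: "\<exists>\<alpha> l. l > 0 \<and> w = inv_fourier (\<lambda>\<xi>. \<alpha> * wexp s l \<xi>)" if "w \<in> ?G" for w
    using that G_fun_eq[OF s] by fastforce
  have G_ne: "?G \<noteq> {}" using zero_less_one by blast

  show "\<forall>u\<in>C0_infinity. deficit s u \<ge> (\<Sum>j=0..m+1. \<beta> N s m j / 2 * energy_dist s (\<H> n \<phi> s m j) u)"
  proof
    fix u :: "real^'n \<Rightarrow> complex" assume u: "u \<in> C0_infinity"
    show "deficit s u \<ge> (\<Sum>j=0..m+1. \<beta> N s m j / 2 * energy_dist s (\<H> n \<phi> s m j) u)"
      unfolding N by (rule stability_from_spectral[OF n2 s u m']) (rule energy_dist_le, unfold H, blast)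
  qed

  show "(\<Sum>j=0..m+1. \<beta> N s m j / 2) = D_const N (m + 1) / 2"
    using sum_beta(2)[OF m(1), of N s] unfolding sum_divide_distrib[symmetric] atLeast0AtMost by simp

  show "\<beta> N s m 0 / 2 = D_const N 1 / 2" by (simp add: \<beta>0)

  show "stability_estimate TYPE('n) s (\<beta> N s m 0 / 2)"
    unfolding stability_estimate_def
  proof (intro allI impI)
    fix u :: "real^'n \<Rightarrow> complex" assume u: "u \<in> C0_infinity"
    \<comment> \<open>Setting the distances of index j > 0 to 0 isolates the first term of the
      sum.\<close>
    define d where "d j = (if j = 0 then energy_dist s ?G u else 0)" for j :: nat
    have "deficit s u \<ge> (\<Sum>j=0..m+1. \<beta> CARD('n) s m j / 2 * d j)"
    proof (rule stability_from_spectral[OF n2 s u m'])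
      fix l j and h :: "real^'n \<Rightarrow> complex" assume l: "l > 0" and h: "h \<in> stable_space s l ?a m j"
      show "d j \<le> energy (s/4) (\<lambda>x. u x - inv_fourier h x)"
      proof (cases "j = 0")
        case True
        \<comment> \<open>\<open>h\<close> and the multiple of \<open>wexp\<close> may differ at the
          origin, which the weighted product does not notice.\<close>
        obtain c where c: "\<And>x. x \<noteq> 0 \<Longrightarrow> h x = c * wexp s l x" using stable_space_0 h True by blast
        have rh: "rapid h" by (rule stable_space_rapid[OF s l a h])
        have rc: "rapid (\<lambda>x::real^'n. c * wexp s l x)" by (intro rapid_scale rapid_wexp s l)
        have "energy_dist s ?G u \<le> energy (s/4) (\<lambda>x. u x - c * G_fun s l x)"
          using l by (intro energy_dist_le) blast
        also have "\<dots> = energy (s/4) (\<lambda>x. u x - inv_fourier (\<lambda>\<xi>. c * wexp s l \<xi>) x)"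
          by (simp only: G_fun_eq[OF s l])
        also have "\<dots> = energy (s/4) (\<lambda>x. u x - inv_fourier h x)"
          unfolding energy_diff[OF n2 u rh s] energy_diff[OF n2 u rc s]
          by (intro arg_cong[where f="\<lambda>x. (2 * pi) powr s * Re x"] wip_cong_off_0) (simp_all add: c)
        finally show ?thesis by (simp add: d_def True)
      qed (simp add: d_def energy_nonneg)
    qed
    also have "(\<Sum>j=0..m+1. \<beta> CARD('n) s m j / 2 * d j) = \<beta> N s m 0 / 2 * energy_dist s ?G u"
      unfolding d_def N by (simp add: if_distrib[of "\<lambda>x. _ * x"] sum.delta cong: if_cong)
    finally show "deficit s u \<ge> \<beta> N s m 0 / 2 * energy_dist s ?G u" .
  qed

  show "\<forall>K. stability_estimate TYPE('n) s K \<longrightarrow> K \<le> \<beta> N s m 0 / 2"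
  proof (intro allI impI)
    fix K assume K: "stability_estimate TYPE('n) s K"
    \<comment> \<open>A negative K is below \<beta>_0 / 2 >= 0 at once; the comparison with an
      eigenfunction of degree 1 is made for nonnegative coefficients.\<close>
    show "K \<le> \<beta> N s m 0 / 2"
    proof (cases "K \<ge> 0")
      case True
      from test_function[OF n2 s] obtain e :: "real^'n \<Rightarrow> complex" and p where p: "harmonic_homogeneous_poly 1 p"
        and e_def: "e = atom s 1 (?a 1 - real 1) p" and e: "e \<in> form_domain" 
        and eig: "qform s 1 e e = of_real (?a 1) * wip s e e" and pos: "Re (wip s e e) > 0" by metis
      have "(\<Sum>i\<in>{0::nat}. K) \<le> ?a 1"
      proof (rule coefficient_sum_le[OF n2 s e eig pos, where I="{0}" and W="\<lambda>_. ?G"])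
        fix w assume "w \<in> ?G"
        then obtain \<alpha> l where l: "l > 0" and w: "w = inv_fourier (\<lambda>\<xi>. \<alpha> * wexp s l \<xi>)" using G by blast
        have "wip s e (\<lambda>\<xi>. \<alpha> * wexp s l \<xi>) = wip s e (atom s l 0 (\<lambda>x. \<alpha>))"
          by (rule wip_cong_off_0) (simp_all add: atom_def)
        also have "\<dots> = 0"
          unfolding e_def using a[of 1] by (intro atom_orthogonal[OF n2 s _ l p harmonic_const]) auto
        finally show "\<exists>g. rapid g \<and> w = inv_fourier g \<and> wip s e g = 0"
          using w rapid_scale[OF rapid_wexp[OF s l]] by blast
      next
        show "deficit s u \<ge> (\<Sum>i\<in>{0::nat}. K * energy_dist s ?G u)" if "u \<in> C0_infinity" for u
          using K that by (simp add: stability_estimate_def)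
      qed (use True G_ne in auto)
      then show ?thesis by (simp add: \<beta>0[unfolded N] N)
    next
      case False
      then show ?thesis using \<beta>[of 0] by simp
    qed
  qed

  show "\<forall>j\<in>{0..m+1} - {m}. \<forall>b.
    multi_stability_estimate n \<phi> s m ((\<lambda>i. \<beta> N s m i / 2)(j := b)) \<longrightarrow> b \<le> \<beta> N s m j / 2"
  proof (intro ballI allI impI)
    fix j b assume j: "j \<in> {0..m+1} - {m}" and b: "multi_stability_estimate n \<phi> s m ((\<lambda>i. \<beta> N s m i / 2)(j := b))"
    let ?c = "(\<lambda>i. \<beta> N s m i / 2)(j := b)"
    show "b \<le> \<beta> N s m j / 2"
    proof (cases "b \<ge> 0")
      case True
      \<comment> \<open>The lowest degree absent from the classes of index 0, ..., j. The eigenvalue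
        D_k / 2 equals the sum of the \<beta>_i / 2 over i <= j both for j < m and for j = m + 1.
        For j = m the degree is m + 1 as well, but the sum is only min (2s, D_(m+1)) / 2, hence the
        exception.\<close>
      define k where "k = (if j < m then j + 1 else m + 1)"
      from test_function[OF n2 s] obtain e :: "real^'n \<Rightarrow> complex" and p where p: "harmonic_homogeneous_poly k p"
        and e_def: "e = atom s 1 (?a k - real k) p" and e: "e \<in> form_domain" 
        and eig: "qform s 1 e e = of_real (?a k) * wip s e e" and pos: "Re (wip s e e) > 0" by metis
      have "(\<Sum>i\<le>j. ?c i) \<le> ?a k"
      proof (rule coefficient_sum_le[OF n2 s e eig pos, where I="{0..m+1}" and W="\<H> n \<phi> s m"])
        fix i w assume i: "i \<in> {..j}" and "w \<in> \<H> n \<phi> s m i"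
        then obtain h l where h: "l > 0" "h \<in> stable_space s l ?a m i" and w: "w = inv_fourier h" unfolding H by blast
        have "min i m < k" using i by (auto simp: k_def)
        then have "wip s e h = 0" unfolding e_def by (intro stable_space_orthogonal[OF n2 s _ h(1) p a _ h(2)]) auto
        then show "\<exists>g. rapid g \<and> w = inv_fourier g \<and> wip s e g = 0"
          using w stable_space_rapid[OF s h(1) a h(2)] by blast
      next
        show "deficit s u \<ge> (\<Sum>i\<in>{0..m+1}. ?c i * energy_dist s (\<H> n \<phi> s m i) u)" if "u \<in> C0_infinity" for u
          using b that unfolding multi_stability_estimate_def by blast
      qed (use True H_ne \<beta> j in auto)
      \<comment> \<open>The original coefficients add up to exactly the bound just obtained for the
        modified ones, and the two families differ at j only.\<close>
      moreover have "(\<Sum>i\<le>j. \<beta> N s m i / 2) = ?a k"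
      proof (cases "j < m")
        case True
        then show ?thesis using sum_beta_lt[OF True, of N s] by (simp add: k_def N flip: sum_divide_distrib)
      next
        case False
        with j have "j = m + 1" by auto
        then show ?thesis using sum_beta(2)[OF m(1), of N s] by (simp add: k_def N flip: sum_divide_distrib)
      qed
      moreover have "(\<Sum>i\<le>j. ?c i) = (\<Sum>i<j. \<beta> N s m i / 2) + b"
        unfolding lessThan_Suc_atMost[symmetric] sum.lessThan_Suc by simp
      moreover have "(\<Sum>i\<le>j. \<beta> N s m i / 2) = (\<Sum>i<j. \<beta> N s m i / 2) + \<beta> N s m j / 2"
        unfolding lessThan_Suc_atMost[symmetric] sum.lessThan_Suc by simp
      ultimately show ?thesis by linarith
    next
      case False
      then show ?thesis using \<beta>[of j] by simp
    qed
  qed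
qed

end
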